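(* Let $A_m(x;q)$, $B_m(x;q)$, $C_m(x;q)$ ($m\in\mathbb Z$, $|q|\neq1$) be the descendant holomorphic blocks of the $\mathbf 5_2$ knot defined in the context. (a) They are $q$-holonomic functions in the variables $(m,x)$ with common annihilating ideal $\mathcal I_{\mathbf 5_2}=\langle P_1,P_2,P_3\rangle$, where $$\begin{aligned}P_1=\;&x(1-q^3x^2)(1-qx^2-q^2x^2-q^{3+m}x^3+q^3x^4)-(1-qx)(1+qx)(1-qx^2)(1-q^3x^2)S_m\\&-x(1-qx)(1+qx)(1-qx-qx^2-q^3x^2+q^2x^3+q^4x^3-q^{3+m}x^3-q^{4+m}x^3+q^4x^4-q^5x^5)S_x\\&-q^{4+m}x^4(1-qx^2)S_x^2,\\ P_2=\;&x-S_m-xS_x+qx^2S_xS_m,\\ P_3=\;&x(1-q^{1+m}-qx^2)-(1-q^{1+m}+x-qx^2+q^{2+m}x^2-qx^3)S_m+(1-qx^2)S_m^2+q^{1+m}xS_x.\end{aligned}$$ The ideal $\mathcal I_{\mathbf 5_2}$ has rank $3$ and the three functions form a basis of solutions of the corresponding system of linear equations. (b) As functions of the integer $m$ they form a basis of solutions of $\widehat B_{\mathbf 5_2}(S_m,x,q^m,q)f_m(x;q)=0$ for $|q|\ne1$, where $\widehat B_{\mathbf 5_2}(S_m,x,q^m,q)=(1-S_m)(1-xS_m)(1-x^{-1}S_m)-q^{2+m}S_m^2$. (c) The Wronskian $W_m(x;q)$, the $3\times3$ matrix with rows $(A_{m+i},B_{m+i},C_{m+i})(x;q)$, $i=0,1,2$,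 satisfies $$\det W_m(x;q)=-\theta(-q^{-1/2}x;q)^{-2}\,\theta(-q^{-1/2}x^2;q)\qquad(|q|\ne1).$$ (d) It satisfies the orthogonality relation $$W_{-1}(x;q)\,W_{-1}(x;q^{-1})^T=\begin{pmatrix}1&0&0\\0&0&1\\0&1&x+x^{-1}\end{pmatrix},$$ and it follows that $W_m(x;q)W_\ell(x;q^{-1})^T\in\mathrm{GL}(3,\mathbb Z[q^{\pm1},x^{\pm1}])$ for all integers $m,\ell$. (e) As functions of $x$ they form a basis of solutions of $\sum_{j=0}^3C_j(x,q^m,q)S_x^j f_m(x;q)=0$, where (here $C_j$ denotes coefficients) $$\begin{aligned}C_0=\;&-q^{2+m}x^2(1-q^2x)(1+q^2x)(1-q^5x^2),\\ C_1=\;&(1-qx)(1+qx)(1-q^5x^2)\\&\times(1-qx-qx^2-q^4x^2+q^{2+m}x^2+q^{3+m}x^2+q^2x^3+q^5x^3+q^5x^4+q^{5+m}x^4-q^6x^5),\\ C_2=\;&qx(1-q^2x)(1+q^2x)(1-qx^2)\\&\times(1-q^2x-q^{2+m}x-q^2x^2-q^5x^2+q^4x^3+q^7x^3-q^{5+m}x^3-q^{6+m}x^3+q^7x^4-q^9x^5),\\ C_3=\;&q^{8+m}x^4(1-qx)(1+qx)(1-qx^2).\end{aligned}$$ (f) The Wronskian $\mathcal W_m(x;q)$, the $3\times3$ matrix with rows $(A_m(q^ix;q),B_m(q^ix;q),C_m(q^ix;q))$, $i=0,1,2$ ($|q|\ne1$), satisfies $$\det\mathcal W_m(x;q)=q^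{-5-2m}x^{-5}(1-q^2x^2)(1-qx^2)(1-q^3x^2)\,\theta(-q^{-1/2}x;q)^{-2}\,\theta(-q^{-1/2}x^2;q).$$
   Context: For $|q|<1$: $(x;q)_\infty=\prod_{j\ge0}(1-q^jx)$, $(x;q)_n=\prod_{j=0}^{n-1}(1-q^jx)$, $\theta(x;q)=(-q^{1/2}x;q)_\infty(-q^{1/2}x^{-1};q)_\infty$, and $\theta(x;q^{-1}):=\theta(x;q)^{-1}$. For $|q|\ne1$ and $x\in\mathbb C^*$, $$A_m(x;q)=H(x,x^{-1},q^m;q),\quad B_m(x;q)=\theta(-q^{1/2}x;q)^{-2}x^mH(x,x^2,q^mx^2;q),$$ $$C_m(x;q)=\theta(-q^{-1/2}x;q)^{-2}x^{-m}H(x^{-1},x^{-2},q^mx^{-2};q),$$ where, for $|q|<1$, $$H(x,y,z;q)=(qx;q)_\infty(qy;q)_\infty\sum_{n\ge0}\frac{q^{n(n+1)}z^n}{(q;q)_n(qx;q)_n(qy;q)_n},$$ $$H(x,y,z;q^{-1})=\frac1{(x;q)_\infty(y;q)_\infty}\sum_{n\ge0}(-1)^n\frac{q^{n(n+1)/2}x^{-n}y^{-n}z^n}{(q;q)_n(qx^{-1};q)_n(qy^{-1};q)_n}.$$ (These are meromorphic in $x$; identities are identities of meromorphic functions.) $S_m$ shifts $m$ to $m+1$ and $S_x$ shifts $x$ to $qx$. Annihilating ideals are left ideals in the algebra of $q$-difference operators in $S_x,S_m$ with coefficients rational functions in $x,q^m,q$ (written on the left), with $S_xx=qxS_x$, $S_mq^m=q\,q^mS_m$,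 and all other pairs of generators commuting; the annihilating ideal of a function of $(m,x)$ is the set of all operators that kill it. The rank of an ideal is the dimension of the quotient of the algebra by the ideal over the field of rational functions in $x,q^m,q$. A function is $q$-holonomic in the sense of Zeilberger. *)

theory Defs
  imports
    "HOL-Complex_Analysis.Complex_Analysis"
    "HOL-Computational_Algebra.Computational_Algebra"
    "HOL-Library.Poly_Mapping"
begin

section \<open>Rational functions in \<open>x\<close>, \<open>q^m\<close>, \<open>q\<close>\<close>

text \<open>
  The outermost variable of a \<open>poly3\<close> is \<open>x\<close>, the middle one is \<open>M = q^m\<close> and the innermost
  one is \<open>q\<close>. All three are independent indeterminates in \<open>ratfun\<close>.
\<close>

type_synonym poly3 = "complex poly poly poly"
type_synonym ratfun = "poly3 fract"

definition var_x :: ratfun where "var_x = Fract [:0, 1:] 1"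
definition var_M :: ratfun where "var_M = Fract [:[:0, 1:]:] 1"
definition var_q :: ratfun where "var_q = Fract [:[:[:0, 1:]:]:] 1"

definition eval3 :: "complex \<Rightarrow> complex \<Rightarrow> complex \<Rightarrow> poly3 \<Rightarrow> complex" where
  "eval3 x M q p = poly (poly (poly p [:[:x:]:]) [:M:]) q"

definition regular_at :: "complex \<Rightarrow> complex \<Rightarrow> complex \<Rightarrow> ratfun \<Rightarrow> bool" where
  "regular_at x M q r \<longleftrightarrow> (\<exists>a b. r = Fract a b \<and> eval3 x M q b \<noteq> 0)"

text \<open>Only meaningful at points where the rational function is regular.\<close>

definition ratval :: "complex \<Rightarrow> complex \<Rightarrow> complex \<Rightarrow> ratfun \<Rightarrow> complex" where
  "ratval x M q r =
     (THE v. \<exists>a b. r = Fract a b \<and> eval3 x M q b \<noteq> 0 \<and> v = eval3 x M q a / eval3 x M q b)"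

lemma ratval_Fract:
  assumes "eval3 x M q b \<noteq> 0"
  shows "ratval x M q (Fract a b) = eval3 x M q a / eval3 x M q b"
  unfolding ratval_def
proof (rule the_equality)
  fix v
  assume "\<exists>a' b'. Fract a b = Fract a' b' \<and> eval3 x M q b' \<noteq> 0 \<and> v = eval3 x M q a' / eval3 x M q b'"
  then obtain a' b' where *: "Fract a b = Fract a' b'" "eval3 x M q b' \<noteq> 0"
      "v = eval3 x M q a' / eval3 x M q b'"
    by blast
  have "b \<noteq> 0" "b' \<noteq> 0"
    using assms *(2) by (auto simp: eval3_def)
  then have "eval3 x M q (a * b') = eval3 x M q (a' * b)"
    using *(1) by (simp add: eq_fract)
  then have "eval3 x M q a * eval3 x M q b' = eval3 x M q a' * eval3 x M q b"
    by (simp add: eval3_def)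
  then show "v = eval3 x M q a / eval3 x M q b"
    using assms *(2,3) by (simp add: frac_eq_eq)
qed (use assms in blast)

text \<open>The substitutions \<open>x \<mapsto> q x\<close> and \<open>M \<mapsto> q M\<close>.\<close>

definition subst_x :: "poly3 \<Rightarrow> poly3" where
  "subst_x p = pcompose p [:0, [:[:0, 1:]:]:]"

definition subst_M :: "poly3 \<Rightarrow> poly3" where
  "subst_M p = map_poly (\<lambda>c. pcompose c [:0, [:0, 1:]:]) p"

lemma subst_x_mult: "subst_x (a * b) = subst_x a * subst_x b"
  by (simp add: subst_x_def pcompose_mult)

lemma subst_x_eq_0_iff: "subst_x a = 0 \<longleftrightarrow> a = 0"
  by (simp add: subst_x_def pcompose_eq_0_iff)

lemma subst_M_mult: "subst_M (a * b) = subst_M a * subst_M b"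
  by (rule poly_eqI)
     (simp add: subst_M_def coeff_map_poly coeff_mult pcompose_sum pcompose_mult)

lemma subst_M_eq_0_iff: "subst_M a = 0 \<longleftrightarrow> a = 0"
proof -
  have "subst_M a = 0 \<longleftrightarrow> (\<forall>n. coeff a n \<circ>\<^sub>p [:0, [:0, 1:]:] = 0)"
    by (simp only: subst_M_def poly_eq_iff[of "map_poly _ a"]) (simp add: coeff_map_poly)
  also have "\<dots> \<longleftrightarrow> (\<forall>n. coeff a n = 0)"
    by (simp add: pcompose_eq_0_iff)
  finally show ?thesis
    by (simp add: poly_eq_iff[of a])
qed

definition map_fract :: "(poly3 \<Rightarrow> poly3) \<Rightarrow> ratfun \<Rightarrow> ratfun" where
  "map_fract \<sigma> r = (THE s. \<exists>a b. b \<noteq> 0 \<and> r = Fract a b \<and> s = Fract (\<sigma> a) (\<sigma> b))"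

lemma map_fract_Fract:
  assumes "\<And>a b. \<sigma> (a * b) = \<sigma> a * \<sigma> b" "\<And>a. \<sigma> a = 0 \<longleftrightarrow> a = 0" "b \<noteq> 0"
  shows "map_fract \<sigma> (Fract a b) = Fract (\<sigma> a) (\<sigma> b)"
  unfolding map_fract_def
proof (rule the_equality)
  show "\<exists>a' b'. b' \<noteq> 0 \<and> Fract a b = Fract a' b' \<and> Fract (\<sigma> a) (\<sigma> b) = Fract (\<sigma> a') (\<sigma> b')"
    using assms(3) by blast
next
  fix s assume "\<exists>a' b'. b' \<noteq> 0 \<and> Fract a b = Fract a' b' \<and> s = Fract (\<sigma> a') (\<sigma> b')"
  then obtain a' b' where *: "b' \<noteq> 0" "Fract a b = Fract a' b'" "s = Fract (\<sigma> a') (\<sigma> b')"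
    by blast
  have "a * b' = a' * b"
    using * assms(3) by (simp add: eq_fract)
  then have "\<sigma> a * \<sigma> b' = \<sigma> a' * \<sigma> b"
    using assms(1) by metis
  then show "s = Fract (\<sigma> a) (\<sigma> b)"
    using * assms(2,3) by (simp add: eq_fract)
qed

definition shift_x :: "ratfun \<Rightarrow> ratfun" where "shift_x = map_fract subst_x"
definition shift_M :: "ratfun \<Rightarrow> ratfun" where "shift_M = map_fract subst_M"

lemma shift_x_Fract: "b \<noteq> 0 \<Longrightarrow> shift_x (Fract a b) = Fract (subst_x a) (subst_x b)"
  by (simp add: shift_x_def map_fract_Fract subst_x_mult subst_x_eq_0_iff)

lemma shift_M_Fract: "b \<noteq> 0 \<Longrightarrow> shift_M (Fract a b) = Fract (subst_M a) (subst_M b)"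
  by (simp add: shift_M_def map_fract_Fract subst_M_mult subst_M_eq_0_iff)

section \<open>The algebra of \<open>q\<close>-difference operators\<close>

text \<open>
  \<open>\<Sum> r\<^sub>i\<^sub>j S_x^i S_m^j\<close> is the finitely supported function \<open>(i, j) \<mapsto> r\<^sub>i\<^sub>j\<close>. The product is the
  skew product \<open>\<star>\<close>, and not the commutative product \<open>*\<close> of the type \<open>poly_mapping\<close>.
\<close>

type_synonym qop = "(nat \<times> nat) \<Rightarrow>\<^sub>0 ratfun"

definition qmono :: "ratfun \<Rightarrow> nat \<Rightarrow> nat \<Rightarrow> qop" where
  "qmono r i j = Poly_Mapping.single (i, j) r"

definition qmult :: "qop \<Rightarrow> qop \<Rightarrow> qop"  (infixl \<open>\<star>\<close> 70) where
  "P \<star> Q = (\<Sum>(i, j)\<in>Poly_Mapping.keys P. \<Sum>(k, l)\<in>Poly_Mapping.keys Q.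
     qmono (Poly_Mapping.lookup P (i, j) *
            (shift_x ^^ i) ((shift_M ^^ j) (Poly_Mapping.lookup Q (k, l)))) (i + k) (j + l))"

abbreviation cf :: "ratfun \<Rightarrow> qop" where "cf r \<equiv> qmono r 0 0"
definition S_x :: qop where "S_x = qmono 1 1 0"
definition S_m :: qop where "S_m = qmono 1 0 1"

lemma shift_0 [simp]: "shift_x 0 = 0" "shift_M 0 = 0"
  by (simp_all add: Zero_fract_def shift_x_Fract shift_M_Fract subst_x_def subst_M_def
                    pcompose_1 map_poly_1')

lemma shift_1 [simp]: "shift_x 1 = 1" "shift_M 1 = 1"
  by (simp_all add: One_fract_def shift_x_Fract shift_M_Fract subst_x_def subst_M_def
                    pcompose_1 map_poly_1')

lemma shift_pow_0 [simp]: "(shift_x ^^ i) 0 = 0" "(shift_M ^^ i) 0 = 0"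
  by (induction i) simp_all

lemma qmult_qmono:
  "qmono r i j \<star> qmono s k l = qmono (r * (shift_x ^^ i) ((shift_M ^^ j) s)) (i + k) (j + l)"
  by (cases "r = 0"; cases "s = 0") (simp_all add: qmult_def qmono_def)

lemma qop_commutation:
  "S_x \<star> cf var_x = cf (var_q * var_x) \<star> S_x"
  "S_m \<star> cf var_M = cf (var_q * var_M) \<star> S_m"
  "S_x \<star> cf var_M = cf var_M \<star> S_x"
  "S_m \<star> cf var_x = cf var_x \<star> S_m"
  "S_x \<star> cf var_q = cf var_q \<star> S_x"
  "S_m \<star> cf var_q = cf var_q \<star> S_m"
  "S_x \<star> S_m = S_m \<star> S_x"
  by (simp_all add: S_x_def S_m_def qmult_qmono var_x_def var_M_def var_q_def shift_x_Fract
        shift_M_Fract subst_x_def subst_M_def pcompose_1 pcompose_pCons map_poly_pCons map_poly_1'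
        one_pCons)

definition left_ideal :: "qop set \<Rightarrow> bool" where
  "left_ideal I \<longleftrightarrow> 0 \<in> I \<and> (\<forall>P\<in>I. \<forall>Q\<in>I. P + Q \<in> I) \<and> (\<forall>P. \<forall>Q\<in>I. P \<star> Q \<in> I)"

text \<open>
  \<open>quot_dim F V I n\<close>: the image of \<open>V\<close> modulo \<open>I\<close> has dimension \<open>n\<close> over the field \<open>F\<close> of scalars
  (acting by multiplication on the left), i.e. it has a basis represented by \<open>b 0, \<dots>, b (n - 1)\<close>.
\<close>

definition quot_dim :: "ratfun set \<Rightarrow> qop set \<Rightarrow> qop set \<Rightarrow> nat \<Rightarrow> bool" where
  "quot_dim F V I n \<longleftrightarrow> (\<exists>b. (\<forall>i<n. b i \<in> V) \<and>
     (\<forall>P\<in>V. \<exists>!c. c \<in> {..<n} \<rightarrow>\<^sub>E F \<and> P - (\<Sum>i<n. cf (c i) \<star> b i) \<in> I))"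

definition has_rank :: "qop set \<Rightarrow> nat \<Rightarrow> bool" where
  "has_rank I n \<longleftrightarrow> quot_dim UNIV UNIV I n"

section \<open>Operators acting on functions\<close>

definition admissible :: "complex \<Rightarrow> bool" where
  "admissible q \<longleftrightarrow> q \<noteq> 0 \<and> norm q \<noteq> 1"

definition act :: "complex \<Rightarrow> qop \<Rightarrow> (int \<Rightarrow> complex \<Rightarrow> complex) \<Rightarrow> int \<Rightarrow> complex \<Rightarrow> complex" where
  "act q P f m x = (\<Sum>(i, j)\<in>Poly_Mapping.keys P.
     ratval x (q powi m) q (Poly_Mapping.lookup P (i, j)) * f (m + int j) (q ^ i * x))"

text \<open>
  Identities of meromorphic functions of \<open>x \<in> \<complex>\<^sup>*\<close> are equalities off a subset of \<open>\<complex>\<^sup>*\<close> without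
  limit points in \<open>\<complex>\<^sup>*\<close>. Values at poles and at removable singularities, where the formulas below
  involve division by zero, are therefore irrelevant.
\<close>

definition kills_at :: "complex \<Rightarrow> qop \<Rightarrow> (int \<Rightarrow> complex \<Rightarrow> complex) \<Rightarrow> bool" where
  "kills_at q P f \<longleftrightarrow> (\<forall>m. \<forall>\<^sub>\<approx>x\<in>-{0}.
     (\<forall>k\<in>Poly_Mapping.keys P. regular_at x (q powi m) q (Poly_Mapping.lookup P k)) \<longrightarrow>
     act q P f m x = 0)"

text \<open>The argument of type \<open>complex\<close> that comes first is \<open>q\<close>.\<close>

definition annihilator :: "(complex \<Rightarrow> int \<Rightarrow> complex \<Rightarrow> complex) \<Rightarrow> qop set" where
  "annihilator F = {P. \<forall>q. admissible q \<longrightarrow> kills_at q P (F q)}"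

section \<open>\<open>q\<close>-holonomic functions\<close>

text \<open>
  The subfield \<open>\<complex>(q)\<close>, and the part of total degree at most \<open>N\<close> of the \<open>q\<close>-Weyl algebra generated
  over it by \<open>x\<close>, \<open>M\<close>, \<open>S_x\<close>, \<open>S_m\<close>.
\<close>

definition field_q :: "ratfun set" where
  "field_q = {Fract [:[:a:]:] [:[:b:]:] | a b. b \<noteq> 0}"

definition q_weyl :: "nat \<Rightarrow> qop set" where
  "q_weyl N = {(\<Sum>(a, b, i, j) | a + b + i + j \<le> N.
      qmono (c (a, b, i, j) * var_x ^ a * var_M ^ b) i j) | c. range c \<subseteq> field_q}"

text \<open>
  The module generated by \<open>F\<close> over the \<open>q\<close>-Weyl algebra is zero, or its Hilbert polynomial has
  degree \<open>2\<close>, the number of variables \<open>m, x\<close>. Torsion under multiplication by monomials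
  in \<open>x\<close> and \<open>q^m\<close> cannot occur in a module of functions on \<open>\<int> \<times> \<complex>\<^sup>*\<close>.
\<close>

definition q_holonomic :: "(complex \<Rightarrow> int \<Rightarrow> complex \<Rightarrow> complex) \<Rightarrow> bool" where
  "q_holonomic F \<longleftrightarrow> cf 1 \<in> annihilator F \<or>
     (\<exists>p :: real poly. degree p = 2 \<and>
        (\<forall>\<^sub>F N in sequentially. \<exists>n.
           quot_dim field_q (q_weyl N) (annihilator F) n \<and> real n = poly p (real N)))"

section \<open>Bases of solutions\<close>

definition q_constants :: "complex \<Rightarrow> (complex \<Rightarrow> complex) set" where
  "q_constants q = {c. c meromorphic_on (-{0}) \<and> (\<forall>\<^sub>\<approx>x\<in>-{0}. c (q * x) = c x)}"

text \<open>
  \<open>F 1, F 2, F 3\<close> is a basis of the space \<open>V\<close> of families of meromorphic functions on \<open>\<complex>\<^sup>*\<close>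
  over the field of meromorphic functions \<open>c\<close> with \<open>c (q x) = c x\<close>.
\<close>

definition q_basis ::
    "complex \<Rightarrow> ('i \<Rightarrow> complex \<Rightarrow> complex) set \<Rightarrow> (3 \<Rightarrow> 'i \<Rightarrow> complex \<Rightarrow> complex) \<Rightarrow> bool" where
  "q_basis q V F \<longleftrightarrow> range F \<subseteq> V \<and>
     (\<forall>c. range c \<subseteq> q_constants q \<and> (\<forall>i. \<forall>\<^sub>\<approx>x\<in>-{0}. (\<Sum>k\<in>UNIV. c k x * F k i x) = 0)
        \<longrightarrow> (\<forall>k. \<forall>\<^sub>\<approx>x\<in>-{0}. c k x = 0)) \<and>
     (\<forall>f\<in>V. \<exists>c. range c \<subseteq> q_constants q \<and>
        (\<forall>i. \<forall>\<^sub>\<approx>x\<in>-{0}. f i x = (\<Sum>k\<in>UNIV. c k x * F k i x)))"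

definition system_solutions :: "complex \<Rightarrow> qop set \<Rightarrow> (int \<Rightarrow> complex \<Rightarrow> complex) set" where
  "system_solutions q G = {f. (\<forall>m. f m meromorphic_on (-{0})) \<and> (\<forall>P\<in>G. kills_at q P f)}"

text \<open>Sequences indexed by \<open>m\<close>, over the field of complex numbers.\<close>

definition seq_basis :: "(int \<Rightarrow> complex) set \<Rightarrow> (3 \<Rightarrow> int \<Rightarrow> complex) \<Rightarrow> bool" where
  "seq_basis V F \<longleftrightarrow> range F \<subseteq> V \<and>
     (\<forall>f\<in>V. \<exists>!c :: complex ^ 3. \<forall>m. f m = (\<Sum>k\<in>UNIV. c $ k * F k m))"

section \<open>The holomorphic blocks\<close>

definition qpoch :: "complex \<Rightarrow> complex \<Rightarrow> nat \<Rightarrow> complex" where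
  "qpoch x q n = (\<Prod>j<n. 1 - q ^ j * x)"

definition qpoch_inf :: "complex \<Rightarrow> complex \<Rightarrow> complex" where
  "qpoch_inf x q = prodinf (\<lambda>j. 1 - q ^ j * x)"

text \<open>
  A square root of \<open>q\<close> that satisfies \<open>qhalf (1 / q) = 1 / qhalf q\<close> whenever \<open>norm q \<noteq> 1\<close>. In the
  arguments \<open>-q\<^bsup>\<plusminus>1/2\<^esup> y\<close> of \<open>theta\<close> used below, the choice of the branch cancels.
\<close>

definition qhalf :: "complex \<Rightarrow> complex" where
  "qhalf q = (if norm q < 1 then csqrt q else inverse (csqrt (inverse q)))"

definition theta :: "complex \<Rightarrow> complex \<Rightarrow> complex" where
  "theta x q =
     (let th = \<lambda>q. qpoch_inf (- qhalf q * x) q * qpoch_inf (- qhalf q * inverse x) q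
      in if norm q < 1 then th q else inverse (th (inverse q)))"

text \<open>The second branch is the formula for \<open>H(x, y, z; p\<^sup>-\<^sup>1)\<close> with \<open>p = q\<^sup>-\<^sup>1\<close>.\<close>

definition H52 :: "complex \<Rightarrow> complex \<Rightarrow> complex \<Rightarrow> complex \<Rightarrow> complex" where
  "H52 x y z q =
     (if norm q < 1
      then qpoch_inf (q * x) q * qpoch_inf (q * y) q *
        suminf (\<lambda>n. q ^ (n * (n + 1)) * z ^ n / (qpoch q q n * qpoch (q * x) q n * qpoch (q * y) q n))
      else let p = inverse q in
        1 / (qpoch_inf x p * qpoch_inf y p) *
        suminf (\<lambda>n. (-1) ^ n * (p ^ (n * (n + 1) div 2) * inverse x ^ n * inverse y ^ n * z ^ n) /
           (qpoch p p n * qpoch (p * inverse x) p n * qpoch (p * inverse y) p n)))"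

definition block_A :: "complex \<Rightarrow> int \<Rightarrow> complex \<Rightarrow> complex" where
  "block_A q m x = H52 x (inverse x) (q powi m) q"

definition block_B :: "complex \<Rightarrow> int \<Rightarrow> complex \<Rightarrow> complex" where
  "block_B q m x =
     theta (- qhalf q * x) q powi (-2) * x powi m * H52 x (x\<^sup>2) (q powi m * x\<^sup>2) q"

definition block_C :: "complex \<Rightarrow> int \<Rightarrow> complex \<Rightarrow> complex" where
  "block_C q m x =
     theta (- inverse (qhalf q) * x) q powi (-2) * x powi (- m) *
     H52 (inverse x) (x powi (-2)) (q powi m * x powi (-2)) q"

definition blocks :: "complex \<Rightarrow> int \<Rightarrow> complex \<Rightarrow> complex ^ 3" where
  "blocks q m x = vector [block_A q m x, block_B q m x, block_C q m x]"

definition Wronskian_m :: "complex \<Rightarrow> int \<Rightarrow> complex \<Rightarrow> complex ^ 3 ^ 3" where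
  "Wronskian_m q m x = vector [blocks q m x, blocks q (m + 1) x, blocks q (m + 2) x]"

definition Wronskian_x :: "complex \<Rightarrow> int \<Rightarrow> complex \<Rightarrow> complex ^ 3 ^ 3" where
  "Wronskian_x q m x = vector [blocks q m x, blocks q m (q * x), blocks q m (q\<^sup>2 * x)]"

text \<open>
  At these points no denominator in the formulas for the blocks vanishes, neither for \<open>q\<close> nor for
  \<open>q\<^sup>-\<^sup>1\<close>. The excluded points of \<open>\<complex>\<^sup>*\<close> form a discrete closed subset.
\<close>

definition generic :: "complex \<Rightarrow> complex \<Rightarrow> bool" where
  "generic q x \<longleftrightarrow> x \<noteq> 0 \<and> (\<forall>k :: int. x\<^sup>2 \<noteq> q powi k)"

section \<open>The equations\<close>

definition P1 :: qop where
  "P1 = (let x = var_x; M = var_M; q = var_q in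
     cf (x * (1 - q^3 * x^2) * (1 - q * x^2 - q^2 * x^2 - q^3 * M * x^3 + q^3 * x^4))
     - cf ((1 - q * x) * (1 + q * x) * (1 - q * x^2) * (1 - q^3 * x^2)) \<star> S_m
     - cf (x * (1 - q * x) * (1 + q * x) *
           (1 - q * x - q * x^2 - q^3 * x^2 + q^2 * x^3 + q^4 * x^3 - q^3 * M * x^3
            - q^4 * M * x^3 + q^4 * x^4 - q^5 * x^5)) \<star> S_x
     - cf (q^4 * M * x^4 * (1 - q * x^2)) \<star> (S_x \<star> S_x))"

definition P2 :: qop where
  "P2 = (let x = var_x; q = var_q in
     cf x - S_m - cf x \<star> S_x + cf (q * x^2) \<star> (S_x \<star> S_m))"

definition P3 :: qop where
  "P3 = (let x = var_x; M = var_M; q = var_q in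
     cf (x * (1 - q * M - q * x^2))
     - cf (1 - q * M + x - q * x^2 + q^2 * M * x^2 - q * x^3) \<star> S_m
     + cf (1 - q * x^2) \<star> (S_m \<star> S_m)
     + cf (q * M * x) \<star> S_x)"

definition I52 :: "qop set" where
  "I52 = left_ideal hull {P1, P2, P3}"

text \<open>\<open>one_minus c\<close> is the operator \<open>1 - c S_m\<close> on sequences.\<close>

definition one_minus :: "complex \<Rightarrow> (int \<Rightarrow> complex) \<Rightarrow> int \<Rightarrow> complex" where
  "one_minus c f m = f m - c * f (m + 1)"

definition B52_solutions :: "complex \<Rightarrow> complex \<Rightarrow> (int \<Rightarrow> complex) set" where
  "B52_solutions q x = {f. \<forall>m.
     one_minus 1 (one_minus x (one_minus (inverse x) f)) m - q powi (2 + m) * f (m + 2) = 0}"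

definition C52 :: "complex \<Rightarrow> complex \<Rightarrow> complex \<Rightarrow> nat \<Rightarrow> complex" where
  "C52 x M q j =
    [- (q^2) * M * x^2 * (1 - q^2 * x) * (1 + q^2 * x) * (1 - q^5 * x^2),
     (1 - q * x) * (1 + q * x) * (1 - q^5 * x^2) *
       (1 - q * x - q * x^2 - q^4 * x^2 + q^2 * M * x^2 + q^3 * M * x^2 + q^2 * x^3 + q^5 * x^3
        + q^5 * x^4 + q^5 * M * x^4 - q^6 * x^5),
     q * x * (1 - q^2 * x) * (1 + q^2 * x) * (1 - q * x^2) *
       (1 - q^2 * x - q^2 * M * x - q^2 * x^2 - q^5 * x^2 + q^4 * x^3 + q^7 * x^3
        - q^5 * M * x^3 - q^6 * M * x^3 + q^7 * x^4 - q^9 * x^5),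
     q^8 * M * x^4 * (1 - q * x) * (1 + q * x) * (1 - q * x^2)] ! j"

text \<open>A family indexed by \<open>unit\<close> is a single function of \<open>x\<close>.\<close>

definition C52_solutions :: "complex \<Rightarrow> int \<Rightarrow> (unit \<Rightarrow> complex \<Rightarrow> complex) set" where
  "C52_solutions q m = {f. f () meromorphic_on (-{0}) \<and>
     (\<forall>\<^sub>\<approx>x\<in>-{0}. (\<Sum>j\<le>3. C52 x (q powi m) q j * f () (q ^ j * x)) = 0)}"

section \<open>Laurent polynomials over the integers\<close>

text \<open>The coefficient at \<open>(a, b)\<close> is that of \<open>q^a x^b\<close>; the product is convolution.\<close>

type_synonym laurent_qx = "(int \<times> int) \<Rightarrow>\<^sub>0 int"

definition laurent_eval :: "complex \<Rightarrow> complex \<Rightarrow> laurent_qx \<Rightarrow> complex" where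
  "laurent_eval q x p = (\<Sum>(a, b)\<in>Poly_Mapping.keys p.
     of_int (Poly_Mapping.lookup p (a, b)) * q powi a * x powi b)"

end

theory Submission
  imports Defs
begin

text \<open>
  Up to a factor that depends only on \<open>x\<close>, the three blocks are \<open>u^m \<Sum> a_n q^(m n)\<close> with \<open>u = 1, x, 1 / x\<close>,
  and \<open>t = u q^n\<close> satisfies \<open>(1 - t) (1 - x t) (1 - t / x) a_n = t^2 a_(n - 1)\<close>, for \<open>norm q < 1\<close> as well as
  for \<open>norm q > 1\<close>. Summing termwise identities gives the recurrence of order three in \<open>m\<close> and expresses \<open>S_x\<close>
  through \<open>1, S_m, S_m\<^sup>2\<close>. Every operator is congruent modulo the ideal to a unique normal form
  \<open>a + b S_m + c S_m\<^sup>2\<close>, and it kills a block only if the normal form vanishes: otherwise the lowest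
  coefficients in \<open>q^m\<close> form a nonzero quadratic polynomial with the roots \<open>1, x, 1 / x\<close>.
  For holonomicity, the standard monomials form the complement of an up-set, whose Hilbert function is eventually
  polynomial by Dickson's lemma; upper and lower bounds show that its degree is two.

  The determinant of the Wronskian and a bilinear pairing between the blocks at \<open>q\<close> and at \<open>1 / q\<close> do not
  depend on \<open>m\<close>, so they can be computed in the limit \<open>q^m \<rightarrow> 0\<close>. The resulting orthogonality relation
  inverts the Wronskian. Hence the coordinates of a solution with respect to the blocks are again meromorphic in \<open>x\<close>,
  and by uniqueness they are invariant under \<open>x \<mapsto> q x\<close>.
\<close>

section \<open>Shifts and evaluation of rational functions\<close>

text \<open>The generators \<open>P1\<close>, \<open>P2\<close>, \<open>P3\<close> do not show the
  rank of their ideal: elimination bounds it by three from above, but a further hidden relation has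
  to be excluded. This is done by a model. Triples with explicit semilinear maps for S_x and S_m
  form a module over the operator algebra as soon as the two maps commute, and commuting amounts to
  one rational identity, the integrability of the system. The ideal is then the annihilator of a
  single vector, so that membership is a computation with three rational functions. The series for
  norm q < 1 and for norm q > 1 look different; what they share is the term ratio, hence the
  recurrence. Reversing m together with q turns the recurrence into its adjoint. This is why a
  bilinear expression in the blocks at q and at 1 / q can be constant in m, and it is the origin of
  the orthogonality relation. Coefficients of operators may have poles that depend on m. A relation
  is therefore tested at a point chosen off a countable set, so that the same point serves
  infinitely many m.\<close>

lemma eval3_simps [simp]:
  "eval3 x M q 0 = 0" "eval3 x M q 1 = 1"
  "eval3 x M q (a + b) = eval3 x M q a + eval3 x M q b"
  "eval3 x M q (a - b) = eval3 x M q a - eval3 x M q b"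
  "eval3 x M q (- a) = - eval3 x M q a"
  "eval3 x M q (a * b) = eval3 x M q a * eval3 x M q b"
  by (simp_all add: eval3_def)

lemma eval3_pCons: "eval3 x M q (pCons a p) = poly (poly a [:M:]) q + x * eval3 x M q p"
  by (simp add: eval3_def)

lemma eval3_smult: "eval3 x M q (smult c p) = poly (poly c [:M:]) q * eval3 x M q p"
  by (simp add: eval3_def)

lemma subst_x_simps [simp]:
  "subst_x 0 = 0" "subst_x 1 = 1"
  "subst_x (a + b) = subst_x a + subst_x b" "subst_x (- a) = - subst_x a"
  by (simp_all add: subst_x_def pcompose_add pcompose_uminus pcompose_1)

lemma subst_M_simps [simp]:
  "subst_M 0 = 0" "subst_M 1 = 1"
  "subst_M (a + b) = subst_M a + subst_M b" "subst_M (- a) = - subst_M a"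
  by (simp_all add: subst_M_def map_poly_1' pcompose_1)
     (rule poly_eqI, simp add: coeff_map_poly pcompose_add pcompose_uminus)+

lemma eval3_subst_x: "eval3 x M q (subst_x p) = eval3 (q * x) M q p"
  by (induction p) (simp_all add: subst_x_def pcompose_pCons eval3_pCons eval3_smult algebra_simps)

lemma eval3_subst_M: "eval3 x M q (subst_M p) = eval3 x (q * M) q p"
proof (induction p)
  case (pCons a p)
  have "poly (poly b [:0, M:]) q = poly (poly b [:q * M:]) q" for b
    by (induction b) (simp_all add: algebra_simps)
  then show ?case
    using pCons by (simp add: subst_M_def map_poly_pCons eval3_pCons poly_pcompose)
qed simp

lemma subst_x_subst_M: "subst_x (subst_M p) = subst_M (subst_x p)"
proof (induction p)
  case (pCons a p)
  have *: "subst_M [:0, [:[:0, 1:]:]:] = [:0, [:[:0, 1:]:]:]"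
    by (simp add: subst_M_def map_poly_pCons)
  have **: "subst_x (pCons b r) = [:b:] + [:0, [:[:0, 1:]:]:] * subst_x r" for b r
    by (simp add: subst_x_def pcompose_pCons)
  have ***: "subst_M (pCons b r) = pCons (b \<circ>\<^sub>p [:0, [:0, 1:]:]) (subst_M r)" for b r
    by (simp add: subst_M_def map_poly_pCons)
  show ?case
    using pCons by (simp only: ** *** subst_M_simps subst_M_mult * pCons.IH) simp
qed simp

lemma map_fract_hom:
  assumes "\<And>a b. \<sigma> (a * b) = \<sigma> a * \<sigma> b" "\<And>a. \<sigma> a = 0 \<longleftrightarrow> a = 0"
    "\<And>a b. \<sigma> (a + b) = \<sigma> a + \<sigma> b" "\<And>a. \<sigma> (- a) = - \<sigma> a" "\<sigma> 1 = 1"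
  shows "map_fract \<sigma> (r + s) = map_fract \<sigma> r + map_fract \<sigma> s"
    "map_fract \<sigma> (- r) = - map_fract \<sigma> r"
    "map_fract \<sigma> (r * s) = map_fract \<sigma> r * map_fract \<sigma> s"
    "map_fract \<sigma> (inverse r) = inverse (map_fract \<sigma> r)"
    "map_fract \<sigma> r = 0 \<longleftrightarrow> r = 0"
proof -
  obtain a b where r: "r = Fract a b" "b \<noteq> 0" by (cases r)
  obtain c d where s: "s = Fract c d" "d \<noteq> 0" by (cases s)
  note [simp] = map_fract_Fract[of \<sigma>, OF assms(1,2)]
  show "map_fract \<sigma> (r + s) = map_fract \<sigma> r + map_fract \<sigma> s"
    "map_fract \<sigma> (- r) = - map_fract \<sigma> r"
    "map_fract \<sigma> (r * s) = map_fract \<sigma> r * map_fract \<sigma> s"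
    using r s by (simp_all add: assms)
  show "map_fract \<sigma> r = 0 \<longleftrightarrow> r = 0"
    using r by (simp add: assms Zero_fract_def eq_fract)
  show "map_fract \<sigma> (inverse r) = inverse (map_fract \<sigma> r)"
  proof (cases "a = 0")
    case True
    have "map_fract \<sigma> 0 = 0"
      using assms(2) by (simp add: Zero_fract_def assms eq_fract)
    then show ?thesis using r True by (simp add: Zero_fract_def[symmetric] fract_collapse)
  qed (use r in simp)
qed

lemma shift_x_hom [simp]:
  "shift_x (r + s) = shift_x r + shift_x s" "shift_x (- r) = - shift_x r"
  "shift_x (r * s) = shift_x r * shift_x s" "shift_x (inverse r) = inverse (shift_x r)"
  "shift_x r = 0 \<longleftrightarrow> r = 0"
  unfolding shift_x_def
  by (rule map_fract_hom; simp add: subst_x_mult subst_x_eq_0_iff)+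

lemma shift_M_hom [simp]:
  "shift_M (r + s) = shift_M r + shift_M s" "shift_M (- r) = - shift_M r"
  "shift_M (r * s) = shift_M r * shift_M s" "shift_M (inverse r) = inverse (shift_M r)"
  "shift_M r = 0 \<longleftrightarrow> r = 0"
  unfolding shift_M_def
  by (rule map_fract_hom; simp add: subst_M_mult subst_M_eq_0_iff)+

lemma shift_hom' [simp]:
  "shift_x (r - s) = shift_x r - shift_x s" "shift_M (r - s) = shift_M r - shift_M s"
  "shift_x (r / s) = shift_x r / shift_x s" "shift_M (r / s) = shift_M r / shift_M s"
  "shift_x (r ^ n) = shift_x r ^ n" "shift_M (r ^ n) = shift_M r ^ n"
  using shift_x_hom(1)[of r "- s"] shift_M_hom(1)[of r "- s"]
  by (simp_all add: divide_inverse) (induction n; simp)+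

lemma shift_var [simp]:
  "shift_x var_x = var_q * var_x" "shift_x var_M = var_M" "shift_x var_q = var_q"
  "shift_M var_x = var_x" "shift_M var_M = var_q * var_M" "shift_M var_q = var_q"
  by (simp_all add: var_x_def var_M_def var_q_def shift_x_Fract
        shift_M_Fract subst_x_def subst_M_def pcompose_1 pcompose_pCons map_poly_pCons map_poly_1'
        one_pCons)

lemma var_nonzero [simp]: "var_x \<noteq> 0" "var_M \<noteq> 0" "var_q \<noteq> 0"
  by (simp_all add: var_x_def var_M_def var_q_def Zero_fract_def eq_fract)

lemma shift_x_shift_M: "shift_x (shift_M r) = shift_M (shift_x r)"
  by (cases r) (simp add: shift_x_Fract shift_M_Fract subst_x_subst_M subst_x_eq_0_iff subst_M_eq_0_iff)

lemma regular_atE: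
  assumes "regular_at x M q r"
  obtains a b where "r = Fract a b" "b \<noteq> 0" "eval3 x M q b \<noteq> 0"
    "ratval x M q r = eval3 x M q a / eval3 x M q b"
proof -
  obtain a b where ab: "r = Fract a b" "eval3 x M q b \<noteq> 0"
    using assms by (auto simp: regular_at_def)
  show ?thesis
    by (rule that[of a b]) (use ab in \<open>auto simp: ratval_Fract\<close>)
qed

lemma regular_at_Fract: "eval3 x M q b \<noteq> 0 \<Longrightarrow> regular_at x M q (Fract a b)"
  by (auto simp: regular_at_def)

lemma regular_at_add:
  assumes "regular_at x M q r" "regular_at x M q s"
  shows "regular_at x M q (r + s)" "ratval x M q (r + s) = ratval x M q r + ratval x M q s"
proof -
  obtain a b where r: "r = Fract a b" "b \<noteq> 0" "eval3 x M q b \<noteq> 0"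
    "ratval x M q r = eval3 x M q a / eval3 x M q b" using assms(1) by (rule regular_atE)
  obtain c d where s: "s = Fract c d" "d \<noteq> 0" "eval3 x M q d \<noteq> 0"
    "ratval x M q s = eval3 x M q c / eval3 x M q d" using assms(2) by (rule regular_atE)
  have eq: "r + s = Fract (a * d + c * b) (b * d)"
    using r s by (simp add: )
  show "regular_at x M q (r + s)" "ratval x M q (r + s) = ratval x M q r + ratval x M q s"
    using r s unfolding eq by (auto intro!: regular_at_Fract simp: ratval_Fract field_simps)
qed

lemma regular_at_mult:
  assumes "regular_at x M q r" "regular_at x M q s"
  shows "regular_at x M q (r * s)" "ratval x M q (r * s) = ratval x M q r * ratval x M q s"
proof -
  obtain a b where r: "r = Fract a b" "b \<noteq> 0" "eval3 x M q b \<noteq> 0"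
    "ratval x M q r = eval3 x M q a / eval3 x M q b" using assms(1) by (rule regular_atE)
  obtain c d where s: "s = Fract c d" "d \<noteq> 0" "eval3 x M q d \<noteq> 0"
    "ratval x M q s = eval3 x M q c / eval3 x M q d" using assms(2) by (rule regular_atE)
  have eq: "r * s = Fract (a * c) (b * d)"
    using r s by simp
  show "regular_at x M q (r * s)" "ratval x M q (r * s) = ratval x M q r * ratval x M q s"
    using r s unfolding eq by (auto intro!: regular_at_Fract simp: ratval_Fract field_simps)
qed

lemma ratval_poly:
  "regular_at x M q (Fract a 1)" "ratval x M q (Fract a 1) = eval3 x M q a"
  by (simp_all add: regular_at_Fract ratval_Fract)

lemma regular_at_simple [simp]:
  "regular_at x M q 0" "ratval x M q 0 = 0" "regular_at x M q 1" "ratval x M q 1 = 1"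
  "regular_at x M q var_x" "ratval x M q var_x = x"
  "regular_at x M q var_M" "ratval x M q var_M = M"
  "regular_at x M q var_q" "ratval x M q var_q = q"
  by (simp_all add: Zero_fract_def One_fract_def ratval_poly var_x_def var_M_def var_q_def
       eval3_pCons)

lemma regular_at_uminus:
  assumes "regular_at x M q r"
  shows "regular_at x M q (- r)" "ratval x M q (- r) = - ratval x M q r"
proof -
  have 1: "regular_at x M q (- 1)" "ratval x M q (- 1) = - 1"
    using ratval_poly[of x M q "- 1"] by (simp_all add: One_fract_def)
  show "regular_at x M q (- r)" "ratval x M q (- r) = - ratval x M q r"
    using regular_at_mult[OF 1(1) assms] 1 by simp_all
qed

lemma regular_at_diff:
  assumes "regular_at x M q r" "regular_at x M q s"
  shows "regular_at x M q (r - s)" "ratval x M q (r - s) = ratval x M q r - ratval x M q s"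
  using regular_at_add[OF assms(1) regular_at_uminus(1)[OF assms(2)]] regular_at_uminus[OF assms(2)]
  by simp_all

lemma regular_at_power:
  assumes "regular_at x M q r"
  shows "regular_at x M q (r ^ n) \<and> ratval x M q (r ^ n) = ratval x M q r ^ n"
  by (induction n) (use assms in \<open>auto simp: regular_at_mult\<close>)

lemma regular_at_inverse:
  assumes "regular_at x M q r" "ratval x M q r \<noteq> 0"
  shows "regular_at x M q (inverse r)" "ratval x M q (inverse r) = inverse (ratval x M q r)"
proof -
  obtain a b where r: "r = Fract a b" "b \<noteq> 0" "eval3 x M q b \<noteq> 0"
    "ratval x M q r = eval3 x M q a / eval3 x M q b" using assms(1) by (rule regular_atE)
  then have "eval3 x M q a \<noteq> 0"
    using assms(2) by auto
  then show "regular_at x M q (inverse r)" "ratval x M q (inverse r) = inverse (ratval x M q r)"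
    using r by (simp_all add: regular_at_Fract ratval_Fract)
qed

lemma regular_at_divide:
  assumes "regular_at x M q r" "regular_at x M q s" "ratval x M q s \<noteq> 0"
  shows "regular_at x M q (r / s)" "ratval x M q (r / s) = ratval x M q r / ratval x M q s"
  using regular_at_inverse[OF assms(2,3)] regular_at_mult[OF assms(1)]
  by (simp_all add: divide_inverse)

lemma regular_at_sum:
  assumes "\<And>i. i \<in> A \<Longrightarrow> regular_at x M q (f i)"
  shows "regular_at x M q (sum f A)" "ratval x M q (sum f A) = (\<Sum>i\<in>A. ratval x M q (f i))"
  using assms by (induction A rule: infinite_finite_induct) (auto simp: regular_at_add)

lemmas regular_at_intros = regular_at_add(1) regular_at_mult(1) regular_at_uminus(1)
  regular_at_diff(1) regular_at_power[THEN conjunct1] regular_at_sum(1)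

lemmas ratval_simps = regular_at_add(2) regular_at_mult(2) regular_at_uminus(2)
  regular_at_diff(2) regular_at_power[THEN conjunct2] regular_at_sum(2)

lemma ratval_shift_x:
  assumes "regular_at (q * x) M q r"
  shows "regular_at x M q (shift_x r)" "ratval x M q (shift_x r) = ratval (q * x) M q r"
proof -
  obtain a b where r: "r = Fract a b" "b \<noteq> 0" "eval3 (q * x) M q b \<noteq> 0"
    "ratval (q * x) M q r = eval3 (q * x) M q a / eval3 (q * x) M q b" using assms by (rule regular_atE)
  then show "regular_at x M q (shift_x r)" "ratval x M q (shift_x r) = ratval (q * x) M q r"
    by (simp_all add: shift_x_Fract regular_at_Fract ratval_Fract eval3_subst_x)
qed

lemma ratval_shift_M:
  assumes "regular_at x (q * M) q r"
  shows "regular_at x M q (shift_M r)" "ratval x M q (shift_M r) = ratval x (q * M) q r"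
proof -
  obtain a b where r: "r = Fract a b" "b \<noteq> 0" "eval3 x (q * M) q b \<noteq> 0"
    "ratval x (q * M) q r = eval3 x (q * M) q a / eval3 x (q * M) q b" using assms by (rule regular_atE)
  then show "regular_at x M q (shift_M r)" "ratval x M q (shift_M r) = ratval x (q * M) q r"
    by (simp_all add: shift_M_Fract regular_at_Fract ratval_Fract eval3_subst_M)
qed

section \<open>Operators as additive maps\<close>

lemma qmono_simps [simp]: "qmono 0 i j = 0" "qmono r i j + qmono s i j = qmono (r + s) i j"
  "- qmono r i j = qmono (- r) i j"
  by (simp_all add: qmono_def single_add single_uminus)

lemma qop_induct [case_names zero add]:
  fixes P :: qop
  assumes "A 0" "\<And>r i j P. A P \<Longrightarrow> A (qmono r i j + P)"
  shows "A P"
proof -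
  have "A (\<Sum>k\<in>K. qmono (Poly_Mapping.lookup P k) (fst k) (snd k))" if "finite K" for K
    using that by (induction K) (simp_all add: assms)
  then have "A (\<Sum>k\<in>Poly_Mapping.keys P. qmono (Poly_Mapping.lookup P k) (fst k) (snd k))"
    by simp
  moreover have "(\<Sum>k\<in>Poly_Mapping.keys P. qmono (Poly_Mapping.lookup P k) (fst k) (snd k)) = P"
  proof (rule poly_mapping_eqI)
    fix l
    have "(\<Sum>k\<in>Poly_Mapping.keys P. Poly_Mapping.lookup (qmono (Poly_Mapping.lookup P k) (fst k) (snd k)) l) =
        (\<Sum>k\<in>Poly_Mapping.keys P. if k = l then Poly_Mapping.lookup P k else 0)"
      by (rule sum.cong) (simp_all add: qmono_def lookup_single when_def)
    then show "Poly_Mapping.lookup (\<Sum>k\<in>Poly_Mapping.keys P.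
        qmono (Poly_Mapping.lookup P k) (fst k) (snd k)) l = Poly_Mapping.lookup P l"
      by (simp add: lookup_sum not_in_keys_iff_lookup_eq_zero)
  qed
  ultimately show ?thesis
    by (rule back_subst)
qed

lemma shift_pow_hom [simp]:
  "(shift_x ^^ i) (r + s) = (shift_x ^^ i) r + (shift_x ^^ i) s"
  "(shift_M ^^ i) (r + s) = (shift_M ^^ i) r + (shift_M ^^ i) s"
  "(shift_x ^^ i) (r * s) = (shift_x ^^ i) r * (shift_x ^^ i) s"
  "(shift_M ^^ i) (r * s) = (shift_M ^^ i) r * (shift_M ^^ i) s"
  "(shift_x ^^ i) 1 = 1" "(shift_M ^^ i) 1 = 1"
  by (induction i; simp)+

lemma qmult_add_left: "(P + Q) \<star> R = P \<star> R + Q \<star> R"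
proof -
  let ?g = "\<lambda>k r. \<Sum>l\<in>Poly_Mapping.keys R. qmono (r * (shift_x ^^ fst k)
    ((shift_M ^^ snd k) (Poly_Mapping.lookup R l))) (fst k + fst l) (snd k + snd l)"
  have *: "P \<star> R = (\<Sum>k\<in>Poly_Mapping.keys P. ?g k (Poly_Mapping.lookup P k))" for P
    by (simp add: qmult_def case_prod_unfold)
  show ?thesis
    unfolding * by (rule setsum_keys_plus_distrib) (simp_all add: distrib_right sum.distrib flip: qmono_simps(2))
qed

lemma qmult_add_right: "P \<star> (Q + R) = P \<star> Q + P \<star> R"
proof -
  let ?g = "\<lambda>k l s. qmono (Poly_Mapping.lookup P k * (shift_x ^^ fst k)
    ((shift_M ^^ snd k) s)) (fst k + fst l) (snd k + snd l)"
  have *: "P \<star> R = (\<Sum>k\<in>Poly_Mapping.keys P. \<Sum>l\<in>Poly_Mapping.keys R. ?g k l (Poly_Mapping.lookup R l))"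
    for R by (simp add: qmult_def case_prod_unfold)
  have "(\<Sum>l\<in>Poly_Mapping.keys (Q + R). ?g k l (Poly_Mapping.lookup (Q + R) l)) =
    (\<Sum>l\<in>Poly_Mapping.keys Q. ?g k l (Poly_Mapping.lookup Q l)) +
    (\<Sum>l\<in>Poly_Mapping.keys R. ?g k l (Poly_Mapping.lookup R l))" for k
    by (rule setsum_keys_plus_distrib) (simp_all add: distrib_left flip: qmono_simps(2))
  then show ?thesis
    unfolding * by (simp add: sum.distrib)
qed

lemma qmult_0 [simp]: "0 \<star> P = 0" "P \<star> 0 = 0"
  by (simp_all add: qmult_def)

lemma qmult_minus: "(- P) \<star> R = - (P \<star> R)" "P \<star> (- R) = - (P \<star> R)"
  using qmult_add_left[of P "- P" R] qmult_add_right[of P R "- R"]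
  by (metis minus_unique qmult_0 right_minus)+

lemma qmult_diff: "(P - Q) \<star> R = P \<star> R - Q \<star> R" "P \<star> (Q - R) = P \<star> Q - P \<star> R"
  using qmult_add_left[of P "- Q" R] qmult_add_right[of P Q "- R"] by (simp_all add: qmult_minus)

text \<open>A vector \<open>(a, b, c)\<close> stands for \<open>a + b S_m + c S_m\<^sup>2\<close> modulo the ideal; \<open>act_m\<close> and \<open>act_x\<close>
  are left multiplication by \<open>S_m\<close> and \<open>S_x\<close>.\<close>

type_synonym triple = "ratfun \<times> ratfun \<times> ratfun"

fun scale3 :: "ratfun \<Rightarrow> triple \<Rightarrow> triple" where
  "scale3 r (a, b, c) = (r * a, r * b, r * c)"

abbreviation e0 :: triple where "e0 \<equiv> (1, 0, 0)"

text \<open>S_m^3 is replaced by means of the recurrence in m solved for its top term: S_m^3 = 1 - s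
  S_m + (s - q^2 M) S_m^2 with s = 1 + x + 1 / x.\<close>

fun act_m :: "triple \<Rightarrow> triple" where
  "act_m (a, b, c) = (shift_M c, shift_M a - (1 + var_x + inverse var_x) * shift_M c,
     shift_M b + (1 + var_x + inverse var_x - var_q^2 * var_M) * shift_M c)"

text \<open>The class of S_x: \<open>P3\<close> solved for S_x, which occurs there once, with the
  invertible coefficient q M x.\<close>

definition x0 :: triple where
  "x0 = (1 - 1 / (var_q * var_M) + var_x^2 / var_M,
     var_q * var_x - 1 / var_x - (var_x + var_x^2) / var_M + (1 + 1 / var_x) / (var_q * var_M),
     var_x / var_M - 1 / (var_q * var_M * var_x))"

fun act_x :: "triple \<Rightarrow> triple" where
  "act_x (a, b, c) = scale3 (shift_x a) x0 + scale3 (shift_x b) (act_m x0)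
     + scale3 (shift_x c) (act_m (act_m x0))"

lemma scale3_add: "scale3 (r + s) v = scale3 r v + scale3 s v" "scale3 r (v + w) = scale3 r v + scale3 r w"
  "scale3 (r * s) v = scale3 r (scale3 s v)"
  by (cases v; cases w; simp add: algebra_simps)+

lemma scale3_simps [simp]: "scale3 0 v = 0" "scale3 1 v = v" "scale3 r 0 = 0"
  by (cases v; simp add: zero_prod_def)+

lemma act_m_add: "act_m (v + w) = act_m v + act_m w"
  by (cases v; cases w; simp add: algebra_simps)

lemma act_m_scale: "act_m (scale3 r v) = scale3 (shift_M r) (act_m v)"
  by (cases v; simp add: algebra_simps)

lemma act_x_add: "act_x (v + w) = act_x v + act_x w"
  by (cases v; cases w; simp add: algebra_simps scale3_add)

lemma act_x_scale: "act_x (scale3 r v) = scale3 (shift_x r) (act_x v)"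
  by (cases v) (simp add: scale3_add)

lemma act_0 [simp]: "act_x 0 = 0" "act_m 0 = 0"
  using act_x_scale[of 0 0] act_m_scale[of 0 0] by simp_all

lemma act_m_x0: "act_m x0 = (-1 / (var_x * var_M * var_q^2) + var_x / (var_M * var_q),
     1 / (var_x^2 * var_M * var_q^2) + 1 / (var_x * var_M * var_q^2) - 1 / (var_M * var_q) + 1 - var_x / (var_M * var_q),
     -1 / (var_x^2 * var_M * var_q^2) + 1 / (var_M * var_q))"
  by (simp add: x0_def field_simps power2_eq_square)

lemma act_m_act_m_x0: "act_m (act_m x0) = (-1 / (var_x^2 * var_M * var_q^3) + 1 / (var_M * var_q^2),
     1 / (var_x^3 * var_M * var_q^3) + 1 / (var_x^2 * var_M * var_q^3) - 1 / (var_x * var_M * var_q^2) - 1 / (var_M * var_q^2),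
     -1 / (var_x^3 * var_M * var_q^3) + 1 / (var_x^2 * var_q) + 1 / (var_x * var_M * var_q^2))"
  unfolding act_m_x0 by (simp add: field_simps power2_eq_square power3_eq_cube)

text \<open>The integrability condition. The image of S_x has to satisfy the recurrence in m with x
  replaced by q x, because S_x S_m^3 can be reduced before or after S_x is moved past S_m.\<close>

lemma act_m_cubed:
  "act_m (act_m (act_m x0)) = x0 + scale3 (shift_x (- (1 + var_x + inverse var_x))) (act_m x0)
     + scale3 (shift_x (1 + var_x + inverse var_x - var_q^2 * var_M)) (act_m (act_m x0))"
  unfolding act_m_act_m_x0 unfolding act_m_x0 x0_def
  by (simp add: field_simps power2_eq_square power3_eq_cube)

text \<open>Both sides are semilinear, so three basis vectors decide. On the classes of 1 and S_m
  the claim holds by definition of \<open>act_x\<close>; on the class of S_m^2 it is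
  \<open>act_m_cubed\<close>.\<close>

lemma act_commute: "act_x (act_m v) = act_m (act_x v)"
proof -
  obtain a b c where v: "v = (a, b, c)" by (cases v)
  have comb: "scale3 a' Y + scale3 b' Z + scale3 c' (X + scale3 s Y + scale3 t Z) =
      scale3 c' X + scale3 (a' + s * c') Y + scale3 (b' + t * c') Z" for a' b' c' s t X Y Z
    by (simp add: scale3_add(1,2) ac_simps flip: scale3_add(3))
  show ?thesis
    unfolding v act_m.simps act_x.simps act_m_add act_m_scale act_m_cubed comb
    by (simp only: shift_x_shift_M shift_x_hom shift_M_hom shift_hom' mult_minus_left
        diff_conv_add_uminus)
qed

lemma act_pow_hom:
  "(act_x ^^ i) (v + w) = (act_x ^^ i) v + (act_x ^^ i) w"
  "(act_m ^^ i) (v + w) = (act_m ^^ i) v + (act_m ^^ i) w"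
  "(act_x ^^ i) (scale3 r v) = scale3 ((shift_x ^^ i) r) ((act_x ^^ i) v)"
  "(act_m ^^ i) (scale3 r v) = scale3 ((shift_M ^^ i) r) ((act_m ^^ i) v)"
  "(act_x ^^ i) 0 = 0" "(act_m ^^ i) 0 = 0"
  by (induction i; simp add: act_x_add act_m_add act_x_scale act_m_scale)+

lemma act_pow_commute: "(act_m ^^ j) ((act_x ^^ i) v) = (act_x ^^ i) ((act_m ^^ j) v)"
proof -
  have "act_m ((act_x ^^ i) v) = (act_x ^^ i) (act_m v)" for v
    by (induction i) (simp_all add: act_commute[symmetric])
  then show ?thesis
    by (induction j) simp_all
qed

section \<open>The module structure on triples\<close>

definition mact :: "qop \<Rightarrow> triple \<Rightarrow> triple" where
  "mact P v = (\<Sum>k\<in>Poly_Mapping.keys P.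
     scale3 (Poly_Mapping.lookup P k) ((act_x ^^ fst k) ((act_m ^^ snd k) v)))"

lemma mact_add: "mact (P + Q) v = mact P v + mact Q v"
  unfolding mact_def by (rule setsum_keys_plus_distrib) (simp_all add: scale3_add)

lemma mact_0 [simp]: "mact 0 v = 0"
  by (simp add: mact_def)

lemma mact_minus: "mact (- P) v = - mact P v"
  using mact_add[of P "- P" v] by (simp add: minus_unique)

lemma mact_diff: "mact (P - Q) v = mact P v - mact Q v"
  using mact_add[of P "- Q" v] by (simp add: mact_minus)

lemma mact_qmono: "mact (qmono r i j) v = scale3 r ((act_x ^^ i) ((act_m ^^ j) v))"
  by (cases "r = 0") (simp_all add: mact_def qmono_def)

lemma mact_vec: "mact P (v + w) = mact P v + mact P w" "mact P 0 = 0"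
  by (simp_all add: mact_def act_pow_hom scale3_add sum.distrib)

text \<open>Operators are written in the normal order S_x^i S_m^j, so multiplying two monomials
  moves S_m^j past S_x^k. For this the two actions must commute.\<close>

lemma mact_qmult: "mact (P \<star> Q) v = mact P (mact Q v)"
proof (induction P rule: qop_induct)
  case (add r i j P)
  have "mact (qmono r i j \<star> Q) v = mact (qmono r i j) (mact Q v)"
  proof (induction Q rule: qop_induct)
    case (add s k l Q)
    have "(act_x ^^ (i + k)) ((act_m ^^ (j + l)) v) = (act_x ^^ i) ((act_m ^^ j) ((act_x ^^ k) ((act_m ^^ l) v)))"
      by (simp add: funpow_add act_pow_commute)
    then have "mact (qmono r i j \<star> qmono s k l) v = mact (qmono r i j) (mact (qmono s k l) v)"
      by (simp add: qmult_qmono mact_qmono act_pow_hom scale3_add)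
    with add show ?case
      by (simp add: qmult_add_right mact_add mact_vec)
  qed (simp add: mact_vec)
  with add show ?case
    by (simp add: qmult_add_left mact_add)
qed simp

text \<open>The action on the class of 1. Its kernel is the annihilator of a vector and hence a left
  ideal.\<close>

definition nform :: "qop \<Rightarrow> triple" where
  "nform P = mact P e0"

lemma nform_add: "nform (P + Q) = nform P + nform Q"
  and nform_diff: "nform (P - Q) = nform P - nform Q"
  and nform_0 [simp]: "nform 0 = 0"
  and nform_qmult: "nform (P \<star> Q) = mact P (nform Q)"
  by (simp_all add: nform_def mact_add mact_diff mact_qmult)

lemma nform_sum: "nform (sum f A) = (\<Sum>i\<in>A. nform (f i))"
  by (induction A rule: infinite_finite_induct) (simp_all add: nform_add)

lemma mact_simps [simp]:
  "mact (cf r) v = scale3 r v" "mact S_x v = act_x v" "mact S_m v = act_m v"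
  by (simp_all add: mact_qmono S_x_def S_m_def)

lemma nform_gens [simp]: "nform (cf r) = scale3 r e0" "nform S_x = x0" "nform S_m = (0, 1, 0)"
  by (simp_all add: nform_def)

lemma nform_P: "nform P1 = 0" "nform P2 = 0" "nform P3 = 0"
proof -
  show "nform P2 = 0" "nform P3 = 0"
    by (simp_all add: P2_def P3_def Let_def nform_diff nform_add nform_qmult mact_qmult act_m_x0)
       (simp_all add: x0_def zero_prod_def field_simps power2_eq_square power3_eq_cube)
  \<comment> \<open>\<open>d\<close> is a common denominator of the images of S_x, S_m S_x and S_m^2
    S_x, and \<open>e\<close> one of the coordinates of \<open>x0\<close> at q x. Pulling both out
    leaves an identity between polynomial triples, small enough to be expanded.\<close>
  define d where "d = inverse (var_q^3 * var_M * var_x^3)"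
  define e where "e = inverse (var_q^2 * var_M * var_x)"
  define v0 :: triple where "v0 =
      (0 - var_x^3 * var_q^2 + var_x^3 * var_M * var_q^3 + var_x^5 * var_q^3,
       var_x^2 * var_q^2 - var_x^2 * var_M * var_q^3 + var_x^3 * var_q^2 - var_x^4 * var_q^3 + var_x^4 * var_M * var_q^4 - var_x^5 * var_q^3,
       0 - var_x^2 * var_q^2 + var_x^4 * var_q^3)"
  have X: "x0 = scale3 d v0"
    by (simp add: v0_def d_def x0_def field_simps eval_nat_numeral)
  define v1 :: triple where "v1 =
      (0 - var_x^2 * var_q + var_x^4 * var_q^2,
       var_x * var_q + var_x^2 * var_q - var_x^3 * var_q^2 + var_x^3 * var_M * var_q^3 - var_x^4 * var_q^2,
       0 - var_x * var_q + var_x^3 * var_q^2)"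
  have Y: "act_m x0 = scale3 d v1"
    by (simp add: v1_def d_def act_m_x0 field_simps eval_nat_numeral)
  define v2 :: triple where "v2 =
      (0 - var_x + var_x^3 * var_q,
       1 + var_x - var_x^2 * var_q - var_x^3 * var_q,
       0 - 1 + var_x * var_M * var_q^2 + var_x^2 * var_q)"
  have Z: "act_m (act_m x0) = scale3 d v2"
    by (simp add: v2_def d_def act_m_act_m_x0 field_simps eval_nat_numeral)
  have XX: "act_x x0 = scale3 (e * (0 - var_x * var_q + var_x * var_M * var_q^2 + var_x^3 * var_q^4)) (scale3 d v0)
      + scale3 (e * (1 - var_M * var_q + var_x * var_q - var_x^2 * var_q^3 + var_x^2 * var_M * var_q^4 - var_x^3 * var_q^4)) (scale3 d v1)
      + scale3 (e * (0 - 1 + var_x^2 * var_q^3)) (scale3 d v2)"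
    unfolding X[symmetric] Y[symmetric] Z[symmetric]
    unfolding arg_cong[OF x0_def, of act_x] act_x.simps
    by (intro arg_cong2[of _ _ _ _ "(+)"] arg_cong2[of _ _ _ _ scale3] refl)
       (simp_all add: e_def field_simps eval_nat_numeral)
  have e: "var_q^4 * var_M * var_x^4 * (e * d) = d * (var_q^2 * var_x^3)"
    by (simp add: e_def field_simps eval_nat_numeral)
  have one: "1 = d * (var_q^3 * var_M * var_x^3)"
    by (simp add: d_def field_simps)
  have sc: "scale3 (var_q^4 * var_M * var_x^4 * (1 - var_q * var_x^2)) (scale3 (e * r) (scale3 d v))
      = scale3 d (scale3 (var_q^2 * var_x^3 * (1 - var_q * var_x^2) * r) v)" for r v
  proof -
    have "var_q^4 * var_M * var_x^4 * (1 - var_q * var_x^2) * (e * r) * d =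
        (var_q^4 * var_M * var_x^4 * (e * d)) * (1 - var_q * var_x^2) * r"
      by (simp only: ac_simps)
    then show ?thesis
      unfolding e by (simp only: ac_simps flip: scale3_add(3))
  qed
  have sc1: "scale3 r (1, 0, 0) = scale3 d (var_q^3 * var_M * var_x^3 * r, 0, 0)"
    "scale3 r (0, 1, 0) = scale3 d (0, var_q^3 * var_M * var_x^3 * r, 0)" for r
    using one by (simp_all add: mult.assoc[symmetric])
  have sc2: "scale3 r (scale3 d v) = scale3 d (scale3 r v)" for r v
    by (simp only: mult.commute flip: scale3_add(3))
  have sub: "scale3 d v - scale3 d w = scale3 d (v - w)" "scale3 d 0 = 0" for v w
    by (cases v; cases w; simp add: algebra_simps)+
  show "nform P1 = 0"
    unfolding P1_def Let_def nform_diff nform_add nform_qmult mact_simps nform_gens mact_qmult XX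
    unfolding X scale3_add(2) sc
    unfolding sc1 sc2 sub
    unfolding scale3_add(2)[symmetric] sub
    by (rule arg_cong[of _ 0 "scale3 d", unfolded sub]) (simp add: v0_def v1_def v2_def zero_prod_def algebra_simps eval_nat_numeral)
qed

section \<open>The ideal as a kernel\<close>

lemma left_ideal_nform: "left_ideal {P. nform P = 0}"
  by (simp add: left_ideal_def nform_add nform_qmult mact_vec)

lemma left_ideal_I52: "left_ideal I52"
  unfolding I52_def hull_def by (auto simp: left_ideal_def)

lemma I52_closed:
  "P \<in> I52 \<Longrightarrow> Q \<in> I52 \<Longrightarrow> P + Q \<in> I52" "Q \<in> I52 \<Longrightarrow> P \<star> Q \<in> I52"
  "0 \<in> I52"
  using left_ideal_I52 by (auto simp: left_ideal_def)

lemma I52_uminus: "P \<in> I52 \<Longrightarrow> - P \<in> I52"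
proof -
  have "cf 1 \<star> P = P"
    by (induction P rule: qop_induct) (simp_all add: qmult_add_right qmult_qmono)
  then have "cf (- 1) \<star> P = - P"
    using qmult_minus(1)[of "cf 1" P] by simp
  then show "P \<in> I52 \<Longrightarrow> - P \<in> I52"
    using I52_closed(2)[of P "cf (- 1)"] by simp
qed

lemma I52_diff: "P \<in> I52 \<Longrightarrow> Q \<in> I52 \<Longrightarrow> P - Q \<in> I52"
  using I52_closed(1)[of P "- Q"] I52_uminus[of Q] by simp

lemma I52_gens: "P1 \<in> I52" "P2 \<in> I52" "P3 \<in> I52"
  by (auto simp: I52_def intro: hull_inc)

lemma nform_I52: "P \<in> I52 \<Longrightarrow> nform P = 0"
  using hull_minimal[of "{P1, P2, P3}" "{P. nform P = 0}" left_ideal] left_ideal_nform nform_P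
  by (auto simp: I52_def)

fun lin3 :: "triple \<Rightarrow> qop" where
  "lin3 (a, b, c) = qmono a 0 0 + qmono b 0 1 + qmono c 0 2"

lemma lin3_add: "lin3 (v + w) = lin3 v + lin3 w"
  by (cases v; cases w) (simp add: ac_simps flip: qmono_simps(2))

lemma nform_lin3: "nform (lin3 v) = v"
  by (cases v) (simp add: nform_def mact_add mact_qmono numeral_2_eq_2)

lemma lin3_scale: "cf r \<star> lin3 v = lin3 (scale3 r v)"
  by (cases v) (simp add: qmult_add_right qmult_qmono numeral_2_eq_2)

lemma P23_qmono:
  "P2 = qmono var_x 0 0 - qmono 1 0 1 - qmono var_x 1 0 + qmono (var_q * var_x^2) 1 1"
  "P3 = qmono (var_x * (1 - var_q * var_M - var_q * var_x^2)) 0 0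
     - qmono (1 - var_q * var_M + var_x - var_q * var_x^2 + var_q^2 * var_M * var_x^2
         - var_q * var_x^3) 0 1
     + qmono (1 - var_q * var_x^2) 0 2 + qmono (var_q * var_M * var_x) 1 0"
  by (simp_all add: P2_def P3_def Let_def S_x_def S_m_def qmult_qmono numeral_2_eq_2)

lemma lookup_qmono: "Poly_Mapping.lookup (qmono r i j) k = (if k = (i, j) then r else 0)"
  by (simp add: qmono_def lookup_single when_def)

text \<open>The inhomogeneous combination eliminates \<open>S_x\<close> from \<open>P2\<close> and \<open>P3\<close>.\<close>

lemma S_m_cubed_mod_I52:
  "qmono 1 0 3 - lin3 (act_m (0, 0, 1)) \<in> I52"
proof -
  \<comment> \<open>\<open>w\<close> is the coefficient of S_m^3 in the combination below. There the
    S_x terms cancel between q M \<open>P2\<close> and \<open>P3\<close>, and the S_x S_m terms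
    between q M \<open>P2\<close> and x S_m \<open>P3\<close>.\<close>
  define w where "w = - var_x * (1 - var_q * var_x^2)"
  have "1 - var_q * var_x^2 \<noteq> 0"
  proof
    assume "1 - var_q * var_x^2 = 0"
    then have "ratval 0 1 1 (1 - var_q * var_x^2) = 0"
      by simp
    then show False
      by (simp add: ratval_simps regular_at_intros)
  qed
  then have nz: "w \<noteq> 0"
    by (simp add: w_def)
  have "cf (inverse w) \<star> (cf (var_q * var_M) \<star> P2 + P3 - cf var_x \<star> (S_m \<star> P3)) \<in> I52"
    by (intro I52_closed I52_diff I52_gens)
  also have "cf (var_q * var_M) \<star> P2 + P3 - cf var_x \<star> (S_m \<star> P3) =
      qmono w 0 3 - lin3 (scale3 w (act_m (0, 0, 1)))"
    unfolding P23_qmono S_m_def qmult_add_right qmult_diff qmult_qmono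
    by (rule poly_mapping_eqI, case_tac k)
       (simp add: w_def lookup_add lookup_minus lookup_qmono numeral_3_eq_3 numeral_2_eq_2 field_simps)
  also have "cf (inverse w) \<star> \<dots> = qmono 1 0 3 - lin3 (act_m (0, 0, 1))"
    unfolding qmult_diff lin3_scale qmult_qmono scale3_add(3)[symmetric] using nz by simp
  finally show ?thesis .
qed

definition reducible :: "qop \<Rightarrow> bool" where
  "reducible P \<longleftrightarrow> (\<exists>v. P - lin3 v \<in> I52)"

lemma reducible_add:
  assumes "reducible P" "reducible Q"
  shows "reducible (P + Q)"
proof -
  obtain v w where "P - lin3 v \<in> I52" "Q - lin3 w \<in> I52"
    using assms by (auto simp: reducible_def)
  then have "(P - lin3 v) + (Q - lin3 w) \<in> I52"
    by (rule I52_closed)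
  then show ?thesis
    unfolding reducible_def by (intro exI[of _ "v + w"]) (simp add: lin3_add algebra_simps)
qed

lemma reducible_lin3: "reducible (lin3 v)"
  unfolding reducible_def by (rule exI[of _ v]) (simp add: I52_closed(3))

lemma reducible_mod:
  assumes "P - Q \<in> I52" "reducible Q"
  shows "reducible P"
proof -
  obtain v where "Q - lin3 v \<in> I52"
    using assms(2) unfolding reducible_def by blast
  from I52_closed(1)[OF assms(1) this] show ?thesis
    unfolding reducible_def by (intro exI[of _ v]) simp
qed

lemma reducible_cf:
  assumes "reducible P"
  shows "reducible (cf r \<star> P)"
proof -
  obtain v where "P - lin3 v \<in> I52"
    using assms by (auto simp: reducible_def)
  from I52_closed(2)[OF this, of "cf r"] show ?thesis
    unfolding reducible_def by (intro exI[of _ "scale3 r v"]) (simp only: lin3_scale qmult_diff)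
qed

lemma reducible_S_m:
  assumes "reducible P"
  shows "reducible (S_m \<star> P)"
proof -
  obtain a b c where v: "P - lin3 (a, b, c) \<in> I52"
    using assms by (auto simp: reducible_def)
  have eq: "S_m \<star> lin3 (a, b, c) = lin3 (0, shift_M a, shift_M b) + cf (shift_M c) \<star> qmono 1 0 3"
    by (simp add: qmult_add_right S_m_def qmult_qmono numeral_3_eq_3 numeral_2_eq_2)
  have "reducible (S_m \<star> lin3 (a, b, c))"
    unfolding eq
    by (intro reducible_add reducible_lin3 reducible_cf reducible_mod[OF S_m_cubed_mod_I52])
  moreover have "S_m \<star> P - S_m \<star> lin3 (a, b, c) \<in> I52"
    using I52_closed(2)[OF v, of S_m] by (simp add: qmult_diff)
  ultimately show ?thesis
    by (rule reducible_mod[rotated])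
qed

text \<open>\<open>P3\<close> reduces S_x itself; S_x S_m and S_x S_m^2 follow by multiplying with
  S_m, which commutes with S_x and preserves reducibility.\<close>

lemma reducible_S_x:
  assumes "reducible P"
  shows "reducible (S_x \<star> P)"
proof -
  obtain a b c where v: "P - lin3 (a, b, c) \<in> I52"
    using assms by (auto simp: reducible_def)
  let ?u = "(var_x * (1 - var_q * var_M - var_q * var_x^2),
     - (1 - var_q * var_M + var_x - var_q * var_x^2 + var_q^2 * var_M * var_x^2 - var_q * var_x^3),
     1 - var_q * var_x^2)"
  have P3: "P3 = lin3 ?u + qmono (var_q * var_M * var_x) 1 0"
    by (simp add: P23_qmono algebra_simps flip: qmono_simps(3))
  have "cf (inverse (var_q * var_M * var_x)) \<star> P3 \<in> I52"
    by (intro I52_closed I52_gens)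
  moreover have "cf (inverse (var_q * var_M * var_x)) \<star> P3 =
      qmono 1 1 0 - lin3 (scale3 (- inverse (var_q * var_M * var_x)) ?u)"
    unfolding P3 qmult_add_right lin3_scale
    by (simp add: qmult_qmono field_simps flip: qmono_simps(3))
  ultimately have "qmono 1 1 0 - lin3 (scale3 (- inverse (var_q * var_M * var_x)) ?u) \<in> I52"
    by (rule subst[rotated])
  then have x: "reducible (qmono 1 1 0)"
    by (rule reducible_mod[OF _ reducible_lin3])
  have "reducible (S_m \<star> qmono 1 1 0)"
    by (intro reducible_S_m x)
  then have xm: "reducible (qmono 1 1 1)"
    by (simp add: S_m_def qmult_qmono)
  have "reducible (S_m \<star> qmono 1 1 1)"
    by (intro reducible_S_m xm)
  then have xmm: "reducible (qmono 1 1 2)"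
    by (simp add: S_m_def qmult_qmono numeral_2_eq_2)
  have eq: "S_x \<star> lin3 (a, b, c) = cf (shift_x a) \<star> qmono 1 1 0 + cf (shift_x b) \<star> qmono 1 1 1
      + cf (shift_x c) \<star> qmono 1 1 2"
    by (simp add: qmult_add_right S_x_def qmult_qmono)
  have "reducible (S_x \<star> lin3 (a, b, c))"
    unfolding eq by (intro reducible_add reducible_cf x xm xmm)
  moreover have "S_x \<star> P - S_x \<star> lin3 (a, b, c) \<in> I52"
    using I52_closed(2)[OF v, of S_x] by (simp add: qmult_diff)
  ultimately show ?thesis
    by (rule reducible_mod[rotated])
qed

lemma reducible: "reducible P"
proof (induction P rule: qop_induct)
  case zero
  then show ?case using reducible_lin3[of "(0, 0, 0)"] by simp
next
  case (add r i j P)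
  have "reducible (qmono 1 0 j)"
  proof (induction j)
    case 0
    then show ?case using reducible_lin3[of "(1, 0, 0)"] by simp
  next
    case (Suc j)
    have "qmono 1 0 (Suc j) = S_m \<star> qmono 1 0 j"
      by (simp add: S_m_def qmult_qmono)
    with Suc show ?case by (simp add: reducible_S_m)
  qed
  then have "reducible (qmono 1 i j)"
  proof (induction i)
    case (Suc i)
    have "qmono 1 (Suc i) j = S_x \<star> qmono 1 i j"
      by (simp add: S_x_def qmult_qmono)
    with Suc show ?case by (simp add: reducible_S_x)
  qed
  moreover have "qmono r i j = cf r \<star> qmono 1 i j"
    by (simp add: qmult_qmono)
  ultimately show ?case
    using add by (simp add: reducible_add reducible_cf)
qed

text \<open>Here the two bounds meet: modulo the ideal every operator equals some triple, and
  \<open>nform\<close>, which vanishes on the ideal, reads this triple off.\<close>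

lemma I52_eq: "I52 = {P. nform P = 0}"
proof (intro equalityI subsetI)
  fix P assume "P \<in> {P. nform P = 0}"
  moreover obtain v where v: "P - lin3 v \<in> I52"
    using reducible[of P] by (auto simp: reducible_def)
  ultimately have "v = 0"
    using nform_I52[OF v] by (simp add: nform_diff nform_lin3)
  then show "P \<in> I52"
    using v by (simp add: zero_prod_def)
qed (simp add: nform_I52)

lemma has_rank_I52: "has_rank I52 3"
  unfolding has_rank_def quot_dim_def
proof (intro exI[of _ "\<lambda>i. qmono 1 0 i"] conjI ballI)
  fix P :: qop
  obtain a b c where P: "nform P = (a, b, c)" by (cases "nform P")
  have eq: "P - (\<Sum>i<3. cf (d i) \<star> qmono 1 0 i) \<in> I52 \<longleftrightarrow> d 0 = a \<and> d 1 = b \<and> d 2 = c" for d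
  proof -
    have "(\<Sum>i<3. cf (d i) \<star> qmono 1 0 i) = lin3 (d 0, d 1, d 2)"
      by (simp add: numeral_3_eq_3 numeral_2_eq_2 qmult_qmono)
    then have "nform (P - (\<Sum>i<3. cf (d i) \<star> qmono 1 0 i)) = (a - d 0, b - d 1, c - d 2)"
      by (simp only: nform_diff nform_lin3 P) simp
    then show ?thesis
      by (auto simp: I52_eq zero_prod_def)
  qed
  show "\<exists>!d. d \<in> {..<3} \<rightarrow>\<^sub>E UNIV \<and> P - (\<Sum>i<3. cf (d i) \<star> qmono 1 0 i) \<in> I52"
    unfolding eq
  \<comment> \<open>Coefficient functions in \<open>quot_dim\<close> are extensional, so uniqueness
    also concerns the fixed value outside {0, 1, 2}.\<close>
  proof (intro ex1I[of _ "restrict (\<lambda>i. [a, b, c] ! i) {..<3}"])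
    fix d assume d: "d \<in> {..<3::nat} \<rightarrow>\<^sub>E UNIV \<and> d 0 = a \<and> d 1 = b \<and> d 2 = c"
    show "d = restrict (\<lambda>i. [a, b, c] ! i) {..<3}"
    proof
      fix i :: nat
      consider "i = 0" | "i = 1" | "i = 2" | "i \<ge> 3" by linarith
      then show "d i = restrict (\<lambda>i. [a, b, c] ! i) {..<3} i"
        using d PiE_arb[of d "{..<3}" "\<lambda>_. UNIV" i] by cases simp_all
    qed
  qed auto
qed auto

section \<open>Pointwise solutions\<close>

text \<open>The denominators in \<open>act_m\<close> and \<open>x0\<close> are monomials in x, M and
  q. The triples obtained from \<open>e0\<close> by the two actions can therefore be evaluated at
  all relevant points; poles come only from the coefficients of the given operator.\<close>

definition lreg :: "ratfun \<Rightarrow> bool" where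
  "lreg r \<longleftrightarrow> (\<forall>x M q. x \<noteq> 0 \<longrightarrow> M \<noteq> 0 \<longrightarrow> q \<noteq> 0 \<longrightarrow> regular_at x M q r)"

lemma lregD: "lreg r \<Longrightarrow> x \<noteq> 0 \<Longrightarrow> M \<noteq> 0 \<Longrightarrow> q \<noteq> 0 \<Longrightarrow> regular_at x M q r"
  by (simp add: lreg_def)

lemma lreg_var: "lreg 0" "lreg 1" "lreg var_x" "lreg var_M" "lreg var_q"
  "lreg (inverse var_x)" "lreg (inverse var_M)" "lreg (inverse var_q)"
  by (auto simp: lreg_def intro: regular_at_inverse)

lemma lreg_closed:
  assumes "lreg r" "lreg s"
  shows "lreg (r + s)" "lreg (r - s)" "lreg (r * s)" "lreg (- r)"
  using assms by (auto simp: lreg_def intro!: regular_at_intros)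

lemma lreg_power: "lreg r \<Longrightarrow> lreg (r ^ n)"
  by (simp add: lreg_def regular_at_intros)

lemma lreg_shift:
  assumes "lreg r"
  shows "lreg (shift_x r)" "lreg (shift_M r)"
  using assms by (auto simp: lreg_def intro!: ratval_shift_x(1) ratval_shift_M(1))

definition lreg3 :: "triple \<Rightarrow> bool" where
  "lreg3 v = (case v of (a, b, c) \<Rightarrow> lreg a \<and> lreg b \<and> lreg c)"

lemma lreg3_closed:
  assumes "lreg3 v" "lreg3 w"
  shows "lreg3 (v + w)" "lreg r \<Longrightarrow> lreg3 (scale3 r v)" "lreg3 (act_m v)"
  using assms by (cases v; cases w;
    simp add: lreg3_def lreg_closed lreg_shift lreg_var lreg_power)+

lemma lreg3_x0: "lreg3 x0"
  by (simp add: lreg3_def x0_def divide_inverse lreg_closed lreg_var lreg_power)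

lemma lreg3_act_x: "lreg3 v \<Longrightarrow> lreg3 (act_x v)"
  by (cases v) (auto simp: lreg3_def[of "(_, _, _)"] simp del: act_m.simps
      intro!: lreg3_closed lreg3_x0 lreg_shift)

definition pair3 :: "complex \<Rightarrow> triple \<Rightarrow> (int \<Rightarrow> complex \<Rightarrow> complex) \<Rightarrow> int \<Rightarrow> complex \<Rightarrow> complex" where
  "pair3 q v f m x = (case v of (a, b, c) \<Rightarrow>
     ratval x (q powi m) q a * f m x + ratval x (q powi m) q b * f (m + 1) x
     + ratval x (q powi m) q c * f (m + 2) x)"

definition treg :: "complex \<Rightarrow> int \<Rightarrow> complex \<Rightarrow> triple \<Rightarrow> bool" where
  "treg q m x v = (case v of (a, b, c) \<Rightarrow> regular_at x (q powi m) q a \<and>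
     regular_at x (q powi m) q b \<and> regular_at x (q powi m) q c)"

lemma treg_lreg3: "lreg3 v \<Longrightarrow> q \<noteq> 0 \<Longrightarrow> x \<noteq> 0 \<Longrightarrow> treg q m x v"
  by (cases v) (auto simp: treg_def lreg3_def intro: lregD)

lemma pair3_add:
  assumes "treg q m x v" "treg q m x w"
  shows "treg q m x (v + w)" "pair3 q (v + w) f m x = pair3 q v f m x + pair3 q w f m x"
  using assms by (cases v; cases w; simp add: treg_def pair3_def regular_at_add algebra_simps)+

lemma pair3_scale:
  assumes "regular_at x (q powi m) q r" "treg q m x v"
  shows "treg q m x (scale3 r v)" "pair3 q (scale3 r v) f m x = ratval x (q powi m) q r * pair3 q v f m x"
  using assms by (cases v; simp add: treg_def pair3_def regular_at_mult algebra_simps)+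

lemma pair3_e0 [simp]: "pair3 q e0 f m x = f m x"
  by (simp add: pair3_def)

text \<open>The two relations to which the system reduces, at a single point \<open>x\<close>.\<close>

definition qsol :: "complex \<Rightarrow> (int \<Rightarrow> complex \<Rightarrow> complex) \<Rightarrow> complex \<Rightarrow> bool" where
  "qsol q f x \<longleftrightarrow> (\<forall>m. f (m + 3) x = f m x - (1 + x + inverse x) * f (m + 1) x
       + (1 + x + inverse x - q^2 * q powi m) * f (m + 2) x \<and>
     f m (q * x) = pair3 q x0 f m x)"

text \<open>\<open>pair3\<close> carries multiplication by S_m on triples to the shift of m on
  functions, since the recurrence in \<open>qsol\<close> is the rule that \<open>act_m\<close> uses
  for S_m^3. The next lemma does the same for S_x, by the second relation of
  \<open>qsol\<close>.\<close>

lemma pair3_act_m: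
  assumes "qsol q f x" "lreg3 v" "q \<noteq> 0" "x \<noteq> 0"
  shows "pair3 q (act_m v) f m x = pair3 q v f (m + 1) x"
proof -
  obtain a b c where v: "v = (a, b, c)" by (cases v)
  have reg: "regular_at x (q * q powi m) q a" "regular_at x (q * q powi m) q b" "regular_at x (q * q powi m) q c"
    using assms by (auto simp: v lreg3_def intro!: lregD)
  have f: "f (m + 3) x = f m x - (1 + x + inverse x) * f (m + 1) x
       + (1 + x + inverse x - q^2 * q powi m) * f (m + 2) x"
    using assms(1) by (simp add: qsol_def)
  have M: "q powi (m + 1) = q * q powi m"
    using assms by (simp add: power_int_add)
  have X: "regular_at x (q powi m) q (inverse var_x)" "ratval x (q powi m) q (inverse var_x) = inverse x"
    using regular_at_inverse[of x "q powi m" q var_x] assms by simp_all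
  show ?thesis
    using reg by (simp add: v pair3_def ratval_simps regular_at_intros ratval_shift_M M f X add.assoc)
      (simp add: algebra_simps)
qed

lemma pair3_act_x:
  assumes "qsol q f x" "lreg3 v" "q \<noteq> 0" "x \<noteq> 0"
  shows "pair3 q (act_x v) f m x = pair3 q v f m (q * x)"
proof -
  obtain a b c where v: "v = (a, b, c)" by (cases v)
  have reg: "regular_at (q * x) (q powi m) q a" "regular_at (q * x) (q powi m) q b" "regular_at (q * x) (q powi m) q c"
    using assms by (auto simp: v lreg3_def intro!: lregD)
  have f: "f n (q * x) = pair3 q x0 f n x" for n
    using assms(1) by (simp add: qsol_def)
  have "pair3 q (act_m x0) f m x = f (m + 1) (q * x)"
    "pair3 q (act_m (act_m x0)) f m x = f (m + 2) (q * x)"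
    using assms by (simp_all add: f pair3_act_m lreg3_x0 lreg3_closed del: act_m.simps add.assoc)
      (simp_all add: add.commute)
  moreover have "treg q m x x0" "treg q m x (act_m x0)" "treg q m x (act_m (act_m x0))"
    using assms by (auto intro!: treg_lreg3 lreg3_closed lreg3_x0)
  ultimately show ?thesis
    using reg f[of m] by (simp add: v pair3_add pair3_scale ratval_shift_x del: act_m.simps)
      (simp add: pair3_def)
qed

lemma lreg3_pow: "lreg3 v \<Longrightarrow> lreg3 ((act_x ^^ i) ((act_m ^^ j) v))"
proof -
  assume "lreg3 v"
  then have "lreg3 ((act_m ^^ j) v)"
    by (induction j) (auto intro: lreg3_closed)
  then show ?thesis
    by (induction i) (auto intro: lreg3_act_x)
qed

lemma lreg3_e0: "lreg3 e0"
  by (simp add: lreg3_def lreg_var)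

lemma pair3_pow:
  assumes "\<And>k. qsol q f (q ^ k * x)" "q \<noteq> 0" "x \<noteq> 0"
  shows "pair3 q ((act_x ^^ i) ((act_m ^^ j) e0)) f m x = f (m + int j) (q ^ i * x)"
proof -
  have m: "pair3 q ((act_m ^^ j) e0) f m y = f (m + int j) y" if "qsol q f y" "y \<noteq> 0" for m y
    using that
  proof (induction j arbitrary: m)
    case (Suc j)
    then show ?case
      using assms lreg3_pow[OF lreg3_e0, of 0 j] by (simp add: pair3_act_m del: act_m.simps)
        (simp add: algebra_simps)
  qed simp
  \<comment> \<open>The induction runs over all points q^k x at once, because removing one
    \<open>act_x\<close> at a point leads to the next one.\<close>
  have "pair3 q ((act_x ^^ i) ((act_m ^^ j) e0)) f m (q ^ k * x) = f (m + int j) (q ^ (i + k) * x)" for k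
  proof (induction i arbitrary: k)
    case 0
    then show ?case using assms by (simp add: m)
  next
    case (Suc i)
    show ?case
      using Suc[of "Suc k"] assms lreg3_pow[OF lreg3_e0, of i j] by (simp add: pair3_act_x mult.assoc del: act_x.simps)
  qed
  from this[of 0] show ?thesis by simp
qed

definition qreg :: "complex \<Rightarrow> int \<Rightarrow> complex \<Rightarrow> qop \<Rightarrow> bool" where
  "qreg q m x P \<longleftrightarrow> (\<forall>k. regular_at x (q powi m) q (Poly_Mapping.lookup P k))"

lemma qregD: "qreg q m x P \<Longrightarrow> regular_at x (q powi m) q (Poly_Mapping.lookup P k)"
  by (simp add: qreg_def del: split_paired_All)

lemma qreg_keys: "qreg q m x P \<longleftrightarrow>
    (\<forall>k\<in>Poly_Mapping.keys P. regular_at x (q powi m) q (Poly_Mapping.lookup P k))"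
  unfolding qreg_def by (metis not_in_keys_iff_lookup_eq_zero regular_at_simple(1))

text \<open>On a function that satisfies the two relations along the orbit of x, an operator acts
  only through its normal form. Thus the ideal kills such a function, and an operator that kills it
  yields a relation between three consecutive values.\<close>

lemma act_eq_pair3:
  assumes "\<And>k. qsol q f (q ^ k * x)" "q \<noteq> 0" "x \<noteq> 0" "qreg q m x P"
  shows "treg q m x (nform P)" "act q P f m x = pair3 q (nform P) f m x"
proof -
  let ?t = "\<lambda>k. scale3 (Poly_Mapping.lookup P k) ((act_x ^^ fst k) ((act_m ^^ snd k) e0))"
  have t: "treg q m x (?t k)"
    "pair3 q (?t k) f m x = ratval x (q powi m) q (Poly_Mapping.lookup P k) * f (m + int (snd k)) (q ^ fst k * x)" for k
    using assms treg_lreg3[OF lreg3_pow[OF lreg3_e0] assms(2,3)]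
    by (simp_all add: qregD pair3_scale pair3_pow)
  have "treg q m x (sum ?t K) \<and> pair3 q (sum ?t K) f m x = (\<Sum>k\<in>K. pair3 q (?t k) f m x)" for K
    by (induction K rule: infinite_finite_induct)
       (simp_all add: t(1) pair3_add treg_lreg3 zero_prod_def, simp_all add: treg_def pair3_def)
  then show "treg q m x (nform P)" "act q P f m x = pair3 q (nform P) f m x"
    by (simp_all add: nform_def mact_def act_def t case_prod_unfold)
qed

lemma act_add:
  assumes "qreg q m x P" "qreg q m x Q"
  shows "qreg q m x (P + Q)" "act q (P + Q) f m x = act q P f m x + act q Q f m x"
  using assms unfolding act_def case_prod_unfold prod.collapse
  by (simp add: qreg_def lookup_add regular_at_add)
     (rule setsum_keys_plus_distrib; use assms in \<open>simp add: qregD regular_at_add algebra_simps\<close>)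

lemma act_qmono:
  assumes "regular_at x (q powi m) q r"
  shows "qreg q m x (qmono r i j)"
    "act q (qmono r i j) f m x = ratval x (q powi m) q r * f (m + int j) (q ^ i * x)"
  using assms by (simp add: qreg_def lookup_qmono) (cases "r = 0"; simp add: act_def qmono_def)

section \<open>Hilbert polynomials of up-sets\<close>

text \<open>Dickson's lemma for words of fixed length, in the form that every sequence has a
  subsequence increasing in all entries. Induction on the length: make the heads nondecreasing
  first, then the tails along that subsequence.\<close>

lemma dickson:
  fixes f :: "nat \<Rightarrow> nat list"
  assumes "\<And>n. length (f n) = k"
  shows "\<exists>r :: nat \<Rightarrow> nat. strict_mono r \<and> (\<forall>i j. i \<le> j \<longrightarrow> list_all2 (\<le>) (f (r i)) (f (r j)))"
  using assms
proof (induction k arbitrary: f)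
  case 0
  then show ?case by (intro exI[of _ id]) (auto simp: strict_mono_def)
next
  case (Suc k)
  have ne: "f n \<noteq> []" for n using Suc.prems[of n] by auto
  obtain r where r: "strict_mono r" "monoseq (\<lambda>n. hd (f (r n)))"
    using seq_monosub[of "\<lambda>n. hd (f n)"] by auto
  have "\<exists>s :: nat \<Rightarrow> nat. strict_mono s \<and> (\<forall>i j. i \<le> j \<longrightarrow> hd (f (s i)) \<le> hd (f (s j)))"
  proof (cases "\<forall>m n. m \<le> n \<longrightarrow> hd (f (r m)) \<le> hd (f (r n))")
    case True
    then show ?thesis using r(1) by blast
  next
    case False
    then have dec: "m \<le> n \<Longrightarrow> hd (f (r n)) \<le> hd (f (r m))" for m n
      using r(2) unfolding monoseq_def by blast
    \<comment> \<open>A nonincreasing sequence of natural numbers is constant from the point where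
      it attains its minimum.\<close>
    define M where "M = (LEAST v. v \<in> range (\<lambda>n. hd (f (r n))))"
    have "M \<in> range (\<lambda>n. hd (f (r n)))"
      unfolding M_def by (rule LeastI[of _ "hd (f (r 0))"]) simp
    then obtain N where N: "hd (f (r N)) = M" by force
    have const: "hd (f (r n)) = M" if "n \<ge> N" for n
    proof (rule antisym)
      show "hd (f (r n)) \<le> M" using dec[OF that] N by simp
      show "M \<le> hd (f (r n))" unfolding M_def by (rule Least_le) simp
    qed
    show ?thesis
      by (rule exI[of _ "\<lambda>i. r (i + N)"]) (use r(1) in \<open>simp add: strict_mono_def const\<close>)
  qed
  then obtain s :: "nat \<Rightarrow> nat" where s: "strict_mono s" "\<And>i j. i \<le> j \<Longrightarrow> hd (f (s i)) \<le> hd (f (s j))"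
    by blast
  obtain t :: "nat \<Rightarrow> nat" where t: "strict_mono t" "\<And>i j. i \<le> j \<Longrightarrow> list_all2 (\<le>) (tl (f (s (t i)))) (tl (f (s (t j))))"
    using Suc.IH[of "\<lambda>n. tl (f (s n))"] Suc.prems by auto
  show ?case
  proof (intro exI[of _ "s \<circ> t"] conjI allI impI)
    show "strict_mono (s \<circ> t)" using s(1) t(1) by (rule strict_mono_o)
    fix i j :: nat assume "i \<le> j"
    then have "hd (f (s (t i))) \<le> hd (f (s (t j)))"
      using s(2) t(1) by (simp add: strict_mono_less_eq)
    then show "list_all2 (\<le>) (f ((s \<circ> t) i)) (f ((s \<circ> t) j))"
      using t(2)[OF \<open>i \<le> j\<close>] ne[of "s (t i)"] ne[of "s (t j)"]
      by (cases "f (s (t i))"; cases "f (s (t j))") auto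
  qed
qed

definition upset :: "nat list set \<Rightarrow> bool" where
  "upset U \<longleftrightarrow> (\<forall>xs ys. xs \<in> U \<longrightarrow> list_all2 (\<le>) xs ys \<longrightarrow> ys \<in> U)"

text \<open>The ascending chain condition. A chain that grows forever would supply a new word at
  infinitely many stages; by Dickson's lemma an earlier one lies below a later one, which therefore
  was not new.\<close>

lemma upset_stabilizes:
  assumes "\<And>t. upset (U t)" "\<And>s t :: nat. s \<le> t \<Longrightarrow> U s \<subseteq> U t"
  shows "\<exists>T. \<forall>t\<ge>T. \<forall>xs. length xs = k \<longrightarrow> (xs \<in> U t \<longleftrightarrow> xs \<in> U T)"
proof (rule ccontr)
  assume neg: "\<not> ?thesis"
  have step: "\<exists>t' xs. t < t' \<and> length xs = k \<and> xs \<in> U t' \<and> xs \<notin> U t" for t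
  proof -
    obtain t' xs where "t' \<ge> t" "length xs = k" "(xs \<in> U t') \<noteq> (xs \<in> U t)"
      using neg by blast
    moreover from this have "xs \<in> U t'" "xs \<notin> U t" using assms(2)[of t t'] by auto
    ultimately show ?thesis
      by (metis le_neq_implies_less)
  qed
  obtain g where g: "\<And>t. t < g t \<and> (\<exists>xs. length xs = k \<and> xs \<in> U (g t) \<and> xs \<notin> U t)"
    using step by metis
  then obtain h where h: "\<And>t. length (h t) = k \<and> h t \<in> U (g t) \<and> h t \<notin> U t"
    by metis
  define \<tau> where "\<tau> n = (g ^^ n) 0" for n
  have \<tau>: "\<tau> (Suc n) = g (\<tau> n)" for n by (simp add: \<tau>_def)
  have mono: "strict_mono \<tau>" using g by (simp add: strict_mono_Suc_iff \<tau>)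
  obtain r :: "nat \<Rightarrow> nat" where r: "strict_mono r" "\<And>i j. i \<le> j \<Longrightarrow> list_all2 (\<le>) (h (\<tau> (r i))) (h (\<tau> (r j)))"
    using dickson[of "\<lambda>n. h (\<tau> n)" k] h by blast
  have "r 0 < r 1" using r(1) by (simp add: strict_mono_def)
  then have "g (\<tau> (r 0)) \<le> \<tau> (r 1)"
    using mono by (metis \<tau> Suc_leI strict_mono_less_eq)
  then have "h (\<tau> (r 0)) \<in> U (\<tau> (r 1))"
    using h assms(2) by blast
  then have "h (\<tau> (r 1)) \<in> U (\<tau> (r 1))"
    using r(2)[of 0 1] assms(1) unfolding upset_def by auto
  then show False using h by blast
qed

section \<open>Counting functions that are eventually polynomial\<close>

definition ev_poly :: "(nat \<Rightarrow> nat) \<Rightarrow> bool" where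
  "ev_poly f \<longleftrightarrow> (\<exists>p :: real poly. \<forall>\<^sub>F N in sequentially. real (f N) = poly p (real N))"

lemma ev_poly_cong:
  assumes "\<forall>\<^sub>F N in sequentially. f N = g N" "ev_poly g"
  shows "ev_poly f"
proof -
  obtain p where "\<forall>\<^sub>F N in sequentially. real (g N) = poly p (real N)"
    using assms(2) by (auto simp: ev_poly_def)
  with assms(1) have "\<forall>\<^sub>F N in sequentially. real (f N) = poly p (real N)"
    by eventually_elim simp
  then show ?thesis unfolding ev_poly_def by blast
qed

lemma ev_poly_const: "ev_poly (\<lambda>_. c)"
  unfolding ev_poly_def by (rule exI[of _ "[:real c:]"]) simp

lemma ev_poly_add:
  assumes "ev_poly f" "ev_poly g"
  shows "ev_poly (\<lambda>N. f N + g N)"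
proof -
  obtain p r where "\<forall>\<^sub>F N in sequentially. real (f N) = poly p (real N)"
    "\<forall>\<^sub>F N in sequentially. real (g N) = poly r (real N)"
    using assms by (auto simp: ev_poly_def)
  then have "\<forall>\<^sub>F N in sequentially. real (f N + g N) = poly (p + r) (real N)"
    by eventually_elim simp
  then show ?thesis unfolding ev_poly_def by blast
qed

lemma ev_poly_sum: "(\<And>i. i \<in> A \<Longrightarrow> ev_poly (f i)) \<Longrightarrow> ev_poly (\<lambda>N. \<Sum>i\<in>A. f i N)"
  by (induction A rule: infinite_finite_induct) (auto intro: ev_poly_add ev_poly_const)

lemma ev_poly_shift:
  assumes "ev_poly f"
  shows "ev_poly (\<lambda>N. f (N - t))"
proof -
  obtain p n0 where p: "\<And>N. N \<ge> n0 \<Longrightarrow> real (f N) = poly p (real N)"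
    using assms by (auto simp: ev_poly_def eventually_sequentially)
  have "\<forall>\<^sub>F N in sequentially. real (f (N - t)) = poly (p \<circ>\<^sub>p [:- real t, 1:]) (real N)"
    unfolding eventually_sequentially
    by (intro exI[of _ "n0 + t"]) (auto simp: p poly_pcompose of_nat_diff)
  then show ?thesis unfolding ev_poly_def by blast
qed

text \<open>Induction on the degree d: subtract the multiple of (x + 1)^(d + 1) - x^(d + 1) with the
  same leading coefficient. Its sum telescopes, and the rest has smaller degree.\<close>

lemma sum_poly:
  fixes p :: "real poly"
  shows "\<exists>P. \<forall>N. (\<Sum>s\<le>N. poly p (real s)) = poly P (real N)"
proof (induction "degree p" arbitrary: p rule: less_induct)
  case less
  define d where "d = degree p"
  define q :: "real poly" where "q = [:1, 1:] ^ Suc d - monom 1 (Suc d)"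
  have q: "poly q x = (x + 1) ^ Suc d - x ^ Suc d" for x
    by (simp add: q_def poly_monom algebra_simps)
  have tele: "(\<Sum>s\<le>N. poly q (real s)) = (real N + 1) ^ Suc d" for N
    by (induction N) (simp_all add: q add.commute)
  have top: "coeff ([:1, 1:] ^ Suc d :: real poly) (Suc d) = 1"
    using coeff_linear_power[of "1 :: real" "Suc d"] by simp
  have deg: "degree ([:1, 1:] ^ Suc d :: real poly) = Suc d"
    using degree_linear_power[of "1 :: real" "Suc d"] by simp
  have dq: "degree q \<le> d"
  proof (rule degree_le, intro allI impI)
    fix i assume "d < i"
    then show "coeff q i = 0"
      using top deg by (cases "i = Suc d") (auto simp: q_def coeff_eq_0 simp del: power_Suc)
  qed
  have qd: "coeff q d = real (Suc d)"
  proof -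
    have "coeff ([:1, 1:] ^ Suc d :: real poly) d = real (Suc d choose d)"
      by (simp only: coeff_linear_poly_power) simp
    then show ?thesis by (simp add: q_def del: power_Suc)
  qed
  define c where "c = coeff p d / real (Suc d)"
  show ?case
  proof (cases "d = 0")
    case True
    then obtain a where "p = [:a:]" using degree_eq_zeroE d_def by metis
    then show ?thesis by (intro exI[of _ "[:a, a:]"]) (simp add: algebra_simps)
  next
    case False
    have "degree (p - smult c q) < d"
    proof -
      have "degree (p - smult c q) \<le> d"
        using dq by (intro degree_diff_le) (auto simp: d_def)
      moreover have "coeff (p - smult c q) d = 0"
        by (simp add: c_def qd)
      ultimately show ?thesis
        using False by (metis eq_zero_or_degree_less degree_0 neq0_conv)
    qed
    then obtain P where P: "\<And>N. (\<Sum>s\<le>N. poly (p - smult c q) (real s)) = poly P (real N)"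
      using less[of "p - smult c q"] by (auto simp: d_def)
    have "(\<Sum>s\<le>N. poly p (real s)) = poly (P + smult c ([:1, 1:] ^ Suc d)) (real N)" for N
    proof -
      have "(\<Sum>s\<le>N. poly p (real s)) = (\<Sum>s\<le>N. poly (p - smult c q) (real s)) + c * (\<Sum>s\<le>N. poly q (real s))"
        by (simp add: sum_distrib_left flip: sum.distrib)
      then show ?thesis unfolding P tele by (simp add: algebra_simps)
    qed
    then show ?thesis by blast
  qed
qed

lemma ev_poly_cumulative:
  assumes "ev_poly f"
  shows "ev_poly (\<lambda>N. \<Sum>s\<le>N. f s)"
proof -
  obtain p n0 where p: "\<And>N. N \<ge> n0 \<Longrightarrow> real (f N) = poly p (real N)"
    using assms by (auto simp: ev_poly_def eventually_sequentially)
  obtain P where P: "\<And>N. (\<Sum>s\<le>N. poly p (real s)) = poly P (real N)"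
    using sum_poly by blast
  define c where "c = (\<Sum>s\<le>n0. real (f s) - poly p (real s))"
  have "real (\<Sum>s\<le>N. f s) = poly (P + [:c:]) (real N)" if "N \<ge> n0" for N
  proof -
    have "(\<Sum>s\<le>N. real (f s) - poly p (real s)) = c"
      unfolding c_def by (rule sum.mono_neutral_right) (use that p in auto)
    then show ?thesis by (simp add: sum_subtractf P[symmetric])
  qed
  then show ?thesis
    unfolding ev_poly_def eventually_sequentially by blast
qed

definition hilb :: "nat \<Rightarrow> nat list set \<Rightarrow> nat \<Rightarrow> nat" where
  "hilb k U N = card {xs. length xs = k \<and> sum_list xs \<le> N \<and> xs \<notin> U}"

lemma finite_bounded_lists: "finite {xs :: nat list. length xs = k \<and> sum_list xs \<le> N}"
proof (rule finite_subset)
  show "{xs. length xs = k \<and> sum_list xs \<le> N} \<subseteq> {xs. set xs \<subseteq> {..N} \<and> length xs = k}"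
    using member_le_sum_list by fastforce
qed (simp add: finite_lists_length_eq)

lemma hilb_Suc: "hilb (Suc k) U N = (\<Sum>t\<le>N. hilb k {xs. t # xs \<in> U} (N - t))"
proof -
  have "{xs. length xs = Suc k \<and> sum_list xs \<le> N \<and> xs \<notin> U} =
      (\<Union>t\<in>{..N}. (#) t ` {xs. length xs = k \<and> sum_list xs \<le> N - t \<and> t # xs \<notin> U})" (is "?L = (\<Union>t\<in>_. ?R t)")
    by (auto simp: length_Suc_conv image_iff)
  moreover have "card (\<Union>t\<in>{..N}. ?R t) = (\<Sum>t\<le>N. card (?R t))"
    by (rule card_UN_disjoint) (auto intro: finite_subset[OF _ finite_bounded_lists])
  ultimately show ?thesis
    by (simp add: hilb_def card_image)
qed

text \<open>Slicing by the first entry t gives an increasing chain of up-sets of shorter words.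
  Beyond some \<open>T\<close> the slices agree, so the count is a finite sum of shifted functions
  plus the cumulative sum of a single one.\<close>

lemma ev_poly_hilb: "upset U \<Longrightarrow> ev_poly (hilb k U)"
proof (induction k arbitrary: U)
  case 0
  have "hilb 0 U = (\<lambda>_. if [] \<in> U then 0 else 1)"
  proof
    fix N
    have "{xs. length xs = 0 \<and> sum_list xs \<le> N \<and> xs \<notin> U} = (if [] \<in> U then {} else {[]})"
      by auto
    then show "hilb 0 U N = (if [] \<in> U then 0 else 1)"
      by (simp add: hilb_def)
  qed
  then show ?case by (simp add: ev_poly_const)
next
  case (Suc k)
  define V where "V t = {xs. t # xs \<in> U}" for t
  have V: "upset (V t)" for t
    using Suc.prems unfolding V_def upset_def by simp
  have mono: "V s \<subseteq> V t" if "s \<le> t" for s t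
  proof
    fix xs assume "xs \<in> V s"
    moreover have "list_all2 (\<le>) (s # xs) (t # xs)"
      using that by (simp add: list_all2_refl)
    ultimately show "xs \<in> V t"
      using Suc.prems unfolding V_def upset_def by blast
  qed
  obtain T where T: "\<And>t xs. t \<ge> T \<Longrightarrow> length xs = k \<Longrightarrow> xs \<in> V t \<longleftrightarrow> xs \<in> V T"
    using upset_stabilizes[of V k, OF V mono] by blast
  have eq: "hilb k (V t) = hilb k (V T)" if "t \<ge> T" for t
    using T[OF that] unfolding hilb_def by (intro ext arg_cong[of _ _ card] Collect_cong) blast
  have "hilb (Suc k) U N = (\<Sum>t<T. hilb k (V t) (N - t)) + (\<Sum>s\<le>N - T. hilb k (V T) s)" if "N \<ge> T" for N
  proof -
    have "{..N} = {..<T} \<union> {T..N}" using that by auto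
    then have "hilb (Suc k) U N = (\<Sum>t<T. hilb k (V t) (N - t)) + (\<Sum>t=T..N. hilb k (V t) (N - t))"
      unfolding hilb_Suc V_def[symmetric] by (simp add: sum.union_disjoint ivl_disj_int)
    also have "(\<Sum>t=T..N. hilb k (V t) (N - t)) = (\<Sum>s\<le>N - T. hilb k (V T) s)"
    proof -
      have "(\<Sum>t=T..N. hilb k (V t) (N - t)) = (\<Sum>t=T..N. hilb k (V T) (N - t))"
        by (rule sum.cong[OF refl]) (metis atLeastAtMost_iff eq)
      also have "\<dots> = (\<Sum>s\<le>N - T. hilb k (V T) s)"
        by (rule sum.reindex_bij_witness[of _ "\<lambda>s. N - s" "\<lambda>t. N - t"]) (use that in auto)
      finally show ?thesis .
    qed
    finally show ?thesis .
  qed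
  moreover have "ev_poly (\<lambda>N. (\<Sum>t<T. hilb k (V t) (N - t)) + (\<Sum>s\<le>N - T. hilb k (V T) s))"
    by (intro ev_poly_add ev_poly_sum ev_poly_shift Suc.IH V
        ev_poly_shift[of "\<lambda>N. \<Sum>s\<le>N. hilb k (V T) s"] ev_poly_cumulative)
  ultimately show ?case
    by (intro ev_poly_cong[of "hilb (Suc k) U"]) (auto simp: eventually_sequentially)
qed

text \<open>In any other degree one of c x^2 - p, p - C x^2 and - p has a positive leading
  coefficient and is eventually positive, against the bounds.\<close>

lemma poly_degree_2:
  fixes p :: "real poly"
  assumes "c > 0" "\<forall>\<^sub>F N in sequentially. c * real N ^ 2 \<le> poly p (real N) \<and> poly p (real N) \<le> C * real N ^ 2"
  shows "degree p = 2"
proof (rule ccontr)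
  assume "degree p \<noteq> 2"
  have bad: False if lc: "lead_coeff r > 0" and ev: "\<forall>\<^sub>F N in sequentially. poly r (real N) \<le> 0" for r :: "real poly"
  proof -
    obtain x0 where x0: "\<And>x. x \<ge> x0 \<Longrightarrow> poly r x \<ge> lead_coeff r"
      using poly_pinfty_gt_lc[OF lc] by metis
    have "\<forall>\<^sub>F N in sequentially. real N \<ge> x0"
      using filterlim_real_sequentially by (auto simp: filterlim_at_top)
    then have "\<forall>\<^sub>F N in sequentially. False"
      using ev by eventually_elim (use x0 lc in fastforce)
    then show False by simp
  qed
  let ?q = "monom 1 2 :: real poly"
  have q: "poly ?q x = x ^ 2" for x by (simp add: poly_monom)
  consider "degree p < 2" | "degree p > 2" "lead_coeff p > 0" | "degree p > 2" "lead_coeff p < 0"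
    using \<open>degree p \<noteq> 2\<close> by (metis degree_0 leading_coeff_0_iff linorder_neqE_nat not_less_zero linorder_less_linear)
  then show False
  proof cases
    case 1
    let ?r = "smult c ?q + (- p)"
    have d: "degree ?r = 2"
      using 1 assms(1) by (subst degree_add_eq_left) (auto simp: degree_monom_eq)
    have "\<forall>\<^sub>F N in sequentially. poly ?r (real N) \<le> 0"
      using assms(2) by eventually_elim (simp add: q)
    then show False
      using 1 assms(1) d by (intro bad[of ?r]) (auto simp: coeff_eq_0)
  next
    case 2
    let ?r = "p + (- smult C ?q)"
    have dq: "degree (smult C ?q) \<le> 2"
      by (metis degree_monom_le degree_smult_le le_trans)
    have d: "degree ?r = degree p"
      using 2 dq by (subst degree_add_eq_left) auto
    have "\<forall>\<^sub>F N in sequentially. poly ?r (real N) \<le> 0"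
      using assms(2) by eventually_elim (simp add: q)
    then show False
      using 2 d dq by (intro bad[of ?r]) (auto simp: coeff_eq_0)
  next
    case 3
    have "\<forall>\<^sub>F N in sequentially. poly (- p) (real N) \<le> 0"
      using assms(2)
    proof eventually_elim
      case (elim N)
      have "0 \<le> c * real N ^ 2" using assms(1) by simp
      with elim show ?case by simp
    qed
    then show False
      using 3 by (intro bad[of "- p"]) auto
  qed
qed

section \<open>The Hilbert polynomial of the system\<close>

lemma field_qI: "b \<noteq> 0 \<Longrightarrow> Fract [:[:a:]:] [:[:b:]:] \<in> field_q"
  by (auto simp: field_q_def)

lemma field_q_closed:
  "0 \<in> field_q" "1 \<in> field_q"
  "r \<in> field_q \<Longrightarrow> s \<in> field_q \<Longrightarrow> r + s \<in> field_q"
  "r \<in> field_q \<Longrightarrow> s \<in> field_q \<Longrightarrow> r * s \<in> field_q"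
  "r \<in> field_q \<Longrightarrow> - r \<in> field_q"
  "r \<in> field_q \<Longrightarrow> inverse r \<in> field_q"
proof -
  show zero: "0 \<in> field_q" and "1 \<in> field_q"
    using field_qI[of 1 0] field_qI[of 1 1] by (simp_all add: Zero_fract_def One_fract_def one_pCons)
  {
    assume "r \<in> field_q" "s \<in> field_q"
    then obtain a b c d where "r = Fract [:[:a:]:] [:[:b:]:]" "b \<noteq> 0" "s = Fract [:[:c:]:] [:[:d:]:]" "d \<noteq> 0"
      by (auto simp: field_q_def)
    then show "r + s \<in> field_q" "r * s \<in> field_q"
      using field_qI[of "b * d" "a * d + c * b"] field_qI[of "b * d" "a * c"] by simp_all
  }
  {
    assume "r \<in> field_q"
    then obtain a b where r: "r = Fract [:[:a:]:] [:[:b:]:]" "b \<noteq> 0"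
      by (auto simp: field_q_def)
    then show "- r \<in> field_q" using field_qI[of b "- a"] by simp
    show "inverse r \<in> field_q"
      using r zero field_qI[of a b] by (cases "a = 0") (simp_all add: fract_collapse)
  }
qed

lemma field_q_diff: "r \<in> field_q \<Longrightarrow> s \<in> field_q \<Longrightarrow> r - s \<in> field_q"
  using field_q_closed(3)[of r "- s"] field_q_closed(5)[of s] by simp

lemma field_q_divide: "r \<in> field_q \<Longrightarrow> s \<in> field_q \<Longrightarrow> r / s \<in> field_q"
  by (simp add: divide_inverse field_q_closed)

lemma var_q_field_q: "var_q \<in> field_q"
  using field_qI[of 1 "[:0, 1:]"] by (simp add: var_q_def one_pCons)

lemma var_q_powi_field_q: "var_q powi k \<in> field_q"
proof -
  have "var_q ^ n \<in> field_q" for n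
    by (induction n) (auto intro: field_q_closed var_q_field_q)
  then show ?thesis by (auto simp: power_int_def power_inverse intro: field_q_closed)
qed

lemma shift_field_q: "r \<in> field_q \<Longrightarrow> shift_x r = r" "r \<in> field_q \<Longrightarrow> shift_M r = r"
  by (auto simp: field_q_def shift_x_Fract shift_M_Fract subst_x_def subst_M_def pcompose_pCons map_poly_pCons)

text \<open>As a type of its own the field can serve as the scalars of a vector space: dimensions in
  the Hilbert function are taken over rational functions of q alone, over which the triples have
  infinite dimension.\<close>

typedef fq = field_q morphisms rep_fq abs_fq
  using field_q_closed by blast

setup_lifting type_definition_fq

instantiation fq :: field
begin

lift_definition zero_fq :: fq is 0 by (rule field_q_closed)
lift_definition one_fq :: fq is 1 by (rule field_q_closed)
lift_definition plus_fq :: "fq \<Rightarrow> fq \<Rightarrow> fq" is "(+)" by (rule field_q_closed)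
lift_definition minus_fq :: "fq \<Rightarrow> fq \<Rightarrow> fq" is "(-)" by (rule field_q_diff)
lift_definition uminus_fq :: "fq \<Rightarrow> fq" is uminus by (rule field_q_closed)
lift_definition times_fq :: "fq \<Rightarrow> fq \<Rightarrow> fq" is "(*)" by (rule field_q_closed)
lift_definition inverse_fq :: "fq \<Rightarrow> fq" is inverse by (rule field_q_closed)
lift_definition divide_fq :: "fq \<Rightarrow> fq \<Rightarrow> fq" is "(/)" by (rule field_q_divide)

instance
  by (standard; transfer) (simp_all add: field_simps)

end

definition fscale :: "fq \<Rightarrow> triple \<Rightarrow> triple" where
  "fscale c v = scale3 (rep_fq c) v"

interpretation fqv: vector_space fscale
  by standard (simp_all add: fscale_def plus_fq.rep_eq times_fq.rep_eq one_fq.rep_eq scale3_add)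

lemma fscale_abs: "r \<in> field_q \<Longrightarrow> fscale (abs_fq r) v = scale3 r v"
  by (simp add: fscale_def abs_fq_inverse)

lemma rep_fq_0_iff: "rep_fq c = 0 \<longleftrightarrow> c = 0"
  by (metis rep_fq_inject zero_fq.rep_eq)

lemma span_scale_field_q: "r \<in> field_q \<Longrightarrow> v \<in> fqv.span S \<Longrightarrow> scale3 r v \<in> fqv.span S"
  using fqv.span_scale[of v S "abs_fq r"] by (simp add: fscale_abs)

lemma span_scale_field_q_iff:
  assumes "r \<in> field_q" "r \<noteq> 0"
  shows "scale3 r v \<in> fqv.span S \<longleftrightarrow> v \<in> fqv.span S"
proof
  assume "scale3 r v \<in> fqv.span S"
  from span_scale_field_q[OF field_q_closed(6)[OF assms(1)] this]
  show "v \<in> fqv.span S" using assms by (simp flip: scale3_add(3))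
qed (rule span_scale_field_q[OF assms(1)])

lemma span_semilinear:
  assumes "\<And>v w. T (v + w) = T v + T w" "\<And>c v. T (fscale c v) = fscale c (T v)"
    "v \<in> fqv.span S" "\<And>s. s \<in> S \<Longrightarrow> T s \<in> fqv.span W"
  shows "T v \<in> fqv.span W"
proof -
  have "T 0 = 0" using assms(2)[of 0 0] by (simp add: fscale_def zero_fq.rep_eq)
  show ?thesis
    using assms(3)
    by (induction rule: fqv.span_induct_alt)
       (auto simp: assms(1,2) \<open>T 0 = 0\<close> intro!: fqv.span_add fqv.span_scale assms(4) fqv.span_zero)
qed

text \<open>Both shifts fix q. So S_x and S_m, which are only semilinear over all rational
  functions, are linear over this field.\<close>

lemma semilinear_acts:
  "act_x (fscale c v) = fscale c (act_x v)" "act_m (fscale c v) = fscale c (act_m v)"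
  "scale3 r (fscale c v) = fscale c (scale3 r v)"
  using rep_fq[of c] by (simp_all add: fscale_def act_x_scale act_m_scale shift_field_q mult.commute flip: scale3_add(3))

subsection \<open>Standard monomials\<close>

type_synonym expo = "nat \<times> nat \<times> nat \<times> nat"

fun edeg :: "expo \<Rightarrow> nat" where "edeg (a, b, i, j) = a + b + i + j"

fun mon :: "expo \<Rightarrow> triple" where
  "mon (a, b, i, j) = scale3 (var_x ^ a * var_M ^ b) ((act_x ^^ i) ((act_m ^^ j) e0))"

text \<open>The degree-lexicographic order. Equal degree together with equal a, b, i forces equal j,
  so the order is total.\<close>

fun elt :: "expo \<Rightarrow> expo \<Rightarrow> bool" where
  "elt (a, b, i, j) (a', b', i', j') \<longleftrightarrow> a + b + i + j < a' + b' + i' + j' \<or>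
     (a + b + i + j = a' + b' + i' + j' \<and> (a < a' \<or> (a = a' \<and> (b < b' \<or> (b = b' \<and> i < i')))))"

lemma elt_trans: "elt m n \<Longrightarrow> elt n r \<Longrightarrow> elt m r"
  by (cases m; cases n; cases r) auto

lemma elt_total: "elt m n \<or> m = n \<or> elt n m"
  by (cases m; cases n) auto

lemma elt_edeg: "elt m n \<Longrightarrow> edeg m \<le> edeg n"
  by (cases m; cases n) auto

lemma wf_elt: "wf {(m, n). elt m n}"
proof (rule wf_subset)
  show "wf (inv_image (less_than <*lex*> less_than <*lex*> less_than <*lex*> less_than)
    (\<lambda>(a, b, i, j). (a + b + i + j, a, b, i :: nat)))"
    by (intro wf_inv_image wf_lex_prod wf_less_than)
qed (auto simp: inv_image_def)

lemma elt_max: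
  assumes "finite S" "S \<noteq> {}"
  shows "\<exists>m\<in>S. \<forall>s\<in>S. s = m \<or> elt s m"
  using assms
proof (induction S rule: finite_ne_induct)
  case (insert x F)
  then obtain m where m: "m \<in> F" "\<forall>s\<in>F. s = m \<or> elt s m" by auto
  show ?case
  proof (cases "elt m x")
    case True
    then have "s = x \<or> elt s x" if "s \<in> insert x F" for s
      using that m elt_trans[OF _ True, of s] by auto
    then show ?thesis by blast
  next
    case False
    then have "s = m \<or> elt s m" if "s \<in> insert x F" for s
      using that m elt_total[of m x] by auto
    then show ?thesis using m by blast
  qed
qed simp

text \<open>The exponents of leading monomials of those elements of the ideal that lie in the q-Weyl
  algebra, as in the theory of Groebner bases.\<close>

definition nonstd :: "expo \<Rightarrow> bool" where
  "nonstd m \<longleftrightarrow> mon m \<in> fqv.span (mon ` {n. elt n m})"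

text \<open>Multiplication by a generator sends a monomial to a power of q times a monomial and
  respects the order, so it carries a relation for m to one for \<open>g m\<close>. This makes the
  nonstandard exponents an up-set.\<close>

lemma nonstd_step:
  assumes "nonstd m" "\<And>v w. T (v + w) = T v + T w" "\<And>c v. T (fscale c v) = fscale c (T v)"
    "\<And>n. T (mon n) = scale3 (var_q ^ k n) (mon (g n))" "\<And>n. elt n m \<Longrightarrow> elt (g n) (g m)"
  shows "nonstd (g m)"
proof -
  have q: "var_q ^ k \<in> field_q" for k using var_q_powi_field_q[of "int k"] by simp
  have "T (mon m) \<in> fqv.span (mon ` {n. elt n (g m)})"
  proof (rule span_semilinear[of T])
    fix s assume "s \<in> mon ` {n. elt n m}"
    then obtain n where n: "s = mon n" "elt n m" by blast
    show "T s \<in> fqv.span (mon ` {n. elt n (g m)})"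
      unfolding n assms(4) using assms(5)[OF n(2)] by (intro span_scale_field_q q fqv.span_base) auto
  qed (use assms in \<open>auto simp: nonstd_def\<close>)
  then show ?thesis
    unfolding nonstd_def assms(4) using q by (simp add: span_scale_field_q_iff)
qed

lemma act_mon:
  "act_x (mon (a, b, i, j)) = scale3 (var_q ^ a) (mon (a, b, Suc i, j))"
  "act_m (mon (a, b, i, j)) = scale3 (var_q ^ b) (mon (a, b, i, Suc j))"
proof -
  have eq: "shift_x (var_x ^ a * var_M ^ b) = var_q ^ a * (var_x ^ a * var_M ^ b)"
    "shift_M (var_x ^ a * var_M ^ b) = var_q ^ b * (var_x ^ a * var_M ^ b)"
    by (simp_all add: power_mult_distrib)
  show "act_x (mon (a, b, i, j)) = scale3 (var_q ^ a) (mon (a, b, Suc i, j))"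
    unfolding mon.simps act_x_scale eq scale3_add(3)[of "var_q ^ a"] by simp
  have "act_m ((act_x ^^ i) v) = (act_x ^^ i) (act_m v)" for v
    using act_pow_commute[of 1 i v] by simp
  then show "act_m (mon (a, b, i, j)) = scale3 (var_q ^ b) (mon (a, b, i, Suc j))"
    unfolding mon.simps act_m_scale eq scale3_add(3)[of "var_q ^ b"] by simp
qed

lemma nonstd_Suc:
  assumes "nonstd (a, b, i, j)"
  shows "nonstd (Suc a, b, i, j)" "nonstd (a, Suc b, i, j)" "nonstd (a, b, Suc i, j)" "nonstd (a, b, i, Suc j)"
proof -
  show "nonstd (Suc a, b, i, j)"
    using nonstd_step[OF assms, of "scale3 var_x" "\<lambda>_. 0" "\<lambda>(a, b, i, j). (Suc a, b, i, j)"]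
    by (auto simp: scale3_add semilinear_acts)
  show "nonstd (a, Suc b, i, j)"
    using nonstd_step[OF assms, of "scale3 var_M" "\<lambda>_. 0" "\<lambda>(a, b, i, j). (a, Suc b, i, j)"]
    by (auto simp: scale3_add(2) semilinear_acts mult.left_commute simp flip: scale3_add(3))
  show "nonstd (a, b, Suc i, j)"
    using nonstd_step[OF assms, of act_x fst "\<lambda>(a, b, i, j). (a, b, Suc i, j)"]
    by (auto simp: act_x_add semilinear_acts act_mon simp del: mon.simps act_x.simps)
  show "nonstd (a, b, i, Suc j)"
    using nonstd_step[OF assms, of act_m "fst \<circ> snd" "\<lambda>(a, b, i, j). (a, b, i, Suc j)"]
    by (auto simp: act_m_add semilinear_acts act_mon simp del: mon.simps act_m.simps)
qed

lemma nonstd_mono: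
  assumes "nonstd (a, b, i, j)" "a \<le> a'" "b \<le> b'" "i \<le> i'" "j \<le> j'"
  shows "nonstd (a', b', i', j')"
proof -
  have 1: "nonstd (a', b, i, j)"
    using assms(2,1) by (induction rule: dec_induct) (assumption, rule nonstd_Suc(1))
  have 2: "nonstd (a', b', i, j)"
    using assms(3) 1 by (induction rule: dec_induct) (assumption, rule nonstd_Suc(2))
  have 3: "nonstd (a', b', i', j)"
    using assms(4) 2 by (induction rule: dec_induct) (assumption, rule nonstd_Suc(3))
  show ?thesis
    using assms(5) 3 by (induction rule: dec_induct) (assumption, rule nonstd_Suc(4))
qed

definition std_upto :: "nat \<Rightarrow> expo set" where
  "std_upto N = {m. \<not> nonstd m \<and> edeg m \<le> N}"

lemma ev_poly_std: "finite (std_upto N)" "ev_poly (\<lambda>N. card (std_upto N))"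
proof -
  define U where "U = {[a, b, i, j] | a b i j. nonstd (a, b, i, j)}"
  let ?S = "\<lambda>N. {xs. length xs = 4 \<and> sum_list xs \<le> N \<and> xs \<notin> U}"
  have bij: "bij_betw (\<lambda>(a, b, i, j). [a, b, i, j]) (std_upto N) (?S N)" for N
  proof (rule bij_betwI')
    fix xs assume "xs \<in> ?S N"
    moreover from this obtain a b i j where "xs = [a, b, i, j]"
      by (auto simp: length_Suc_conv numeral_eq_Suc)
    ultimately show "\<exists>m\<in>std_upto N. xs = (\<lambda>(a, b, i, j). [a, b, i, j]) m"
      by (intro bexI[of _ "(a, b, i, j)"]) (auto simp: U_def std_upto_def)
  qed (auto simp: U_def std_upto_def)
  have "finite (?S N)" for N
    by (rule finite_subset[OF _ finite_bounded_lists[of 4 N]]) auto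
  then show "finite (std_upto N)"
    using bij_betw_finite[OF bij] by blast
  have "upset U"
    unfolding upset_def U_def by (auto simp: list_all2_Cons1) (rule nonstd_mono; assumption)
  then have "ev_poly (hilb 4 U)"
    by (rule ev_poly_hilb)
  then show "ev_poly (\<lambda>N. card (std_upto N))"
    using bij_betw_same_card[OF bij] by (simp add: hilb_def[abs_def])
qed

text \<open>Nonstandard monomials are replaced by smaller ones until only standard ones remain. The
  order refines the total degree, so the degree bound survives the rewriting.\<close>

lemma mon_in_span_std: "mon m \<in> fqv.span (mon ` std_upto (edeg m))"
proof -
  have "mon m \<in> fqv.span (mon ` {n. \<not> nonstd n \<and> (n = m \<or> elt n m)})"
  proof (induction m rule: wf_induct_rule[OF wf_elt])
    case (1 m)
    show ?case
    proof (cases "nonstd m")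
      case True
      have "mon n \<in> fqv.span (mon ` {n. \<not> nonstd n \<and> (n = m \<or> elt n m)})" if "elt n m" for n
      proof -
        have "mon n \<in> fqv.span (mon ` {k. \<not> nonstd k \<and> (k = n \<or> elt k n)})"
          using 1[of n] that by simp
        moreover have "{k. \<not> nonstd k \<and> (k = n \<or> elt k n)} \<subseteq> {k. \<not> nonstd k \<and> (k = m \<or> elt k m)}"
          using that elt_trans by blast
        ultimately show ?thesis
          using fqv.span_mono[OF image_mono] by blast
      qed
      then have "fqv.span (mon ` {n. elt n m}) \<subseteq> fqv.span (mon ` {n. \<not> nonstd n \<and> (n = m \<or> elt n m)})"
        by (intro fqv.span_minimal fqv.subspace_span) auto
      with True show ?thesis by (auto simp: nonstd_def)
    qed (auto intro: fqv.span_base)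
  qed
  then show ?thesis
    by (rule fqv.span_mono[THEN subsetD, rotated]) (auto simp: std_upto_def dest: elt_edeg)
qed

text \<open>The largest monomial with a nonzero coefficient would be a combination of smaller
  ones.\<close>

lemma std_independent:
  assumes "finite S" "\<And>m. m \<in> S \<Longrightarrow> \<not> nonstd m" "(\<Sum>m\<in>S. fscale (u m) (mon m)) = 0" "m \<in> S"
  shows "u m = 0"
proof (rule ccontr)
  assume "u m \<noteq> 0"
  then have "{m\<in>S. u m \<noteq> 0} \<noteq> {}" using assms(4) by blast
  then obtain t where t: "t \<in> S" "u t \<noteq> 0" "\<And>s. s \<in> S \<Longrightarrow> u s \<noteq> 0 \<Longrightarrow> s = t \<or> elt s t"
    using elt_max[of "{m\<in>S. u m \<noteq> 0}"] assms(1) by auto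
  have "(\<Sum>m\<in>S - {t}. fscale (u m) (mon m)) \<in> fqv.span (mon ` {n. elt n t})"
  proof (rule fqv.span_sum)
    fix s assume "s \<in> S - {t}"
    then show "fscale (u s) (mon s) \<in> fqv.span (mon ` {n. elt n t})"
      using t(3)[of s] by (cases "u s = 0") (simp_all add: fqv.span_zero fqv.span_scale fqv.span_base)
  qed
  moreover have "fscale (u t) (mon t) = - (\<Sum>m\<in>S - {t}. fscale (u m) (mon m))"
    using assms(1,3) t(1) by (simp add: sum.remove eq_neg_iff_add_eq_0)
  ultimately have "fscale (u t) (mon t) \<in> fqv.span (mon ` {n. elt n t})"
    by (simp add: fqv.span_neg)
  from fqv.span_scale[OF this, of "inverse (u t)"] have "nonstd t"
    using t(2) by (simp add: nonstd_def)
  then show False using assms(2) t(1) by blast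
qed

lemma inj_on_mon: "inj_on mon {m. \<not> nonstd m}"
proof (rule inj_onI)
  have no: "\<not> elt m n" if eq: "mon m = mon n" and std: "\<not> nonstd n" for m n
  proof
    assume "elt m n"
    then have "mon m \<in> fqv.span (mon ` {k. elt k n})"
      by (intro fqv.span_base) blast
    with eq std show False by (simp add: nonstd_def)
  qed
  fix m n assume "m \<in> {m. \<not> nonstd m}" "n \<in> {m. \<not> nonstd m}" "mon m = mon n"
  then show "m = n"
    using no[of m n] no[of n m] elt_total[of m n] by simp
qed

lemma std_upto_image:
  "inj_on mon (std_upto N)" "card (mon ` std_upto N) = card (std_upto N)"
  "fqv.independent (mon ` std_upto N)"
proof -
  show inj: "inj_on mon (std_upto N)"
    by (rule inj_on_subset[OF inj_on_mon]) (auto simp: std_upto_def)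
  then show "card (mon ` std_upto N) = card (std_upto N)" by (rule card_image)
  show "fqv.independent (mon ` std_upto N)"
  proof (rule fqv.independent_if_scalars_zero)
    fix f v assume "(\<Sum>v\<in>mon ` std_upto N. fscale (f v) v) = 0" "v \<in> mon ` std_upto N"
    then obtain m where m: "v = mon m" "m \<in> std_upto N"
      and "(\<Sum>m\<in>std_upto N. fscale (f (mon m)) (mon m)) = 0"
      by (auto simp: sum.reindex[OF inj])
    from std_independent[OF ev_poly_std(1) _ this(3,2)] show "f v = 0"
      unfolding m(1) by (simp add: std_upto_def)
  qed (simp add: ev_poly_std)
qed

fun qmon :: "expo \<Rightarrow> qop" where
  "qmon (a, b, i, j) = qmono (var_x ^ a * var_M ^ b) i j"

lemma nform_qmon: "nform (qmon m) = mon m"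
  by (cases m) (simp add: nform_def mact_qmono)

lemma finite_edeg: "finite {m. edeg m \<le> N}"
proof (rule finite_subset)
  show "{m. edeg m \<le> N} \<subseteq> {..N} \<times> {..N} \<times> {..N} \<times> {..N}" by auto
qed auto

lemma q_weyl_eq: "q_weyl N = {(\<Sum>m | edeg m \<le> N. cf (c m) \<star> qmon m) | c. range c \<subseteq> field_q}"
proof -
  have *: "(\<Sum>(a, b, i, j) | a + b + i + j \<le> N. qmono (c (a, b, i, j) * var_x ^ a * var_M ^ b) i j) =
      (\<Sum>m | edeg m \<le> N. cf (c m) \<star> qmon m)" for c
  proof (rule sum.cong)
    show "{(a, b, i, j). a + b + i + j \<le> N} = {m. edeg m \<le> N}"
      by auto
    fix m :: expo
    show "(case m of (a, b, i, j) \<Rightarrow> qmono (c (a, b, i, j) * var_x ^ a * var_M ^ b) i j) = cf (c m) \<star> qmon m"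
      by (cases m) (simp add: qmult_qmono mult.assoc)
  qed
  show ?thesis unfolding q_weyl_def * ..
qed

lemma qmon_in_q_weyl:
  assumes "edeg m \<le> N"
  shows "qmon m \<in> q_weyl N"
proof -
  have "cf 1 \<star> qmon m = qmon m" by (cases m) (simp add: qmult_qmono)
  moreover have "cf 0 \<star> P = 0" for P by simp
  ultimately have "(\<Sum>n | edeg n \<le> N. cf (if n = m then 1 else 0) \<star> qmon n) = qmon m"
    using assms finite_edeg[of N] by (subst sum.mono_neutral_right[of _ "{m}"]) auto
  then show ?thesis
    unfolding q_weyl_eq using field_q_closed
    by (intro CollectI exI[of _ "\<lambda>n. if n = m then 1 else 0"]) auto
qed

text \<open>The standard monomials up to degree N represent a basis. Because the ideal is the kernel
  of \<open>nform\<close>, spanning and independence may be checked on triples.\<close>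

lemma quot_dim_q_weyl: "quot_dim field_q (q_weyl N) I52 (card (std_upto N))"
proof -
  let ?n = "card (std_upto N)"
  obtain e where e: "bij_betw e {..<?n} (std_upto N)"
    using ex_bij_betw_nat_finite[OF ev_poly_std(1)] by (auto simp: atLeast0LessThan)
  have nf: "nform (\<Sum>i<?n. cf (c i) \<star> qmon (e i)) = (\<Sum>i<?n. scale3 (c i) (mon (e i)))" for c
    by (simp add: nform_sum nform_qmult nform_qmon)
  show ?thesis
    unfolding quot_dim_def
  proof (intro exI[of _ "\<lambda>i. qmon (e i)"] conjI allI impI ballI)
    fix i assume "i < ?n"
    then show "qmon (e i) \<in> q_weyl N"
      using bij_betwE[OF e] by (intro qmon_in_q_weyl) (simp add: std_upto_def)
  next
    fix P assume "P \<in> q_weyl N"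
    then obtain c where c: "P = (\<Sum>m | edeg m \<le> N. cf (c m) \<star> qmon m)" "range c \<subseteq> field_q"
      unfolding q_weyl_eq by blast
    have "nform P = (\<Sum>m | edeg m \<le> N. scale3 (c m) (mon m))"
      by (simp add: c(1) nform_sum nform_qmult nform_qmon)
    also have "\<dots> \<in> fqv.span (mon ` std_upto N)"
    proof (intro fqv.span_sum span_scale_field_q)
      fix m assume "m \<in> {m. edeg m \<le> N}"
      then have "std_upto (edeg m) \<subseteq> std_upto N"
        by (simp add: std_upto_def subset_iff)
      then have "fqv.span (mon ` std_upto (edeg m)) \<subseteq> fqv.span (mon ` std_upto N)"
        by (intro fqv.span_mono image_mono)
      then show "mon m \<in> fqv.span (mon ` std_upto N)"
        using mon_in_span_std by (rule subsetD)
    next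
      fix m show "c m \<in> field_q" using c(2) by blast
    qed
    finally have "nform P \<in> range (\<lambda>u. \<Sum>v\<in>mon ` std_upto N. fscale (u v) v)"
      by (simp only: fqv.span_finite finite_imageI ev_poly_std(1))
    then obtain u where "nform P = (\<Sum>v\<in>mon ` std_upto N. fscale (u v) v)"
      by (rule rangeE)
    also have "\<dots> = (\<Sum>m\<in>std_upto N. fscale (u (mon m)) (mon m))"
      by (simp add: sum.reindex std_upto_image)
    also have "\<dots> = (\<Sum>i<?n. fscale (u (mon (e i))) (mon (e i)))"
      by (rule sum.reindex_bij_betw[OF e, symmetric])
    finally have P: "nform P = (\<Sum>i<?n. scale3 (rep_fq (u (mon (e i)))) (mon (e i)))"
      by (simp add: fscale_def)
    show "\<exists>!c. c \<in> {..<?n} \<rightarrow>\<^sub>E field_q \<and> P - (\<Sum>i<?n. cf (c i) \<star> qmon (e i)) \<in> I52"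
    proof (rule ex1I)
      let ?c = "\<lambda>i\<in>{..<?n}. rep_fq (u (mon (e i)))"
      show "?c \<in> {..<?n} \<rightarrow>\<^sub>E field_q \<and> P - (\<Sum>i<?n. cf (?c i) \<star> qmon (e i)) \<in> I52"
        by (simp add: I52_eq nform_diff nf P rep_fq)
      fix c assume c: "c \<in> {..<?n} \<rightarrow>\<^sub>E field_q \<and> P - (\<Sum>i<?n. cf (c i) \<star> qmon (e i)) \<in> I52"
      then have cF: "c i \<in> field_q" if "i < ?n" for i
        using that PiE_mem[of c "{..<?n}" "\<lambda>_. field_q" i] by simp
      from c have *: "(\<Sum>i<?n. scale3 (c i) (mon (e i))) = (\<Sum>i<?n. scale3 (rep_fq (u (mon (e i)))) (mon (e i)))"
        by (simp add: I52_eq nform_diff nf P)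
      have "(\<Sum>i<?n. fscale (abs_fq (c i) - u (mon (e i))) (mon (e i))) = 0"
      proof -
        have "(\<Sum>i<?n. scale3 (c i) (mon (e i))) = (\<Sum>i<?n. fscale (abs_fq (c i)) (mon (e i)))"
          by (rule sum.cong) (simp_all add: fscale_abs cF)
        with * have "(\<Sum>i<?n. fscale (abs_fq (c i)) (mon (e i))) = (\<Sum>i<?n. fscale (u (mon (e i))) (mon (e i)))"
          by (simp add: fscale_def)
        then show ?thesis
          unfolding fqv.scale_left_diff_distrib sum_subtractf by simp
      qed
      then have z: "(\<Sum>m\<in>std_upto N. fscale (abs_fq (c (inv_into {..<?n} e m)) - u (mon m)) (mon m)) = 0"
        using e by (subst sum.reindex_bij_betw[OF e, symmetric]) (simp add: bij_betw_def)
      have "c i = rep_fq (u (mon (e i)))" if "i < ?n" for i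
      proof -
        have "abs_fq (c (inv_into {..<?n} e (e i))) - u (mon (e i)) = 0"
          by (rule std_independent[OF _ _ z])
             (use that bij_betwE[OF e] ev_poly_std(1) in \<open>simp_all add: std_upto_def\<close>)
        then have "abs_fq (c i) = u (mon (e i))"
          using that e by (simp add: bij_betw_def)
        then show ?thesis
          using abs_fq_inverse[OF cF[OF that]] by simp
      qed
      then show "c = ?c"
        using PiE_arb[OF conjunct1[OF c]] by (auto simp: fun_eq_iff restrict_def)
    qed
  qed
qed

subsection \<open>Bounds for the dimension\<close>

lemma common_denominator:
  assumes "finite A" "\<And>i. i \<in> A \<Longrightarrow> r i \<in> field_q"
  shows "\<exists>D s. D \<noteq> 0 \<and> (\<forall>i\<in>A. r i = Fract [:[:s i:]:] [:[:D:]:])"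
  using assms
proof (induction A rule: finite_induct)
  case (insert x F)
  then obtain D s where D: "D \<noteq> 0" "\<And>i. i \<in> F \<Longrightarrow> r i = Fract [:[:s i:]:] [:[:D:]:]" by auto
  obtain a b where ab: "r x = Fract [:[:a:]:] [:[:b:]:]" "b \<noteq> 0"
    using insert.prems[of x] by (auto simp: field_q_def)
  show ?case
    by (intro exI[of _ "D * b"] exI[of _ "\<lambda>i. if i = x then a * D else s i * b"])
       (use D ab insert.hyps in \<open>auto simp: eq_fract\<close>)
qed (auto intro: exI[of _ 1])

lemma sum_Fract: "d \<noteq> 0 \<Longrightarrow> (\<Sum>i\<in>A. Fract (f i) d) = Fract (\<Sum>i\<in>A. f i) d"
  by (induction A rule: infinite_finite_induct)
     (auto simp: fract_collapse eq_fract algebra_simps)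

lemma var_monomial: "var_x ^ a * var_M ^ b = Fract (monom (monom 1 b) a) 1"
proof -
  have "var_x ^ a = Fract (monom 1 a) 1"
    by (induction a) (simp_all add: var_x_def One_fract_def monom_Suc)
  moreover have "var_M ^ b = Fract [:monom 1 b:] 1"
    by (induction b) (simp_all add: var_M_def One_fract_def monom_Suc monom_0 flip: one_pCons)
  ultimately show ?thesis
    by (simp add: mult_monom monom_0[symmetric])
qed

text \<open>After multiplication by a common denominator in q alone the relation is one between
  polynomials, and the coefficients of x^a M^b can be compared.\<close>

lemma monomials_independent:
  assumes "finite A" "(\<Sum>(a, b)\<in>A. rep_fq (u (a, b)) * (var_x ^ a * var_M ^ b)) = 0" "(a, b) \<in> A"
  shows "u (a, b) = 0"
proof -
  from common_denominator[of A "\<lambda>i. rep_fq (u i)", OF assms(1) rep_fq]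
  obtain D s where "D \<noteq> 0 \<and> (\<forall>i\<in>A. rep_fq (u i) = Fract [:[:s i:]:] [:[:D:]:])"
    by (elim exE)
  then have D: "D \<noteq> 0" "\<And>i. i \<in> A \<Longrightarrow> rep_fq (u i) = Fract [:[:s i:]:] [:[:D:]:]"
    by simp_all
  let ?g = "\<lambda>i. monom (monom (s i) (snd i)) (fst i)"
  have each: "rep_fq (u i) * (var_x ^ fst i * var_M ^ snd i) = Fract (?g i) [:[:D:]:]" if "i \<in> A" for i
    unfolding D(2)[OF that] var_monomial mult_fract by (simp add: smult_monom)
  have "0 = (\<Sum>i\<in>A. rep_fq (u i) * (var_x ^ fst i * var_M ^ snd i))"
    using assms(2) by (simp add: case_prod_unfold)
  also have "\<dots> = (\<Sum>i\<in>A. Fract (?g i) [:[:D:]:])"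
    by (rule sum.cong[OF refl each])
  also have "\<dots> = Fract (\<Sum>i\<in>A. ?g i) [:[:D:]:]"
    by (rule sum_Fract) (simp add: D(1))
  finally have "(\<Sum>i\<in>A. ?g i) = 0"
    using D(1) by (simp add: Zero_fract_def eq_fract)
  then have "0 = coeff (coeff (\<Sum>i\<in>A. ?g i) a) b"
    by simp
  also have "\<dots> = (\<Sum>i\<in>A. coeff (coeff (?g i) a) b)"
    by (simp only: coeff_sum)
  also have "\<dots> = (\<Sum>i\<in>A. if i = (a, b) then s i else 0)"
    by (rule sum.cong) (simp_all add: prod_eq_iff)
  finally have "s (a, b) = 0"
    using assms(1,3) by simp
  then have "rep_fq (u (a, b)) = 0"
    unfolding D(2)[OF assms(3)] by (simp add: fract_collapse)
  then show ?thesis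
    by (simp only: rep_fq_0_iff)
qed

text \<open>The monomials x^a M^b with a and b at most N / 2 have degree at most N, and their normal
  forms (x^a M^b, 0, 0) are independent.\<close>

lemma dim_lower: "(N div 2 + 1) ^ 2 \<le> card (std_upto N)"
proof -
  let ?A = "{..N div 2} \<times> {..N div 2}"
  let ?f = "\<lambda>(a, b). mon (a, b, 0, 0)"
  have ind: "u (a, b) = 0" if "(\<Sum>i\<in>?A. fscale (u i) (?f i)) = 0" "(a, b) \<in> ?A" for u a b
  proof -
    have comp: "(\<Sum>i\<in>K. fscale (u i) (?f i)) = ((\<Sum>(a, b)\<in>K. rep_fq (u (a, b)) * (var_x ^ a * var_M ^ b)), 0, 0)"
      for K by (induction K rule: infinite_finite_induct) (auto simp: fscale_def zero_prod_def)
    have "(\<Sum>(a, b)\<in>?A. rep_fq (u (a, b)) * (var_x ^ a * var_M ^ b)) = 0"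
      using that(1) unfolding comp by (simp only: zero_prod_def prod.inject)
    from monomials_independent[OF _ this that(2)] show ?thesis by simp
  qed
  \<comment> \<open>A coincidence would be a relation with the coefficients 1 and -1.\<close>
  have inj: "inj_on ?f ?A"
  proof (rule inj_onI, rule ccontr)
    fix i k assume ik: "i \<in> ?A" "k \<in> ?A" "?f i = ?f k" "i \<noteq> k"
    let ?u = "\<lambda>l. if l = i then 1 else if l = k then - 1 else 0 :: fq"
    have "(\<Sum>l\<in>?A. fscale (?u l) (?f l)) = (\<Sum>l\<in>{i, k}. fscale (?u l) (?f l))"
      using ik(1,2) by (intro sum.mono_neutral_right) auto
    also have "\<dots> = fscale 1 (?f i) + fscale (- 1) (?f k)"
      using ik(4) by simp
    also have "\<dots> = 0"
      unfolding ik(3) fqv.scale_minus_left by simp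
    finally have "?u (fst i, snd i) = 0"
      by (rule ind) (use ik(1) in simp)
    then show False by simp
  qed
  have "fqv.independent (?f ` ?A)"
  proof (rule fqv.independent_if_scalars_zero)
    fix f v assume "(\<Sum>v\<in>?f ` ?A. fscale (f v) v) = 0" "v \<in> ?f ` ?A"
    then obtain a b where ab: "v = mon (a, b, 0, 0)" "(a, b) \<in> ?A"
      and "(\<Sum>i\<in>?A. fscale (f (?f i)) (?f i)) = 0"
      by (auto simp: sum.reindex[OF inj] simp del: mon.simps)
    from ind[OF this(3,2)] show "f v = 0"
      by (simp add: ab(1))
  qed simp
  moreover have "?f ` ?A \<subseteq> fqv.span (mon ` std_upto N)"
  proof
    fix v assume "v \<in> ?f ` ?A"
    then obtain a b where v: "v = mon (a, b, 0, 0)" "a \<le> N div 2" "b \<le> N div 2" by auto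
    then have "std_upto (edeg (a, b, 0, 0)) \<subseteq> std_upto N"
      by (auto simp: std_upto_def)
    then have "fqv.span (mon ` std_upto (edeg (a, b, 0, 0))) \<subseteq> fqv.span (mon ` std_upto N)"
      by (intro fqv.span_mono image_mono)
    then show "v \<in> fqv.span (mon ` std_upto N)"
      unfolding v(1) using mon_in_span_std by (rule subsetD)
  qed
  ultimately have "card (?f ` ?A) \<le> card (mon ` std_upto N)"
    using fqv.independent_span_bound[of "mon ` std_upto N" "?f ` ?A"] ev_poly_std(1) by simp
  then show ?thesis
    unfolding card_image[OF inj] std_upto_image by (simp add: card_cartesian_product power2_eq_square)
qed

section \<open>Upper bound through boxes of Laurent monomials\<close>

definition lmon :: "int \<Rightarrow> int \<Rightarrow> int \<Rightarrow> ratfun" where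
  "lmon k a b = var_q powi k * (var_x powi a * var_M powi b)"

text \<open>Exponents of x and M range over a square of side 2 K + 1, and powers of q are scalars.
  So the span has dimension at most 3 (2 K + 1)^2, quadratic in K although the operator monomials
  have four exponents.\<close>

definition laurent_box :: "int \<Rightarrow> triple set" where
  "laurent_box K = (\<lambda>(a, b, v). scale3 (lmon 0 a b) v) ` ({- K..K} \<times> {- K..K} \<times> {(1, 0, 0), (0, 1, 0), (0, 0, 1)})"

lemma laurent_boxI:
  assumes "\<bar>a\<bar> \<le> K" "\<bar>b\<bar> \<le> K" "e \<in> {(1, 0, 0), (0, 1, 0), (0, 0, 1)}"
  shows "scale3 (lmon 0 a b) e \<in> laurent_box K"
  unfolding laurent_box_def
  by (rule image_eqI[of _ _ "(a, b, e)"]) (use assms in \<open>simp_all add: abs_le_iff minus_le_iff\<close>)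

lemma laurent_boxE:
  assumes "s \<in> laurent_box K"
  obtains a b e where "s = scale3 (lmon 0 a b) e" "\<bar>a\<bar> \<le> K" "\<bar>b\<bar> \<le> K"
    "e \<in> {(1, 0, 0), (0, 1, 0), (0, 0, 1)}"
proof -
  obtain p where p: "s = (\<lambda>(a, b, v). scale3 (lmon 0 a b) v) p"
      "p \<in> {- K..K} \<times> {- K..K} \<times> {(1, 0, 0), (0, 1, 0), (0, 0, 1)}"
    using assms unfolding laurent_box_def by (rule imageE)
  obtain a b e where "p = (a, b, e)" by (cases p)
  with p show ?thesis by (intro that[of a b e]) (simp_all add: abs_le_iff minus_le_iff)
qed

lemma lmon_mult: "lmon k a b * lmon k' a' b' = lmon (k + k') (a + a') (b + b')"
  by (simp add: lmon_def power_int_add)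

lemma shift_lmon: "shift_x (lmon k a b) = lmon (k + a) a b" "shift_M (lmon k a b) = lmon (k + b) a b"
proof -
  have "shift_x (r powi n) = shift_x r powi n" "shift_M (r powi n) = shift_M r powi n" for r n
    by (simp_all add: power_int_def)
  then show "shift_x (lmon k a b) = lmon (k + a) a b" "shift_M (lmon k a b) = lmon (k + b) a b"
    by (simp_all add: lmon_def power_int_mult_distrib power_int_add)
qed

lemma span_lmon:
  assumes "v \<in> fqv.span S" "\<And>s. s \<in> S \<Longrightarrow> scale3 (lmon 0 a b) s \<in> fqv.span W"
  shows "scale3 (lmon k a b) v \<in> fqv.span W"
proof -
  have "scale3 (lmon 0 a b) v \<in> fqv.span W"
    by (rule span_semilinear[OF scale3_add(2) semilinear_acts(3) assms])
  then have "scale3 (var_q powi k) (scale3 (lmon 0 a b) v) \<in> fqv.span W"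
    by (rule span_scale_field_q[OF var_q_powi_field_q])
  then show ?thesis by (simp only: lmon_def power_int_0_right mult_1_left flip: scale3_add(3))
qed

lemma span_box_lmon:
  assumes "v \<in> fqv.span (laurent_box K)" "\<bar>a\<bar> \<le> L" "\<bar>b\<bar> \<le> L"
  shows "scale3 (lmon k a b) v \<in> fqv.span (laurent_box (K + L))"
proof (rule span_lmon[OF assms(1)])
  fix s assume "s \<in> laurent_box K"
  then obtain a' b' e where s: "s = scale3 (lmon 0 a' b') e" "\<bar>a'\<bar> \<le> K" "\<bar>b'\<bar> \<le> K"
      "e \<in> {(1, 0, 0), (0, 1, 0), (0, 0, 1)}"
    by (rule laurent_boxE)
  have "scale3 (lmon 0 a b) s = scale3 (lmon 0 (a + a') (b + b')) e"
    by (simp only: s(1) lmon_mult add_0 flip: scale3_add(3))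
  also have "\<dots> \<in> laurent_box (K + L)"
    using s(2-4) assms(2,3) by (intro laurent_boxI) auto
  finally show "scale3 (lmon 0 a b) s \<in> fqv.span (laurent_box (K + L))"
    by (rule fqv.span_base)
qed

lemma lmon_in_box:
  assumes "\<bar>a\<bar> \<le> K" "\<bar>b\<bar> \<le> K"
  shows "(lmon k a b, 0, 0) \<in> fqv.span (laurent_box K)" "(0, lmon k a b, 0) \<in> fqv.span (laurent_box K)"
    "(0, 0, lmon k a b) \<in> fqv.span (laurent_box K)"
proof -
  have "e \<in> fqv.span (laurent_box 0)" if "e \<in> {(1, 0, 0), (0, 1, 0), (0, 0, 1)}" for e
    using that laurent_boxI[of 0 0 0 e] by (intro fqv.span_base) (simp add: lmon_def)
  from span_box_lmon[OF this assms, of _ k]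
  show "(lmon k a b, 0, 0) \<in> fqv.span (laurent_box K)" "(0, lmon k a b, 0) \<in> fqv.span (laurent_box K)"
    "(0, 0, lmon k a b) \<in> fqv.span (laurent_box K)"
    by force+
qed

text \<open>The bound 3 is forced by the terms with x^-3 in the image of S_m^2 S_x; all other
  exponents in the two actions are smaller in absolute value.\<close>

definition lbox :: "ratfun \<Rightarrow> bool" where
  "lbox r \<longleftrightarrow> (r, 0, 0) \<in> fqv.span (laurent_box 3) \<and> (0, r, 0) \<in> fqv.span (laurent_box 3) \<and> (0, 0, r) \<in> fqv.span (laurent_box 3)"

lemma lbox_closed:
  "lbox r \<Longrightarrow> lbox s \<Longrightarrow> lbox (r + s)" "lbox r \<Longrightarrow> lbox (- r)" "lbox 0"
  "\<bar>a\<bar> \<le> 3 \<Longrightarrow> \<bar>b\<bar> \<le> 3 \<Longrightarrow> lbox (lmon k a b)"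
proof -
  show "lbox (r + s)" if "lbox r" "lbox s"
    using that fqv.span_add[of "(r, 0, 0)" "laurent_box 3" "(s, 0, 0)"] fqv.span_add[of "(0, r, 0)" "laurent_box 3" "(0, s, 0)"]
      fqv.span_add[of "(0, 0, r)" "laurent_box 3" "(0, 0, s)"] by (simp add: lbox_def)
  show "lbox (- r)" if "lbox r"
    using that fqv.span_neg[of "(r, 0, 0)" "laurent_box 3"] fqv.span_neg[of "(0, r, 0)" "laurent_box 3"]
      fqv.span_neg[of "(0, 0, r)" "laurent_box 3"] by (simp add: lbox_def)
  show "lbox 0" using fqv.span_zero[of "laurent_box 3"] by (simp add: lbox_def zero_prod_def)
  show "lbox (lmon k a b)" if "\<bar>a\<bar> \<le> 3" "\<bar>b\<bar> \<le> 3"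
    using that by (auto simp: lbox_def intro: lmon_in_box)
qed

lemma lbox_diff: "lbox r \<Longrightarrow> lbox s \<Longrightarrow> lbox (r - s)"
  using lbox_closed(1)[of r "- s"] lbox_closed(2)[of s] by simp

lemma lbox_triple: "lbox a \<Longrightarrow> lbox b \<Longrightarrow> lbox c \<Longrightarrow> (a, b, c) \<in> fqv.span (laurent_box 3)"
  using fqv.span_add[OF fqv.span_add, of "(a, 0, 0)" "laurent_box 3" "(0, b, 0)" "(0, 0, c)"] by (simp add: lbox_def)

lemma x0_lmon:
  "x0 = (- lmon (-1) (0) (-1) + lmon (0) (0) (0) + lmon (0) (2) (-1),
     lmon (-1) (-1) (-1) - lmon (0) (-1) (0) + lmon (-1) (0) (-1) - lmon (0) (1) (-1) + lmon (1) (1) (0) - lmon (0) (2) (-1),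
     - lmon (-1) (-1) (-1) + lmon (0) (1) (-1))"
  "act_m x0 = (- lmon (-2) (-1) (-1) + lmon (-1) (1) (-1),
     lmon (-2) (-2) (-1) + lmon (-2) (-1) (-1) - lmon (-1) (0) (-1) + lmon (0) (0) (0) - lmon (-1) (1) (-1),
     - lmon (-2) (-2) (-1) + lmon (-1) (0) (-1))"
  "act_m (act_m x0) = (- lmon (-3) (-2) (-1) + lmon (-2) (0) (-1),
     lmon (-3) (-3) (-1) + lmon (-3) (-2) (-1) - lmon (-2) (-1) (-1) - lmon (-2) (0) (-1),
     - lmon (-3) (-3) (-1) + lmon (-1) (-2) (0) + lmon (-2) (-1) (-1))"
  by (simp_all only: act_m_act_m_x0, simp_all only: act_m_x0, simp_all only: x0_def lmon_def)
     (simp_all add: power_int_minus field_simps)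

lemma acts_in_box:
  assumes "e \<in> {(1, 0, 0), (0, 1, 0), (0, 0, 1)}"
  shows "act_x e \<in> fqv.span (laurent_box 3)" "act_m e \<in> fqv.span (laurent_box 3)"
proof -
  have "x0 \<in> fqv.span (laurent_box 3)" "act_m x0 \<in> fqv.span (laurent_box 3)" "act_m (act_m x0) \<in> fqv.span (laurent_box 3)"
    unfolding x0_lmon(3) unfolding x0_lmon(2) unfolding x0_lmon(1)
    by (intro lbox_triple lbox_closed lbox_diff; simp)+
  then show "act_x e \<in> fqv.span (laurent_box 3)"
    using assms by (elim insertE emptyE) (simp_all del: act_m.simps)
  have vars: "lmon 0 0 0 = 1" "lmon 0 1 0 = var_x" "lmon 0 (- 1) 0 = inverse var_x" "lmon 2 0 1 = var_q ^ 2 * var_M"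
    by (simp_all add: lmon_def power_int_minus)
  have l1: "lbox 1" "lbox var_x" "lbox (inverse var_x)" "lbox (var_q ^ 2 * var_M)"
    using lbox_closed(4)[of 0 0 0] lbox_closed(4)[of 1 0 0] lbox_closed(4)[of "- 1" 0 0]
      lbox_closed(4)[of 0 1 2] by (simp_all add: vars)
  then have l: "lbox 1" "lbox (- (1 + var_x + inverse var_x))" "lbox (1 + var_x + inverse var_x - var_q ^ 2 * var_M)"
    by (simp_all only: lbox_closed(1,2) lbox_diff)
  have "act_m e \<in> {(0, 1, 0), (0, 0, 1), (1, - (1 + var_x + inverse var_x), 1 + var_x + inverse var_x - var_q ^ 2 * var_M)}"
    using assms by auto
  then show "act_m e \<in> fqv.span (laurent_box 3)"
    using l lbox_closed(3) by (elim insertE emptyE) (simp_all only: lbox_triple)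
qed

text \<open>A Laurent monomial passes through S_x or S_m up to a power of q, so each generator
  enlarges the box by at most 3, and a monomial of degree N ends in the box of size 3 N.\<close>

lemma span_box_acts:
  assumes "v \<in> fqv.span (laurent_box K)"
  shows "act_x v \<in> fqv.span (laurent_box (K + 3))" "act_m v \<in> fqv.span (laurent_box (K + 3))"
proof -
  have *: "act_x s \<in> fqv.span (laurent_box (K + 3)) \<and> act_m s \<in> fqv.span (laurent_box (K + 3))" if sK: "s \<in> laurent_box K" for s
  proof -
    obtain a b e where s: "s = scale3 (lmon 0 a b) e" "\<bar>a\<bar> \<le> K" "\<bar>b\<bar> \<le> K"
        "e \<in> {(1, 0, 0), (0, 1, 0), (0, 0, 1)}"
      using sK by (rule laurent_boxE)
    have "act_x s = scale3 (lmon a a b) (act_x e)" "act_m s = scale3 (lmon b a b) (act_m e)"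
      by (simp_all only: s(1) act_x_scale act_m_scale shift_lmon add_0)
    then show ?thesis
      using span_box_lmon[OF acts_in_box(1)[OF s(4)] s(2,3), of a]
        span_box_lmon[OF acts_in_box(2)[OF s(4)] s(2,3), of b] by (simp only: add.commute)
  qed
  show "act_x v \<in> fqv.span (laurent_box (K + 3))"
    by (rule span_semilinear[OF act_x_add semilinear_acts(1) assms]) (use * in blast)
  show "act_m v \<in> fqv.span (laurent_box (K + 3))"
    by (rule span_semilinear[OF act_m_add semilinear_acts(2) assms]) (use * in blast)
qed

lemma box_mono: "K \<le> L \<Longrightarrow> fqv.span (laurent_box K) \<subseteq> fqv.span (laurent_box L)"
  unfolding laurent_box_def by (intro fqv.span_mono image_mono Sigma_mono) auto

lemma mon_in_box: "mon m \<in> fqv.span (laurent_box (3 * int (edeg m)))"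
proof -
  obtain a b i j where m: "m = (a, b, i, j)" by (cases m)
  have j: "(act_m ^^ j) e0 \<in> fqv.span (laurent_box (3 * int j))"
  proof (induction j)
    case 0
    show ?case using lmon_in_box(1)[of 0 0 0 0] by (simp add: lmon_def)
  next
    case (Suc j)
    from span_box_acts(2)[OF Suc.IH] show ?case by (simp add: algebra_simps del: act_m.simps)
  qed
  have ij: "(act_x ^^ i) ((act_m ^^ j) e0) \<in> fqv.span (laurent_box (3 * int (i + j)))"
  proof (induction i)
    case 0
    show ?case using j by simp
  next
    case (Suc i)
    from span_box_acts(1)[OF Suc.IH] show ?case by (simp add: algebra_simps del: act_x.simps)
  qed
  have "mon m = scale3 (lmon 0 (int a) (int b)) ((act_x ^^ i) ((act_m ^^ j) e0))"
    by (simp add: m lmon_def)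
  then have "mon m \<in> fqv.span (laurent_box (3 * int (i + j) + (int a + int b)))"
    using span_box_lmon[OF ij, of "int a" "int a + int b" "int b" 0] by simp
  moreover have "fqv.span (laurent_box (3 * int (i + j) + (int a + int b))) \<subseteq> fqv.span (laurent_box (3 * int (edeg m)))"
    by (rule box_mono) (simp add: m)
  ultimately show ?thesis by (rule subsetD[rotated])
qed

lemma dim_upper: "card (std_upto N) \<le> 3 * (6 * N + 1) ^ 2"
proof -
  let ?K = "3 * int N"
  have fin: "finite (laurent_box ?K)" by (simp add: laurent_box_def)
  have "mon ` std_upto N \<subseteq> fqv.span (laurent_box ?K)"
  proof
    fix v assume "v \<in> mon ` std_upto N"
    then obtain m where m: "v = mon m" "edeg m \<le> N" by (auto simp: std_upto_def)
    have "fqv.span (laurent_box (3 * int (edeg m))) \<subseteq> fqv.span (laurent_box ?K)"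
      by (rule box_mono) (use m(2) in simp)
    then show "v \<in> fqv.span (laurent_box ?K)"
      unfolding m(1) using mon_in_box by (rule subsetD)
  qed
  then have "card (mon ` std_upto N) \<le> card (laurent_box ?K)"
    using fqv.independent_span_bound[OF fin std_upto_image(3)] by blast
  also have "\<dots> \<le> card ({- ?K..?K} \<times> {- ?K..?K} \<times> {(1, 0, 0), (0, 1, 0), (0, 0, 1) :: triple})"
    unfolding laurent_box_def by (rule card_image_le) simp
  also have "\<dots> = nat (6 * int N + 1) * (nat (6 * int N + 1) * 3)"
    by (simp add: card_cartesian_product)
  also have "\<dots> = 3 * (6 * N + 1) ^ 2"
  proof -
    have "nat (6 * int N + 1) = 6 * N + 1" by simp
    then show ?thesis by (simp only: power2_eq_square ac_simps)
  qed
  finally show ?thesis by (simp add: std_upto_image)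
qed

lemma q_holonomic_I52:
  assumes "annihilator F = I52"
  shows "q_holonomic F"
proof -
  obtain p :: "real poly" where p: "\<forall>\<^sub>F N in sequentially. real (card (std_upto N)) = poly p (real N)"
    using ev_poly_std(2) by (auto simp: ev_poly_def)
  have "degree p = 2"
  \<comment> \<open>1 / 4 comes from N \<le> 2 (N div 2 + 1), and 147 = 3 * 7^2 from 6 N + 1 \<le> 7
    N for positive N.\<close>
  proof (rule poly_degree_2[of "1 / 4" _ 147])
    show "\<forall>\<^sub>F N in sequentially. 1 / 4 * real N ^ 2 \<le> poly p (real N) \<and> poly p (real N) \<le> 147 * real N ^ 2"
      using p eventually_ge_at_top[of 1]
    proof eventually_elim
      case (elim N)
      have "N \<le> 2 * (N div 2 + 1)" by simp
      then have "real N \<le> 2 * real (N div 2 + 1)" by linarith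
      then have "real N ^ 2 \<le> (2 * real (N div 2 + 1)) ^ 2" by (rule power_mono) simp
      also have "\<dots> = 4 * real ((N div 2 + 1) ^ 2)" by (simp add: power2_eq_square algebra_simps)
      also have "\<dots> \<le> 4 * real (card (std_upto N))" using of_nat_mono[OF dim_lower[of N], where 'a = real] by linarith
      finally have lo: "real N ^ 2 \<le> 4 * real (card (std_upto N))" .
      have "card (std_upto N) \<le> 3 * (7 * N) ^ 2"
        using dim_upper[of N] elim(2) power_mono[of "6 * N + 1" "7 * N" 2] by linarith
      then have "real (card (std_upto N)) \<le> real (3 * (7 * N) ^ 2)" by (simp only: of_nat_mono)
      then show ?case using lo elim(1) by (simp add: power_mult_distrib)
    qed
  qed simp
  moreover have "\<forall>\<^sub>F N in sequentially. \<exists>n.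
      quot_dim field_q (q_weyl N) (annihilator F) n \<and> real n = poly p (real N)"
    using p by eventually_elim (use quot_dim_q_weyl assms in auto)
  ultimately show ?thesis
    unfolding q_holonomic_def by blast
qed

section \<open>The hypergeometric series\<close>

definition ratio :: "complex \<Rightarrow> complex \<Rightarrow> complex" where
  "ratio x t = t\<^sup>2 / ((1 - t) * (1 - x * t) * (1 - t / x))"

text \<open>For \<open>u = 1, x, 1 / x\<close> these are the coefficients of the three blocks, both for \<open>norm q < 1\<close>
  and for \<open>norm q > 1\<close>.\<close>

definition ac :: "complex \<Rightarrow> complex \<Rightarrow> complex \<Rightarrow> nat \<Rightarrow> complex" where
  "ac q x u n = (\<Prod>k<n. ratio x (u * q ^ Suc k))"

definition phi :: "complex \<Rightarrow> complex \<Rightarrow> complex \<Rightarrow> complex \<Rightarrow> complex" where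
  "phi q x u M = suminf (\<lambda>n. ac q x u n * M ^ n)"

lemma ac_0 [simp]: "ac q x u 0 = 1" and ac_Suc: "ac q x u (Suc n) = ac q x u n * ratio x (u * q ^ Suc n)"
  by (simp_all add: ac_def)

lemma norm_ratio_small:
  assumes "R \<ge> 1" "norm x \<le> R" "1 / R \<le> norm x" "norm t \<le> 1 / (2 * R)"
  shows "norm (ratio x t) \<le> 8 * norm t ^ 2"
proof -
  have x: "x \<noteq> 0" using assms(1,3) by (auto simp: divide_simps split: if_splits)
  have "1 / (2 * R) \<le> 1 / 2" using assms(1) by (simp add: field_simps)
  then have t: "norm t \<le> 1 / 2" using assms(4) by linarith
  have half: "norm (1 - z) \<ge> 1 / 2" if "norm z \<le> 1 / 2" for z :: complex
    using that norm_triangle_ineq2[of 1 z] by simp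
  have "norm (x * t) \<le> R * (1 / (2 * R))"
    unfolding norm_mult by (rule mult_mono) (use assms in auto)
  then have 2: "norm (x * t) \<le> 1 / 2" using assms(1) by simp
  have "norm t \<le> (1 / 2) * (1 / R)" using assms(4) by simp
  also have "\<dots> \<le> (1 / 2) * norm x" by (intro mult_left_mono assms(3)) simp
  finally have 3: "norm (t / x) \<le> 1 / 2"
    using x by (simp add: norm_divide divide_le_eq)
  have "(1 / 2) * (1 / 2) * (1 / 2) \<le> norm (1 - t) * norm (1 - x * t) * norm (1 - t / x)"
    by (intro mult_mono half t 2 3) auto
  then have "norm t ^ 2 / (norm (1 - t) * norm (1 - x * t) * norm (1 - t / x)) \<le> norm t ^ 2 / (1 / 8)"
    by (intro divide_left_mono mult_pos_pos) (auto intro!: mult_nonneg_nonneg)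
  then show ?thesis
    by (simp add: ratio_def norm_divide norm_mult norm_power)
qed

lemma norm_ratio_large:
  assumes "R \<ge> 1" "norm x \<le> R" "1 / R \<le> norm x" "norm t \<ge> 2 * R"
  shows "norm (ratio x t) \<le> 8 / norm t"
proof -
  have x: "norm x > 0" using assms(1,3) by (auto simp: divide_simps split: if_splits)
  have tpos: "norm t > 0" using assms by auto
  have half: "norm (1 - z) \<ge> norm z / 2" if "norm z \<ge> 2" for z :: complex
    using that norm_triangle_ineq2[of z 1] by (simp add: norm_minus_commute)
  have 2: "norm (x * t) \<ge> 2"
  proof -
    have "1 / R * (2 * R) \<le> norm x * norm t" by (rule mult_mono) (use assms in auto)
    then show ?thesis using assms(1) by (simp add: norm_mult)
  qed
  have 3: "norm (t / x) \<ge> 2"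
    using assms x by (simp add: norm_divide field_simps)
  have "norm t / 2 * (norm (x * t) / 2) * (norm (t / x) / 2) \<le> norm (1 - t) * norm (1 - x * t) * norm (1 - t / x)"
    by (intro mult_mono half 2 3) (use assms in auto)
  also have "norm t / 2 * (norm (x * t) / 2) * (norm (t / x) / 2) = norm t ^ 3 / 8"
    using x by (simp add: norm_mult norm_divide power3_eq_cube)
  finally have "norm t ^ 2 / (norm (1 - t) * norm (1 - x * t) * norm (1 - t / x)) \<le> norm t ^ 2 / (norm t ^ 3 / 8)"
    using tpos by (intro divide_left_mono mult_pos_pos) (auto intro: less_le_trans[of _ "norm t ^ 3 / 8"])
  also have "\<dots> = 8 / norm t" using tpos by (simp add: power2_eq_square power3_eq_cube)
  finally show ?thesis
    by (simp add: ratio_def norm_divide norm_mult norm_power)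
qed

text \<open>The arguments u q^k tend to 0 or to infinity. The ratio is O(t^2) at 0 and O(1 / t) at
  infinity, uniformly for x and u in an annulus. Hence the coefficients decay faster than any
  geometric sequence in both regimes, and the series are entire in M.\<close>

lemma ratio_tail:
  assumes "admissible q" "R \<ge> 1" "\<epsilon> > 0"
  shows "\<exists>N. \<forall>k\<ge>N. \<forall>x u. norm x \<le> R \<longrightarrow> 1 / R \<le> norm x \<longrightarrow> norm u \<le> R \<longrightarrow> 1 / R \<le> norm u \<longrightarrow>
    norm (ratio x (u * q ^ k)) \<le> \<epsilon>"
proof (cases "norm q < 1")
  case True
  define \<delta> where "\<delta> = min (1 / (2 * R)) (sqrt (\<epsilon> / 8)) / R"
  have "\<delta> > 0" using assms by (simp add: \<delta>_def)
  moreover have "(\<lambda>k. norm q ^ k) \<longlonglongrightarrow> 0" using True by (intro LIMSEQ_power_zero) auto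
  ultimately have "\<forall>\<^sub>F k in sequentially. norm q ^ k < \<delta>"
    by (simp add: order_tendstoD)
  then obtain N where N: "\<And>k. k \<ge> N \<Longrightarrow> norm q ^ k < \<delta>" by (auto simp: eventually_sequentially)
  show ?thesis
  proof (intro exI[of _ N] allI impI)
    fix k and x u :: complex assume *: "k \<ge> N" "norm x \<le> R" "1 / R \<le> norm x" "norm u \<le> R"
    have "norm (u * q ^ k) \<le> R * \<delta>"
      unfolding norm_mult norm_power using N[OF *(1)] * assms by (intro mult_mono) auto
    also have "\<dots> = min (1 / (2 * R)) (sqrt (\<epsilon> / 8))" using assms by (simp add: \<delta>_def)
    finally have t: "norm (u * q ^ k) \<le> 1 / (2 * R)" "norm (u * q ^ k) \<le> sqrt (\<epsilon> / 8)" by auto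
    have "norm (ratio x (u * q ^ k)) \<le> 8 * norm (u * q ^ k) ^ 2"
      by (rule norm_ratio_small[OF assms(2) *(2,3) t(1)])
    also have "\<dots> \<le> 8 * sqrt (\<epsilon> / 8) ^ 2"
      by (intro mult_left_mono power_mono t) auto
    finally show "norm (ratio x (u * q ^ k)) \<le> \<epsilon>" using assms by simp
  qed
next
  case False
  then have q: "norm q > 1" using assms by (auto simp: admissible_def)
  define B where "B = max (2 * R) (8 / \<epsilon>) * R"
  obtain N0 where "B < norm q ^ N0" using real_arch_pow[OF q] by blast
  then have N: "norm q ^ k \<ge> B" if "k \<ge> N0" for k
    using power_increasing[OF that, of "norm q"] q by linarith
  show ?thesis
  proof (intro exI[of _ N0] allI impI)
    fix k and x u :: complex assume *: "k \<ge> N0" "norm x \<le> R" "1 / R \<le> norm x" "1 / R \<le> norm u"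
    have "1 / R * B \<le> norm (u * q ^ k)"
      unfolding norm_mult norm_power using N[OF *(1)] * assms by (intro mult_mono) (auto simp: B_def)
    then have t: "norm (u * q ^ k) \<ge> 2 * R" "norm (u * q ^ k) \<ge> 8 / \<epsilon>" using assms by (auto simp: B_def)
    have "norm (ratio x (u * q ^ k)) \<le> 8 / norm (u * q ^ k)"
      by (rule norm_ratio_large[OF assms(2) *(2,3) t(1)])
    also have "\<dots> \<le> \<epsilon>"
    proof -
    have "8 / T \<le> \<epsilon>" if "8 / \<epsilon> \<le> T" for T :: real
    proof -
      have "0 < 8 / \<epsilon>" using assms by simp
      then have "T > 0" using that by linarith
      then show ?thesis using that assms by (simp add: field_simps)
    qed
    from this[OF t(2)] show ?thesis .
    qed
    finally show "norm (ratio x (u * q ^ k)) \<le> \<epsilon>" .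
  qed
qed

lemma annulus_ex:
  fixes x u :: complex
  assumes "x \<noteq> 0" "u \<noteq> 0"
  obtains R where "R \<ge> 1" "norm x \<le> R" "1 / R \<le> norm x" "norm u \<le> R" "1 / R \<le> norm u"
proof
  let ?R = "max 1 (max (max (norm x) (1 / norm x)) (max (norm u) (1 / norm u)))"
  have *: "1 / R \<le> norm z" if "R \<ge> 1" "1 / norm z \<le> R" "norm z > 0" for R and z :: complex
    using that by (simp add: field_simps)
  show "1 / ?R \<le> norm x" "1 / ?R \<le> norm u" by (rule *; use assms in simp)+
qed auto

lemma summable_ac:
  assumes "admissible q" "x \<noteq> 0" "u \<noteq> 0"
  shows "summable (\<lambda>n. ac q x u n * M ^ n)"
proof -
  obtain R where R: "R \<ge> 1" "norm x \<le> R" "1 / R \<le> norm x" "norm u \<le> R" "1 / R \<le> norm u"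
    using annulus_ex[OF assms(2,3)] .
  obtain N where N: "\<And>k. k \<ge> N \<Longrightarrow> norm (ratio x (u * q ^ k)) \<le> 1 / (2 * (norm M + 1))"
    using ratio_tail[OF assms(1) R(1), of "1 / (2 * (norm M + 1))"] R
    by (auto simp: add_pos_nonneg add_nonneg_pos)
  show ?thesis
  proof (rule summable_ratio_test)
    fix n assume n: "n \<ge> N"
    have "norm (ratio x (u * q ^ Suc n)) * norm M \<le> 1 / (2 * (norm M + 1)) * norm M"
      by (rule mult_right_mono[OF N]) (use n in auto)
    also have "\<dots> \<le> 1 / 2"
    proof -
      have "1 / (2 * (a + 1)) * a \<le> 1 / 2" if "a \<ge> 0" for a :: real
        using that by (auto simp: field_simps)
      from this[of "norm M"] show ?thesis by (simp only: norm_ge_zero)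
    qed
    finally have r: "norm (ratio x (u * q ^ Suc n)) * norm M \<le> 1 / 2" .
    have "norm (ac q x u (Suc n) * M ^ Suc n) = (norm (ratio x (u * q ^ Suc n)) * norm M) * norm (ac q x u n * M ^ n)"
      by (simp add: ac_Suc norm_mult norm_power)
    also have "\<dots> \<le> 1 / 2 * norm (ac q x u n * M ^ n)"
      by (rule mult_right_mono[OF r]) simp
    finally show "norm (ac q x u (Suc n) * M ^ Suc n) \<le> 1 / 2 * norm (ac q x u n * M ^ n)" .
  qed simp
qed

lemma phi_sums:
  assumes "admissible q" "x \<noteq> 0" "u \<noteq> 0"
  shows "(\<lambda>n. ac q x u n * M ^ n) sums phi q x u M"
  unfolding phi_def by (rule summable_sums[OF summable_ac[OF assms]])

lemma phi_sums_q:
  assumes "admissible q" "x \<noteq> 0" "u \<noteq> 0"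
  shows "(\<lambda>n. (u * q ^ n) ^ j * (ac q x u n * M ^ n)) sums (u ^ j * phi q x u (q ^ j * M))"
proof -
  have "(u * q ^ n) ^ j * (ac q x u n * M ^ n) = u ^ j * (ac q x u n * (q ^ j * M) ^ n)" for n
    by (simp add: power_mult_distrib mult.commute flip: power_mult)
  then show ?thesis
    by (simp only:) (intro sums_mult phi_sums assms)
qed

lemma phi_holomorphic:
  assumes "admissible q" "x \<noteq> 0" "u \<noteq> 0"
  shows "phi q x u holomorphic_on A"
  unfolding phi_def[abs_def]
  by (rule holomorphic_on_subset[of _ UNIV])
     (auto simp: holomorphic_on_def field_differentiable_def
       intro!: has_field_derivative_at_within termdiffs_strong_converges_everywhere summable_ac[OF assms])

lemma phi_0 [simp]: "phi q x u 0 = 1"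
  using powser_sums_zero[of "ac q x u"] by (simp add: phi_def sums_iff)

lemma shift_sums:
  fixes g :: "nat \<Rightarrow> complex"
  assumes "(\<lambda>n. g n * M ^ n) sums L"
  shows "(\<lambda>n. (if n = 0 then 0 else g (n - 1)) * M ^ n) sums (M * L)"
proof -
  have "(\<lambda>n. M * (g n * M ^ n)) sums (M * L)" by (rule sums_mult[OF assms])
  then show ?thesis
    by (subst sums_Suc_iff[symmetric, where f = "\<lambda>n. (if n = 0 then 0 else g (n - 1)) * M ^ n", simplified])
       (simp add: mult.left_commute)
qed

section \<open>Recurrences of the series\<close>

definition nonres :: "complex \<Rightarrow> complex \<Rightarrow> complex \<Rightarrow> bool" where
  "nonres q x u \<longleftrightarrow> (\<forall>n. (1 - u * q ^ Suc n) * (1 - x * (u * q ^ Suc n)) * (1 - u * q ^ Suc n / x) \<noteq> 0)"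

lemma generic_powi:
  assumes "generic q x"
  shows "x \<noteq> 0" "x\<^sup>2 \<noteq> q powi k" "x \<noteq> q powi k" "x * q powi k \<noteq> 1" "x\<^sup>2 * q powi k \<noteq> 1"
proof -
  show g: "x \<noteq> 0" "x\<^sup>2 \<noteq> q powi k" for k using assms by (auto simp: generic_def)
  show x: "x \<noteq> q powi k" for k
    using g(2)[of "k * 2"] by (auto simp: power_int_mult power_int_numeral)
  have inv: "y = q powi (- k)" if "y * q powi k = 1" for y
    using that by (metis inverse_unique mult.commute power_int_minus)
  show "x * q powi k \<noteq> 1" "x\<^sup>2 * q powi k \<noteq> 1"
    using inv[of x] inv[of "x\<^sup>2"] x g(2) by blast+
qed

lemma generic_power:
  assumes "generic q x"
  shows "x\<^sup>2 \<noteq> q ^ n" "x \<noteq> q ^ n" "x * q ^ n \<noteq> 1" "x\<^sup>2 * q ^ n \<noteq> 1"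
  using generic_powi(2-5)[OF assms, of "int n"] unfolding power_int_of_nat by blast+

lemma admissible_power:
  assumes "admissible q" "n > 0"
  shows "q ^ n \<noteq> 1"
proof
  assume "q ^ n = 1"
  then have "norm q ^ n = 1" by (metis norm_one norm_power)
  then have "norm q = 1" using assms(2) power_eq_imp_eq_base[of "norm q" n 1] by simp
  then show False using assms(1) by (simp add: admissible_def)
qed

lemma generic_inverse: "generic q x \<Longrightarrow> generic q (inverse x)" "generic q x \<Longrightarrow> generic (inverse q) x"
proof -
  assume g: "generic q x"
  have "inverse x ^ 2 \<noteq> q powi k" for k
    using generic_powi(2)[OF g, of "- k"] by (metis inverse_inverse_eq power_int_minus power_inverse)
  then show "generic q (inverse x)" using g by (auto simp: generic_def)
  have "inverse q powi k = q powi (- k)" for k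
    by (simp add: power_int_inverse power_int_minus)
  then show "generic (inverse q) x"
    using g by (simp add: generic_def)
qed

lemma generic_shift:
  assumes "generic q x" "q \<noteq> 0"
  shows "generic q (q ^ k * x)"
proof -
  have "(q ^ k * x)\<^sup>2 \<noteq> q powi j" for j
  proof
    assume "(q ^ k * x)\<^sup>2 = q powi j"
    then have "q powi (2 * int k) * x\<^sup>2 = q powi j"
      by (simp add: power_mult_distrib power_int_mult power_int_numeral power_commutes flip: power_mult)
         (metis mult.commute power_mult)
    then have "x\<^sup>2 = q powi j / q powi (2 * int k)"
      using assms(2) by (simp add: field_simps)
    then have "x\<^sup>2 = q powi (j - 2 * int k)" using assms(2) by (simp add: power_int_diff)
    then show False using assms(1) by (auto simp: generic_def)
  qed
  then show ?thesis using assms by (auto simp: generic_def)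
qed

lemma nonres_generic:
  assumes "generic q x" "admissible q" "u \<in> {1, x, inverse x}"
  shows "nonres q x u"
proof -
  have q1: "q ^ Suc n \<noteq> 1" for n using admissible_power[OF assms(2), of "Suc n"] by (simp del: power_Suc)
  have x: "x \<noteq> 0" using generic_powi[OF assms(1)] by blast
  have "1 - u * q ^ Suc n \<noteq> 0 \<and> 1 - x * (u * q ^ Suc n) \<noteq> 0 \<and> 1 - u * q ^ Suc n / x \<noteq> 0" for n
    using assms(3) q1[of n] generic_power[OF assms(1), of "Suc n"] x
    by (elim insertE emptyE; hypsubst) (simp_all add: field_simps power2_eq_square del: power_Suc)
  then show ?thesis unfolding nonres_def mult_eq_0_iff by blast
qed

lemma ac_recurrence:
  assumes "nonres q x u"
  shows "(1 - u * q ^ Suc n) * (1 - x * (u * q ^ Suc n)) * (1 - u * q ^ Suc n / x) * ac q x u (Suc n) =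
    (u * q ^ Suc n)\<^sup>2 * ac q x u n"
  using assms unfolding nonres_def ac_Suc ratio_def by (simp del: power_Suc)

section \<open>The blocks as hypergeometric series\<close>

lemma qpoch_inf_conv:
  fixes q x :: complex
  assumes "norm q < 1"
  shows "convergent_prod (\<lambda>j. 1 - q ^ j * x)"
proof -
  have "summable (\<lambda>j. norm q ^ j * norm x)"
    using assms by (intro summable_mult2 summable_geometric) auto
  then have "summable (\<lambda>j. norm ((1 - q ^ j * x) - 1))"
    by (simp add: norm_mult norm_power)
  then show ?thesis
    by (intro abs_convergent_prod_imp_convergent_prod) (simp add: abs_convergent_prod_conv_summable)
qed

lemma qpoch_inf_LIMSEQ:
  assumes "norm q < 1"
  shows "(\<lambda>n. \<Prod>j<n. 1 - q ^ j * x) \<longlonglongrightarrow> qpoch_inf x q"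
  using convergent_prod_LIMSEQ[OF qpoch_inf_conv[OF assms, of x]]
  unfolding qpoch_inf_def by (subst filterlim_sequentially_Suc[symmetric]) (simp only: lessThan_Suc_atMost)

lemma qpoch_inf_step:
  assumes "norm q < 1"
  shows "qpoch_inf x q = (1 - x) * qpoch_inf (q * x) q"
proof (rule LIMSEQ_unique)
  show "(\<lambda>n. \<Prod>j<Suc n. 1 - q ^ j * x) \<longlonglongrightarrow> qpoch_inf x q"
    using qpoch_inf_LIMSEQ[OF assms, of x] by (subst filterlim_sequentially_Suc)
  have "(\<Prod>j<Suc n. 1 - q ^ j * x) = (1 - x) * (\<Prod>j<n. 1 - q ^ j * (q * x))" for n
    by (subst prod.lessThan_Suc_shift) (simp add: mult_ac)
  then show "(\<lambda>n. \<Prod>j<Suc n. 1 - q ^ j * x) \<longlonglongrightarrow> (1 - x) * qpoch_inf (q * x) q"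
    by (simp only:) (intro tendsto_mult_left qpoch_inf_LIMSEQ assms)
qed

lemma qpoch_inf_nonzero:
  assumes "norm q < 1" "\<And>j. q ^ j * x \<noteq> 1"
  shows "qpoch_inf x q \<noteq> 0"
  unfolding qpoch_inf_def by (rule prodinf_nonzero[OF qpoch_inf_conv[OF assms(1)]]) (use assms(2) in auto)

lemma generic_qpoch:
  assumes "generic q x" "norm q < 1"
  shows "qpoch_inf x q \<noteq> 0" "qpoch_inf (inverse x) q \<noteq> 0" "qpoch_inf (q * x) q \<noteq> 0"
    "qpoch_inf (q * inverse x) q \<noteq> 0" "qpoch_inf (x\<^sup>2) q \<noteq> 0" "qpoch_inf (q * x\<^sup>2) q \<noteq> 0"
    "qpoch_inf (inverse (x\<^sup>2)) q \<noteq> 0" "qpoch_inf (q * inverse (x\<^sup>2)) q \<noteq> 0"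
proof -
  have x: "x \<noteq> 0" using generic_powi[OF assms(1)] by blast
  have "q ^ n * x \<noteq> 1" "q ^ n * inverse x \<noteq> 1" "q ^ n * x\<^sup>2 \<noteq> 1" "q ^ n * inverse (x\<^sup>2) \<noteq> 1"
    for n using generic_power[OF assms(1), of n] x by (auto simp: field_simps)
  moreover from this[of "Suc _"] have "q ^ n * (q * x) \<noteq> 1" "q ^ n * (q * inverse x) \<noteq> 1"
    "q ^ n * (q * x\<^sup>2) \<noteq> 1" "q ^ n * (q * inverse (x\<^sup>2)) \<noteq> 1" for n
    by (simp_all add: mult.left_commute mult.assoc)
  ultimately show "qpoch_inf x q \<noteq> 0" "qpoch_inf (inverse x) q \<noteq> 0" "qpoch_inf (q * x) q \<noteq> 0"
    "qpoch_inf (q * inverse x) q \<noteq> 0" "qpoch_inf (x\<^sup>2) q \<noteq> 0" "qpoch_inf (q * x\<^sup>2) q \<noteq> 0"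
    "qpoch_inf (inverse (x\<^sup>2)) q \<noteq> 0" "qpoch_inf (q * inverse (x\<^sup>2)) q \<noteq> 0"
    by (simp_all only: qpoch_inf_nonzero[OF assms(2)] not_False_eq_True)
qed

lemma qpoch_inf_holomorphic:
  assumes "norm q < 1"
  shows "(\<lambda>x. qpoch_inf x q) holomorphic_on A"
proof (rule holomorphic_on_subset)
  show "(\<lambda>x. qpoch_inf x q) holomorphic_on UNIV"
  proof (rule holomorphic_uniform_sequence[where f = "\<lambda>n x. \<Prod>j<n. 1 - q ^ j * x"])
    fix x :: complex
    have "uniformly_convergent_on (cball x 1) (\<lambda>n x. \<Prod>j<n. 1 - q ^ j * x)"
    proof (rule uniformly_convergent_on_prod')
      show "uniformly_convergent_on (cball x 1) (\<lambda>N x. \<Sum>n<N. norm ((1 - q ^ n * x) - 1))"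
      proof (rule Weierstrass_m_test')
        fix n y assume "y \<in> cball x 1"
        then have "norm y \<le> norm x + 1"
          using norm_triangle_ineq2[of y x] by (simp add: dist_norm norm_minus_commute)
        then show "norm (norm ((1 - q ^ n * y) - 1)) \<le> norm q ^ n * (norm x + 1)"
          by (simp add: norm_mult norm_power mult_left_mono)
      next
        show "summable (\<lambda>n. norm q ^ n * (norm x + 1))"
          using assms by (intro summable_mult2 summable_geometric) auto
      qed
    qed (auto intro!: continuous_intros)
    then have "uniform_limit (cball x 1) (\<lambda>n x. \<Prod>j<n. 1 - q ^ j * x)
        (\<lambda>x. lim (\<lambda>n. \<Prod>j<n. 1 - q ^ j * x)) sequentially"
      by (simp add: uniformly_convergent_uniform_limit_iff)
    moreover have "lim (\<lambda>n. \<Prod>j<n. 1 - q ^ j * x) = qpoch_inf x q" for x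
      by (rule limI[OF qpoch_inf_LIMSEQ[OF assms]])
    ultimately show "\<exists>d>0. cball x d \<subseteq> UNIV \<and>
        uniform_limit (cball x d) (\<lambda>n x. \<Prod>j<n. 1 - q ^ j * x) (\<lambda>x. qpoch_inf x q) sequentially"
      by (intro exI[of _ 1]) simp
  qed (auto intro!: holomorphic_intros)
qed simp

definition preA :: "complex \<Rightarrow> complex \<Rightarrow> complex" where
  "preA q x = (if norm q < 1 then qpoch_inf (q * x) q * qpoch_inf (q * inverse x) q
     else 1 / (qpoch_inf x (inverse q) * qpoch_inf (inverse x) (inverse q)))"

text \<open>The products in front of the sum in H, merged with the square of theta. The prefactor of
  the third block is the value at 1 / x.\<close>

definition preB :: "complex \<Rightarrow> complex \<Rightarrow> complex" where
  "preB q x = (if norm q < 1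
     then qpoch_inf (q * x\<^sup>2) q / (qpoch_inf (q * x) q * (qpoch_inf (inverse x) q)\<^sup>2)
     else qpoch_inf x (inverse q) * (qpoch_inf (inverse q * inverse x) (inverse q))\<^sup>2 / qpoch_inf (x\<^sup>2) (inverse q))"

definition uroot :: "complex \<Rightarrow> complex ^ 3" where "uroot x = vector [1, x, inverse x]"

definition pre :: "complex \<Rightarrow> complex \<Rightarrow> complex ^ 3" where
  "pre q x = vector [preA q x, preB q x, preB q (inverse x)]"

lemma uroot_simps [simp]: "uroot x $ 1 = 1" "uroot x $ 2 = x" "uroot x $ 3 = inverse x"
  and pre_simps [simp]: "pre q x $ 1 = preA q x" "pre q x $ 2 = preB q x" "pre q x $ 3 = preB q (inverse x)"
  and blocks_simps [simp]: "blocks q m x $ 1 = block_A q m x" "blocks q m x $ 2 = block_B q m x"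
    "blocks q m x $ 3 = block_C q m x"
  by (simp_all add: uroot_def pre_def blocks_def)

lemma uroot_in: "uroot x $ k \<in> {1, x, inverse x}"
  using exhaust_3[of k] by auto

lemma uroot_nonzero: "x \<noteq> 0 \<Longrightarrow> uroot x $ k \<noteq> 0"
  using exhaust_3[of k] by auto

lemma qpoch_Suc: "qpoch x q (Suc n) = qpoch x q n * (1 - q ^ n * x)"
  by (simp add: qpoch_def)

text \<open>In this form the coefficients can be compared with \<open>ac\<close> factor by
  factor.\<close>

lemma H_coeff_in:
  "q ^ (n * (n + 1)) * Z ^ n / (qpoch q q n * qpoch (q * X) q n * qpoch (q * Y) q n) =
   (\<Prod>k<n. (q ^ Suc k)\<^sup>2 * Z / ((1 - q ^ Suc k) * (1 - q ^ Suc k * X) * (1 - q ^ Suc k * Y)))"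
proof (induction n)
  case (Suc n)
  have "Suc n * (Suc n + 1) = n * (n + 1) + (Suc n + Suc n)" by simp
  then have e: "q ^ (Suc n * (Suc n + 1)) = q ^ (n * (n + 1)) * (q ^ Suc n)\<^sup>2"
    by (simp only: power_add power2_eq_square)
  have "q ^ (Suc n * (Suc n + 1)) * Z ^ Suc n / (qpoch q q (Suc n) * qpoch (q * X) q (Suc n) * qpoch (q * Y) q (Suc n)) =
      (q ^ (n * (n + 1)) * Z ^ n / (qpoch q q n * qpoch (q * X) q n * qpoch (q * Y) q n)) *
      ((q ^ Suc n)\<^sup>2 * Z / ((1 - q ^ Suc n) * (1 - q ^ Suc n * X) * (1 - q ^ Suc n * Y)))"
    unfolding qpoch_Suc times_divide_times_eq e
    by (rule arg_cong2[of _ _ _ _ "(/)"]) (simp_all add: mult_ac)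
  then show ?case unfolding Suc.IH by simp
qed (simp add: qpoch_def)

lemma H_coeff_out:
  "(- 1) ^ n * (p ^ (n * (n + 1) div 2) * X ^ n * Y ^ n * Z ^ n) / (qpoch p p n * qpoch (p * X) p n * qpoch (p * Y) p n) =
   (\<Prod>k<n. - (p ^ Suc k * X * Y * Z) / ((1 - p ^ Suc k) * (1 - p ^ Suc k * X) * (1 - p ^ Suc k * Y)))"
proof (induction n)
  case (Suc n)
  have "Suc n * (Suc n + 1) div 2 = n * (n + 1) div 2 + Suc n"
  proof -
    have "Suc n * (Suc n + 1) = n * (n + 1) + Suc n * 2" by simp
    then show ?thesis by (simp only: div_mult_self3) simp
  qed
  then have e: "p ^ (Suc n * (Suc n + 1) div 2) = p ^ (n * (n + 1) div 2) * p ^ Suc n"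
    by (simp only: power_add)
  have "(- 1) ^ Suc n * (p ^ (Suc n * (Suc n + 1) div 2) * X ^ Suc n * Y ^ Suc n * Z ^ Suc n) /
       (qpoch p p (Suc n) * qpoch (p * X) p (Suc n) * qpoch (p * Y) p (Suc n)) =
      ((- 1) ^ n * (p ^ (n * (n + 1) div 2) * X ^ n * Y ^ n * Z ^ n) / (qpoch p p n * qpoch (p * X) p n * qpoch (p * Y) p n)) *
      (- (p ^ Suc n * X * Y * Z) / ((1 - p ^ Suc n) * (1 - p ^ Suc n * X) * (1 - p ^ Suc n * Y)))"
    unfolding qpoch_Suc times_divide_times_eq e
    by (rule arg_cong2[of _ _ _ _ "(/)"]) (simp_all add: mult_ac)
  then show ?case unfolding Suc.IH by simp
qed (simp add: qpoch_def)

lemma ratio_inverse: "ratio (inverse x) t = ratio x t"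
  by (simp add: ratio_def divide_inverse mult_ac)

lemma phi_inverse: "phi q (inverse x) u = phi q x u"
  by (simp add: fun_eq_iff phi_def ac_def ratio_inverse)

lemma admissible_cases:
  assumes "admissible q"
  obtains "norm q < 1" | "\<not> norm q < 1" "norm (inverse q) < 1" "q \<noteq> 0"
proof (cases "norm q < 1")
  case False
  then have "norm q > 1" "q \<noteq> 0" using assms by (auto simp: admissible_def)
  then show ?thesis using False that(2) by (simp add: norm_inverse inverse_less_1_iff)
qed (rule that(1))

lemma ac_in:
  assumes "x \<noteq> 0"
  shows "q ^ (n * (n + 1)) * M ^ n / (qpoch q q n * qpoch (q * x) q n * qpoch (q * inverse x) q n) = ac q x 1 n * M ^ n"
    "q ^ (n * (n + 1)) * (M * x\<^sup>2) ^ n / (qpoch q q n * qpoch (q * x) q n * qpoch (q * x\<^sup>2) q n) = ac q x x n * M ^ n"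
proof -
  have "(q ^ Suc k)\<^sup>2 * M / ((1 - q ^ Suc k) * (1 - q ^ Suc k * x) * (1 - q ^ Suc k * inverse x)) = ratio x (1 * q ^ Suc k) * M" for k
    by (simp add: ratio_def divide_inverse mult_ac)
  then show "q ^ (n * (n + 1)) * M ^ n / (qpoch q q n * qpoch (q * x) q n * qpoch (q * inverse x) q n) = ac q x 1 n * M ^ n"
    unfolding H_coeff_in by (simp add: prod.distrib ac_def)
  have "(q ^ Suc k)\<^sup>2 * (M * x\<^sup>2) / ((1 - q ^ Suc k) * (1 - q ^ Suc k * x) * (1 - q ^ Suc k * x\<^sup>2)) = ratio x (x * q ^ Suc k) * M" for k
    using assms by (simp add: ratio_def power_mult_distrib power2_eq_square mult_ac)
  then show "q ^ (n * (n + 1)) * (M * x\<^sup>2) ^ n / (qpoch q q n * qpoch (q * x) q n * qpoch (q * x\<^sup>2) q n) = ac q x x n * M ^ n"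
    unfolding H_coeff_in by (simp add: prod.distrib ac_def)
qed

text \<open>The ratio rewritten in 1 / Q. With Q = q^k this is the term ratio of the series for norm
  q > 1, which is expanded in powers of 1 / q; so both regimes share the same coefficients.\<close>

lemma ratio_reflect:
  assumes "x \<noteq> 0" "Q \<noteq> 0"
  shows "ratio x Q = - inverse Q / ((1 - inverse Q) * (1 - inverse Q * inverse x) * (1 - inverse Q * x))"
    "ratio x (x * Q) = - (inverse Q * inverse x) / ((1 - inverse Q) * (1 - inverse Q * inverse x) * (1 - inverse Q * inverse (x\<^sup>2)))"
proof -
  have *: "t\<^sup>2 / (- (t ^ 3) * D) = - inverse t / D" if "t \<noteq> 0" for t D :: complex
    using that by (cases "D = 0") (simp_all add: field_simps power2_eq_square power3_eq_cube)
  have "(1 - Q) * (1 - x * Q) * (1 - Q / x) =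
      - (Q ^ 3) * ((1 - inverse Q) * (1 - inverse Q * inverse x) * (1 - inverse Q * x))"
    using assms by (simp add: field_simps power3_eq_cube)
  then show "ratio x Q = - inverse Q / ((1 - inverse Q) * (1 - inverse Q * inverse x) * (1 - inverse Q * x))"
    unfolding ratio_def by (simp only: *[OF assms(2)])
  have "(1 - x * Q) * (1 - x * (x * Q)) * (1 - x * Q / x) =
      - ((x * Q) ^ 3) * ((1 - inverse Q) * (1 - inverse Q * inverse x) * (1 - inverse Q * inverse (x\<^sup>2)))"
    using assms by (simp add: field_simps power3_eq_cube power2_eq_square)
  then have "ratio x (x * Q) = (x * Q)\<^sup>2 /
      (- ((x * Q) ^ 3) * ((1 - inverse Q) * (1 - inverse Q * inverse x) * (1 - inverse Q * inverse (x\<^sup>2))))"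
    unfolding ratio_def by (simp only:)
  also have "\<dots> = - inverse (x * Q) / ((1 - inverse Q) * (1 - inverse Q * inverse x) * (1 - inverse Q * inverse (x\<^sup>2)))"
    by (rule *) (use assms in simp)
  finally show "ratio x (x * Q) = - (inverse Q * inverse x) / ((1 - inverse Q) * (1 - inverse Q * inverse x) * (1 - inverse Q * inverse (x\<^sup>2)))"
    by (simp only: inverse_mult_distrib mult.commute)
qed

lemma ac_out:
  assumes "x \<noteq> 0" "q \<noteq> 0" "p = inverse q"
  shows "(- 1) ^ n * (p ^ (n * (n + 1) div 2) * inverse x ^ n * inverse (inverse x) ^ n * M ^ n) /
      (qpoch p p n * qpoch (p * inverse x) p n * qpoch (p * inverse (inverse x)) p n) = ac q x 1 n * M ^ n"
    "(- 1) ^ n * (p ^ (n * (n + 1) div 2) * inverse x ^ n * inverse (x\<^sup>2) ^ n * (M * x\<^sup>2) ^ n) /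
      (qpoch p p n * qpoch (p * inverse x) p n * qpoch (p * inverse (x\<^sup>2)) p n) = ac q x x n * M ^ n"
proof -
  have p: "p ^ Suc k = inverse (q ^ Suc k)" for k by (simp only: assms(3) power_inverse)
  have "- (p ^ Suc k * inverse x * inverse (inverse x) * M) / ((1 - p ^ Suc k) * (1 - p ^ Suc k * inverse x) * (1 - p ^ Suc k * inverse (inverse x)))
      = ratio x (1 * q ^ Suc k) * M" for k
    using assms(1,2) unfolding mult_1_left ratio_reflect(1)[OF assms(1) power_not_zero[OF assms(2)]] p by simp
  then show "(- 1) ^ n * (p ^ (n * (n + 1) div 2) * inverse x ^ n * inverse (inverse x) ^ n * M ^ n) /
      (qpoch p p n * qpoch (p * inverse x) p n * qpoch (p * inverse (inverse x)) p n) = ac q x 1 n * M ^ n"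
    unfolding H_coeff_out by (simp add: prod.distrib ac_def)
  have "- (p ^ Suc k * inverse x * inverse (x\<^sup>2) * (M * x\<^sup>2)) / ((1 - p ^ Suc k) * (1 - p ^ Suc k * inverse x) * (1 - p ^ Suc k * inverse (x\<^sup>2)))
      = ratio x (x * q ^ Suc k) * M" for k
    using assms(1,2) unfolding ratio_reflect(2)[OF assms(1) power_not_zero[OF assms(2)]] p by simp
  then show "(- 1) ^ n * (p ^ (n * (n + 1) div 2) * inverse x ^ n * inverse (x\<^sup>2) ^ n * (M * x\<^sup>2) ^ n) /
      (qpoch p p n * qpoch (p * inverse x) p n * qpoch (p * inverse (x\<^sup>2)) p n) = ac q x x n * M ^ n"
    unfolding H_coeff_out by (simp add: prod.distrib ac_def)
qed

text \<open>The two square roots in each argument multiply to q, to 1 or to 1 / q. For norm q > 1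
  this uses that the chosen root of 1 / q is the inverse of the root of q.\<close>

lemma theta_half:
  assumes "admissible q"
  shows "theta (- qhalf q * x) q = (if norm q < 1 then qpoch_inf (q * x) q * qpoch_inf (inverse x) q
      else inverse (qpoch_inf x (inverse q) * qpoch_inf (inverse q * inverse x) (inverse q)))"
    "theta (- inverse (qhalf q) * x) q = (if norm q < 1 then qpoch_inf x q * qpoch_inf (q * inverse x) q
      else inverse (qpoch_inf (inverse q * x) (inverse q) * qpoch_inf (inverse x) (inverse q)))"
proof -
  have sq: "qhalf q * qhalf q = q" if "q \<noteq> 0" for q
  proof -
    have "csqrt z * csqrt z = z" for z using power2_csqrt[of z] by (simp add: power2_eq_square)
    then show ?thesis using that
      by (cases "norm q < 1") (simp_all add: qhalf_def flip: inverse_mult_distrib)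
  qed
  have inv: "qhalf (inverse q) = inverse (qhalf q)" if "\<not> norm q < 1" "norm (inverse q) < 1"
    using that by (simp add: qhalf_def)
  have q0: "q \<noteq> 0" using assms by (simp add: admissible_def)
  have h0: "qhalf q \<noteq> 0" using sq[OF q0] q0 by auto
  have 1: "- qhalf q * (- qhalf q * x) = q * x" "- qhalf q * inverse (- qhalf q * x) = inverse x"
    "- qhalf q * (- inverse (qhalf q) * x) = x" "- qhalf q * inverse (- inverse (qhalf q) * x) = q * inverse x"
    "- inverse (qhalf q) * (- qhalf q * x) = x" "- inverse (qhalf q) * inverse (- qhalf q * x) = inverse q * inverse x"
    "- inverse (qhalf q) * (- inverse (qhalf q) * x) = inverse q * x" "- inverse (qhalf q) * inverse (- inverse (qhalf q) * x) = inverse x" for x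
    using h0 sq[OF q0] by (simp_all add: inverse_mult_distrib flip: mult.assoc) (metis inverse_mult_distrib)+
  show "theta (- qhalf q * x) q = (if norm q < 1 then qpoch_inf (q * x) q * qpoch_inf (inverse x) q
      else inverse (qpoch_inf x (inverse q) * qpoch_inf (inverse q * inverse x) (inverse q)))"
    "theta (- inverse (qhalf q) * x) q = (if norm q < 1 then qpoch_inf x q * qpoch_inf (q * inverse x) q
      else inverse (qpoch_inf (inverse q * x) (inverse q) * qpoch_inf (inverse x) (inverse q)))"
    using assms by (cases rule: admissible_cases; simp only: theta_def Let_def inv 1 if_True if_False)+
qed

lemma theta_inverse: "theta (inverse y) q = theta y q"
  by (simp add: theta_def Let_def mult_ac)

text \<open>theta is invariant under inversion of its argument, and - q^(-1/2) x is the inverse of -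
  q^(1/2) / x. This halves the work: the third block needs no series of its own.\<close>

lemma block_C_eq: "block_C q m x = block_B q m (inverse x)"
proof -
  have "- inverse (qhalf q) * x = inverse (- qhalf q * inverse x)" by simp
  then have t: "theta (- inverse (qhalf q) * x) q = theta (- qhalf q * inverse x) q"
    by (simp only: theta_inverse)
  show ?thesis
    unfolding block_C_def block_B_def t by (simp add: power_int_minus power_int_inverse power_inverse)
qed

lemma power_int_m2: "y powi (- 2) = inverse (y\<^sup>2)" for y :: complex
  by (simp add: power_int_minus power_int_numeral)

lemma block_series:
  assumes "admissible q" "generic q x"
  shows "block_A q m x = preA q x * phi q x 1 (q powi m)"
    "block_B q m x = preB q x * x powi m * phi q x x (q powi m)"
proof -
  have x: "x \<noteq> 0" using generic_powi[OF assms(2)] by blast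
  show "block_A q m x = preA q x * phi q x 1 (q powi m)"
    using assms(1)
  proof (cases rule: admissible_cases)
    case 1
    then show ?thesis by (simp only: block_A_def H52_def preA_def phi_def ac_in[OF x] if_True)
  next
    case 2
    then show ?thesis
      by (simp only: block_A_def H52_def preA_def phi_def ac_out[OF x 2(3) refl] Let_def if_False)
  qed
  show "block_B q m x = preB q x * x powi m * phi q x x (q powi m)"
    using assms(1)
  proof (cases rule: admissible_cases)
    case 1
    have nz: "qpoch_inf (q * x) q \<noteq> 0" "qpoch_inf (inverse x) q \<noteq> 0"
      using generic_qpoch[OF assms(2) 1] by blast+
    have "block_B q m x = inverse ((qpoch_inf (q * x) q * qpoch_inf (inverse x) q)\<^sup>2) * x powi m *
        (qpoch_inf (q * x) q * qpoch_inf (q * x\<^sup>2) q * phi q x x (q powi m))"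
      unfolding block_B_def theta_half[OF assms(1)] power_int_m2 using 1
      by (simp only: H52_def phi_def ac_in[OF x] if_True)
    also have "\<dots> = preB q x * x powi m * phi q x x (q powi m)"
    proof -
      have "inverse ((a * b)\<^sup>2) * X * (a * c * h) = c / (a * b\<^sup>2) * X * h"
        if "a \<noteq> 0" "b \<noteq> 0" for a b c X h :: complex
        using that by (simp add: field_simps power2_eq_square)
      then show ?thesis using 1 nz by (simp only: preB_def if_True simp_thms)
    qed
    finally show ?thesis .
  next
    case 2
    define p where "p = inverse q"
    have nz: "qpoch_inf x p \<noteq> 0"
      using generic_qpoch[OF generic_inverse(2)[OF assms(2)] 2(2)] by (simp add: p_def)
    have "block_B q m x = (qpoch_inf x p * qpoch_inf (p * inverse x) p)\<^sup>2 * x powi m *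
        (1 / (qpoch_inf x p * qpoch_inf (x\<^sup>2) p) * phi q x x (q powi m))"
      unfolding block_B_def theta_half[OF assms(1)] power_int_m2 using 2
      by (simp only: H52_def phi_def ac_out[OF x 2(3) refl] Let_def p_def if_False)
        (simp only: power_inverse inverse_inverse_eq)
    also have "\<dots> = preB q x * x powi m * phi q x x (q powi m)"
    proof -
      have "(a * b)\<^sup>2 * X * (1 / (a * c) * h) = a * b\<^sup>2 / c * X * h"
        if "a \<noteq> 0" for a b c X h :: complex
        using that by (simp add: field_simps power2_eq_square)
      then show ?thesis using 2 nz by (simp only: preB_def if_False p_def simp_thms)
    qed
    finally show ?thesis .
  qed
qed

lemma blocks_series:
  assumes "admissible q" "generic q x"
  shows "blocks q m x $ k = pre q x $ k * (uroot x $ k) powi m * phi q x (uroot x $ k) (q powi m)"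
  using exhaust_3[of k] block_series[OF assms] block_series(2)[OF assms(1) generic_inverse(1)[OF assms(2)]]
  by (auto simp: block_C_eq phi_inverse)

lemma pre_nonzero:
  assumes "admissible q" "generic q x"
  shows "pre q x $ k \<noteq> 0"
proof -
  have A: "preA q x \<noteq> 0" "preB q x \<noteq> 0" if g: "generic q x" for x
  proof -
    have "preA q x \<noteq> 0 \<and> preB q x \<noteq> 0"
      using assms(1)
    proof (cases rule: admissible_cases)
      case 1
      have nz: "qpoch_inf (q * x) q \<noteq> 0" "qpoch_inf (inverse x) q \<noteq> 0" "qpoch_inf (q * x\<^sup>2) q \<noteq> 0"
          "qpoch_inf (q * inverse x) q \<noteq> 0"
        using generic_qpoch[OF g 1] by blast+
      then show ?thesis using 1 by (simp add: preA_def preB_def)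
    next
      case 2
      define p where "p = inverse q"
      have nz: "qpoch_inf x p \<noteq> 0" "qpoch_inf (inverse x) p \<noteq> 0" "qpoch_inf (x\<^sup>2) p \<noteq> 0"
          "qpoch_inf (p * inverse x) p \<noteq> 0"
        using generic_qpoch[OF generic_inverse(2)[OF g] 2(2)] by (simp_all add: p_def)
      then show ?thesis using 2 by (simp add: preA_def preB_def p_def)
    qed
    then show "preA q x \<noteq> 0" "preB q x \<noteq> 0" by auto
  qed
  show ?thesis
    using exhaust_3[of k] A[OF assms(2)] A[OF generic_inverse(1)[OF assms(2)]] by auto
qed

section \<open>The equations for the blocks\<close>

definition bser :: "complex \<Rightarrow> int \<Rightarrow> complex \<Rightarrow> 3 \<Rightarrow> nat \<Rightarrow> complex" where
  "bser q m x k n = pre q x $ k * (uroot x $ k) powi m * (ac q x (uroot x $ k) n * (q powi m) ^ n)"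

text \<open>Shifting m by j multiplies the n-th term by t^j with t = u q^n. Hence polynomials in S_m
  act on the series termwise as polynomials in t.\<close>

lemma block_sums:
  assumes "admissible q" "generic q x"
  shows "(\<lambda>n. (uroot x $ k * q ^ n) ^ j * bser q m x k n) sums (blocks q (m + int j) x $ k)"
proof -
  have x: "x \<noteq> 0" using generic_powi[OF assms(2)] by blast
  have q: "q \<noteq> 0" using assms by (simp add: admissible_def)
  define u where "u = uroot x $ k"
  have u: "u \<noteq> 0" using uroot_nonzero[OF x] by (simp add: u_def)
  have e: "blocks q (m + int j) x $ k = pre q x $ k * u powi m * (u ^ j * phi q x u (q ^ j * q powi m))"
    using q u by (simp add: blocks_series[OF assms] u_def power_int_add mult_ac)
  show ?thesis
    unfolding e bser_def u_def[symmetric]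
    using sums_mult[OF phi_sums_q[OF assms(1) x u], of "pre q x $ k * u powi m" j "q powi m"]
    by (simp only: mult_ac)
qed

lemma bser_Suc:
  assumes "admissible q" "generic q x" "t = uroot x $ k * q ^ Suc n"
  shows "(1 - t) * (1 - x * t) * (1 - t / x) * bser q m x k (Suc n) = t\<^sup>2 * (q powi m * bser q m x k n)"
proof -
  have alg: "D * (w * (a' * (M * Mn))) = T * (M * (w * (a * Mn)))" if "D * a' = T * a" for D w a' M Mn T a :: complex
  proof -
    have "D * (w * (a' * (M * Mn))) = D * a' * (w * M * Mn)" by (simp only: mult_ac)
    then show ?thesis unfolding that by (simp only: mult_ac)
  qed
  show ?thesis
    unfolding assms(3) bser_def power_Suc[of "q powi m"]
    by (rule alg) (rule ac_recurrence[OF nonres_generic[OF assms(2,1) uroot_in]])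
qed

lemma uroot_poly:
  assumes "x \<noteq> 0" "t = uroot x $ k"
  shows "(1 - t) * (1 - x * t) * (1 - t / x) = 0"
  using assms exhaust_3[of k] by auto

text \<open>The factor (1 - t) (1 - x t) (1 - t / x) kills the term n = 0, where t = u is one of its
  roots, and turns the term n + 1 into q^2 M t^2 times the term n. Summation shifts the index
  without a boundary term.\<close>

lemma block_recurrence:
  assumes "admissible q" "generic q x"
  shows "blocks q (m + 3) x $ k = blocks q m x $ k - (1 + x + inverse x) * blocks q (m + 1) x $ k
    + (1 + x + inverse x - q\<^sup>2 * q powi m) * blocks q (m + 2) x $ k"
proof -
  have x: "x \<noteq> 0" using generic_powi[OF assms(2)] by blast
  define t where "t n = uroot x $ k * q ^ n" for n
  define s where "s = 1 + x + inverse x"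
  define b where "b = bser q m x k"
  have S: "(\<lambda>n. t n ^ j * b n) sums (blocks q (m + int j) x $ k)" for j
    unfolding t_def b_def by (rule block_sums[OF assms])
  have S0: "b sums (blocks q m x $ k)" using S[of 0] by simp
  have S1: "(\<lambda>n. t n * b n) sums (blocks q (m + 1) x $ k)" using S[of 1] by simp
  have S2: "(\<lambda>n. t n ^ 2 * b n) sums (blocks q (m + 2) x $ k)" using S[of 2] by simp
  have S3: "(\<lambda>n. t n ^ 3 * b n) sums (blocks q (m + 3) x $ k)" using S[of 3] by simp
  have L: "(\<lambda>n. b n - s * (t n * b n) + s * (t n ^ 2 * b n) - t n ^ 3 * b n) sums
      (blocks q m x $ k - s * (blocks q (m + 1) x $ k) + s * (blocks q (m + 2) x $ k) - blocks q (m + 3) x $ k)"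
    by (intro sums_add sums_diff sums_mult S0 S1 S2 S3)
  have D: "b n - s * (t n * b n) + s * (t n ^ 2 * b n) - t n ^ 3 * b n = (1 - t n) * (1 - x * t n) * (1 - t n / x) * b n" for n
    using x by (simp add: s_def field_simps power2_eq_square power3_eq_cube)
  have D0: "b 0 - s * (t 0 * b 0) + s * (t 0 ^ 2 * b 0) - t 0 ^ 3 * b 0 = 0"
    unfolding D using uroot_poly[OF x, of "t 0" k] by (simp add: t_def)
  have DS: "b (Suc n) - s * (t (Suc n) * b (Suc n)) + s * (t (Suc n) ^ 2 * b (Suc n)) - t (Suc n) ^ 3 * b (Suc n) =
      q\<^sup>2 * q powi m * (t n ^ 2 * b n)" for n
  proof -
    have "t (Suc n) ^ 2 = q\<^sup>2 * t n ^ 2" by (simp add: t_def power_mult_distrib mult_ac)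
    then show ?thesis
      unfolding D using bser_Suc[OF assms, of "t (Suc n)" k n m, folded b_def] by (simp only: t_def) (simp only: mult_ac)
  qed
  have "(\<lambda>n. q\<^sup>2 * q powi m * (t n ^ 2 * b n)) sums
      (blocks q m x $ k - s * (blocks q (m + 1) x $ k) + s * (blocks q (m + 2) x $ k) - blocks q (m + 3) x $ k)"
    using L unfolding DS[symmetric] by (subst sums_Suc_iff) (simp add: D0)
  then have "blocks q m x $ k - s * (blocks q (m + 1) x $ k) + s * (blocks q (m + 2) x $ k) - blocks q (m + 3) x $ k =
      q\<^sup>2 * q powi m * (blocks q (m + 2) x $ k)"
    using sums_mult[OF S2] by (rule sums_unique2)
  then show ?thesis by (simp add: s_def algebra_simps)
qed

section \<open>The shift of x on the series\<close>

definition wq :: "complex \<Rightarrow> complex \<Rightarrow> complex \<Rightarrow> complex" where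
  "wq q x t = (1 - t / (q * x)) * (1 - t) * (1 - t / x) / t\<^sup>2"

text \<open>The functional equation that defines \<open>wq\<close>: it says that the weighted
  coefficients at x have the term ratio of the coefficients at q x. So q^m times a block at q x is
  the series at x with its terms weighted by \<open>wq\<close>.\<close>

lemma ratio_wq:
  assumes "q \<noteq> 0" "x \<noteq> 0" "T \<noteq> 0" "1 - T \<noteq> 0" "1 - T / (q * x) \<noteq> 0" "1 - q * T \<noteq> 0" "1 - q * T / x \<noteq> 0"
  shows "ratio (q * x) T * wq q x T = ratio x (q * T) * wq q x (q * T)"
proof -
  have "ratio (q * x) T * wq q x T = (1 - T / x) / (1 - q * x * T)"
    using assms unfolding ratio_def wq_def by (simp add: divide_simps)
  moreover have "ratio x (q * T) * wq q x (q * T) = (1 - T / x) / (1 - q * x * T)"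
    using assms unfolding ratio_def wq_def by (simp add: divide_simps mult_ac)
  ultimately show ?thesis by simp
qed

lemma qpoch_inf_step':
  "norm q < 1 \<Longrightarrow> y = q * z \<Longrightarrow> qpoch_inf z q = (1 - z) * qpoch_inf y q"
  using qpoch_inf_step[of q z] by simp

lemma preA_shift:
  assumes "admissible q" "generic q x"
  shows "preA q (q * x) * (1 - q * x) = preA q x * (1 - inverse x)"
proof -
  have x: "x \<noteq> 0" using generic_powi[OF assms(2)] by blast
  show ?thesis
    using assms(1)
  proof (cases rule: admissible_cases)
    case 1
    have "q \<noteq> 0" using assms by (simp add: admissible_def)
    then have "q * inverse (q * x) = inverse x" using x by simp
    then show ?thesis
      unfolding preA_def if_P[OF 1] qpoch_inf_step[OF 1, of "q * x"] qpoch_inf_step[OF 1, of "inverse x"]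
      by (simp only: qpoch_inf_step[OF 1, of "inverse x"] mult_ac)
  next
    case 2
    define p where "p = inverse q"
    have pp: "norm p < 1" and pq: "p * q = 1" using 2 by (simp_all add: p_def)
    have p: "inverse (q * x) = p * inverse x" by (simp add: p_def)
    have st: "qpoch_inf (q * x) p = (1 - q * x) * qpoch_inf x p"
      "qpoch_inf (inverse x) p = (1 - inverse x) * qpoch_inf (p * inverse x) p"
      by (rule qpoch_inf_step'[OF pp]; simp add: pq flip: mult.assoc)+
    have nz: "1 - q * x \<noteq> 0" "1 - inverse x \<noteq> 0"
      using generic_power[OF assms(2), of 1] generic_power[OF assms(2), of 0] x by (auto simp: mult.commute)
    have "preA q (q * x) = 1 / ((1 - q * x) * qpoch_inf x p * qpoch_inf (p * inverse x) p)"
      unfolding preA_def if_not_P[OF 2(1)] p_def[symmetric] st(1) p ..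
    moreover have "preA q x = 1 / (qpoch_inf x p * ((1 - inverse x) * qpoch_inf (p * inverse x) p))"
      unfolding preA_def if_not_P[OF 2(1)] p_def[symmetric] st(2) ..
    ultimately show ?thesis using nz by simp
  qed
qed

text \<open>Each infinite product changes by finitely many factors, and the product in q x^2 by two,
  since x^2 is multiplied by q^2.\<close>

lemma preB_shift:
  assumes "admissible q" "generic q x"
  shows "preB q (q * x) * ((1 - q * x\<^sup>2) * (1 - q\<^sup>2 * x\<^sup>2) * (1 - inverse (q * x))\<^sup>2) = preB q x * (1 - q * x)"
proof -
  have x: "x \<noteq> 0" using generic_powi[OF assms(2)] by blast
  have nz: "1 - q * x \<noteq> 0" "1 - inverse (q * x) \<noteq> 0" "1 - q * x\<^sup>2 \<noteq> 0" "1 - q\<^sup>2 * x\<^sup>2 \<noteq> 0"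
    using generic_power[OF assms(2), of 1] generic_power[OF assms(2), of 2]
    by (auto simp del: inverse_mult_distrib simp: inverse_eq_1_iff mult.commute)
  show ?thesis
    using assms(1)
  proof (cases rule: admissible_cases)
    case 1
    have q: "q \<noteq> 0" using assms by (simp add: admissible_def)
    have "qpoch_inf (q\<^sup>2 * x\<^sup>2) q = (1 - q\<^sup>2 * x\<^sup>2) * qpoch_inf (q * (q * x)\<^sup>2) q"
      "qpoch_inf (q * x\<^sup>2) q = (1 - q * x\<^sup>2) * qpoch_inf (q\<^sup>2 * x\<^sup>2) q"
      by (rule qpoch_inf_step'[OF 1]; simp add: power2_eq_square)+
    then have st: "qpoch_inf (q * x) q = (1 - q * x) * qpoch_inf (q * (q * x)) q"
      "qpoch_inf (inverse (q * x)) q = (1 - inverse (q * x)) * qpoch_inf (inverse x) q"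
      "qpoch_inf (q * x\<^sup>2) q = (1 - q * x\<^sup>2) * ((1 - q\<^sup>2 * x\<^sup>2) * qpoch_inf (q * (q * x)\<^sup>2) q)"
      using q by (auto intro!: qpoch_inf_step'[OF 1])
    have iv: "q * inverse (q * x) = inverse x" using q by simp
    have nz2: "qpoch_inf (inverse x) q \<noteq> 0" "qpoch_inf (q * (q * x)) q \<noteq> 0"
      using generic_qpoch[OF assms(2) 1] generic_qpoch[OF generic_shift[OF assms(2) q, of 1] 1] by simp_all
    have alg: "G / (B * (d * E)\<^sup>2) * (f * g * d\<^sup>2) = f * (g * G) / (a * B * E\<^sup>2) * a"
      if "a \<noteq> 0" "d \<noteq> 0" for a d f g B E G :: complex
      using that by (simp add: field_simps power2_eq_square)
    show ?thesis
      unfolding preB_def if_P[OF 1] st using nz by (intro alg)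
  next
    case 2
    define p where "p = inverse q"
    have pp: "norm p < 1" and pq: "p * q = 1" using 2 by (simp_all add: p_def)
    have iq: "inverse (q * x) = p * inverse x" by (simp add: p_def)
    have "p * (q * x\<^sup>2) = x\<^sup>2" "p * (q * x)\<^sup>2 = (p * q) * (q * x\<^sup>2)"
      using pq by (simp_all add: power2_eq_square flip: mult.assoc)
    then have p: "p * (q * x\<^sup>2) = x\<^sup>2" "p * (q * x)\<^sup>2 = q * x\<^sup>2" using pq by simp_all
    have "qpoch_inf (q * x\<^sup>2) p = (1 - q * x\<^sup>2) * qpoch_inf (x\<^sup>2) p"
      "qpoch_inf ((q * x)\<^sup>2) p = (1 - (q * x)\<^sup>2) * qpoch_inf (q * x\<^sup>2) p"
      by (rule qpoch_inf_step'[OF pp]; simp only: p)+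
    then have st: "qpoch_inf (q * x) p = (1 - q * x) * qpoch_inf x p"
      "qpoch_inf (p * inverse x) p = (1 - inverse (q * x)) * qpoch_inf (p * inverse (q * x)) p"
      "qpoch_inf ((q * x)\<^sup>2) p = (1 - q\<^sup>2 * x\<^sup>2) * ((1 - q * x\<^sup>2) * qpoch_inf (x\<^sup>2) p)"
      using qpoch_inf_step'[OF pp, of x "q * x"] qpoch_inf_step[OF pp, of "p * inverse x"] pq
      by (simp_all only: iq power_mult_distrib mult.assoc[symmetric] mult_1_left)
    have alg: "a * B * E\<^sup>2 / (g * (f * G)) * (f * g * d\<^sup>2) = B * (d * E)\<^sup>2 / G * a"
      if "f \<noteq> 0" "g \<noteq> 0" for a d f g B E G :: complex
      using that by (simp add: field_simps power2_eq_square)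
    show ?thesis
      unfolding preB_def if_not_P[OF 2(1)] p_def[symmetric] st using nz by (intro alg)
  qed
qed

lemma ac_shift_step:
  assumes "c * ac q (q * x) u' 0 = ac q x u d * wq q x (u * q ^ d)"
    "\<And>n. u' * q ^ Suc n = u * q ^ (d + n)"
    "\<And>n. ratio (q * x) (u * q ^ (d + n)) * wq q x (u * q ^ (d + n)) = ratio x (u * q ^ Suc (d + n)) * wq q x (u * q ^ Suc (d + n))"
  shows "c * ac q (q * x) u' n = ac q x u (d + n) * wq q x (u * q ^ (d + n))"
proof (induction n)
  case (Suc n)
  have "c * ac q (q * x) u' (Suc n) = (ac q x u (d + n) * wq q x (u * q ^ (d + n))) * ratio (q * x) (u * q ^ (d + n))"
    unfolding ac_Suc assms(2) Suc.IH[symmetric] by simp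
  also have "\<dots> = ac q x u (d + n) * (ratio (q * x) (u * q ^ (d + n)) * wq q x (u * q ^ (d + n)))"
    by (simp only: mult_ac)
  also have "\<dots> = ac q x u (d + Suc n) * wq q x (u * q ^ (d + Suc n))"
    unfolding assms(3) by (simp only: add_Suc_right ac_Suc mult_ac)
  finally show ?case .
qed (use assms(1) in simp)

text \<open>Term n at q x corresponds to term n + d at x. The weight vanishes at the d skipped
  terms, so the sum at x may start at 0. It remains to match the first terms, which is the condition
  on \<open>c\<close>, the quotient of the prefactors.\<close>

lemma shift_series:
  assumes "admissible q" "generic q x"
    and "pre q (q * x) $ k = c * pre q x $ k" "uroot (q * x) $ k * q = uroot x $ k * q ^ d"
    and "\<And>i. i < d \<Longrightarrow> wq q x (uroot x $ k * q ^ i) = 0"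
    and "c = ac q x (uroot x $ k) d * wq q x (uroot x $ k * q ^ d)"
    and "\<And>n T. T = uroot x $ k * q ^ (d + n) \<Longrightarrow>
      1 - T \<noteq> 0 \<and> 1 - T / (q * x) \<noteq> 0 \<and> 1 - q * T \<noteq> 0 \<and> 1 - q * T / x \<noteq> 0"
  shows "(\<lambda>n. wq q x (uroot x $ k * q ^ n) * bser q m x k n) sums (q powi m * blocks q m (q * x) $ k)"
proof -
  have x: "x \<noteq> 0" using generic_powi[OF assms(2)] by blast
  have q: "q \<noteq> 0" using assms(1) by (simp add: admissible_def)
  define u u' M where "u = uroot x $ k" and "u' = uroot (q * x) $ k" and "M = q powi m"
  have u: "u \<noteq> 0" "u' \<noteq> 0" using uroot_nonzero x q by (simp_all add: u_def u'_def)
  have uu: "u' * q = u * q ^ d" using assms(4) by (simp add: u_def u'_def)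
  have step: "c * ac q (q * x) u' n = ac q x u (d + n) * wq q x (u * q ^ (d + n))" for n
  proof (rule ac_shift_step)
    show "c * ac q (q * x) u' 0 = ac q x u d * wq q x (u * q ^ d)" using assms(6) by (simp add: u_def)
    show "u' * q ^ Suc n = u * q ^ (d + n)" for n
      using uu by (simp add: power_add flip: mult.assoc)
    show "ratio (q * x) (u * q ^ (d + n)) * wq q x (u * q ^ (d + n)) = ratio x (u * q ^ Suc (d + n)) * wq q x (u * q ^ Suc (d + n))" for n
    proof -
      have e: "u * q ^ Suc (d + n) = q * (u * q ^ (d + n))" by (simp add: mult_ac)
      show ?thesis unfolding e
        using assms(7)[OF refl, of n] u q x by (intro ratio_wq) (simp_all add: u_def)
    qed
  qed
  \<comment> \<open>This is why the block at q x is multiplied by q^m: the factor supplies the power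
    M^d that the offset requires.\<close>
  have Mp: "M * (u' powi m) = u powi m * M ^ d"
  proof -
    have "(u' * q) powi m = (u * q ^ d) powi m" by (simp only: uu)
    then show ?thesis
      by (simp add: M_def power_int_mult_distrib power_int_power' mult.commute power_int_power)
  qed
  have "(\<lambda>n. M * (pre q (q * x) $ k * u' powi m) * (ac q (q * x) u' n * M ^ n)) sums
      (M * (pre q (q * x) $ k * u' powi m) * phi q (q * x) u' M)"
    by (intro sums_mult phi_sums assms(1)) (use x q u in auto)
  moreover have "M * (pre q (q * x) $ k * u' powi m) * phi q (q * x) u' M = M * blocks q m (q * x) $ k"
    using blocks_series[OF assms(1), of "q * x" m k] generic_shift[OF assms(2) q, of 1] by (simp add: u'_def M_def)
  moreover have "M * (pre q (q * x) $ k * u' powi m) * (ac q (q * x) u' n * M ^ n) =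
      wq q x (u * q ^ (n + d)) * bser q m x k (n + d)" for n
  proof -
    have "M * (pre q (q * x) $ k * u' powi m) * (ac q (q * x) u' n * M ^ n) =
        pre q x $ k * (M * u' powi m) * (c * ac q (q * x) u' n) * M ^ n"
      unfolding assms(3) by (simp only: mult_ac)
    also have "\<dots> = wq q x (u * q ^ (n + d)) * bser q m x k (n + d)"
      unfolding step Mp bser_def u_def[symmetric] M_def[symmetric] power_add[of M] by (simp only: mult_ac add.commute)
    finally show ?thesis .
  qed
  ultimately have "(\<lambda>n. wq q x (u * q ^ (n + d)) * bser q m x k (n + d)) sums (M * blocks q m (q * x) $ k)"
    by simp
  then show ?thesis
    using assms(5) unfolding u_def M_def by (subst (asm) sums_zero_iff_shift) simp_all
qed

text \<open>The roots 1, x, 1 / x become 1, q x, 1 / (q x), which gives the offsets 1, 2, 0. For the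
  first two, the zeros of the weight at 1 and at x, q x are the skipped terms.\<close>

lemma block_shift_sums:
  assumes "admissible q" "generic q x"
  shows "(\<lambda>n. wq q x (uroot x $ k * q ^ n) * bser q m x k n) sums (q powi m * blocks q m (q * x) $ k)"
proof -
  have x: "x \<noteq> 0" using generic_powi[OF assms(2)] by blast
  have q: "q \<noteq> 0" using assms(1) by (simp add: admissible_def)
  have g: "x\<^sup>2 \<noteq> q ^ n" "x \<noteq> q ^ n" "x * q ^ n \<noteq> 1" "x\<^sup>2 * q ^ n \<noteq> 1" for n
    using generic_power[OF assms(2)] by blast+
  have q1: "q ^ n \<noteq> 1" if "n > 0" for n by (rule admissible_power[OF assms(1) that])
  have q1': "q \<noteq> 1" using q1[of 1] by simp
  have nzq: "1 - x * q \<noteq> 0" "1 - q \<noteq> 0" "1 - q / x \<noteq> 0" "1 - x \<noteq> 0" "1 - 1 / x \<noteq> 0"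
    using g(3)[of 1] q1' g(2)[of 1] g(2)[of 0] x by auto
  consider "k = 1" | "k = 2" | "k = 3" using exhaust_3[of k] by blast
  then show ?thesis
  proof cases
    case 1
    show ?thesis
    proof (rule shift_series[OF assms, where d = 1 and c = "(1 - 1 / x) / (1 - x * q)"])
      show "pre q (q * x) $ k = (1 - 1 / x) / (1 - x * q) * pre q x $ k"
        using preA_shift[OF assms] nzq unfolding 1 by (simp add: field_simps)
      show "wq q x (uroot x $ k * q ^ i) = 0" if "i < 1" for i
        using that 1 by (simp add: wq_def)
      have "(1 - 1 / x) / (1 - x * q) = q\<^sup>2 / ((1 - q) * (1 - x * q) * (1 - q / x)) * ((1 - q / (q * x)) * (1 - q) * (1 - q / x) / q\<^sup>2)"
      proof -
        have "a / b = Q / (c * b * d) * (a * c * d / Q)" if "Q \<noteq> 0" "b \<noteq> 0" "c \<noteq> 0" "d \<noteq> 0" for a b c d Q :: complex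
          using that by (simp add: field_simps)
        from this[of "q\<^sup>2" "1 - x * q" "1 - q" "1 - q / x" "1 - 1 / x"] show ?thesis using nzq q by simp
      qed
      then show "(1 - 1 / x) / (1 - x * q) = ac q x (uroot x $ k) 1 * wq q x (uroot x $ k * q ^ 1)"
        using 1 by (simp add: ac_def ratio_def wq_def)
      show "1 - T \<noteq> 0 \<and> 1 - T / (q * x) \<noteq> 0 \<and> 1 - q * T \<noteq> 0 \<and> 1 - q * T / x \<noteq> 0"
        if "T = uroot x $ k * q ^ (1 + n)" for n T
        using that 1 x q q1[of "Suc n"] q1[of "Suc (Suc n)"] g(2)[of n] g(2)[of "Suc (Suc n)"] by auto
    qed (use 1 in simp)
  next
    case 2
    show ?thesis
    proof (rule shift_series[OF assms, where d = 2 and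
          c = "(1 - q * x) / ((1 - q * x\<^sup>2) * (1 - q\<^sup>2 * x\<^sup>2) * (1 - inverse (q * x))\<^sup>2)"])
      have nz: "1 - q * x\<^sup>2 \<noteq> 0" "1 - q\<^sup>2 * x\<^sup>2 \<noteq> 0" "1 - inverse (q * x) \<noteq> 0"
        using g(4)[of 1] g(4)[of 2] g(3)[of 1]
        by (auto simp del: inverse_mult_distrib simp: inverse_eq_1_iff mult.commute)
      have "a * b = c * d \<Longrightarrow> b \<noteq> 0 \<Longrightarrow> a = d / b * c" for a b c d :: complex
        by (simp add: field_simps)
      from this[OF preB_shift[OF assms]] nz
      show "pre q (q * x) $ k = (1 - q * x) / ((1 - q * x\<^sup>2) * (1 - q\<^sup>2 * x\<^sup>2) * (1 - inverse (q * x))\<^sup>2) * pre q x $ k"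
        unfolding 2 by simp
      show "wq q x (uroot x $ k * q ^ i) = 0" if "i < 2" for i
        using that 2 x q by (cases i) (auto simp: wq_def)
      have q2: "1 - q\<^sup>2 \<noteq> 0" using q1[of 2] by simp
      have "(1 - q * x) / ((1 - q * x\<^sup>2) * (1 - q\<^sup>2 * x\<^sup>2) * (1 - inverse (q * x))\<^sup>2) =
         (q * x)\<^sup>2 / ((1 - q * x) * (1 - q * x\<^sup>2) * (1 - q)) *
         ((q\<^sup>2 * x)\<^sup>2 / ((1 - q\<^sup>2 * x) * (1 - q\<^sup>2 * x\<^sup>2) * (1 - q\<^sup>2))) *
         ((1 - q) * (1 - q\<^sup>2 * x) * (1 - q\<^sup>2) / (q\<^sup>2 * x)\<^sup>2)"
      proof -
        have "a / (e * f * (1 - inverse y)\<^sup>2) = y\<^sup>2 / (a * e * c) * (T / (b * f * d)) * (c * b * d / T)"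
          if "T \<noteq> 0" "b \<noteq> 0" "c \<noteq> 0" "d \<noteq> 0" "e \<noteq> 0" "f \<noteq> 0" "a \<noteq> 0" "y \<noteq> 0" "a = 1 - y" for a b c d e f T y :: complex
        proof -
          have "1 - inverse y = - (a / y)" unfolding that(9) using that(8) by (simp add: field_simps)
          then have "(1 - inverse y)\<^sup>2 = a\<^sup>2 / y\<^sup>2" by (simp add: power_divide)
          then show ?thesis using that(1-8) by (simp add: field_simps power2_eq_square)
        qed
        then show ?thesis by this (use nz nzq q x q2 g(3)[of 2] in \<open>simp_all add: mult.commute\<close>)
      qed
      then show "(1 - q * x) / ((1 - q * x\<^sup>2) * (1 - q\<^sup>2 * x\<^sup>2) * (1 - inverse (q * x))\<^sup>2) =
          ac q x (uroot x $ k) 2 * wq q x (uroot x $ k * q ^ 2)"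
        using 2 x q by (simp add: ac_def ratio_def wq_def numeral_2_eq_2 power2_eq_square mult_ac)
      show "1 - T \<noteq> 0 \<and> 1 - T / (q * x) \<noteq> 0 \<and> 1 - q * T \<noteq> 0 \<and> 1 - q * T / x \<noteq> 0"
        if "T = uroot x $ k * q ^ (2 + n)" for n T
      proof -
        have e: "T = x * q ^ Suc (Suc n)" "T / (q * x) = q ^ Suc n" "q * T = x * q ^ Suc (Suc (Suc n))"
          "q * T / x = q ^ Suc (Suc (Suc n))"
          using that 2 x q by simp_all
        have "T \<noteq> 1" using e(1) g(3)[of "Suc (Suc n)"] by (simp del: power_Suc)
        moreover have "T / (q * x) \<noteq> 1" unfolding e(2) by (rule q1) simp
        moreover have "q * T \<noteq> 1" unfolding e(3) by (rule g(3))
        moreover have "q * T / x \<noteq> 1" unfolding e(4) by (rule q1) simp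
        ultimately show ?thesis by simp
      qed
    qed (use 2 in \<open>simp add: power2_eq_square\<close>)
  next
    case 3
    show ?thesis
    proof (rule shift_series[OF assms, where d = 0 and
          c = "(1 - inverse x / (q * x)) * (1 - inverse x) * (1 - inverse x / x) / (inverse x)\<^sup>2"])
      \<comment> \<open>The shift moves 1 / x to 1 / (q x). \<open>preB_shift\<close> therefore is
        applied at 1 / (q x), whose shift is 1 / x, and read backwards.\<close>
      have g': "generic q (inverse (q * x))"
        using generic_inverse(1)[OF generic_shift[OF assms(2) q, of 1]] by simp
      have iv: "q * inverse (q * x) = inverse x" using q by simp
      have sh: "preB q (inverse x) * ((1 - q * (inverse (q * x))\<^sup>2) * (1 - q\<^sup>2 * (inverse (q * x))\<^sup>2) * (1 - x)\<^sup>2) =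
          preB q (inverse (q * x)) * (1 - inverse x)"
        using preB_shift[OF assms(1) g'] unfolding iv inverse_inverse_eq .
      have e: "(1 - q * (inverse (q * x))\<^sup>2) = 1 - inverse x / (q * x)" "1 - q\<^sup>2 * (inverse (q * x))\<^sup>2 = 1 - inverse x / x"
        using q x by (simp_all add: field_simps power2_eq_square)
      have "(1 - x)\<^sup>2 = (1 - inverse x) * ((1 - inverse x) / (inverse x)\<^sup>2)"
        using x by (simp add: field_simps power2_eq_square)
      moreover have "1 - inverse x \<noteq> 0" using nzq by (simp add: divide_inverse)
      moreover have "B2 = a * d * b / i * B1" if "B1 * (a * b * (d * (d / i))) = B2 * d" "d \<noteq> 0" for B1 B2 a b d i :: complex
      proof -
        have "(a * d * b / i * B1) * d = B2 * d" unfolding that(1)[symmetric] by (simp add: mult_ac)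
        then show ?thesis unfolding mult_right_cancel[OF that(2)] by (rule sym)
      qed
      ultimately show "pre q (q * x) $ k = (1 - inverse x / (q * x)) * (1 - inverse x) * (1 - inverse x / x) / (inverse x)\<^sup>2 * pre q x $ k"
        using sh unfolding e 3 pre_simps by presburger
      show "(1 - inverse x / (q * x)) * (1 - inverse x) * (1 - inverse x / x) / (inverse x)\<^sup>2 =
          ac q x (uroot x $ k) 0 * wq q x (uroot x $ k * q ^ 0)"
        using 3 by (simp add: wq_def)
      show "1 - T \<noteq> 0 \<and> 1 - T / (q * x) \<noteq> 0 \<and> 1 - q * T \<noteq> 0 \<and> 1 - q * T / x \<noteq> 0"
        if "T = uroot x $ k * q ^ (0 + n)" for n T
      proof -
        have "x\<^sup>2 * q \<noteq> q ^ n"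
          using generic_powi(2)[OF assms(2), of "int n - 1"] q by (simp add: power_int_diff field_simps)
        moreover have Tx: "T * x = q ^ n" using that 3 x by simp
        ultimately have "T \<noteq> q * x" by (auto simp: power2_eq_square mult_ac)
        moreover have "T \<noteq> 1" using Tx g(2)[of n] by auto
        moreover have "q * T \<noteq> 1"
        proof
          assume "q * T = 1"
          then have "x = q * T * x" by simp
          also have "\<dots> = q ^ Suc n" using Tx by (simp add: mult.assoc)
          finally show False using g(2)[of "Suc n"] by blast
        qed
        moreover have "q * T \<noteq> x"
        proof
          assume "q * T = x"
          then have "x\<^sup>2 = q * T * x" by (simp add: power2_eq_square)
          also have "\<dots> = q ^ Suc n" using Tx by (simp add: mult.assoc)
          finally show False using g(1)[of "Suc n"] by blast
        qed
        ultimately show ?thesis using q x by simp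
      qed
    qed (use 3 q in \<open>simp_all\<close>)
  qed
qed

text \<open>The weight \<open>wq\<close> has a double pole at t = 0, so it is not a polynomial in
  S_m. A multiple of (1 - t) (1 - x t) (1 - t / x) / t^2 has the same pole, but sums to a multiple
  of M by the recursion of the terms; the remainder is quadratic in t.\<close>

lemma block_shift:
  assumes "admissible q" "generic q x"
  shows "q powi m * blocks q m (q * x) $ k =
    q powi m * (blocks q m x $ k + (q * x - 1 / x) * blocks q (m + 1) x $ k)
    + ((x\<^sup>2 - 1 / q) * blocks q m x $ k + ((1 + 1 / x) / q - (x + x\<^sup>2)) * blocks q (m + 1) x $ k
       + (x - 1 / (q * x)) * blocks q (m + 2) x $ k)"
proof -
  have x: "x \<noteq> 0" using generic_powi[OF assms(2)] by blast
  have q: "q \<noteq> 0" using assms(1) by (simp add: admissible_def)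
  define t where "t n = uroot x $ k * q ^ n" for n
  have t0: "t n \<noteq> 0" for n using uroot_nonzero[OF x] q by (simp add: t_def)
  define b where "b = bser q m x k"
  define M where "M = q powi m"
  have S: "(\<lambda>n. t n ^ j * b n) sums (blocks q (m + int j) x $ k)" for j
    unfolding t_def b_def by (rule block_sums[OF assms])
  have S0: "b sums (blocks q m x $ k)" using S[of 0] by simp
  have S1: "(\<lambda>n. t n * b n) sums (blocks q (m + 1) x $ k)" using S[of 1] by simp
  have S2: "(\<lambda>n. t n ^ 2 * b n) sums (blocks q (m + 2) x $ k)" using S[of 2] by simp
  define D where "D t = (1 - t) * (1 - x * t) * (1 - t / x)" for t
  \<comment> \<open>The linear factor makes (1 - x t) (1 + (x - 1 / (q x)) t) agree with 1 - t / (q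
    x) up to order t^2, so that the difference of \<open>wq\<close> and \<open>G\<close> is a
    polynomial.\<close>
  define G where "G t = D t * (1 + (x - 1 / (q * x)) * t) / t\<^sup>2" for t
  have DS: "D (t (Suc n)) * b (Suc n) = (t (Suc n))\<^sup>2 * (M * b n)" for n
    unfolding D_def b_def M_def by (rule bser_Suc[OF assms]) (simp only: t_def)
  have GS: "G (t (Suc n)) * b (Suc n) = M * (b n + (q * x - 1 / x) * (t n * b n))" for n
  proof -
    have "G (t (Suc n)) * b (Suc n) = (D (t (Suc n)) * b (Suc n)) * (1 + (x - 1 / (q * x)) * t (Suc n)) / (t (Suc n))\<^sup>2"
      by (simp add: G_def)
    also have "\<dots> = M * b n * (1 + (x - 1 / (q * x)) * t (Suc n))"
      unfolding DS using t0[of "Suc n"] by simp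
    also have "1 + (x - 1 / (q * x)) * t (Suc n) = 1 + (q * x - 1 / x) * t n"
    proof -
      have "t (Suc n) = q * t n" by (simp add: t_def mult_ac)
      then show ?thesis using q x by (simp add: field_simps)
    qed
    finally show ?thesis by (simp add: algebra_simps)
  qed
  have "(\<lambda>n. M * (b n + (q * x - 1 / x) * (t n * b n))) sums
      (M * (blocks q m x $ k + (q * x - 1 / x) * blocks q (m + 1) x $ k))"
    by (intro sums_mult sums_add S0 S1)
  then have "(\<lambda>n. G (t n) * b n) sums (M * (blocks q m x $ k + (q * x - 1 / x) * blocks q (m + 1) x $ k))"
  proof (subst (asm) GS[symmetric], subst (asm) sums_Suc_iff)
    have "G (t 0) = 0" using uroot_poly[OF x, of "t 0" k] by (simp add: G_def D_def t_def)
    then show "(\<lambda>n. G (t n) * b n) sums (M * (blocks q m x $ k + (q * x - 1 / x) * blocks q (m + 1) x $ k))"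
      if "(\<lambda>n. G (t n) * b n) sums (M * (blocks q m x $ k + (q * x - 1 / x) * blocks q (m + 1) x $ k) + G (t 0) * b 0)"
      using that by simp
  qed
  then have "(\<lambda>n. G (t n) * b n + ((x\<^sup>2 - 1 / q) * b n + ((1 + 1 / x) / q - (x + x\<^sup>2)) * (t n * b n)
       + (x - 1 / (q * x)) * (t n ^ 2 * b n))) sums
     (M * (blocks q m x $ k + (q * x - 1 / x) * blocks q (m + 1) x $ k)
    + ((x\<^sup>2 - 1 / q) * blocks q m x $ k + ((1 + 1 / x) / q - (x + x\<^sup>2)) * blocks q (m + 1) x $ k
       + (x - 1 / (q * x)) * blocks q (m + 2) x $ k))"
    by (intro sums_add sums_mult S0 S1 S2)
  moreover have "G (t n) * b n + ((x\<^sup>2 - 1 / q) * b n + ((1 + 1 / x) / q - (x + x\<^sup>2)) * (t n * b n)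
       + (x - 1 / (q * x)) * (t n ^ 2 * b n)) = wq q x (t n) * b n" for n
  proof -
    have "G t + (x\<^sup>2 - 1 / q) + ((1 + 1 / x) / q - (x + x\<^sup>2)) * t + (x - 1 / (q * x)) * t\<^sup>2 = wq q x t" if "t \<noteq> 0" for t
      using that q x unfolding G_def D_def wq_def by (simp add: divide_simps) (simp add: algebra_simps power2_eq_square)
    moreover have "G * b + (A * b + B * (t * b) + C * (t\<^sup>2 * b)) = w * b" if "G + A + B * t + C * t\<^sup>2 = w"
      for G A B C t w b :: complex
      unfolding that[symmetric] by (simp add: algebra_simps)
    ultimately show ?thesis using t0[of n] by blast
  qed
  ultimately show ?thesis
    using block_shift_sums[OF assms, of k m] unfolding t_def[symmetric] b_def[symmetric] M_def
    by (simp add: sums_unique2)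
qed

lemma pair3_x0:
  assumes "q \<noteq> 0" "x \<noteq> 0"
  shows "pair3 q x0 f m x = (1 - 1 / (q * q powi m) + x\<^sup>2 / q powi m) * f m x
    + (q * x - 1 / x - (x + x\<^sup>2) / q powi m + (1 + 1 / x) / (q * q powi m)) * f (m + 1) x
    + (x / q powi m - 1 / (q * q powi m * x)) * f (m + 2) x"
  using assms unfolding pair3_def x0_def
  by (simp add: ratval_simps regular_at_intros regular_at_divide)

lemma qsol_blocks:
  assumes "admissible q" "generic q x"
  shows "qsol q (\<lambda>m x. blocks q m x $ k) x"
  unfolding qsol_def
proof (intro allI conjI)
  fix m
  show "blocks q (m + 3) x $ k = blocks q m x $ k - (1 + x + inverse x) * blocks q (m + 1) x $ k
    + (1 + x + inverse x - q\<^sup>2 * q powi m) * blocks q (m + 2) x $ k"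
    by (rule block_recurrence[OF assms])
  have x: "x \<noteq> 0" using generic_powi[OF assms(2)] by blast
  have q: "q \<noteq> 0" using assms(1) by (simp add: admissible_def)
  define M where "M = q powi m"
  have M: "M \<noteq> 0" using q by (simp add: M_def)
  have alg: "B = (1 - 1 / (q * M) + x\<^sup>2 / M) * F0 + (q * x - 1 / x - (x + x\<^sup>2) / M + (1 + 1 / x) / (q * M)) * F1
      + (x / M - 1 / (q * M * x)) * F2"
    if e: "M * B = M * (F0 + (q * x - 1 / x) * F1) + ((x\<^sup>2 - 1 / q) * F0 + ((1 + 1 / x) / q - (x + x\<^sup>2)) * F1
       + (x - 1 / (q * x)) * F2)" for B F0 F1 F2
  proof -
    have "B = (M * B) / M" using M by simp
    then show ?thesis unfolding e using M q x by (simp add: divide_simps) (simp add: algebra_simps)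
  qed
  show "blocks q m (q * x) $ k = pair3 q x0 (\<lambda>m x. blocks q m x $ k) m x"
    using alg[OF block_shift[OF assms, of m k, folded M_def]] q x M
    by (simp only: pair3_x0[OF q x] M_def)
qed

section \<open>Duality between \<open>q\<close> and \<open>1 / q\<close>\<close>

text \<open>The bilinear concomitant of the recurrence: m \<mapsto> g (- m) solves the adjoint
  equation when g solves the equation for 1 / q.\<close>

definition pairing :: "complex \<Rightarrow> complex \<Rightarrow> int \<Rightarrow> 3 \<Rightarrow> 3 \<Rightarrow> complex" where
  "pairing q x m j k = (let f = (\<lambda>m. blocks q m x $ j); g = (\<lambda>m. blocks (inverse q) m x $ k) in
     f m * g (- 2 - m) + (q powi (m + 1) - (1 + x + inverse x)) * f (m + 1) * g (- 1 - m)
     + f (m + 1) * g (- m) + f (m + 2) * g (- 1 - m))"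

lemma pairing_swap: "pairing (inverse q) x (- 2 - m) k j = pairing q x m j k"
proof -
  have "inverse q powi (- 1 - m) = q powi (m + 1)"
    by (simp add: power_int_inverse flip: power_int_minus)
  then show ?thesis
    by (simp add: pairing_def Let_def algebra_simps)
qed

lemma admissible_inverse: "admissible q \<Longrightarrow> admissible (inverse q)"
  by (auto simp: admissible_def norm_inverse inverse_eq_1_iff)

text \<open>The recurrence at 1 / q, read with decreasing index, contains the same coefficient q^(m
  + 1) as the one at q. Inserting both makes the difference of consecutive pairings vanish.\<close>

lemma pairing_Suc:
  assumes "admissible q" "generic q x"
  shows "pairing q x (m + 1) j k = pairing q x m j k"
proof -
  have q: "q \<noteq> 0" using assms(1) by (simp add: admissible_def)
  define f where "f m = blocks q m x $ j" for m
  define g where "g m = blocks (inverse q) m x $ k" for m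
  define s where "s = 1 + x + inverse x"
  have f: "f (m + 3) = f m - s * f (m + 1) + (s - q\<^sup>2 * q powi m) * f (m + 2)"
    unfolding f_def s_def by (rule block_recurrence[OF assms])
  have "g (- 3 - m + 3) = g (- 3 - m) - s * g (- 3 - m + 1) + (s - (inverse q)\<^sup>2 * inverse q powi (- 3 - m)) * g (- 3 - m + 2)"
    unfolding g_def s_def by (rule block_recurrence[OF admissible_inverse[OF assms(1)] generic_inverse(2)[OF assms(2)]])
  moreover have "(inverse q)\<^sup>2 * inverse q powi (- 3 - m) = q powi (m + 1)"
  proof -
    have "(inverse q)\<^sup>2 * inverse q powi (- 3 - m) = inverse q powi (2 + (- 3 - m))"
      using q by (subst power_int_add) (simp_all add: power_int_numeral)
    also have "\<dots> = q powi (m + 1)" by (simp add: power_int_inverse flip: power_int_minus)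
    finally show ?thesis .
  qed
  ultimately have g: "g (- m) = g (- 3 - m) - s * g (- 2 - m) + (s - q powi (m + 1)) * g (- 1 - m)"
    by (simp add: algebra_simps)
  have qq: "q powi (m + 2) = q\<^sup>2 * q powi m" using q by (simp add: power_int_add power_int_numeral)
  have idx: "m + 1 + 1 = m + 2" "m + 1 + 2 = m + 3" "- 2 - (m + 1) = - 3 - m" "- 1 - (m + 1) = - 2 - m" "- (m + 1) = - 1 - m"
    by simp_all
  have 1: "pairing q x (m + 1) j k = f (m + 1) * g (- 3 - m) + (q powi (m + 2) - s) * f (m + 2) * g (- 2 - m)
      + f (m + 2) * g (- 1 - m) + f (m + 3) * g (- 2 - m)"
    unfolding pairing_def Let_def f_def[symmetric] g_def[symmetric] s_def[symmetric] idx ..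
  have 2: "pairing q x m j k = f m * g (- 2 - m) + (q powi (m + 1) - s) * f (m + 1) * g (- 1 - m)
      + f (m + 1) * g (- m) + f (m + 2) * g (- 1 - m)"
    unfolding pairing_def Let_def f_def[symmetric] g_def[symmetric] s_def[symmetric] ..
  show ?thesis unfolding 1 2 f g qq by (simp add: algebra_simps)
qed

lemma shift_invariant:
  fixes h :: "int \<Rightarrow> 'a"
  assumes "\<And>m. h (m + 1) = h m"
  shows "h m = h l"
proof -
  have "h m = h 0" for m
  proof (induction m rule: int_induct[where k = 0])
    case (step2 i)
    then show ?case using assms[of "i - 1"] by simp
  qed (use assms in simp_all)
  then show ?thesis by metis
qed

text \<open>If \<open>\<gamma>\<close> vanishes to order \<open>d\<close> at \<open>0\<close>, then \<open>(q^d r)^n\<close> converges to a nonzero limit.\<close>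

lemma holomorphic_geometric_eq_0:
  assumes "\<gamma> holomorphic_on UNIV" "norm q < 1" "q \<noteq> 0"
    and "\<And>n. r ^ n * \<gamma> (q ^ n) = K" "\<And>d. q ^ d * r \<noteq> 1"
  shows "K = 0"
proof (rule ccontr)
  assume K: "K \<noteq> 0"
  have "\<exists>d h \<rho>. \<rho> > 0 \<and> isCont h 0 \<and> h 0 \<noteq> 0 \<and> (\<forall>w\<in>ball 0 \<rho>. \<gamma> w = w ^ d * h w)"
  proof (cases "\<gamma> 0 = 0")
    case False
    have "isCont \<gamma> 0"
      using holomorphic_on_imp_continuous_on[OF assms(1)] by (simp add: continuous_on_eq_continuous_at)
    with False show ?thesis by (intro exI[of _ 0] exI[of _ \<gamma>] exI[of _ 1]) auto
  next
    case True
    have "\<not> \<gamma> constant_on UNIV"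
      using assms(4)[of 0] True K unfolding constant_on_def by (metis UNIV_I mult_1 power_0)
    then obtain h r d where h: "0 < r" "h holomorphic_on ball 0 r"
      "\<And>w. w \<in> ball 0 r \<Longrightarrow> \<gamma> w = (w - 0) ^ d * h w" "\<And>w. w \<in> ball 0 r \<Longrightarrow> h w \<noteq> 0"
      using holomorphic_factor_zero_nonconstant[OF assms(1) open_UNIV connected_UNIV UNIV_I True] by metis
    have "isCont h 0"
      using holomorphic_on_imp_continuous_on[OF h(2)] h(1) by (simp add: continuous_on_eq_continuous_at)
    with h show ?thesis by (intro exI[of _ d] exI[of _ h] exI[of _ r]) auto
  qed
  then obtain d h \<rho> where h: "\<rho> > 0" "isCont h 0" "h 0 \<noteq> 0" "\<And>w. w \<in> ball 0 \<rho> \<Longrightarrow> \<gamma> w = w ^ d * h w" by blast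
  have q0: "(\<lambda>n. q ^ n) \<longlonglongrightarrow> 0" using assms(2) by (rule LIMSEQ_power_zero)
  have "(\<lambda>n. K / h (q ^ n)) \<longlonglongrightarrow> K / h 0"
    by (intro tendsto_divide tendsto_const isCont_tendsto_compose[OF h(2)] q0 h(3))
  moreover have "\<forall>\<^sub>F n in sequentially. K / h (q ^ n) = (q ^ d * r) ^ n"
  proof -
    have "\<forall>\<^sub>F n in sequentially. q ^ n \<in> ball 0 \<rho>"
      by (rule topological_tendstoD[OF q0]) (use h(1) in auto)
    then show ?thesis
    proof eventually_elim
      case (elim n)
      have "K = (q ^ d * r) ^ n * h (q ^ n)"
        using assms(4)[of n] h(4)[OF elim] by (simp add: power_mult_distrib mult_ac flip: power_mult)
      moreover from this K have "h (q ^ n) \<noteq> 0" by auto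
      ultimately show ?case by simp
    qed
  qed
  ultimately have L: "(\<lambda>n. (q ^ d * r) ^ n) \<longlonglongrightarrow> K / h 0"
    by (rule Lim_transform_eventually)
  have "(\<lambda>n. (q ^ d * r) ^ Suc n) \<longlonglongrightarrow> K / h 0"
    using L by (subst filterlim_sequentially_Suc)
  moreover have "(\<lambda>n. (q ^ d * r) ^ Suc n) \<longlonglongrightarrow> (q ^ d * r) * (K / h 0)"
    unfolding power_Suc by (intro tendsto_mult_left L)
  ultimately have "K / h 0 = (q ^ d * r) * (K / h 0)" by (rule LIMSEQ_unique)
  then show False using K h(3) assms(5)[of d] by simp
qed

text \<open>The infinite products at q and at 1 / q both run over powers of the same base, and only
  the factors with exponent 0 fail to cancel.\<close>

lemma pre_dual:
  assumes "norm q < 1" "admissible q" "generic q x"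
  shows "preA q x * preA (inverse q) x * ((1 - x) * (1 - inverse x)) = 1"
    "preB q x * preB (inverse q) x * ((1 - x) * (1 - x\<^sup>2)) = x\<^sup>2"
proof -
  have x: "x \<noteq> 0" using generic_powi[OF assms(3)] by blast
  have q: "q \<noteq> 0" using assms(2) by (simp add: admissible_def)
  have iq: "\<not> norm (inverse q) < 1"
    using assms(1) q by (simp add: norm_inverse inverse_less_1_iff)
  have nz: "1 - x \<noteq> 0" "1 - inverse x \<noteq> 0" "1 - x\<^sup>2 \<noteq> 0"
    using generic_power[OF assms(3), of 0] by auto
  note s = qpoch_inf_step[OF assms(1), of x] qpoch_inf_step[OF assms(1), of "inverse x"] qpoch_inf_step[OF assms(1), of "x\<^sup>2"]
  note g = generic_qpoch[OF assms(3,1)]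
  have alg: "(a * b) * (1 / (c * a * (d * b))) * (c * d) = 1" if "a \<noteq> 0" "b \<noteq> 0" "c \<noteq> 0" "d \<noteq> 0" for a b c d :: complex
    using that by simp
  show "preA q x * preA (inverse q) x * ((1 - x) * (1 - inverse x)) = 1"
    unfolding preA_def if_P[OF assms(1)] if_not_P[OF iq] inverse_inverse_eq s by (intro alg g nz)
  have alg: "G / (a * (d * b)\<^sup>2) * (c * a * b\<^sup>2 / (e * G)) * (c * e) = x\<^sup>2"
    if "a \<noteq> 0" "b \<noteq> 0" "e \<noteq> 0" "G \<noteq> 0" "d \<noteq> 0" "c = - (x * d)" for a b c d e G
    unfolding that(6) using that(1-5) by (simp add: power2_eq_square)
  show "preB q x * preB (inverse q) x * ((1 - x) * (1 - x\<^sup>2)) = x\<^sup>2"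
    unfolding preB_def if_P[OF assms(1)] if_not_P[OF iq] inverse_inverse_eq s
    by (rule alg) (use g nz x in \<open>auto simp: field_simps\<close>)
qed

text \<open>The constant value is found as m tends to infinity. For equal roots it is the value of
  \<open>\<gamma>\<close> at 0; for different roots a constant value other than 0 is incompatible
  with the factor (u / v)^n.\<close>

lemma pairing_inside:
  assumes "norm q < 1" "admissible q" "generic q x"
  shows "pairing q x m j k = (if j = k then 1 else 0)"
proof -
  have x: "x \<noteq> 0" using generic_powi[OF assms(3)] by blast
  have q: "q \<noteq> 0" using assms(2) by (simp add: admissible_def)
  have ai: "admissible (inverse q)" "generic (inverse q) x"
    by (rule admissible_inverse[OF assms(2)] generic_inverse(2)[OF assms(3)])+
  define u v where "u = uroot x $ j" and "v = uroot x $ k"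
  have uv: "u \<noteq> 0" "v \<noteq> 0" using uroot_nonzero[OF x] by (simp_all add: u_def v_def)
  define \<phi> where "\<phi> = phi q x u"
  define \<psi> where "\<psi> = phi (inverse q) x v"
  define P where "P = pre q x $ j * pre (inverse q) x $ k"
  define s where "s = 1 + x + inverse x"
  \<comment> \<open>The index of the second function decreases while its base is 1 / q, so both
    series are evaluated at multiples of q^n and \<open>\<gamma>\<close> is one entire function of M
    = q^n.\<close>
  define \<gamma> where "\<gamma> M = \<phi> M * (inverse v)\<^sup>2 * \<psi> (q\<^sup>2 * M) + (q * M - s) * (u * inverse v) * \<phi> (q * M) * \<psi> (q * M)
      + u * \<phi> (q * M) * \<psi> M + u\<^sup>2 * inverse v * \<phi> (q\<^sup>2 * M) * \<psi> (q * M)" for M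
  have h1: "\<phi> holomorphic_on UNIV" "\<psi> holomorphic_on UNIV"
    unfolding \<phi>_def \<psi>_def by (intro phi_holomorphic assms ai x uv)+
  have h: "(\<lambda>M. \<phi> (c * M)) holomorphic_on UNIV" "(\<lambda>M. \<psi> (c * M)) holomorphic_on UNIV" for c
    by (rule holomorphic_on_compose_gen[OF _ h1(1), unfolded o_def] holomorphic_on_compose_gen[OF _ h1(2), unfolded o_def];
        auto intro!: holomorphic_intros)+
  have hol: "\<gamma> holomorphic_on UNIV"
    unfolding \<gamma>_def[abs_def] by (intro holomorphic_intros h1 h)
  have val: "P * ((u * inverse v) ^ n * \<gamma> (q ^ n)) = pairing q x m j k" for n
  proof -
    have ip: "inverse q powi (- 2 - int n) = q\<^sup>2 * q ^ n" "inverse q powi (- 1 - int n) = q * q ^ n"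
      "inverse q powi (- int n) = q ^ n"
      using q by (simp_all add: power_int_inverse power_int_diff power_int_minus power_int_numeral field_simps)
    have vp: "v powi (- 2 - int n) = (inverse v)\<^sup>2 * inverse v ^ n" "v powi (- 1 - int n) = inverse v * inverse v ^ n"
      "v powi (- int n) = inverse v ^ n"
      using uv by (simp_all add: power_int_diff power_int_minus power_int_numeral field_simps power_inverse)
    have qp: "q powi (int n + 1) = q * q ^ n" "q powi (int n + 2) = q\<^sup>2 * q ^ n" "u powi (int n + 1) = u * u ^ n"
      "u powi (int n + 2) = u\<^sup>2 * u ^ n" "q powi int n = q ^ n" "u powi int n = u ^ n"
      using q uv by (simp_all add: power_int_add power_int_numeral)
    have "pairing q x m j k = pairing q x (int n) j k"
      by (rule shift_invariant) (rule pairing_Suc[OF assms(2,3)])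
    also have "\<dots> = P * ((u * inverse v) ^ n * \<gamma> (q ^ n))"
      unfolding pairing_def Let_def blocks_series[OF assms(2,3)] blocks_series[OF ai] u_def[symmetric] v_def[symmetric]
        \<phi>_def[symmetric] \<psi>_def[symmetric] s_def[symmetric] ip vp qp power_mult_distrib \<gamma>_def P_def
      by (simp only: algebra_simps)
    finally show ?thesis ..
  qed
  show ?thesis
  proof (cases "j = k")
    case True
    have uv1: "u * inverse v = 1" using True uv by (simp add: u_def v_def)
    have "(\<lambda>n. P * \<gamma> (q ^ n)) \<longlonglongrightarrow> P * \<gamma> 0"
    proof (intro tendsto_mult_left isCont_tendsto_compose[of 0 \<gamma>])
      show "isCont \<gamma> 0"
        using holomorphic_on_imp_continuous_on[OF hol] by (simp add: continuous_on_eq_continuous_at)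
      show "(\<lambda>n. q ^ n) \<longlonglongrightarrow> 0" using assms(1) by (rule LIMSEQ_power_zero)
    qed
    moreover have "P * \<gamma> (q ^ n) = pairing q x m j k" for n
      using val[of n] unfolding uv1 by simp
    ultimately have "pairing q x m j k = P * \<gamma> 0" by (simp add: LIMSEQ_const_iff)
    \<comment> \<open>Multiplied by u^2 this is (1 - u) (1 - u^2) for u = x and u = 1 / x; for u = 1
      it is (1 - x) (1 - 1 / x). These are the finite factors left over in
      \<open>pre_dual\<close>.\<close>
    also have "\<gamma> 0 = (inverse u)\<^sup>2 - s + u + u"
      unfolding \<gamma>_def \<phi>_def \<psi>_def using True uv by (simp add: u_def v_def power2_eq_square)
    also have "P * ((inverse u)\<^sup>2 - s + u + u) = 1"
    proof -
      have B: "preB q y * preB (inverse q) y * ((inverse y)\<^sup>2 - (1 + y + inverse y) + y + y) = 1" if "generic q y" for y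
      proof -
        have y: "y \<noteq> 0" using generic_powi[OF that] by blast
        have "y\<^sup>2 * ((inverse y)\<^sup>2 - (1 + y + inverse y) + y + y) = (1 - y) * (1 - y\<^sup>2)"
          using y by (simp add: field_simps power2_eq_square)
        then have "y\<^sup>2 * (preB q y * preB (inverse q) y * ((inverse y)\<^sup>2 - (1 + y + inverse y) + y + y)) =
           preB q y * preB (inverse q) y * ((1 - y) * (1 - y\<^sup>2))"
          by (metis mult.left_commute)
        also have "\<dots> = y\<^sup>2 * 1" using pre_dual(2)[OF assms(1,2) that] by simp
        finally show ?thesis using y by (simp only: mult_left_cancel power_not_zero not_False_eq_True)
      qed
      have A: "preA q x * preA (inverse q) x * (3 - s) = 1"
      proof -
        have "3 - s = (1 - x) * (1 - inverse x)" using x by (simp add: s_def field_simps)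
        then show ?thesis using pre_dual(1)[OF assms] by simp
      qed
      consider "j = 1" | "j = 2" | "j = 3" using exhaust_3[of j] by blast
      then show ?thesis
      proof cases
        case 1
        then show ?thesis using A True by (simp add: P_def u_def)
      next
        case 2
        then show ?thesis using B[OF assms(3)] True by (simp add: P_def u_def s_def)
      next
        case 3
        then show ?thesis using B[OF generic_inverse(1)[OF assms(3)]] True by (simp add: P_def u_def s_def add.commute add.left_commute)
      qed
    qed
    finally show ?thesis using True by simp
  next
    case False
    define K where "K = \<gamma> 1"
    have P0: "P \<noteq> 0" using pre_nonzero[OF assms(2,3)] pre_nonzero[OF ai] by (simp add: P_def)
    have K: "(u * inverse v) ^ n * \<gamma> (q ^ n) = K" for n
      using val[of n] val[of 0] P0 by (simp add: K_def) (metis mult_left_cancel)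
    \<comment> \<open>The quotients of different roots are x, x^2 and their inverses, which are no
      powers of q at a generic point.\<close>
    have "q ^ d * (u * inverse v) \<noteq> 1" for d
    proof -
      have ne: "q ^ d * x \<noteq> 1" "q ^ d * inverse x \<noteq> 1" "q ^ d * x\<^sup>2 \<noteq> 1" "q ^ d * inverse (x\<^sup>2) \<noteq> 1"
        using generic_power[OF assms(3), of d] x by (auto simp: field_simps)
      show ?thesis
        using exhaust_3[of j] exhaust_3[of k] False ne
        unfolding u_def v_def by (elim disjE) (simp_all add: power2_eq_square)
    qed
    then have "K = 0" by (rule holomorphic_geometric_eq_0[OF hol assms(1) q K])
    then show ?thesis using val[of 0] K[of 0] False by simp
  qed
qed

lemma pairing:
  assumes "admissible q" "generic q x"
  shows "pairing q x m j k = (if j = k then 1 else 0)"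
  using assms(1)
proof (cases rule: admissible_cases)
  case 1
  then show ?thesis using pairing_inside assms by blast
next
  case 2
  have "pairing (inverse q) x (- 2 - m) k j = (if k = j then 1 else 0)"
    by (rule pairing_inside[OF 2(2) admissible_inverse[OF assms(1)] generic_inverse(2)[OF assms(2)]])
  then show ?thesis unfolding pairing_swap by auto
qed

text \<open>The rows collect what multiplies f m, f (m + 1) and f (m + 2) in \<open>pairing\<close>,
  so that orthonormality of the pairing says that this matrix inverts the transposed
  Wronskian.\<close>

definition dual_blocks :: "complex \<Rightarrow> int \<Rightarrow> complex \<Rightarrow> complex ^ 3 ^ 3" where
  "dual_blocks q m x = (let g = (\<lambda>m. blocks (inverse q) m x) in
     vector [g (- 2 - m), (q powi (m + 1) - (1 + x + inverse x)) *s g (- 1 - m) + g (- m), g (- 1 - m)])"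

lemma Wronskian_m_nth [simp]:
  "Wronskian_m q m x $ 1 = blocks q m x" "Wronskian_m q m x $ 2 = blocks q (m + 1) x"
  "Wronskian_m q m x $ 3 = blocks q (m + 2) x"
  by (simp_all add: Wronskian_m_def)

lemma dual_blocks_mult:
  assumes "admissible q" "generic q x"
  shows "transpose (Wronskian_m q m x) ** dual_blocks q m x = mat 1"
    "dual_blocks q m x ** transpose (Wronskian_m q m x) = mat 1"
proof -
  show *: "transpose (Wronskian_m q m x) ** dual_blocks q m x = mat 1"
  proof (intro vec_eq_iff[THEN iffD2] allI)
    fix j k
    have "(transpose (Wronskian_m q m x) ** dual_blocks q m x) $ j $ k = pairing q x m j k"
      by (simp add: matrix_matrix_mult_def transpose_def sum_3 dual_blocks_def pairing_def Let_def algebra_simps)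
    then show "(transpose (Wronskian_m q m x) ** dual_blocks q m x) $ j $ k = mat 1 $ j $ k"
      using pairing[OF assms] by (simp add: mat_def)
  qed
  show "dual_blocks q m x ** transpose (Wronskian_m q m x) = mat 1"
    using * by (simp only: matrix_left_right_inverse)
qed

lemma dual_blocks_orth:
  assumes "admissible q" "generic q x"
  shows "(\<Sum>i\<in>UNIV. Wronskian_m q m x $ i $ j * dual_blocks q m x $ i $ k) = (if j = k then 1 else 0)"
    "(\<Sum>k\<in>UNIV. Wronskian_m q m x $ i $ k * dual_blocks q m x $ l $ k) = (if i = l then 1 else 0)"
proof -
  have "(transpose (Wronskian_m q m x) ** dual_blocks q m x) $ j $ k = (mat 1 :: complex ^ 3 ^ 3) $ j $ k"
    "(dual_blocks q m x ** transpose (Wronskian_m q m x)) $ l $ i = (mat 1 :: complex ^ 3 ^ 3) $ l $ i"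
    by (simp_all only: dual_blocks_mult[OF assms])
  then show "(\<Sum>i\<in>UNIV. Wronskian_m q m x $ i $ j * dual_blocks q m x $ i $ k) = (if j = k then 1 else 0)"
    "(\<Sum>k\<in>UNIV. Wronskian_m q m x $ i $ k * dual_blocks q m x $ l $ k) = (if i = l then 1 else 0)"
    by (auto simp: matrix_matrix_mult_def transpose_def mat_def mult.commute)
qed

text \<open>At m = -1 the dual rows involve the indices -1, 0, 1, the rows of the Wronskian at 1 /
  q, and the factor q^(m + 1) is 1. So the relation is \<open>dual_blocks_orth\<close> after an
  elementary row operation.\<close>

lemma Wronskian_orthogonality:
  assumes "admissible q" "generic q x"
  shows "Wronskian_m q (-1) x ** transpose (Wronskian_m (inverse q) (-1) x) =
    vector [vector [1, 0, 0], vector [0, 0, 1], vector [0, 1, x + inverse x]]"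
proof -
  define w where "w i j = (\<Sum>k\<in>UNIV. Wronskian_m q (-1) x $ i $ k * Wronskian_m (inverse q) (-1) x $ j $ k)" for i j
  have d: "dual_blocks q (- 1) x $ 1 = Wronskian_m (inverse q) (- 1) x $ 1"
    "dual_blocks q (- 1) x $ 3 = Wronskian_m (inverse q) (- 1) x $ 2"
    "dual_blocks q (- 1) x $ 2 = Wronskian_m (inverse q) (- 1) x $ 3 - (x + inverse x) *s Wronskian_m (inverse q) (- 1) x $ 2"
    by (simp_all add: dual_blocks_def Let_def vec_eq_iff algebra_simps)
  have w1: "w i 1 = (if i = 1 then 1 else 0)" for i
    using dual_blocks_orth(2)[OF assms, of "- 1" i 1] by (simp add: w_def d(1))
  have w2: "w i 2 = (if i = 3 then 1 else 0)" for i
    using dual_blocks_orth(2)[OF assms, of "- 1" i 3] by (simp add: w_def d(2))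
  have "w i 3 - (x + inverse x) * w i 2 = (if i = 2 then 1 else 0)" for i
  proof -
    have "w i 3 - (x + inverse x) * w i 2 = (\<Sum>k\<in>UNIV. Wronskian_m q (-1) x $ i $ k * dual_blocks q (- 1) x $ 2 $ k)"
      unfolding d(3) w_def sum_3 vector_minus_component vector_smult_component by (simp only: algebra_simps)
    then show ?thesis using dual_blocks_orth(2)[OF assms, of "- 1" i 2] by simp
  qed
  then have w3: "w i 3 = (if i = 2 then 1 else 0) + (x + inverse x) * (if i = 3 then 1 else 0)" for i
    using w2 by (simp add: algebra_simps)
  have "(Wronskian_m q (-1) x ** transpose (Wronskian_m (inverse q) (-1) x)) $ i $ j = w i j" for i j
    by (simp add: matrix_matrix_mult_def transpose_def w_def)
  then show ?thesis
    by (simp add: vec_eq_iff forall_3 w1 w2 w3)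
qed

text \<open>Coordinates with respect to the blocks through the inverse Wronskian. Being polynomial
  in the blocks at 1 / q, they stay meromorphic in x without any division by a determinant.\<close>

definition coef :: "complex \<Rightarrow> int \<Rightarrow> complex \<Rightarrow> 3 \<Rightarrow> (int \<Rightarrow> complex) \<Rightarrow> complex" where
  "coef q m x k f = dual_blocks q m x $ 1 $ k * f m + dual_blocks q m x $ 2 $ k * f (m + 1)
     + dual_blocks q m x $ 3 $ k * f (m + 2)"

lemma coef_expand:
  assumes "admissible q" "generic q x" "l \<in> {m, m + 1, m + 2}"
  shows "(\<Sum>k\<in>UNIV. coef q m x k f * blocks q l x $ k) = f l"
proof -
  define W where "W = Wronskian_m q m x"
  define D where "D = dual_blocks q m x"
  have o: "W $ i $ 1 * D $ l $ 1 + W $ i $ 2 * D $ l $ 2 + W $ i $ 3 * D $ l $ 3 = (if i = l then 1 else 0)" for i l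
    using dual_blocks_orth(2)[OF assms(1,2), of m i l] by (simp add: W_def D_def sum_3)
  have "(\<Sum>k\<in>UNIV. (D $ 1 $ k * f m + D $ 2 $ k * f (m + 1) + D $ 3 $ k * f (m + 2)) * W $ i $ k) =
    (if i = 1 then 1 else 0) * f m + (if i = 2 then 1 else 0) * f (m + 1) + (if i = 3 then 1 else 0) * f (m + 2)" for i
    unfolding o[symmetric] sum_3 by (simp only: algebra_simps)
  from this[of 1] this[of 2] this[of 3] show ?thesis
    using assms(3) unfolding coef_def D_def W_def by auto
qed

lemma coef_unique:
  assumes "admissible q" "generic q x"
    "\<And>l. l \<in> {m, m + 1, m + 2} \<Longrightarrow> f l = (\<Sum>k\<in>UNIV. c k * blocks q l x $ k)"
  shows "coef q m x k f = c k"
proof -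
  define W where "W = Wronskian_m q m x"
  define D where "D = dual_blocks q m x"
  have o: "W $ 1 $ j * D $ 1 $ k + W $ 2 $ j * D $ 2 $ k + W $ 3 $ j * D $ 3 $ k = (if j = k then 1 else 0)" for j
    using dual_blocks_orth(1)[OF assms(1,2), of m j k] by (simp add: W_def D_def sum_3)
  have "coef q m x k f = D $ 1 $ k * (\<Sum>k\<in>UNIV. c k * W $ 1 $ k) + D $ 2 $ k * (\<Sum>k\<in>UNIV. c k * W $ 2 $ k)
      + D $ 3 $ k * (\<Sum>k\<in>UNIV. c k * W $ 3 $ k)"
    using assms(3)[of m] assms(3)[of "m + 1"] assms(3)[of "m + 2"] by (simp add: coef_def D_def W_def)
  also have "\<dots> = c 1 * (if 1 = k then 1 else 0) + c 2 * (if 2 = k then 1 else 0) + c 3 * (if 3 = k then 1 else 0)"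
    unfolding o[symmetric] sum_3 by (simp only: algebra_simps)
  also have "\<dots> = c k" using exhaust_3[of k] by auto
  finally show ?thesis .
qed

section \<open>Sequences in \<open>m\<close>\<close>

lemma B52_solutions_iff:
  assumes "x \<noteq> 0" "q \<noteq> 0"
  shows "f \<in> B52_solutions q x \<longleftrightarrow> (\<forall>m. f (m + 3) = f m - (1 + x + inverse x) * f (m + 1)
    + (1 + x + inverse x - q\<^sup>2 * q powi m) * f (m + 2))"
proof -
  have idx: "m + 1 + 1 = m + 2" "m + 2 + 1 = m + 3" for m :: int by simp_all
  have e: "one_minus 1 (one_minus x (one_minus (inverse x) f)) m - q powi (2 + m) * f (m + 2) =
     f m - (1 + x + inverse x) * f (m + 1) + (1 + x + inverse x - q\<^sup>2 * q powi m) * f (m + 2) - f (m + 3)" for m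
    using assms unfolding one_minus_def idx by (simp add: power_int_add power_int_numeral idx field_simps)
  show ?thesis unfolding B52_solutions_def mem_Collect_eq e unfolding right_minus_eq by metis
qed

text \<open>The coefficients of f m and f (m + 3) are constants different from 0, so three
  consecutive values propagate in both directions.\<close>

lemma recurrence_unique:
  fixes f g :: "int \<Rightarrow> complex"
  assumes "\<And>m. f (m + 3) = f m - s * f (m + 1) + t m * f (m + 2)"
    and "\<And>m. g (m + 3) = g m - s * g (m + 1) + t m * g (m + 2)"
    and "\<And>l. l \<in> {0, 1, 2} \<Longrightarrow> f l = g l"
  shows "f m = g m"
proof -
  have "f m = g m \<and> f (m + 1) = g (m + 1) \<and> f (m + 2) = g (m + 2)"
  proof (induction m rule: int_induct[where k = 0])
    case base
    then show ?case using assms(3) by simp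
  next
    case (step1 i)
    then show ?case using assms(1,2)[of i] by (simp add: add.commute[of i] add.assoc)
  next
    case (step2 i)
    have "f (i - 1) = f (i + 2) + s * f i - t (i - 1) * f (i + 1)" "g (i - 1) = g (i + 2) + s * g i - t (i - 1) * g (i + 1)"
      using assms(1,2)[of "i - 1"] by (simp_all add: algebra_simps)
    then show ?case using step2 by (simp add: add.commute)
  qed
  then show ?thesis ..
qed

lemma seq_basis_blocks:
  assumes "admissible q" "generic q x"
  shows "seq_basis (B52_solutions q x) (\<lambda>k m. blocks q m x $ k)"
proof -
  have x: "x \<noteq> 0" using generic_powi[OF assms(2)] by blast
  have q: "q \<noteq> 0" using assms(1) by (simp add: admissible_def)
  note iff = B52_solutions_iff[OF x q]
  have "\<exists>!c :: complex ^ 3. \<forall>m. f m = (\<Sum>k\<in>UNIV. c $ k * blocks q m x $ k)" if f: "f \<in> B52_solutions q x" for f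
  proof (rule ex1I[of _ "\<chi> k. coef q 0 x k f"])
    show "\<forall>m. f m = (\<Sum>k\<in>UNIV. (\<chi> k. coef q 0 x k f) $ k * blocks q m x $ k)"
    proof
      fix m
      show "f m = (\<Sum>k\<in>UNIV. (\<chi> k. coef q 0 x k f) $ k * blocks q m x $ k)"
      proof (rule recurrence_unique[where s = "1 + x + inverse x" and t = "\<lambda>m. 1 + x + inverse x - q\<^sup>2 * q powi m"])
        show "f l = (\<Sum>k\<in>UNIV. (\<chi> k. coef q 0 x k f) $ k * blocks q l x $ k)" if "l \<in> {0, 1, 2}" for l
          using coef_expand[OF assms, of l 0 f] that by simp
        show "(\<Sum>k\<in>UNIV. (\<chi> k. coef q 0 x k f) $ k * blocks q (m + 3) x $ k) =
            (\<Sum>k\<in>UNIV. (\<chi> k. coef q 0 x k f) $ k * blocks q m x $ k)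
            - (1 + x + inverse x) * (\<Sum>k\<in>UNIV. (\<chi> k. coef q 0 x k f) $ k * blocks q (m + 1) x $ k)
            + (1 + x + inverse x - q\<^sup>2 * q powi m) * (\<Sum>k\<in>UNIV. (\<chi> k. coef q 0 x k f) $ k * blocks q (m + 2) x $ k)" for m
          unfolding block_recurrence[OF assms] sum_3 by (simp only: algebra_simps)
      qed (use f iff in blast)
    qed
    show "c = (\<chi> k. coef q 0 x k f)" if "\<forall>m. f m = (\<Sum>k\<in>UNIV. c $ k * blocks q m x $ k)" for c
      using coef_unique[OF assms, of 0 f "\<lambda>k. c $ k"] that by (simp add: vec_eq_iff)
  qed
  moreover have "(\<lambda>m. blocks q m x $ k) \<in> B52_solutions q x" for k
    unfolding iff using block_recurrence[OF assms] by blast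
  ultimately show ?thesis unfolding seq_basis_def by auto
qed

section \<open>The Wronskian in \<open>m\<close>\<close>

lemma powi_null_sequence:
  assumes "admissible q"
  obtains \<mu> :: "nat \<Rightarrow> int" where "(\<lambda>n. q powi \<mu> n) \<longlonglongrightarrow> 0"
  using assms
proof (cases rule: admissible_cases)
  case 1
  have "(\<lambda>n. q powi int n) \<longlonglongrightarrow> 0" using LIMSEQ_power_zero[OF 1] by simp
  then show ?thesis by (rule that)
next
  case 2
  have "(\<lambda>n. q powi (- int n)) \<longlonglongrightarrow> 0"
    using LIMSEQ_power_zero[OF 2(2)] by (simp add: power_int_minus power_inverse)
  then show ?thesis by (rule that)
qed

text \<open>The last factor on the left is the Vandermonde determinant of 1, x, 1 / x, the limit of
  the Wronskian without its prefactors.\<close>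

lemma pre_prod:
  assumes "admissible q" "generic q x"
  shows "preA q x * preB q x * preB q (inverse x) * ((x - 1) * (inverse x - 1) * (inverse x - x)) =
    - (theta (- inverse (qhalf q) * x) q powi (-2)) * theta (- inverse (qhalf q) * x\<^sup>2) q"
proof -
  have x: "x \<noteq> 0" using generic_powi[OF assms(2)] by blast
  have nz: "1 - x \<noteq> 0" "1 - inverse x \<noteq> 0" "1 - x\<^sup>2 \<noteq> 0"
    using generic_power[OF assms(2), of 0] by auto
  have V: "(x - 1) * (inverse x - 1) * (inverse x - x) = - ((1 - inverse x)\<^sup>2 * (1 - x\<^sup>2))"
    using x by (simp add: field_simps power2_eq_square)
  show ?thesis
    using assms(1)
  proof (cases rule: admissible_cases)
    case 1
    note s = qpoch_inf_step[OF 1, of "inverse x"] qpoch_inf_step[OF 1, of "x\<^sup>2"]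
    note g = generic_qpoch[OF assms(2) 1]
    have alg: "a * b * (c / (a * (e * b)\<^sup>2)) * (d / (b * (f)\<^sup>2)) * (- (e\<^sup>2 * h)) = - inverse ((f * b)\<^sup>2) * (h * c * d)"
      if "a \<noteq> 0" "b \<noteq> 0" "e \<noteq> 0" "f \<noteq> 0" for a b c d e f h :: complex
      using that by (simp add: field_simps power2_eq_square)
    show ?thesis
      unfolding theta_half[OF assms(1)] power_int_m2 preA_def preB_def if_P[OF 1] V inverse_inverse_eq
        power_inverse[of x, symmetric] s[unfolded power_inverse]
      by (rule alg) (use g nz in simp_all)
  next
    case 2
    define p where "p = inverse q"
    have pp: "norm p < 1" using 2 by (simp add: p_def)
    note s = qpoch_inf_step[OF pp, of "inverse x"] qpoch_inf_step[OF pp, of "x\<^sup>2"]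
    note g = generic_qpoch[OF generic_inverse(2)[OF assms(2), folded p_def] pp]
    have alg: "1 / (a * (e * b)) * (a * b\<^sup>2 / (h * c)) * (e * b * f\<^sup>2 / d) * (- (e\<^sup>2 * h)) =
        - (f * (e * b))\<^sup>2 * inverse (c * d)"
      if "a \<noteq> 0" "b \<noteq> 0" "e \<noteq> 0" "f \<noteq> 0" "h \<noteq> 0" for a b c d e f h :: complex
      using that by (simp add: field_simps power2_eq_square)
    show ?thesis
      unfolding theta_half[OF assms(1)] power_int_m2 preA_def preB_def if_not_P[OF 2(1)] V inverse_inverse_eq
        p_def[symmetric] s power_inverse
      by (rule alg) (use g nz in simp_all)
  qed
qed

text \<open>Expressing the new row by the recurrence leaves the determinant unchanged, because f m
  has coefficient 1. Letting q^m tend to 0 along a suitable sequence of m replaces every series by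
  1.\<close>

lemma det_Wronskian_m:
  assumes "admissible q" "generic q x"
  shows "det (Wronskian_m q m x) =
    - (theta (- inverse (qhalf q) * x) q powi (-2)) * theta (- inverse (qhalf q) * x\<^sup>2) q"
proof -
  have x: "x \<noteq> 0" using generic_powi[OF assms(2)] by blast
  have q: "q \<noteq> 0" using assms(1) by (simp add: admissible_def)
  have step: "det (Wronskian_m q (m + 1) x) = det (Wronskian_m q m x)" for m
  proof -
    have idx: "m + 1 + 1 = m + 2" "m + 1 + 2 = m + 3" by simp_all
    have alg: "a1 * b2 * (c0 - s * c1 + t * c2) + b1 * c2 * (a0 - s * a1 + t * a2) + c1 * a2 * (b0 - s * b1 + t * b2)
        - a1 * c2 * (b0 - s * b1 + t * b2) - b1 * a2 * (c0 - s * c1 + t * c2) - c1 * b2 * (a0 - s * a1 + t * a2)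
      = a0 * b1 * c2 + b0 * c1 * a2 + c0 * a1 * b2 - a0 * c1 * b2 - b0 * a1 * c2 - c0 * b1 * a2"
      for a0 a1 a2 b0 b1 b2 c0 c1 c2 s t :: complex
      by (simp add: algebra_simps)
    show ?thesis
      unfolding det_3 Wronskian_m_nth idx block_recurrence[OF assms] by (rule alg)
  qed
  define \<Delta> where "\<Delta> M =
    (let a = phi q x 1; b = phi q x x; c = phi q x (inverse x) in
       a M * (x * b (q * M)) * ((inverse x)\<^sup>2 * c (q\<^sup>2 * M)) + b M * (inverse x * c (q * M)) * a (q\<^sup>2 * M)
       + c M * a (q * M) * (x\<^sup>2 * b (q\<^sup>2 * M)) - a M * (inverse x * c (q * M)) * (x\<^sup>2 * b (q\<^sup>2 * M))
       - b M * a (q * M) * ((inverse x)\<^sup>2 * c (q\<^sup>2 * M)) - c M * (x * b (q * M)) * a (q\<^sup>2 * M))" for M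
  define P where "P = preA q x * preB q x * preB q (inverse x)"
  have val: "det (Wronskian_m q m x) = P * \<Delta> (q powi m)" for m
  proof -
    have qp: "q powi (m + 1) = q * q powi m" "q powi (m + 2) = q\<^sup>2 * q powi m"
      and xp: "y powi (m + 1) = y * y powi m" "y powi (m + 2) = y\<^sup>2 * y powi m" if "y \<noteq> 0" for y :: complex
      using q that by (simp_all add: power_int_add power_int_numeral)
    \<comment> \<open>The product of the three roots is 1, so the factors u^m drop out of the
      determinant.\<close>
    have XY: "x powi m * inverse x powi m = 1"
      using x by (simp flip: power_int_mult_distrib)
    have alg: "A * a0 * (B * (x * X) * b1) * (C * (x'\<^sup>2 * Y) * c2) + B * X * b0 * (C * (x' * Y) * c1) * (A * a2)
        + C * Y * c0 * (A * a1) * (B * (x\<^sup>2 * X) * b2) - A * a0 * (C * (x' * Y) * c1) * (B * (x\<^sup>2 * X) * b2)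
        - B * X * b0 * (A * a1) * (C * (x'\<^sup>2 * Y) * c2) - C * Y * c0 * (B * (x * X) * b1) * (A * a2) =
      A * B * C * (X * Y * (a0 * (x * b1) * (x'\<^sup>2 * c2) + b0 * (x' * c1) * a2 + c0 * a1 * (x\<^sup>2 * b2)
        - a0 * (x' * c1) * (x\<^sup>2 * b2) - b0 * a1 * (x'\<^sup>2 * c2) - c0 * (x * b1) * a2))"
      for A B C X Y x x' a0 a1 a2 b0 b1 b2 c0 c1 c2 :: complex
      by (simp only: algebra_simps)
    have "det (Wronskian_m q m x) = P * (x powi m * inverse x powi m * \<Delta> (q powi m))"
      unfolding det_3 Wronskian_m_nth blocks_series[OF assms] pre_simps uroot_simps qp[OF q] xp[OF x]
        xp[OF x[THEN nonzero_imp_inverse_nonzero]] \<Delta>_def Let_def P_def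
      using alg[where x = x and x' = "inverse x"] by simp
    then show ?thesis unfolding XY by simp
  qed
  obtain \<mu> :: "nat \<Rightarrow> int" where \<mu>: "(\<lambda>n. q powi \<mu> n) \<longlonglongrightarrow> 0" by (rule powi_null_sequence[OF assms(1)])
  have c: "isCont (phi q x u) z" if "u \<noteq> 0" for u z
    using holomorphic_on_imp_continuous_on[OF phi_holomorphic[OF assms(1) x that, of UNIV]]
    by (simp add: continuous_on_eq_continuous_at)
  have cc: "(\<lambda>n. phi q x u (k * q powi \<mu> n)) \<longlonglongrightarrow> 1" "(\<lambda>n. phi q x u (q powi \<mu> n)) \<longlonglongrightarrow> 1" if "u \<noteq> 0" for u k
    using isCont_tendsto_compose[OF c[OF that, of 0], of "\<lambda>n. k * q powi \<mu> n" sequentially]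
      isCont_tendsto_compose[OF c[OF that, of 0] \<mu>] tendsto_mult_left[OF \<mu>, of k] by simp_all
  have "(\<lambda>n. P * \<Delta> (q powi \<mu> n)) \<longlonglongrightarrow> P * (1 * (x * 1) * ((inverse x)\<^sup>2 * 1) + 1 * (inverse x * 1) * 1
      + 1 * 1 * (x\<^sup>2 * 1) - 1 * (inverse x * 1) * (x\<^sup>2 * 1) - 1 * 1 * ((inverse x)\<^sup>2 * 1) - 1 * (x * 1) * 1)"
    unfolding \<Delta>_def Let_def by (intro tendsto_intros cc) (use x in simp_all)
  moreover have "P * \<Delta> (q powi \<mu> n) = det (Wronskian_m q m x)" for n
    unfolding val[symmetric] by (rule shift_invariant[of "\<lambda>m. det (Wronskian_m q m x)"]) (rule step)
  ultimately have "det (Wronskian_m q m x) = P * (1 * (x * 1) * ((inverse x)\<^sup>2 * 1) + 1 * (inverse x * 1) * 1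
      + 1 * 1 * (x\<^sup>2 * 1) - 1 * (inverse x * 1) * (x\<^sup>2 * 1) - 1 * 1 * ((inverse x)\<^sup>2 * 1) - 1 * (x * 1) * 1)"
    by (simp only: LIMSEQ_const_iff)
  also have "\<dots> = P * ((x - 1) * (inverse x - 1) * (inverse x - x))"
    using x by (simp add: field_simps power2_eq_square)
  also have "\<dots> = - (theta (- inverse (qhalf q) * x) q powi (-2)) * theta (- inverse (qhalf q) * x\<^sup>2) q"
    unfolding P_def by (rule pre_prod[OF assms])
  finally show ?thesis .
qed

section \<open>Laurent polynomials\<close>

lemma laurent_eval_add: "laurent_eval q x (a + b) = laurent_eval q x a + laurent_eval q x b"
  unfolding laurent_eval_def case_prod_unfold prod.collapse
  by (rule setsum_keys_plus_distrib) (simp_all add: algebra_simps)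

lemma laurent_eval_0 [simp]: "laurent_eval q x 0 = 0"
  by (simp add: laurent_eval_def)

lemma laurent_eval_single [simp]:
  "laurent_eval q x (Poly_Mapping.single (a, b) c) = of_int c * q powi a * x powi b"
  by (cases "c = 0") (simp_all add: laurent_eval_def)

lemma laurent_eval_uminus: "laurent_eval q x (- a) = - laurent_eval q x a"
  using laurent_eval_add[of q x a "- a"] by (simp add: eq_neg_iff_add_eq_0 add.commute)

lemma laurent_eval_diff: "laurent_eval q x (a - b) = laurent_eval q x a - laurent_eval q x b"
  using laurent_eval_add[of q x a "- b"] by (simp add: laurent_eval_uminus)

lemma laurent_eval_1 [simp]: "laurent_eval q x 1 = 1"
proof -
  have e: "(1 :: laurent_qx) = Poly_Mapping.single (0, 0) 1"
    by (simp only: zero_prod_def[symmetric] single_one)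
  show ?thesis unfolding e by simp
qed

lemma laurent_induct [case_names zero add]:
  fixes P :: "laurent_qx \<Rightarrow> bool"
  assumes "P 0" "\<And>a i j c. P a \<Longrightarrow> P (a + Poly_Mapping.single (i, j) c)"
  shows "P a"
proof (induction a rule: update_induct)
  case (update f k c)
  obtain i j where k: "k = (i, j)" by (cases k)
  have "Poly_Mapping.update k c f = f + Poly_Mapping.single (i, j) c"
    using update by (intro poly_mapping_eqI) (auto simp: k lookup_update lookup_add lookup_single in_keys_iff when_def)
  then show ?case using assms(2) update by simp
qed (rule assms(1))

lemma laurent_eval_mult:
  assumes "q \<noteq> 0" "x \<noteq> 0"
  shows "laurent_eval q x (a * b) = laurent_eval q x a * laurent_eval q x b"
proof (induction a rule: laurent_induct)
  case (add a i j c)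
  have "laurent_eval q x (Poly_Mapping.single (i, j) c * b) = laurent_eval q x (Poly_Mapping.single (i, j) c) * laurent_eval q x b"
  proof (induction b rule: laurent_induct)
    case (add b k l d)
    have "laurent_eval q x (Poly_Mapping.single (i, j) c * Poly_Mapping.single (k, l) d) =
        laurent_eval q x (Poly_Mapping.single (i, j) c) * laurent_eval q x (Poly_Mapping.single (k, l) d)"
      using assms by (simp add: mult_single power_int_add)
    then show ?case using add by (simp only: distrib_left laurent_eval_add)
  qed simp
  then show ?case using add by (simp only: distrib_right laurent_eval_add)
qed simp

lemma laurent_eval_matrix_mult:
  fixes A B :: "laurent_qx ^ 3 ^ 3"
  assumes "q \<noteq> 0" "x \<noteq> 0"
  shows "map_matrix (laurent_eval q x) (A ** B) = map_matrix (laurent_eval q x) A ** map_matrix (laurent_eval q x) B"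
  by (simp add: vec_eq_iff matrix_matrix_mult_def sum_3 laurent_eval_add laurent_eval_mult[OF assms])

lemma laurent_eval_transpose:
  "map_matrix (laurent_eval q x) (transpose A) = transpose (map_matrix (laurent_eval q x) A)"
  by (simp add: vec_eq_iff transpose_def)

lemma invertible_mult:
  fixes A B :: "'a :: comm_ring_1 ^ 'n ^ 'n"
  assumes "invertible A" "invertible B"
  shows "invertible (A ** B)"
proof -
  obtain A' B' where AB: "A ** A' = mat 1" "A' ** A = mat 1" "B ** B' = mat 1" "B' ** B = mat 1"
    using assms by (auto simp: invertible_def)
  have "(A ** B) ** (B' ** A') = A ** (B ** B') ** A'" "(B' ** A') ** (A ** B) = B' ** (A' ** A) ** B"
    by (simp_all only: matrix_mul_assoc)
  then show ?thesis unfolding invertible_def AB matrix_mul_rid using AB by metis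
qed

lemma invertible_transpose_ring:
  fixes A :: "'a :: comm_ring_1 ^ 'n ^ 'n"
  assumes "invertible A"
  shows "invertible (transpose A)"
  using assms unfolding invertible_def by (metis matrix_transpose_mul transpose_mat)

section \<open>Companion matrices over Laurent polynomials\<close>

definition companion :: "'a :: comm_ring_1 \<Rightarrow> 'a \<Rightarrow> 'a ^ 3 ^ 3" where
  "companion s t = vector [vector [0, 1, 0], vector [0, 0, 1], vector [1, - s, s - t]]"

definition companion_inv :: "'a :: comm_ring_1 \<Rightarrow> 'a \<Rightarrow> 'a ^ 3 ^ 3" where
  "companion_inv s t = vector [vector [s, t - s, 1], vector [1, 0, 0], vector [0, 1, 0]]"

lemma companion_inverse:
  "companion s t ** companion_inv s t = mat 1" "companion_inv s t ** companion s t = mat 1"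
  by (simp_all add: vec_eq_iff forall_3 matrix_matrix_mult_def sum_3 mat_def companion_def companion_inv_def)

lemma Wronskian_m_Suc:
  assumes "admissible q" "generic q x"
  shows "Wronskian_m q (m + 1) x = companion (1 + x + inverse x) (q powi (m + 2)) ** Wronskian_m q m x"
proof -
  have q: "q \<noteq> 0" using assms(1) by (simp add: admissible_def)
  have idx: "m + 1 + 1 = m + 2" "m + 1 + 2 = m + 3" by simp_all
  have qp: "q powi (m + 2) = q\<^sup>2 * q powi m" using q by (simp add: power_int_add power_int_numeral)
  show ?thesis
    unfolding vec_eq_iff forall_3 matrix_matrix_mult_def qp
    by (simp add: sum_3 companion_def idx block_recurrence[OF assms, of m] algebra_simps del: blocks_simps)
qed

definition laurent_s :: laurent_qx where
  "laurent_s = 1 + Poly_Mapping.single (0, 1) 1 + Poly_Mapping.single (0, -1) 1"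

lemma laurent_companion:
  assumes "q \<noteq> 0" "x \<noteq> 0"
  shows "map_matrix (laurent_eval q x) (companion laurent_s (Poly_Mapping.single (e, 0) 1)) =
      companion (1 + x + inverse x) (q powi e)"
    "map_matrix (laurent_eval q x) (companion_inv laurent_s (Poly_Mapping.single (e, 0) 1)) =
      companion_inv (1 + x + inverse x) (q powi e)"
  by (simp_all add: vec_eq_iff forall_3 companion_def companion_inv_def laurent_s_def laurent_eval_add
       laurent_eval_diff laurent_eval_uminus power_int_minus)

definition laurent_family :: "(complex \<Rightarrow> complex \<Rightarrow> complex ^ 3 ^ 3) \<Rightarrow> bool" where
  "laurent_family F \<longleftrightarrow> (\<exists>L :: laurent_qx ^ 3 ^ 3. invertible L \<and>
     (\<forall>q x. admissible q \<and> generic q x \<longrightarrow> F q x = map_matrix (laurent_eval q x) L))"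

lemma generic_nonzero: "admissible q \<Longrightarrow> generic q x \<Longrightarrow> q \<noteq> 0 \<and> x \<noteq> 0"
  by (auto simp: admissible_def generic_def)

lemma laurent_family_mult:
  assumes "laurent_family F" "laurent_family G"
    and "\<And>q x. admissible q \<Longrightarrow> generic q x \<Longrightarrow> H q x = F q x ** G q x"
  shows "laurent_family H"
proof -
  obtain K L :: "laurent_qx ^ 3 ^ 3" where "invertible K" "invertible L"
    and KL: "\<And>q x. admissible q \<Longrightarrow> generic q x \<Longrightarrow> F q x = map_matrix (laurent_eval q x) K"
      "\<And>q x. admissible q \<Longrightarrow> generic q x \<Longrightarrow> G q x = map_matrix (laurent_eval q x) L"
    using assms(1,2) unfolding laurent_family_def by blast
  then show ?thesis
    unfolding laurent_family_def
    by (intro exI[of _ "K ** L"]) (auto simp: assms(3) KL laurent_eval_matrix_mult generic_nonzero intro: invertible_mult)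
qed

lemma laurent_family_transpose:
  assumes "laurent_family F" "\<And>q x. admissible q \<Longrightarrow> generic q x \<Longrightarrow> H q x = transpose (F q x)"
  shows "laurent_family H"
proof -
  obtain K :: "laurent_qx ^ 3 ^ 3" where "invertible K"
    and K: "\<And>q x. admissible q \<Longrightarrow> generic q x \<Longrightarrow> F q x = map_matrix (laurent_eval q x) K"
    using assms(1) unfolding laurent_family_def by blast
  then show ?thesis
    unfolding laurent_family_def
    by (intro exI[of _ "transpose K"]) (auto simp: assms(2) K laurent_eval_transpose intro: invertible_transpose_ring)
qed

lemma laurent_family_companion:
  "laurent_family (\<lambda>q x. companion (1 + x + inverse x) (q powi e))"
  "laurent_family (\<lambda>q x. companion_inv (1 + x + inverse x) (q powi e))"
proof -
  have "invertible (companion s t)" "invertible (companion_inv s t)" for s t :: laurent_qx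
    unfolding invertible_def using companion_inverse by blast+
  then show "laurent_family (\<lambda>q x. companion (1 + x + inverse x) (q powi e))"
    "laurent_family (\<lambda>q x. companion_inv (1 + x + inverse x) (q powi e))"
    unfolding laurent_family_def using laurent_companion generic_nonzero by metis+
qed

lemma int_shift_iff:
  assumes "\<And>m :: int. P m \<longleftrightarrow> P (m + 1)"
  shows "P m \<longleftrightarrow> P l"
  using shift_invariant[of P m l] assms by blast

text \<open>The case m = l = -1 is the orthogonality relation. A step in m or l multiplies by a
  companion matrix or its inverse from the left, or by a transposed one from the right; for 1 / q
  the entry is still a power of q, with a negative exponent.\<close>

lemma laurent_Wronskian: "laurent_family (\<lambda>q x. Wronskian_m q m x ** transpose (Wronskian_m (inverse q) l x))"
proof -
  let ?F = "\<lambda>m l q x. Wronskian_m q m x ** transpose (Wronskian_m (inverse q) l x)"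
  let ?K = "\<lambda>e q x. companion (1 + x + inverse x) (q powi e)"
  let ?L = "\<lambda>e q x. companion_inv (1 + x + inverse x) (q powi e)"
  have m: "laurent_family (?F m l) \<longleftrightarrow> laurent_family (?F (m + 1) l)" for m l
  proof
    show "laurent_family (?F (m + 1) l)" if "laurent_family (?F m l)"
      by (rule laurent_family_mult[OF laurent_family_companion(1)[of "m + 2"] that])
         (simp only: Wronskian_m_Suc matrix_mul_assoc)
    show "laurent_family (?F m l)" if "laurent_family (?F (m + 1) l)"
      by (rule laurent_family_mult[OF laurent_family_companion(2)[of "m + 2"] that])
         (simp only: Wronskian_m_Suc matrix_mul_assoc companion_inverse matrix_mul_lid)
  qed
  have l: "laurent_family (?F m l) \<longleftrightarrow> laurent_family (?F m (l + 1))" for m l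
  proof
    have e: "inverse q powi (l + 2) = q powi (- (l + 2))" for q :: complex
      by (simp only: power_int_inverse power_int_minus)
    have S: "Wronskian_m (inverse q) (l + 1) x = ?K (- (l + 2)) q x ** Wronskian_m (inverse q) l x"
      if "admissible q" "generic q x" for q x
      unfolding e[symmetric] by (rule Wronskian_m_Suc[OF admissible_inverse[OF that(1)] generic_inverse(2)[OF that(2)]])
    show "laurent_family (?F m (l + 1))" if "laurent_family (?F m l)"
      by (rule laurent_family_mult[OF that laurent_family_transpose[OF laurent_family_companion(1)[of "- (l + 2)"] refl]])
         (simp only: S matrix_transpose_mul matrix_mul_assoc)
    have id: "transpose (?K e q x) ** transpose (?L e q x) = mat 1" for e q x
      by (simp only: companion_inverse transpose_mat flip: matrix_transpose_mul)
    show "laurent_family (?F m l)" if "laurent_family (?F m (l + 1))"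
      by (rule laurent_family_mult[OF that laurent_family_transpose[OF laurent_family_companion(2)[of "- (l + 2)"] refl]])
         (simp only: S matrix_transpose_mul id matrix_mul_rid flip: matrix_mul_assoc)
  qed
  have "laurent_family (?F (-1) (-1))"
  proof -
    let ?s = "Poly_Mapping.single (0, 1) 1 + Poly_Mapping.single (0, -1) 1 :: laurent_qx"
    let ?Y = "vector [vector [1, 0, 0], vector [0, 0, 1], vector [0, 1, ?s]] :: laurent_qx ^ 3 ^ 3"
    let ?X = "vector [vector [1, 0, 0], vector [0, - ?s, 1], vector [0, 1, 0]] :: laurent_qx ^ 3 ^ 3"
    have "?Y ** ?X = mat 1" "?X ** ?Y = mat 1"
      by (simp_all add: vec_eq_iff forall_3 matrix_matrix_mult_def sum_3 mat_def)
    then have "invertible ?Y" by (auto simp: invertible_def)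
    moreover have "?F (-1) (-1) q x = map_matrix (laurent_eval q x) ?Y" if "admissible q" "generic q x" for q x
      unfolding Wronskian_orthogonality[OF that]
      by (simp add: vec_eq_iff forall_3 laurent_eval_add power_int_minus)
    ultimately show ?thesis unfolding laurent_family_def by blast
  qed
  then show ?thesis
    using int_shift_iff[of "\<lambda>m. laurent_family (?F m (-1))", OF m, of "-1" m]
      int_shift_iff[of "\<lambda>l. laurent_family (?F m l)", OF l, of "-1" l] by blast
qed

section \<open>Meromorphy in \<open>x\<close>\<close>

lemma cosparse_punctured: "(\<forall>\<^sub>\<approx>x\<in>-{0::complex}. P x) \<longleftrightarrow> (\<forall>x. x \<noteq> 0 \<longrightarrow> eventually P (at x))"
  by (subst eventually_cosparse_open_eq) auto

lemma cosparse_scale: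
  assumes "c \<noteq> 0" "\<forall>\<^sub>\<approx>x\<in>-{0::complex}. P x"
  shows "\<forall>\<^sub>\<approx>x\<in>-{0::complex}. P (c * x)"
  unfolding cosparse_punctured
proof (intro allI impI)
  fix x :: complex assume "x \<noteq> 0"
  have "filterlim (\<lambda>y. c * y) (at (c * x)) (at x)"
    by (rule filterlim_atI) (use assms(1) in \<open>auto intro!: tendsto_intros simp: eventually_at_filter\<close>)
  moreover have "eventually P (at (c * x))"
    using assms \<open>x \<noteq> 0\<close> unfolding cosparse_punctured by simp
  ultimately show "\<forall>\<^sub>F y in at x. P (c * y)" by (rule eventually_compose_filterlim[rotated])
qed

section \<open>Exceptional points in annuli\<close>

definition annulus :: "real \<Rightarrow> complex set" where "annulus R = {z. 1 / R < norm z \<and> norm z < R}"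

lemma open_annulus: "open (annulus R)"
  unfolding annulus_def by (intro open_Collect_conj open_Collect_less continuous_intros)

lemma in_annulus:
  assumes "x \<noteq> 0"
  obtains R where "R \<ge> 1" "x \<in> annulus R"
proof -
  obtain R where R: "R \<ge> 1" "norm x \<le> R" "1 / R \<le> norm x" using annulus_ex[OF assms assms] by metis
  then have "1 / (R + 1) < 1 / R" by (simp add: field_simps)
  then have "x \<in> annulus (R + 1)" using R by (simp add: annulus_def)
  then show ?thesis using that[of "R + 1"] R by simp
qed

lemma annulusD:
  assumes "x \<in> annulus R"
  shows "norm x \<le> R" "1 / R \<le> norm x" "R \<ge> 1 \<Longrightarrow> x \<noteq> 0"
    "R \<ge> 1 \<Longrightarrow> inverse x \<in> annulus R"
proof -
  have n: "1 / R < norm x" "norm x < R" using assms by (auto simp: annulus_def)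
  then show "norm x \<le> R" "1 / R \<le> norm x" by simp_all
  assume R: "R \<ge> 1"
  have pos: "norm x > 0" using n(1) R by (intro less_trans[OF _ n(1)]) simp
  then show "x \<noteq> 0" by simp
  have "1 / R < inverse t \<and> inverse t < R" if "1 / R < t" "t < R" "t > 0" for t
    using that R by (simp add: field_simps)
  from this[OF n pos] show "inverse x \<in> annulus R" by (simp add: annulus_def norm_inverse)
qed

text \<open>In an annulus the equation y^2 = q^k bounds k through norms, and each k contributes
  finitely many points. So the exceptions do not accumulate in the punctured plane.\<close>

lemma generic_cosparse:
  assumes "admissible q"
  shows "\<forall>\<^sub>\<approx>x\<in>-{0}. generic q x"
  unfolding cosparse_punctured
proof (intro allI impI)
  fix x :: complex assume "x \<noteq> 0"
  then obtain R where R: "R \<ge> 1" "x \<in> annulus R" by (rule in_annulus)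
  have q: "norm q > 0" "norm q \<noteq> 1" using assms by (auto simp: admissible_def)
  define B where "B = {y \<in> annulus R. \<exists>k. y\<^sup>2 = q powi k}"
  \<comment> \<open>Logarithms of y^2 = q^k give |k| |ln (norm q)| = 2 |ln (norm y)|, which is at
    most 2 ln R.\<close>
  define L where "L = 2 * ln R / \<bar>ln (norm q)\<bar>"
  have "B \<subseteq> (\<Union>k\<in>{- \<lceil>L\<rceil>..\<lceil>L\<rceil>}. {y. y\<^sup>2 = q powi k})"
  proof
    fix y assume "y \<in> B"
    then obtain k where y: "y \<in> annulus R" "y\<^sup>2 = q powi k" by (auto simp: B_def)
    have ny: "norm y > 0" using annulusD(3)[OF y(1) R(1)] by simp
    have "norm (y\<^sup>2) = norm (q powi k)" by (simp only: y(2))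
    then have "norm y ^ 2 = norm q powr of_int k"
      unfolding norm_power norm_power_int using q powr_real_of_int'[of "norm q" k] by simp
    then have "2 * ln (norm y) = of_int k * ln (norm q)"
      using arg_cong[of _ _ ln] ny q by (metis ln_powr ln_realpow of_nat_numeral)
    moreover have "\<bar>ln (norm y)\<bar> \<le> ln R"
    proof -
      have "ln (norm y) \<le> ln R" using annulusD(1)[OF y(1)] ny R(1) by (subst ln_le_cancel_iff) auto
      moreover have "ln (1 / R) \<le> ln (norm y)" using annulusD(2)[OF y(1)] R(1) ny by (subst ln_le_cancel_iff) auto
      ultimately show ?thesis using R(1) by (simp add: ln_div)
    qed
    ultimately have "\<bar>of_int k\<bar> * \<bar>ln (norm q)\<bar> \<le> 2 * ln R"
      by (simp flip: abs_mult)
    then have "\<bar>of_int k\<bar> \<le> L" using q by (simp add: L_def field_simps)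
    then have "k \<in> {- \<lceil>L\<rceil>..\<lceil>L\<rceil>}" by (simp add: abs_le_iff) linarith
    then show "y \<in> (\<Union>k\<in>{- \<lceil>L\<rceil>..\<lceil>L\<rceil>}. {y. y\<^sup>2 = q powi k})" using y by blast
  qed
  moreover have "finite (\<Union>k\<in>{- \<lceil>L\<rceil>..\<lceil>L\<rceil>}. {y. y\<^sup>2 = q powi k})"
    by (intro finite_UN_I finite_nth_roots) auto
  ultimately have "finite B" by (rule finite_subset)
  then have "\<not> x islimpt B" by (rule islimpt_finite)
  then have "\<forall>\<^sub>F y in at x. y \<notin> B" by (simp add: islimpt_conv_frequently_at frequently_def)
  moreover have "\<forall>\<^sub>F y in at x. y \<in> annulus R"
    by (rule eventually_at_in_open'[OF open_annulus R(2)])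
  ultimately show "\<forall>\<^sub>F y in at x. generic q y"
  proof eventually_elim
    case (elim y)
    then show ?case using annulusD(3)[OF elim(2) R(1)] by (auto simp: B_def generic_def)
  qed
qed

text \<open>A vanishing factor puts norm q^k between 1 / R^2 and R^2, and only finitely many k allow
  this as norm q is not 1.\<close>

lemma ratio_denominator_tail:
  assumes "admissible q" "R \<ge> 1"
  shows "\<exists>N. \<forall>k\<ge>N. \<forall>x u. x \<in> annulus R \<longrightarrow> u \<in> annulus R \<longrightarrow>
    (1 - u * q ^ k) * (1 - x * (u * q ^ k)) * (1 - u * q ^ k / x) \<noteq> 0"
proof -
  have B: "1 / R\<^sup>2 \<le> norm q ^ k \<and> norm q ^ k \<le> R\<^sup>2"
    if x: "x \<in> annulus R" and u: "u \<in> annulus R"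
      and z: "(1 - u * q ^ k) * (1 - x * (u * q ^ k)) * (1 - u * q ^ k / x) = 0" for x u k
  proof -
    have n: "norm x > 0" "norm u > 0" using annulusD(3)[OF x assms(2)] annulusD(3)[OF u assms(2)] by auto
    have "\<exists>y \<in> {1, norm x, 1 / norm x}. norm q ^ k * (norm u * y) = 1"
    proof -
      consider "u * q ^ k = 1" | "x * (u * q ^ k) = 1" | "u * q ^ k / x = 1" using z by auto
      then show ?thesis
      proof cases
        case 1
        then have "norm (u * q ^ k) = 1" by simp
        then show ?thesis by (simp add: norm_mult norm_power mult.commute)
      next
        case 2
        then have "norm (x * (u * q ^ k)) = 1" by simp
        then show ?thesis by (simp add: norm_mult norm_power mult_ac)
      next
        case 3
        then have "norm (u * q ^ k / x) = 1" by simp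
        then have "norm q ^ k * (norm u * (1 / norm x)) = 1"
          by (simp only: norm_divide norm_mult norm_power times_divide_eq_right mult_1_right mult_ac)
        then show ?thesis by blast
      qed
    qed
    then obtain y where y: "y \<in> {1, norm x, 1 / norm x}" "norm q ^ k * (norm u * y) = 1" by blast
    have "1 / R \<le> 1 / norm x" "1 / norm x \<le> R"
      using assms(2) annulusD(1,2)[OF x] n by (simp_all add: field_simps)
    moreover have "1 / R \<le> 1" using assms(2) by simp
    ultimately have yb: "1 / R \<le> y" "y \<le> R"
      using y(1) assms(2) annulusD(1,2)[OF x] by auto
    have c: "1 / R\<^sup>2 \<le> norm u * y" "norm u * y \<le> R\<^sup>2"
    proof -
      have "1 / R * (1 / R) \<le> norm u * y" using yb annulusD(1,2)[OF u] assms(2) n by (intro mult_mono) auto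
      then show "1 / R\<^sup>2 \<le> norm u * y" by (simp add: power2_eq_square)
      show "norm u * y \<le> R\<^sup>2" unfolding power2_eq_square
        using yb annulusD(1,2)[OF u] assms(2) n by (intro mult_mono) (auto intro: order_trans[of _ "1 / R"])
    qed
    have "0 < 1 / R\<^sup>2" using assms(2) by simp
    then have pos: "R\<^sup>2 > 0" "0 < norm u * y" using c(1) assms(2) by (simp, linarith)
    have "1 / a \<le> T \<and> T \<le> a" if "T * b = 1" "b > 0" "a > 0" "1 / a \<le> b" "b \<le> a" for a b T :: real
    proof -
      have "T = 1 / b" using that by (simp add: eq_divide_eq)
      then show ?thesis using that(2-) by (simp only:) (simp add: field_simps)
    qed
    from this[OF y(2) pos(2,1) c] show ?thesis .
  qed
  have "\<forall>\<^sub>F k in sequentially. \<not> (1 / R\<^sup>2 \<le> norm q ^ k \<and> norm q ^ k \<le> R\<^sup>2)"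
  proof (cases "norm q < 1")
    case True
    have "(\<lambda>k. norm q ^ k) \<longlonglongrightarrow> 0" using True by (intro LIMSEQ_power_zero) auto
    then have "\<forall>\<^sub>F k in sequentially. norm q ^ k < 1 / R\<^sup>2" using assms(2) by (intro order_tendstoD) auto
    then show ?thesis by eventually_elim auto
  next
    case False
    then have "norm q > 1" using assms(1) by (auto simp: admissible_def)
    moreover obtain n where "R\<^sup>2 < norm q ^ n" using real_arch_pow[OF \<open>norm q > 1\<close>] by blast
    ultimately have "R\<^sup>2 < norm q ^ k" if "k \<ge> n" for k
      using power_increasing[OF that, of "norm q"] by linarith
    then have "\<forall>\<^sub>F k in sequentially. R\<^sup>2 < norm q ^ k" by (rule eventually_sequentiallyI)
    then show ?thesis by eventually_elim auto
  qed
  then obtain N where "\<And>k. k \<ge> N \<Longrightarrow> \<not> (1 / R\<^sup>2 \<le> norm q ^ k \<and> norm q ^ k \<le> R\<^sup>2)"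
    by (auto simp: eventually_sequentially)
  then show ?thesis using B by (intro exI[of _ N]) blast
qed

text \<open>Only finitely many factors of the coefficients have poles in a given annulus.\<close>

lemma phi_meromorphic:
  assumes "admissible q" "u holomorphic_on -{0}" "\<And>x. x \<noteq> 0 \<Longrightarrow> u x \<in> {1, x, inverse x}"
  shows "(\<lambda>x. phi q x (u x) M) meromorphic_on -{0}"
proof (subst meromorphic_on_meromorphic_at, intro ballI)
  fix z :: complex assume "z \<in> -{0}"
  then obtain R where R: "R \<ge> 1" "z \<in> annulus R" using in_annulus[of z] by auto
  let ?S = "annulus R"
  have S0: "?S \<subseteq> -{0}" using annulusD(3)[OF _ R(1)] by auto
  have one: "1 \<in> ?S"
  proof -
    have "R \<noteq> 1" using R(2) by (auto simp: annulus_def)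
    then show ?thesis using R(1) by (simp add: annulus_def field_simps)
  qed
  have uS: "u x \<in> ?S" if "x \<in> ?S" for x
    using assms(3)[OF annulusD(3)[OF that R(1)]] that annulusD(4)[OF that R(1)] one by auto
  have hu: "u holomorphic_on ?S" using assms(2) S0 by (rule holomorphic_on_subset)
  have mu: "u meromorphic_on ?S"
    by (rule analytic_on_imp_meromorphic_on) (use hu open_annulus in \<open>simp add: analytic_on_open\<close>)
  have \<epsilon>: "1 / (2 * (norm M + 1)) > 0" by (simp add: add_nonneg_pos)
  obtain N1 where N1: "\<And>k x u. k \<ge> N1 \<Longrightarrow> x \<in> ?S \<Longrightarrow> u \<in> ?S \<Longrightarrow> norm (ratio x (u * q ^ k)) \<le> 1 / (2 * (norm M + 1))"
    using ratio_tail[OF assms(1) R(1) \<epsilon>] annulusD(1,2) by meson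
  obtain N2 where N2: "\<And>k x u. k \<ge> N2 \<Longrightarrow> x \<in> ?S \<Longrightarrow> u \<in> ?S \<Longrightarrow>
      (1 - u * q ^ k) * (1 - x * (u * q ^ k)) * (1 - u * q ^ k / x) \<noteq> 0"
    using ratio_denominator_tail[OF assms(1) R(1)] by meson
  define N where "N = max N1 N2"
  \<comment> \<open>The tail of the series divided by its term of index N. From N on the factors
    have no poles in the annulus and are at most 1 / 2 in norm, so the sum \<open>G\<close>
    converges uniformly and is holomorphic there.\<close>
  define T where "T n x = (\<Prod>j<n. ratio x (u x * q ^ Suc (N + j)) * M)" for n x
  have hT: "T n holomorphic_on ?S" for n
    unfolding T_def[abs_def] ratio_def
    by (intro holomorphic_intros hu) (use N2[of "Suc (N + _)"] uS S0 in \<open>auto simp: N_def simp del: power_Suc\<close>)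
  have bT: "norm (T n x) \<le> (1 / 2) ^ n" if "x \<in> ?S" for n x
  proof -
    have "norm (T n x) = (\<Prod>j<n. norm (ratio x (u x * q ^ Suc (N + j)) * M))" by (simp only: T_def prod_norm)
    also have "\<dots> \<le> (\<Prod>j<n. 1 / 2)"
    proof (rule prod_mono, intro conjI)
      fix j
      have "norm (ratio x (u x * q ^ Suc (N + j))) * norm M \<le> 1 / (2 * (norm M + 1)) * norm M"
        by (intro mult_right_mono N1 that uS) (auto simp: N_def)
      also have "\<dots> \<le> 1 / 2"
      proof -
        have "1 / (2 * (a + 1)) * a \<le> 1 / 2" if "a \<ge> 0" for a :: real using that by (auto simp: field_simps)
        from this[of "norm M"] show ?thesis by (simp only: norm_ge_zero)
      qed
      finally show "norm (ratio x (u x * q ^ Suc (N + j)) * M) \<le> 1 / 2" by (simp only: norm_mult)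
    qed simp
    finally show ?thesis by simp
  qed
  define G where "G x = suminf (\<lambda>n. T n x)" for x
  have lim: "uniform_limit ?S (\<lambda>n x. \<Sum>i<n. T i x) G sequentially"
    unfolding G_def[abs_def] by (rule Weierstrass_m_test[where M = "\<lambda>n. (1 / 2) ^ n"]) (use bT in auto)
  have "G holomorphic_on ?S"
  proof (rule holomorphic_uniform_sequence[OF open_annulus])
    show "(\<lambda>x. \<Sum>i<n. T i x) holomorphic_on ?S" for n by (intro holomorphic_intros hT)
    fix x assume "x \<in> ?S"
    then have "\<exists>d>0. cball x d \<subseteq> ?S" by (rule bspec[OF iffD1[OF open_contains_cball open_annulus]])
    then show "\<exists>d>0. cball x d \<subseteq> ?S \<and> uniform_limit (cball x d) (\<lambda>n x. \<Sum>i<n. T i x) G sequentially"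
      using uniform_limit_on_subset[OF lim] by blast
  qed
  then have mG: "G meromorphic_on ?S"
    by (intro analytic_on_imp_meromorphic_on) (use open_annulus in \<open>simp add: analytic_on_open\<close>)
  have mac: "(\<lambda>x. ac q x (u x) n) meromorphic_on ?S" for n
    unfolding ac_def ratio_def by (intro meromorphic_intros mu)
  have "(\<lambda>x. ac q x (u x) N * M ^ N * G x + (\<Sum>n<N. ac q x (u x) n * M ^ n)) meromorphic_on ?S"
    by (intro meromorphic_intros mac mG)
  moreover have "ac q x (u x) N * M ^ N * G x + (\<Sum>n<N. ac q x (u x) n * M ^ n) = phi q x (u x) M" if x: "x \<in> ?S" for x
  proof -
    have x0: "x \<noteq> 0" "u x \<noteq> 0" using S0 x uS[OF x] by auto
    have "ac q x (u x) (n + N) * M ^ (n + N) = ac q x (u x) N * M ^ N * T n x" for n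
    proof (induction n)
      case (Suc n)
      have "ac q x (u x) (Suc n + N) * M ^ (Suc n + N) = (ac q x (u x) (n + N) * M ^ (n + N)) * (ratio x (u x * q ^ Suc (N + n)) * M)"
        by (simp only: add_Suc ac_Suc power_Suc2[of M] add.commute[of N n] mult_ac)
      then show ?case unfolding Suc.IH by (simp only: T_def prod.lessThan_Suc mult.assoc)
    qed (simp add: T_def)
    moreover have "summable (\<lambda>n. T n x)"
      by (rule summable_comparison_test'[where g = "\<lambda>n. (1 / 2) ^ n"]) (use bT[OF x] in auto)
    ultimately have "suminf (\<lambda>n. ac q x (u x) (n + N) * M ^ (n + N)) = ac q x (u x) N * M ^ N * G x"
      unfolding G_def by (simp only: suminf_mult)
    then show ?thesis
      unfolding phi_def using suminf_split_initial_segment[OF summable_ac[OF assms(1) x0], of M N] by simp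
  qed
  moreover have "z \<in> ?S" by (rule R)
  ultimately have "(\<lambda>x. phi q x (u x) M) meromorphic_on ?S"
    by (subst meromorphic_on_cong[of _ _ "\<lambda>x. ac q x (u x) N * M ^ N * G x + (\<Sum>n<N. ac q x (u x) n * M ^ n)", OF _ refl])
       (auto intro!: eventually_mono[OF eventually_at_in_open'[OF open_annulus]])
  then show "(\<lambda>x. phi q x (u x) M) meromorphic_on {z}"
    by (rule meromorphic_on_subset) (use R in auto)
qed

lemma qpoch_inf_meromorphic:
  assumes "norm q < 1" "f holomorphic_on -{0}"
  shows "(\<lambda>x. qpoch_inf (f x) q) meromorphic_on -{0}"
proof -
  have "(\<lambda>x. qpoch_inf (f x) q) holomorphic_on -{0}"
    using holomorphic_on_compose_gen[OF assms(2) qpoch_inf_holomorphic[OF assms(1), of UNIV]] by (simp add: o_def)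
  moreover have "open (-{0::complex})" by auto
  ultimately show ?thesis
    by (intro analytic_on_imp_meromorphic_on) (simp add: analytic_on_open)
qed

lemma blocks_meromorphic:
  assumes "admissible q"
  shows "(\<lambda>x. blocks q m x $ k) meromorphic_on -{0}"
proof -
  have ih: "inverse holomorphic_on (-{0::complex})" by (auto intro!: holomorphic_intros)
  have u: "(\<lambda>x. uroot x $ k) holomorphic_on -{0}"
  proof -
    consider "k = 1" | "k = 2" | "k = 3" using exhaust_3[of k] by blast
    then show ?thesis by cases (auto intro!: holomorphic_intros)
  qed
  then have mu: "(\<lambda>x. uroot x $ k) meromorphic_on -{0}"
  proof -
    have "open (-{0::complex})" by auto
    then show ?thesis using u by (intro analytic_on_imp_meromorphic_on) (simp add: analytic_on_open)
  qed
  have pA: "preA q meromorphic_on -{0}"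
    using assms unfolding preA_def[abs_def]
    by (cases rule: admissible_cases; simp; intro meromorphic_intros qpoch_inf_meromorphic; auto intro!: holomorphic_intros)
  have pB: "(\<lambda>x. preB q (g x)) meromorphic_on -{0}" if "g holomorphic_on -{0}" "\<And>x. x \<noteq> 0 \<Longrightarrow> g x \<noteq> 0" for g
    using assms that unfolding preB_def[abs_def]
    by (cases rule: admissible_cases; simp; intro meromorphic_intros qpoch_inf_meromorphic; auto intro!: holomorphic_intros)
  have "(\<lambda>x. pre q x $ k) meromorphic_on -{0}"
  proof -
    consider "k = 1" | "k = 2" | "k = 3" using exhaust_3[of k] by blast
    then show ?thesis by cases (use pA pB[of "\<lambda>x. x"] pB[of inverse] ih in auto)
  qed
  then have "(\<lambda>x. pre q x $ k * (uroot x $ k) powi m * phi q x (uroot x $ k) (q powi m)) meromorphic_on -{0}"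
    by (intro meromorphic_intros mu phi_meromorphic[OF assms u] uroot_in)
  \<comment> \<open>At the remaining points the defining formulas divide by zero and differ from the
    series; meromorphy ignores such a set.\<close>
  moreover have "\<forall>\<^sub>\<approx>x\<in>-{0}. blocks q m x $ k = pre q x $ k * (uroot x $ k) powi m * phi q x (uroot x $ k) (q powi m)"
    using generic_cosparse[OF assms] by eventually_elim (rule blocks_series[OF assms])
  ultimately show ?thesis by (subst meromorphic_on_cong'[OF _ refl])
qed

lemma coef_meromorphic:
  assumes "admissible q" "\<And>l. (\<lambda>x. f l x) meromorphic_on -{0}"
  shows "(\<lambda>x. coef q m x k (\<lambda>l. f l x)) meromorphic_on -{0}"
proof -
  note b = blocks_meromorphic[OF admissible_inverse[OF assms(1)]]
  have "(\<lambda>x. dual_blocks q m x $ 1 $ k) meromorphic_on -{0}" "(\<lambda>x. dual_blocks q m x $ 2 $ k) meromorphic_on -{0}"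
    "(\<lambda>x. dual_blocks q m x $ 3 $ k) meromorphic_on -{0}"
    unfolding dual_blocks_def Let_def vector_3 vector_add_component vector_smult_component
    by (intro meromorphic_intros b)+
  then show ?thesis unfolding coef_def by (intro meromorphic_intros assms)
qed

section \<open>The system of equations in \<open>x\<close> and \<open>m\<close>\<close>

lemma kills_atI:
  assumes "\<And>m. \<forall>\<^sub>\<approx>x\<in>-{0}. qreg q m x P \<longrightarrow> act q P f m x = 0"
  shows "kills_at q P f"
  unfolding kills_at_def
proof
  fix m
  show "\<forall>\<^sub>\<approx>x\<in>-{0}. (\<forall>k\<in>Poly_Mapping.keys P. regular_at x (q powi m) q (Poly_Mapping.lookup P k)) \<longrightarrow> act q P f m x = 0"
    using assms[of m] by (simp only: qreg_keys)
qed

lemma kills_atD: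
  assumes "kills_at q P f" "\<And>x. qreg q m x P"
  shows "\<forall>\<^sub>\<approx>x\<in>-{0}. act q P f m x = 0"
  using assms(1)[unfolded kills_at_def, rule_format, of m]
  by (rule eventually_mono) (use assms(2) in \<open>simp add: qreg_keys\<close>)

lemma act_blocks:
  assumes "admissible q" "generic q x" "qreg q m x P"
  shows "treg q m x (nform P)" "act q P (\<lambda>m x. blocks q m x $ k) m x = pair3 q (nform P) (\<lambda>m x. blocks q m x $ k) m x"
proof -
  have q: "q \<noteq> 0" "x \<noteq> 0" using generic_nonzero[OF assms(1,2)] by auto
  have "qsol q (\<lambda>m x. blocks q m x $ k) (q ^ j * x)" for j
    by (rule qsol_blocks[OF assms(1) generic_shift[OF assms(2) q(1)]])
  from act_eq_pair3[OF this q assms(3)]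
  show "treg q m x (nform P)" "act q P (\<lambda>m x. blocks q m x $ k) m x = pair3 q (nform P) (\<lambda>m x. blocks q m x $ k) m x" .
qed

lemma I52_kills_blocks:
  assumes "admissible q" "P \<in> I52"
  shows "kills_at q P (\<lambda>m x. blocks q m x $ k)"
proof (rule kills_atI)
  fix m
  show "\<forall>\<^sub>\<approx>x\<in>-{0}. qreg q m x P \<longrightarrow> act q P (\<lambda>m x. blocks q m x $ k) m x = 0"
    using generic_cosparse[OF assms(1)]
    by eventually_elim (auto simp: act_blocks[OF assms(1)] nform_I52[OF assms(2)] pair3_def zero_prod_def)
qed

section \<open>The generators as equations at a point\<close>

definition P1c :: "complex \<Rightarrow> complex \<Rightarrow> complex \<Rightarrow> nat \<Rightarrow> complex" where
  "P1c q M x j =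
    [x * (1 - q^3 * x^2) * (1 - q * x^2 - q^2 * x^2 - q^3 * M * x^3 + q^3 * x^4),
     (1 - q * x) * (1 + q * x) * (1 - q * x^2) * (1 - q^3 * x^2),
     x * (1 - q * x) * (1 + q * x) *
       (1 - q * x - q * x^2 - q^3 * x^2 + q^2 * x^3 + q^4 * x^3 - q^3 * M * x^3
        - q^4 * M * x^3 + q^4 * x^4 - q^5 * x^5),
     q^4 * M * x^4 * (1 - q * x^2)] ! j"

definition P1_eq :: "complex \<Rightarrow> complex \<Rightarrow> complex \<Rightarrow> complex \<Rightarrow> complex \<Rightarrow> complex \<Rightarrow> complex \<Rightarrow> complex" where
  "P1_eq q M x f f' g h = P1c q M x 0 * f - P1c q M x 1 * f' - P1c q M x 2 * g - P1c q M x 3 * h"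

lemma P1_qmono:
  "P1 = qmono (var_x * (1 - var_q^3 * var_x^2) * (1 - var_q * var_x^2 - var_q^2 * var_x^2 - var_q^3 * var_M * var_x^3 + var_q^3 * var_x^4)) 0 0
     - qmono ((1 - var_q * var_x) * (1 + var_q * var_x) * (1 - var_q * var_x^2) * (1 - var_q^3 * var_x^2)) 0 1
     - qmono (var_x * (1 - var_q * var_x) * (1 + var_q * var_x) *
           (1 - var_q * var_x - var_q * var_x^2 - var_q^3 * var_x^2 + var_q^2 * var_x^3 + var_q^4 * var_x^3 - var_q^3 * var_M * var_x^3
            - var_q^4 * var_M * var_x^3 + var_q^4 * var_x^4 - var_q^5 * var_x^5)) 1 0
     - qmono (var_q^4 * var_M * var_x^4 * (1 - var_q * var_x^2)) 2 0"
  by (simp add: P1_def Let_def S_x_def S_m_def qmult_qmono numeral_2_eq_2)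

lemma act_diff:
  assumes "qreg q m x P" "regular_at x (q powi m) q r"
  shows "qreg q m x (P - qmono r i j)"
    "act q (P - qmono r i j) f m x = act q P f m x - ratval x (q powi m) q r * f (m + int j) (q ^ i * x)"
proof -
  have e: "P - qmono r i j = P + qmono (- r) i j" by (metis diff_conv_add_uminus qmono_simps(3))
  have r: "regular_at x (q powi m) q (- r)" "ratval x (q powi m) q (- r) = - ratval x (q powi m) q r"
    using regular_at_uminus[OF assms(2)] by auto
  show "qreg q m x (P - qmono r i j)"
    "act q (P - qmono r i j) f m x = act q P f m x - ratval x (q powi m) q r * f (m + int j) (q ^ i * x)"
    unfolding e using act_add[OF assms(1) act_qmono(1)[OF r(1)]] act_qmono(2)[OF r(1)] r(2) by simp_all
qed

lemma act_gens:
  "qreg q m x P1" "act q P1 f m x = P1_eq q (q powi m) x (f m x) (f (m + 1) x) (f m (q * x)) (f m (q\<^sup>2 * x))"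
  "qreg q m x P2" "act q P2 f m x = x * f m x - f (m + 1) x - x * f m (q * x) + q * x\<^sup>2 * f (m + 1) (q * x)"
  "qreg q m x P3" "act q P3 f m x = x * (1 - q * q powi m - q * x\<^sup>2) * f m x
     - (1 - q * q powi m + x - q * x\<^sup>2 + q\<^sup>2 * q powi m * x\<^sup>2 - q * x ^ 3) * f (m + 1) x
     + (1 - q * x\<^sup>2) * f (m + 2) x + q * q powi m * x * f m (q * x)"
proof -
  note [simp] = act_diff act_add act_qmono regular_at_intros ratval_simps
  show "qreg q m x P1" "qreg q m x P2" "qreg q m x P3"
    "act q P2 f m x = x * f m x - f (m + 1) x - x * f m (q * x) + q * x\<^sup>2 * f (m + 1) (q * x)"
    "act q P3 f m x = x * (1 - q * q powi m - q * x\<^sup>2) * f m x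
     - (1 - q * q powi m + x - q * x\<^sup>2 + q\<^sup>2 * q powi m * x\<^sup>2 - q * x ^ 3) * f (m + 1) x
     + (1 - q * x\<^sup>2) * f (m + 2) x + q * q powi m * x * f m (q * x)"
    unfolding P1_qmono P23_qmono by simp_all
  show "act q P1 f m x = P1_eq q (q powi m) x (f m x) (f (m + 1) x) (f m (q * x)) (f m (q\<^sup>2 * x))"
    unfolding P1_qmono P1_eq_def P1c_def by simp
qed

lemma blocks_P1:
  assumes "admissible q" "generic q x"
  shows "P1_eq q (q powi m) x (blocks q m x $ k) (blocks q (m + 1) x $ k) (blocks q m (q * x) $ k) (blocks q m (q\<^sup>2 * x) $ k) = 0"
    "x * blocks q m x $ k - blocks q (m + 1) x $ k - x * blocks q m (q * x) $ k + q * x\<^sup>2 * blocks q (m + 1) (q * x) $ k = 0"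
proof -
  have z: "pair3 q 0 f m x = 0" for f by (simp add: pair3_def zero_prod_def)
  show "P1_eq q (q powi m) x (blocks q m x $ k) (blocks q (m + 1) x $ k) (blocks q m (q * x) $ k) (blocks q m (q\<^sup>2 * x) $ k) = 0"
    using act_blocks(2)[OF assms act_gens(1)] unfolding act_gens nform_P by (simp only: z)
  show "x * blocks q m x $ k - blocks q (m + 1) x $ k - x * blocks q m (q * x) $ k + q * x\<^sup>2 * blocks q (m + 1) (q * x) $ k = 0"
    using act_blocks(2)[OF assms act_gens(3)] unfolding act_gens nform_P by (simp only: z)
qed

lemma pair3_x0_comb:
  fixes F :: "int \<Rightarrow> complex \<Rightarrow> complex ^ 3"
  assumes "q \<noteq> 0" "x \<noteq> 0"
    "\<And>l. l \<in> {m, m + 1, m + 2} \<Longrightarrow> f l x = (\<Sum>k\<in>(UNIV :: 3 set). c k * F l x $ k)"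
  shows "pair3 q x0 f m x = (\<Sum>k\<in>UNIV. c k * pair3 q x0 (\<lambda>l x. F l x $ k) m x)"
  unfolding pair3_x0[OF assms(1,2)] using assms(3)[of m] assms(3)[of "m + 1"] assms(3)[of "m + 2"]
  by (simp add: sum_3 algebra_simps)

lemma blocks_shift:
  assumes "admissible q" "generic q x"
  shows "blocks q m (q * x) $ k = pair3 q x0 (\<lambda>m x. blocks q m x $ k) m x"
  using qsol_blocks[OF assms] by (simp add: qsol_def)

lemma system_relations:
  assumes "admissible q" "f \<in> system_solutions q {P1, P2, P3}"
  shows "\<forall>\<^sub>\<approx>x\<in>-{0}. f m (q * x) = pair3 q x0 f m x"
    "\<forall>\<^sub>\<approx>x\<in>-{0}. f (m + 3) x = f m x - (1 + x + inverse x) * f (m + 1) x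
        + (1 + x + inverse x - q\<^sup>2 * q powi m) * f (m + 2) x"
proof -
  have q: "q \<noteq> 0" using assms(1) by (simp add: admissible_def)
  have k: "kills_at q P2 f" "kills_at q P3 f" using assms(2) by (auto simp: system_solutions_def)
  have R2: "\<forall>\<^sub>\<approx>x\<in>-{0}. x * f m x - f (m + 1) x - x * f m (q * x) + q * x\<^sup>2 * f (m + 1) (q * x) = 0" for m
    using kills_atD[OF k(1) act_gens(3), of m] by (simp only: act_gens)
  have R3: "\<forall>\<^sub>\<approx>x\<in>-{0}. x * (1 - q * q powi m - q * x\<^sup>2) * f m x
     - (1 - q * q powi m + x - q * x\<^sup>2 + q\<^sup>2 * q powi m * x\<^sup>2 - q * x ^ 3) * f (m + 1) x
     + (1 - q * x\<^sup>2) * f (m + 2) x + q * q powi m * x * f m (q * x) = 0" for m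
    using kills_atD[OF k(2) act_gens(5), of m] by (simp only: act_gens)
  have alg: "d = (1 - 1 / (q * M) + x\<^sup>2 / M) * a + (q * x - 1 / x - (x + x\<^sup>2) / M + (1 + 1 / x) / (q * M)) * b
      + (x / M - 1 / (q * M * x)) * c"
    if "x * (1 - q * M - q * x\<^sup>2) * a - (1 - q * M + x - q * x\<^sup>2 + q\<^sup>2 * M * x\<^sup>2 - q * x ^ 3) * b
      + (1 - q * x\<^sup>2) * c + q * M * x * d = 0" "x \<noteq> 0" "M \<noteq> 0" for x M a b c d
  proof -
    have "d = - (x * (1 - q * M - q * x\<^sup>2) * a - (1 - q * M + x - q * x\<^sup>2 + q\<^sup>2 * M * x\<^sup>2 - q * x ^ 3) * b
      + (1 - q * x\<^sup>2) * c) / (q * M * x)"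
      using that q by (simp add: eq_divide_eq add_eq_0_iff mult.commute)
    then show ?thesis
      using that(2,3) q by (simp only:) (simp add: divide_simps, simp add: algebra_simps power2_eq_square power3_eq_cube)
  qed
  show "\<forall>\<^sub>\<approx>x\<in>-{0}. f m (q * x) = pair3 q x0 f m x"
    using R3[of m] generic_cosparse[OF assms(1)]
  proof eventually_elim
    case (elim x)
    have "x \<noteq> 0" using generic_nonzero[OF assms(1) elim(2)] by simp
    then show ?case unfolding pair3_x0[OF q \<open>x \<noteq> 0\<close>] by (intro alg elim) (use q in simp_all)
  qed
  have alg: "a3 = a0 - (1 + x + inverse x) * a1 + (1 + x + inverse x - q\<^sup>2 * M) * a2"
    if e: "x * a0 - a1 - x * d0 + q * x\<^sup>2 * d1 = 0"
      "x * (1 - q * M - q * x\<^sup>2) * a0 - (1 - q * M + x - q * x\<^sup>2 + q\<^sup>2 * M * x\<^sup>2 - q * x ^ 3) * a1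
      + (1 - q * x\<^sup>2) * a2 + q * M * x * d0 = 0"
      "x * (1 - q * (q * M) - q * x\<^sup>2) * a1 - (1 - q * (q * M) + x - q * x\<^sup>2 + q\<^sup>2 * (q * M) * x\<^sup>2 - q * x ^ 3) * a2
      + (1 - q * x\<^sup>2) * a3 + q * (q * M) * x * d1 = 0" and nz: "x \<noteq> 0" "1 - q * x\<^sup>2 \<noteq> 0" for x M a0 a1 a2 a3 d0 d1
  proof -
    \<comment> \<open>Up to sign the combination q M \<open>P2\<close> + \<open>P3\<close> - x S_m
      \<open>P3\<close> that reduced S_m^3 modulo the ideal, now between values of f at one
      point.\<close>
    have "(1 - q * x\<^sup>2) * (x * a3 - (x * a0 - (x + x\<^sup>2 + 1) * a1 + (x + x\<^sup>2 + 1 - q\<^sup>2 * M * x) * a2)) = 0"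
      using e by algebra
    then have "x * a3 = x * a0 - (x + x\<^sup>2 + 1) * a1 + (x + x\<^sup>2 + 1 - q\<^sup>2 * M * x) * a2" using nz by simp
    also have "\<dots> = x * (a0 - (1 + x + inverse x) * a1 + (1 + x + inverse x - q\<^sup>2 * M) * a2)"
      using nz(1) by (simp add: algebra_simps power2_eq_square)
    finally show ?thesis using nz(1) by simp
  qed
  have M1: "q powi (m + 1) = q * q powi m" using q by (simp add: power_int_add)
  show "\<forall>\<^sub>\<approx>x\<in>-{0}. f (m + 3) x = f m x - (1 + x + inverse x) * f (m + 1) x
        + (1 + x + inverse x - q\<^sup>2 * q powi m) * f (m + 2) x"
    using R2[of m] R3[of m] R3[of "m + 1"] generic_cosparse[OF assms(1)]
  proof eventually_elim
    case (elim x)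
    have "x \<noteq> 0" using generic_nonzero[OF assms(1) elim(4)] by simp
    moreover have "1 - q * x\<^sup>2 \<noteq> 0" using generic_power(4)[OF elim(4), of 1] by (simp add: mult.commute)
    moreover have idx: "m + 1 + 1 = m + 2" "m + 1 + 2 = m + 3" by simp_all
    ultimately show ?case by (intro alg[OF elim(1,2) elim(3)[unfolded M1 idx]])
  qed
qed

lemma int_induct3:
  fixes Q :: "int \<Rightarrow> bool"
  assumes "Q 0" "Q 1" "Q 2" and up: "\<And>m. Q m \<Longrightarrow> Q (m + 1) \<Longrightarrow> Q (m + 2) \<Longrightarrow> Q (m + 3)"
    and down: "\<And>m. Q (m + 3) \<Longrightarrow> Q (m + 1) \<Longrightarrow> Q (m + 2) \<Longrightarrow> Q m"
  shows "Q m"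
proof -
  have "Q m \<and> Q (m + 1) \<and> Q (m + 2)"
  proof (induction m rule: int_induct[where k = 0])
    case (step1 i)
    then show ?case using up[of i] by (simp add: add.assoc)
  next
    case (step2 i)
    have "i - 1 + 3 = i + 2" "i - 1 + 1 = i" "i - 1 + 2 = i + 1" by simp_all
    then show ?case using down[of "i - 1"] step2 by metis
  qed (use assms(1-3) in simp)
  then show ?thesis ..
qed

lemma q_basis_system:
  assumes "admissible q"
  shows "q_basis q (system_solutions q {P1, P2, P3}) (\<lambda>k m x. blocks q m x $ k)"
  unfolding q_basis_def
proof (intro conjI allI impI ballI)
  have q: "q \<noteq> 0" using assms(1) by (simp add: admissible_def)
  show "range (\<lambda>k m x. blocks q m x $ k) \<subseteq> system_solutions q {P1, P2, P3}"
    using blocks_meromorphic[OF assms] I52_kills_blocks[OF assms] I52_gens by (auto simp: system_solutions_def)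
next
  fix c :: "3 \<Rightarrow> complex \<Rightarrow> complex" and k
  assume c: "range c \<subseteq> q_constants q \<and> (\<forall>i. \<forall>\<^sub>\<approx>x\<in>-{0}. (\<Sum>k\<in>UNIV. c k x * blocks q i x $ k) = 0)"
  have z: "\<forall>\<^sub>\<approx>x\<in>-{0}. (\<Sum>k\<in>UNIV. c k x * blocks q i x $ k) = 0" for i using c by blast
  show "\<forall>\<^sub>\<approx>x\<in>-{0}. c k x = 0"
    using z[of 0] z[of 1] z[of 2] generic_cosparse[OF assms]
  proof eventually_elim
    case (elim x)
    have "coef q 0 x k (\<lambda>_. 0) = c k x"
      by (rule coef_unique[OF assms elim(4)]) (use elim in auto)
    then show ?case by (simp add: coef_def)
  qed
next
  have q: "q \<noteq> 0" using assms(1) by (simp add: admissible_def)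
  fix f assume f: "f \<in> system_solutions q {P1, P2, P3}"
  define c where "c k x = coef q 0 x k (\<lambda>l. f l x)" for k x
  have mero: "c k meromorphic_on -{0}" for k
    unfolding c_def[abs_def] by (rule coef_meromorphic[OF assms]) (use f in \<open>simp add: system_solutions_def\<close>)
  let ?Q = "\<lambda>m. \<forall>\<^sub>\<approx>x\<in>-{0}. f m x = (\<Sum>k\<in>UNIV. c k x * blocks q m x $ k)"
  note R = system_relations[OF assms f]
  have base: "?Q m" if "m \<in> {0, 1, 2}" for m
    using generic_cosparse[OF assms]
  proof eventually_elim
    case (elim x)
    have "m \<in> {0, 0 + 1, 0 + 2}" using that by simp
    then show ?case using coef_expand[OF assms elim, of m 0 "\<lambda>l. f l x"] by (simp add: c_def)
  qed
  have up: "?Q (m + 3)" if "?Q m" "?Q (m + 1)" "?Q (m + 2)" for m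
    using that R(2)[of m] generic_cosparse[OF assms]
  proof eventually_elim
    case (elim x)
    show ?case unfolding elim(4) block_recurrence[OF assms elim(5)] elim(1-3) sum_3 by (simp only: algebra_simps)
  qed
  have down: "?Q m" if "?Q (m + 3)" "?Q (m + 1)" "?Q (m + 2)" for m
    using that R(2)[of m] generic_cosparse[OF assms]
  proof eventually_elim
    case (elim x)
    have "f m x = f (m + 3) x + (1 + x + inverse x) * f (m + 1) x - (1 + x + inverse x - q\<^sup>2 * q powi m) * f (m + 2) x"
      unfolding elim(4) by simp
    from this[unfolded elim(1-3) block_recurrence[OF assms elim(5)]] show ?case
      unfolding sum_3 by (simp add: algebra_simps del: blocks_simps)
  qed
  have Q: "?Q m" for m
  proof (rule int_induct3[where Q = ?Q])
    show "?Q 0" "?Q 1" "?Q 2" by (rule base; simp)+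
    show "?Q (m + 3)" if "?Q m" "?Q (m + 1)" "?Q (m + 2)" for m by (rule up[OF that])
    show "?Q m" if "?Q (m + 3)" "?Q (m + 1)" "?Q (m + 2)" for m by (rule down[OF that])
  qed
  have "c k \<in> q_constants q" for k
    unfolding q_constants_def
  proof (intro CollectI conjI mero)
    show "\<forall>\<^sub>\<approx>x\<in>-{0}. c k (q * x) = c k x"
      using Q[of 0] Q[of 1] Q[of 2] Q[of 3] Q[of 4] R(1)[of 0] R(1)[of 1] R(1)[of 2] generic_cosparse[OF assms]
    proof eventually_elim
      case (elim x)
      have x: "x \<noteq> 0" using generic_nonzero[OF assms elim(9)] by simp
      have g: "generic q (q * x)" using generic_shift[OF elim(9) q, of 1] by simp
      \<comment> \<open>The coordinates are kept at their values at x while f moves to q x. As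
        \<open>pair3\<close> reads f at l, l + 1 and l + 2, the expansion of f is used up to index
        4.\<close>
      have "f l (q * x) = (\<Sum>k\<in>UNIV. c k x * blocks q l (q * x) $ k)" if "l \<in> {0, 0 + 1, 0 + 2}" for l
      proof -
        have "f l (q * x) = pair3 q x0 f l x" using that elim(6-8) by auto
        also have "\<dots> = (\<Sum>k\<in>UNIV. c k x * pair3 q x0 (\<lambda>l x. blocks q l x $ k) l x)"
          by (rule pair3_x0_comb[OF q x]) (use that elim(1-5) in auto)
        finally show ?thesis unfolding blocks_shift[OF assms elim(9)] .
      qed
      then show ?case unfolding c_def[of _ "q * x"] by (rule coef_unique[OF assms g])
    qed
  qed
  then show "\<exists>c. range c \<subseteq> q_constants q \<and> (\<forall>i. \<forall>\<^sub>\<approx>x\<in>-{0}. f i x = (\<Sum>k\<in>UNIV. c k x * blocks q i x $ k))"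
    using Q by (intro exI[of _ c]) blast
qed

section \<open>The equation in \<open>x\<close>\<close>

lemma C52_sum:
  "(\<Sum>j\<le>3. C52 x M q j * F j) =
     - (q^2) * M * x^2 * (1 - q^2 * x) * (1 + q^2 * x) * (1 - q^5 * x^2) * F 0 +
     (1 - q * x) * (1 + q * x) * (1 - q^5 * x^2) *
       (1 - q * x - q * x^2 - q^4 * x^2 + q^2 * M * x^2 + q^3 * M * x^2 + q^2 * x^3 + q^5 * x^3
        + q^5 * x^4 + q^5 * M * x^4 - q^6 * x^5) * F 1 +
     q * x * (1 - q^2 * x) * (1 + q^2 * x) * (1 - q * x^2) *
       (1 - q^2 * x - q^2 * M * x - q^2 * x^2 - q^5 * x^2 + q^4 * x^3 + q^7 * x^3
        - q^5 * M * x^3 - q^6 * M * x^3 + q^7 * x^4 - q^9 * x^5) * F 2 +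
     q^8 * M * x^4 * (1 - q * x) * (1 + q * x) * (1 - q * x^2) * F 3"
proof -
  have "{..3::nat} = {0, 1, 2, 3}" by auto
  then show ?thesis by (simp add: C52_def)
qed

text \<open>Eliminating \<open>S_m\<close> from \<open>P1\<close>, \<open>S_x P1\<close> and \<open>P2\<close>.\<close>

lemma C52_relation:
  assumes e1: "P1_eq q M x f0 g0 f1 f2 = 0" and e2: "P1_eq q M (q * x) f1 g1 f2 f3 = 0"
    and e3: "x * f0 - g0 - x * f1 + q * x\<^sup>2 * g1 = 0"
    and nz: "q \<noteq> 0" "x \<noteq> 0" "1 - q^3 * x^2 \<noteq> 0"
  shows "- (q^2) * M * x^2 * (1 - q^2 * x) * (1 + q^2 * x) * (1 - q^5 * x^2) * f0 +
     (1 - q * x) * (1 + q * x) * (1 - q^5 * x^2) *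
       (1 - q * x - q * x^2 - q^4 * x^2 + q^2 * M * x^2 + q^3 * M * x^2 + q^2 * x^3 + q^5 * x^3
        + q^5 * x^4 + q^5 * M * x^4 - q^6 * x^5) * f1 +
     q * x * (1 - q^2 * x) * (1 + q^2 * x) * (1 - q * x^2) *
       (1 - q^2 * x - q^2 * M * x - q^2 * x^2 - q^5 * x^2 + q^4 * x^3 + q^7 * x^3
        - q^5 * M * x^3 - q^6 * M * x^3 + q^7 * x^4 - q^9 * x^5) * f2 +
     q^8 * M * x^4 * (1 - q * x) * (1 + q * x) * (1 - q * x^2) * f3 = 0"
proof -
  \<comment> \<open>The factors of the coefficients of \<open>P1\<close> at x and at q x; c occurs
    at both, as 1 - q y^2 at y = q x equals 1 - q^3 y^2 at y = x.\<close>
  define a b c d e where "a = (1 - q * x) * (1 + q * x)" and "b = 1 - q * x^2" and "c = 1 - q^3 * x^2"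
    and "d = (1 - q^2 * x) * (1 + q^2 * x)" and "e = 1 - q^5 * x^2"
  define K0 K0' where "K0 = 1 - q * x^2 - q^2 * x^2 - q^3 * M * x^3 + q^3 * x^4"
    and "K0' = 1 - q^3 * x^2 - q^4 * x^2 - q^6 * M * x^3 + q^7 * x^4"
  define K2 K2' where "K2 = 1 - q * x - q * x^2 - q^3 * x^2 + q^2 * x^3 + q^4 * x^3 - q^3 * M * x^3
        - q^4 * M * x^3 + q^4 * x^4 - q^5 * x^5"
    and "K2' = 1 - q^2 * x - q^3 * x^2 - q^5 * x^2 + q^5 * x^3 + q^7 * x^3 - q^6 * M * x^3
        - q^7 * M * x^3 + q^8 * x^4 - q^10 * x^5"
  define L1 L2 where "L1 = 1 - q * x - q * x^2 - q^4 * x^2 + q^2 * M * x^2 + q^3 * M * x^2 + q^2 * x^3 + q^5 * x^3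
        + q^5 * x^4 + q^5 * M * x^4 - q^6 * x^5"
    and "L2 = 1 - q^2 * x - q^2 * M * x - q^2 * x^2 - q^5 * x^2 + q^4 * x^3 + q^7 * x^3
        - q^5 * M * x^3 - q^6 * M * x^3 + q^7 * x^4 - q^9 * x^5"
  \<comment> \<open>These identities make the coefficients of f0, f1 and f2 after elimination
    divisible by c; L1 and L2 are the long factors of the equation to be proved.\<close>
  have k0: "a * b - K0 = q^3 * M * x^3" unfolding a_def b_def K0_def by algebra
  have k1: "d * (K2 - b * c) + q^2 * x^2 * b * K0' = - q * x * c * L1"
    unfolding d_def K2_def b_def c_def K0'_def L1_def by algebra
  have k2: "a * K2' - q^2 * M * x * e = c * L2"
    unfolding a_def K2'_def e_def c_def L2_def by algebra
  define A B C where "A y = (1 - q * y) * (1 + q * y)" and "B y = 1 - q * y^2" and "C y = 1 - q^3 * y^2" for y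
  define T0 T2 where "T0 y = 1 - q * y^2 - q^2 * y^2 - q^3 * M * y^3 + q^3 * y^4"
    and "T2 y = 1 - q * y - q * y^2 - q^3 * y^2 + q^2 * y^3 + q^4 * y^3 - q^3 * M * y^3
        - q^4 * M * y^3 + q^4 * y^4 - q^5 * y^5" for y
  have P1e: "P1_eq q M y f f' g h = y * C y * T0 y * f - A y * B y * C y * f' - y * A y * T2 y * g - q^4 * M * y^4 * B y * h" for y f f' g h
    unfolding P1_eq_def P1c_def A_def B_def C_def T0_def T2_def by (simp add: mult.assoc)
  have at_x: "A x = a" "B x = b" "C x = c" "T0 x = K0" "T2 x = K2"
    by (simp_all only: A_def B_def C_def T0_def T2_def a_def b_def c_def K0_def K2_def)
  have at_qx: "A (q * x) = d" "B (q * x) = c" "C (q * x) = e" "T0 (q * x) = K0'" "T2 (q * x) = K2'"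
    unfolding A_def B_def C_def T0_def T2_def c_def d_def e_def K0'_def K2'_def by algebra+
  \<comment> \<open>The multipliers on the right are chosen so that g0 and g1 cancel. All remaining
    coefficients are divisible by q x^2 c, which is nonzero.\<close>
  have "- q * x^2 * c * (- (q^2) * M * x^2 * d * e * f0 + a * e * L1 * f1 + q * x * d * b * L2 * f2 + q^8 * M * x^4 * a * b * f3)
     = d * e * (a * b * c) * (x * f0 - g0 - x * f1 + q * x\<^sup>2 * g1)
       - d * e * P1_eq q M x f0 g0 f1 f2 + q * x^2 * a * b * P1_eq q M (q * x) f1 g1 f2 f3"
  proof -
    have "d * e * (a * b * c) * (x * f0 - g0 - x * f1 + q * x\<^sup>2 * g1)
       - d * e * P1_eq q M x f0 g0 f1 f2 + q * x^2 * a * b * P1_eq q M (q * x) f1 g1 f2 f3 =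
       x * c * d * e * (a * b - K0) * f0 + x * a * e * (d * (K2 - b * c) + q^2 * x^2 * b * K0') * f1
       - q^2 * x^3 * b * d * (a * K2' - q^2 * M * x * e) * f2 - q^9 * M * x^6 * a * b * c * f3"
      unfolding P1e at_x at_qx by algebra
    also have "\<dots> = - q * x^2 * c * (- (q^2) * M * x^2 * d * e * f0 + a * e * L1 * f1 + q * x * d * b * L2 * f2 + q^8 * M * x^4 * a * b * f3)"
      unfolding k0 k1 k2 by algebra
    finally show ?thesis ..
  qed
  also have "\<dots> = 0" unfolding e1 e2 e3 by simp
  finally have "- (q^2) * M * x^2 * d * e * f0 + a * e * L1 * f1 + q * x * d * b * L2 * f2 + q^8 * M * x^4 * a * b * f3 = 0"
    using nz by (simp add: c_def)
  then show ?thesis unfolding a_def b_def d_def e_def L1_def L2_def by (simp only: mult.assoc)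
qed

lemma blocks_C52:
  assumes "admissible q" "generic q x"
  shows "(\<Sum>j\<le>3. C52 x (q powi m) q j * blocks q m (q ^ j * x) $ k) = 0"
proof -
  have q: "q \<noteq> 0" "x \<noteq> 0" using generic_nonzero[OF assms] by auto
  have g: "generic q (q * x)" using generic_shift[OF assms(2) q(1), of 1] by simp
  have sh: "q * (q * x) = q ^ 2 * x" "q\<^sup>2 * (q * x) = q ^ 3 * x" by (simp_all add: power2_eq_square power3_eq_cube)
  have nz: "1 - q^3 * x^2 \<noteq> 0" using generic_power(4)[OF assms(2), of 3] by (simp add: mult.commute)
  show ?thesis
    unfolding C52_sum power_0 power_one_right mult_1_left
    by (rule C52_relation[OF blocks_P1(1)[OF assms] blocks_P1(1)[OF assms(1) g, unfolded sh] blocks_P1(2)[OF assms] q nz])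
qed

lemma P1c_nonzero:
  assumes "admissible q" "generic q x"
  shows "P1c q (q powi m) x 1 \<noteq> 0" "P1c q (q powi m) x 3 \<noteq> 0" "x / q powi m - 1 / (q * q powi m * x) \<noteq> 0"
    "C52 x (q powi m) q 3 \<noteq> 0"
proof -
  have q: "q \<noteq> 0" "x \<noteq> 0" using generic_nonzero[OF assms] by auto
  have g: "1 - q ^ n * x\<^sup>2 \<noteq> 0" for n using generic_power(4)[OF assms(2), of n] by (simp add: mult.commute)
  have "(1 - q * x) * (1 + q * x) = 1 - q ^ 2 * x\<^sup>2" by algebra
  then have a: "1 - q * x \<noteq> 0" "1 + q * x \<noteq> 0" using g[of 2] by auto
  have b: "1 - q * x\<^sup>2 \<noteq> 0" using g[of 1] by simp
  show "P1c q (q powi m) x 1 \<noteq> 0" "P1c q (q powi m) x 3 \<noteq> 0" "C52 x (q powi m) q 3 \<noteq> 0"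
    using a b g[of 3] q by (simp_all add: P1c_def C52_def)
  have "x / q powi m - 1 / (q * q powi m * x) = - (1 - q * x\<^sup>2) / (q * q powi m * x)"
    using q by (simp add: field_simps power2_eq_square)
  then show "x / q powi m - 1 / (q * q powi m * x) \<noteq> 0" using b q by simp
qed

text \<open>Modulo the other rows, \<open>P1\<close> replaces the row at q^2 x by a multiple of the
  row m + 1, and \<open>x0\<close> then replaces the row at q x by a multiple of the row m + 2. The
  two Wronskians thus differ by an explicit factor.\<close>

lemma det_Wronskian_x:
  assumes "admissible q" "generic q x"
  shows "det (Wronskian_x q m x) =
     q powi (-5 - 2 * m) * x powi (-5) * (1 - q\<^sup>2 * x\<^sup>2) * (1 - q * x\<^sup>2) * (1 - q^3 * x\<^sup>2) *
          theta (- inverse (qhalf q) * x) q powi (-2) * theta (- inverse (qhalf q) * x\<^sup>2) q"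
proof -
  have q: "q \<noteq> 0" "x \<noteq> 0" using generic_nonzero[OF assms] by auto
  define M where "M = q powi m"
  have M: "M \<noteq> 0" using q by (simp add: M_def)
  define X where "X = x / M - 1 / (q * M * x)"
  note nz = P1c_nonzero[OF assms, of m, folded M_def]
  have alg: "D3 * (f1 * p2 * r3 + f2 * p3 * r1 + f3 * p1 * r2 - f1 * p3 * r2 - f2 * p1 * r3 - f3 * p2 * r1) =
     D1 * X * (f1 * g2 * h3 + f2 * g3 * h1 + f3 * g1 * h2 - f1 * g3 * h2 - f2 * g1 * h3 - f3 * g2 * h1)"
    if r: "D0 * f1 - D1 * g1 - D2 * p1 - D3 * r1 = 0" "D0 * f2 - D1 * g2 - D2 * p2 - D3 * r2 = 0" "D0 * f3 - D1 * g3 - D2 * p3 - D3 * r3 = 0"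
      and p: "p1 = Y * f1 + Z * g1 + X * h1" "p2 = Y * f2 + Z * g2 + X * h2" "p3 = Y * f3 + Z * g3 + X * h3"
    for D0 D1 D2 D3 X Y Z f1 f2 f3 g1 g2 g3 h1 h2 h3 p1 p2 p3 r1 r2 r3 :: complex
  proof -
    have r': "D3 * r1 = D0 * f1 - D1 * g1 - D2 * p1" "D3 * r2 = D0 * f2 - D1 * g2 - D2 * p2" "D3 * r3 = D0 * f3 - D1 * g3 - D2 * p3"
      using r by simp_all
    have "D3 * (f1 * p2 * r3 + f2 * p3 * r1 + f3 * p1 * r2 - f1 * p3 * r2 - f2 * p1 * r3 - f3 * p2 * r1) =
      f1 * p2 * (D3 * r3) + f2 * p3 * (D3 * r1) + f3 * p1 * (D3 * r2) - f1 * p3 * (D3 * r2) - f2 * p1 * (D3 * r3) - f3 * p2 * (D3 * r1)"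
      by (simp add: algebra_simps)
    also have "\<dots> = D1 * (f1 * (g2 * p3 - g3 * p2) + f2 * (g3 * p1 - g1 * p3) + f3 * (g1 * p2 - g2 * p1))"
      unfolding r' by (simp add: algebra_simps)
    also have "\<dots> = D1 * X * (f1 * g2 * h3 + f2 * g3 * h1 + f3 * g1 * h2 - f1 * g3 * h2 - f2 * g1 * h3 - f3 * g2 * h1)"
      unfolding p by (simp add: algebra_simps)
    finally show ?thesis .
  qed
  have sh: "blocks q m (q * x) $ k = (1 - 1 / (q * M) + x\<^sup>2 / M) * blocks q m x $ k
    + (q * x - 1 / x - (x + x\<^sup>2) / M + (1 + 1 / x) / (q * M)) * blocks q (m + 1) x $ k
    + X * blocks q (m + 2) x $ k" for k
    using blocks_shift[OF assms, of m k] unfolding pair3_x0[OF q] M_def X_def .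
  have P: "P1c q M x 0 * blocks q m x $ k - P1c q M x 1 * blocks q (m + 1) x $ k - P1c q M x 2 * blocks q m (q * x) $ k
      - P1c q M x 3 * blocks q m (q\<^sup>2 * x) $ k = 0" for k
    using blocks_P1(1)[OF assms, of m k] unfolding P1_eq_def M_def .
  have "P1c q M x 3 * det (Wronskian_x q m x) = P1c q M x 1 * X * det (Wronskian_m q m x)"
    unfolding det_3 Wronskian_x_def Wronskian_m_nth vector_3
    by (rule alg[OF P P P sh sh sh])
  then have d: "det (Wronskian_x q m x) = P1c q M x 1 * X / P1c q M x 3 * det (Wronskian_m q m x)"
    using nz by (simp add: eq_divide_eq mult.commute)
  have "P1c q M x 1 * X / P1c q M x 3 = - ((1 - q\<^sup>2 * x\<^sup>2) * (1 - q * x\<^sup>2) * (1 - q^3 * x\<^sup>2)) / (q ^ 5 * M\<^sup>2 * x ^ 5)"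
  proof -
    have b: "1 - q * x\<^sup>2 \<noteq> 0" using generic_power(4)[OF assms(2), of 1] by (simp add: mult.commute)
    have X: "X = - (1 - q * x\<^sup>2) / (q * M * x)"
      using q M by (simp add: X_def field_simps power2_eq_square)
    have a: "(1 - q * x) * (1 + q * x) = 1 - q\<^sup>2 * x\<^sup>2" by algebra
    have "A * b * c * (- b / (q * M * x)) / (q ^ 4 * M * x ^ 4 * b) = - (A * b * c) / (q ^ 5 * M\<^sup>2 * x ^ 5)"
      if "b \<noteq> 0" for A b c
      using that q M by (simp add: field_simps power_numeral_reduce)
    from this[OF b] show ?thesis unfolding X P1c_def by (simp add: a)
  qed
  moreover have "q powi (-5 - 2 * m) = 1 / (q ^ 5 * M\<^sup>2)"
  proof -
    have "q powi (-5 - 2 * m) = q powi (- 5) * q powi (- (m * 2))"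
      using q by (subst power_int_add[symmetric]) (simp_all add: algebra_simps)
    also have "\<dots> = inverse (q ^ 5) * inverse (M\<^sup>2)"
      by (simp only: power_int_minus power_int_mult M_def) (simp add: power_int_numeral)
    finally show ?thesis by (simp add: divide_inverse)
  qed
  moreover have "x powi (-5) = 1 / x ^ 5" by (simp add: power_int_minus power_int_numeral divide_inverse)
  ultimately show ?thesis
    unfolding d det_Wronskian_m[OF assms] by (simp add: mult_ac)
qed

text \<open>The coefficients are constants: below, coordinate functions are frozen at their value at
  one point x, and the resulting combination still satisfies all linear relations, also at q
  x.\<close>

lemma comb_relations:
  fixes c :: "3 \<Rightarrow> complex"
  assumes "admissible q" "generic q x" "L = (\<lambda>l y. \<Sum>k\<in>UNIV. c k * blocks q l y $ k)"
  shows "L m (q * x) = pair3 q x0 L m x"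
    "P1_eq q (q powi m) x (L m x) (L (m + 1) x) (L m (q * x)) (L m (q\<^sup>2 * x)) = 0"
    "(\<Sum>j\<le>3. C52 x (q powi m) q j * L m (q ^ j * x)) = 0"
proof -
  have q: "q \<noteq> 0" "x \<noteq> 0" using generic_nonzero[OF assms(1,2)] by auto
  show "L m (q * x) = pair3 q x0 L m x"
    using pair3_x0_comb[OF q, of m L c "blocks q"] blocks_shift[OF assms(1,2), of m] by (simp add: assms(3))
  have "P1_eq q (q powi m) x (L m x) (L (m + 1) x) (L m (q * x)) (L m (q\<^sup>2 * x)) =
     (\<Sum>k\<in>UNIV. c k * P1_eq q (q powi m) x (blocks q m x $ k) (blocks q (m + 1) x $ k) (blocks q m (q * x) $ k) (blocks q m (q\<^sup>2 * x) $ k))"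
    unfolding assms(3) P1_eq_def sum_3 by (simp only: algebra_simps)
  then show "P1_eq q (q powi m) x (L m x) (L (m + 1) x) (L m (q * x)) (L m (q\<^sup>2 * x)) = 0"
    unfolding blocks_P1[OF assms(1,2)] by simp
  have "(\<Sum>j\<le>3. C52 x (q powi m) q j * L m (q ^ j * x)) =
      (\<Sum>k\<in>UNIV. c k * (\<Sum>j\<le>3. C52 x (q powi m) q j * blocks q m (q ^ j * x) $ k))"
    unfolding assms(3) sum_distrib_left by (subst sum.swap) (simp only: mult.left_commute)
  then show "(\<Sum>j\<le>3. C52 x (q powi m) q j * L m (q ^ j * x)) = 0"
    unfolding blocks_C52[OF assms(1,2)] by simp
qed

text \<open>The values of a solution at \<open>x, q x, q\<^sup>2 x\<close> determine the values of \<open>S_m\<close> and \<open>S_m\<^sup>2\<close> applied to it.\<close>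

definition lift_m :: "complex \<Rightarrow> int \<Rightarrow> (complex \<Rightarrow> complex) \<Rightarrow> int \<Rightarrow> complex \<Rightarrow> complex" where
  "lift_m q m g l x = (let M = q powi m;
       g1 = (P1c q M x 0 * g x - P1c q M x 2 * g (q * x) - P1c q M x 3 * g (q\<^sup>2 * x)) / P1c q M x 1 in
     if l = m then g x else if l = m + 1 then g1
     else (g (q * x) - (1 - 1 / (q * M) + x\<^sup>2 / M) * g x
         - (q * x - 1 / x - (x + x\<^sup>2) / M + (1 + 1 / x) / (q * M)) * g1) / (x / M - 1 / (q * M * x)))"

lemma lift_m_eq:
  assumes "admissible q" "generic q x"
    "g x = L m x" "g (q * x) = L m (q * x)" "g (q\<^sup>2 * x) = L m (q\<^sup>2 * x)"
    "L m (q * x) = pair3 q x0 L m x"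
    "P1_eq q (q powi m) x (L m x) (L (m + 1) x) (L m (q * x)) (L m (q\<^sup>2 * x)) = 0"
    "l \<in> {m, m + 1, m + 2}"
  shows "lift_m q m g l x = L l x"
proof -
  have q: "q \<noteq> 0" "x \<noteq> 0" using generic_nonzero[OF assms(1,2)] by auto
  note nz = P1c_nonzero[OF assms(1,2), of m]
  have "(P1c q (q powi m) x 0 * L m x - P1c q (q powi m) x 2 * L m (q * x) - P1c q (q powi m) x 3 * L m (q\<^sup>2 * x))
      / P1c q (q powi m) x 1 = L (m + 1) x"
    using assms(7) nz(1) unfolding P1_eq_def by (simp add: divide_eq_eq algebra_simps)
  moreover have "(T - A - B) / X = h" if "T = A + B + X * h" "X \<noteq> 0" for T A B X h :: complex
    using that by simp
  from this[OF assms(6)[unfolded pair3_x0[OF q]] nz(3)]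
  have "(L m (q * x) - (1 - 1 / (q * q powi m) + x\<^sup>2 / q powi m) * L m x
      - (q * x - 1 / x - (x + x\<^sup>2) / q powi m + (1 + 1 / x) / (q * q powi m)) * L (m + 1) x)
      / (x / q powi m - 1 / (q * q powi m * x)) = L (m + 2) x" .
  ultimately show ?thesis
    using assms(8) unfolding lift_m_def Let_def assms(3-5) by auto
qed

text \<open>The equations that define \<open>lift_m\<close> are triangular with nonzero pivots, so
  they can be solved back for the values at x, q x and q^2 x.\<close>

lemma lift_m_eq_converse:
  assumes "admissible q" "generic q x"
    "\<And>l. l \<in> {m, m + 1, m + 2} \<Longrightarrow> lift_m q m g l x = L l x"
    "L m (q * x) = pair3 q x0 L m x"
    "P1_eq q (q powi m) x (L m x) (L (m + 1) x) (L m (q * x)) (L m (q\<^sup>2 * x)) = 0"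
  shows "g x = L m x" "g (q * x) = L m (q * x)" "g (q\<^sup>2 * x) = L m (q\<^sup>2 * x)"
proof -
  have q: "q \<noteq> 0" "x \<noteq> 0" using generic_nonzero[OF assms(1,2)] by auto
  note nz = P1c_nonzero[OF assms(1,2), of m]
  show 0: "g x = L m x" using assms(3)[of m] by (simp add: lift_m_def)
  have 1: "(P1c q (q powi m) x 0 * g x - P1c q (q powi m) x 2 * g (q * x) - P1c q (q powi m) x 3 * g (q\<^sup>2 * x))
      / P1c q (q powi m) x 1 = L (m + 1) x"
    using assms(3)[of "m + 1"] by (simp add: lift_m_def Let_def)
  have 2: "(g (q * x) - (1 - 1 / (q * q powi m) + x\<^sup>2 / q powi m) * g x
      - (q * x - 1 / x - (x + x\<^sup>2) / q powi m + (1 + 1 / x) / (q * q powi m)) * L (m + 1) x)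
      / (x / q powi m - 1 / (q * q powi m * x)) = L (m + 2) x"
    using assms(3)[of "m + 2"] unfolding lift_m_def Let_def 1 by simp
  have "T = A + B + X * h" if "(T - A - B) / X = h" "X \<noteq> 0" for T A B X h :: complex
    using that by (auto simp: field_simps)
  from this[OF 2 nz(3)] show 3: "g (q * x) = L m (q * x)"
    unfolding assms(4) pair3_x0[OF q] 0 .
  have "r = r'" if "(A - B - D * r) / E = h" "A - E * h - B - D * r' = 0" "E \<noteq> 0" "D \<noteq> 0" for A B D E r r' h :: complex
  proof -
    have "A - B - D * r = E * h" using that(1,3) by (auto simp: field_simps)
    then have "D * r = D * r'" using that(2) by (simp add: algebra_simps)
    then show ?thesis using that(4) by simp
  qed
  from this[OF 1[unfolded 0 3] assms(5)[unfolded P1_eq_def] nz(1,2)] show "g (q\<^sup>2 * x) = L m (q\<^sup>2 * x)" .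
qed

lemma lift_m_meromorphic:
  assumes "q \<noteq> 0" "g meromorphic_on -{0}"
  shows "(\<lambda>x. lift_m q m g l x) meromorphic_on -{0}"
proof -
  have g: "(\<lambda>x. g (c * x)) meromorphic_on -{0}" if "c \<noteq> 0" for c
    by (rule meromorphic_on_compose[OF assms(2)]) (use that in \<open>auto intro!: analytic_intros\<close>)
  have p: "(\<lambda>x. P1c q M x j) meromorphic_on -{0}" if "j \<in> {0, 1, 2, 3}" for M j
    using that unfolding P1c_def by (auto intro!: meromorphic_intros)
  have 1: "(\<lambda>x. (P1c q M x 0 * g x - P1c q M x 2 * g (q * x) - P1c q M x 3 * g (q\<^sup>2 * x)) / P1c q M x 1) meromorphic_on -{0}" for M
    by (intro meromorphic_intros assms g p) (use assms in auto)
  consider "l = m" | "l \<noteq> m" "l = m + 1" | "l \<noteq> m" "l \<noteq> m + 1" by blast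
  then show ?thesis
  proof cases
    case 1
    then show ?thesis using assms(2) by (simp add: lift_m_def Let_def)
  next
    case 2
    then show ?thesis using 1 unfolding lift_m_def Let_def if_not_P[OF 2(1)] if_P[OF 2(2)] by blast
  next
    case 3
    show ?thesis
      unfolding lift_m_def Let_def if_not_P[OF 3(1)] if_not_P[OF 3(2)]
      by (intro meromorphic_intros assms g p) (use assms in auto)
  qed
qed

lemma q_basis_C52:
  assumes "admissible q"
  shows "q_basis q (C52_solutions q m) (\<lambda>k (_ :: unit) x. blocks q m x $ k)"
  unfolding q_basis_def
proof (intro conjI allI impI ballI)
  show "range (\<lambda>k (_ :: unit) x. blocks q m x $ k) \<subseteq> C52_solutions q m"
  proof -
    have "\<forall>\<^sub>\<approx>x\<in>-{0}. (\<Sum>j\<le>3. C52 x (q powi m) q j * blocks q m (q ^ j * x) $ k) = 0" for k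
      using generic_cosparse[OF assms] by eventually_elim (rule blocks_C52[OF assms])
    then show ?thesis using blocks_meromorphic[OF assms] by (auto simp: C52_solutions_def)
  qed
next
  have q: "q \<noteq> 0" using assms(1) by (simp add: admissible_def)
  fix c :: "3 \<Rightarrow> complex \<Rightarrow> complex" and k
  assume c: "range c \<subseteq> q_constants q \<and> (\<forall>i :: unit. \<forall>\<^sub>\<approx>x\<in>-{0}. (\<Sum>k\<in>UNIV. c k x * blocks q m x $ k) = 0)"
  have z: "\<forall>\<^sub>\<approx>x\<in>-{0}. (\<Sum>k\<in>UNIV. c k x * blocks q m x $ k) = 0" using c by blast
  have ck: "\<forall>\<^sub>\<approx>x\<in>-{0}. c k (q * x) = c k x" for k using c by (auto simp: q_constants_def)
  have ck2: "\<forall>\<^sub>\<approx>x\<in>-{0}. c k (q\<^sup>2 * x) = c k (q * x)" for k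
    using cosparse_scale[OF q ck] by (simp add: power2_eq_square mult.assoc)
  have q2: "q\<^sup>2 \<noteq> 0" using q by simp
  show "\<forall>\<^sub>\<approx>x\<in>-{0}. c k x = 0"
    using z cosparse_scale[OF q z] cosparse_scale[OF q2 z] ck[of 1] ck[of 2] ck[of 3] ck2[of 1] ck2[of 2] ck2[of 3]
      generic_cosparse[OF assms]
  proof eventually_elim
    case (elim x)
    \<comment> \<open>By invariance of the coefficients, freezing them at x does not change the
      relation at q x and q^2 x. So \<open>L\<close> vanishes at three points of the orbit, which
      forces its next two values in m to vanish at x.\<close>
    define L where "L = (\<lambda>l y. \<Sum>k\<in>UNIV. c k x * blocks q l y $ k)"
    note R = comb_relations[OF assms elim(10) L_def]
    have L0: "L m x = 0" "L m (q * x) = 0" "L m (q\<^sup>2 * x) = 0"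
      using elim(1-9) by (simp_all add: L_def sum_3)
    have "L l x = lift_m q m (\<lambda>_. 0) l x" if "l \<in> {m, m + 1, m + 2}" for l
      by (rule lift_m_eq[OF assms elim(10) _ _ _ R(1,2) that, symmetric]) (simp_all add: L0)
    then have "L l x = 0" if "l \<in> {m, m + 1, m + 2}" for l
      using that by (simp add: lift_m_def Let_def)
    then have "coef q m x k (\<lambda>_. 0) = c k x"
      by (intro coef_unique[OF assms elim(10)]) (simp add: L_def)
    then show ?case by (simp add: coef_def)
  qed
next
  have q: "q \<noteq> 0" using assms(1) by (simp add: admissible_def)
  fix f :: "unit \<Rightarrow> complex \<Rightarrow> complex" assume "f \<in> C52_solutions q m"
  then obtain g where fg: "f = (\<lambda>_. g)" and mg: "g meromorphic_on -{0}"
    and eq: "\<forall>\<^sub>\<approx>x\<in>-{0}. (\<Sum>j\<le>3. C52 x (q powi m) q j * g (q ^ j * x)) = 0"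
    by (intro that[of "f ()"]) (auto simp: C52_solutions_def)
  define c where "c k x = coef q m x k (\<lambda>l. lift_m q m g l x)" for k x
  have mero: "c k meromorphic_on -{0}" for k
    unfolding c_def[abs_def] by (rule coef_meromorphic[OF assms lift_m_meromorphic[OF q mg]])
  have A: "lift_m q m g l x = (\<Sum>k\<in>UNIV. c k x * blocks q l x $ k)" if "generic q x" "l \<in> {m, m + 1, m + 2}" for x l
    unfolding c_def by (rule coef_expand[OF assms that, symmetric])
  have "c k \<in> q_constants q" for k
    unfolding q_constants_def
  proof (intro CollectI conjI mero)
    show "\<forall>\<^sub>\<approx>x\<in>-{0}. c k (q * x) = c k x"
      using eq generic_cosparse[OF assms]
    proof eventually_elim
      case (elim x)
      have g: "generic q (q * x)" using generic_shift[OF elim(2) q, of 1] by simp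
      define L where "L = (\<lambda>l y. \<Sum>k\<in>UNIV. c k x * blocks q l y $ k)"
      note R = comb_relations[OF assms elim(2) L_def] and R' = comb_relations[OF assms g L_def]
      have 012: "g x = L m x" "g (q * x) = L m (q * x)" "g (q\<^sup>2 * x) = L m (q\<^sup>2 * x)"
        by (rule lift_m_eq_converse[OF assms elim(2) _ R(1,2)], simp add: A[OF elim(2)] L_def)+
      have "C52 x (q powi m) q 3 * g (q ^ 3 * x) = C52 x (q powi m) q 3 * L m (q ^ 3 * x)"
      proof -
        have e: "{..3::nat} = {0, 1, 2, 3}" by auto
        have eqn: "a = b" if "y + (z + (w + a)) = 0" "y + (z + (w + b)) = 0" for a b y z w :: complex
          using that by (metis add_left_cancel)
        show ?thesis
          by (rule eqn[of "C52 x (q powi m) q 0 * L m x" "C52 x (q powi m) q 1 * L m (q * x)" "C52 x (q powi m) q 2 * L m (q\<^sup>2 * x)"])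
            (use elim(1) R(3)[of m] in \<open>simp_all add: e 012\<close>)
      qed
      then have 3: "g (q ^ 3 * x) = L m (q ^ 3 * x)" using P1c_nonzero(4)[OF assms elim(2), of m] by simp
      have sh: "q * (q * x) = q ^ 2 * x" "q\<^sup>2 * (q * x) = q ^ 3 * x" by (simp_all add: power2_eq_square power3_eq_cube)
      have "lift_m q m g l (q * x) = L l (q * x)" if "l \<in> {m, m + 1, m + 2}" for l
        by (rule lift_m_eq[OF assms g _ _ _ R'(1,2) that]) (simp_all only: sh 012 3)
      then show ?case unfolding c_def[of _ "q * x"] by (intro coef_unique[OF assms g]) (simp add: L_def)
    qed
  qed
  moreover have "\<forall>\<^sub>\<approx>x\<in>-{0}. g x = (\<Sum>k\<in>UNIV. c k x * blocks q m x $ k)"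
    using generic_cosparse[OF assms]
  proof eventually_elim
    case (elim x)
    show ?case using A[OF elim, of m] by (simp add: lift_m_def Let_def)
  qed
  ultimately show "\<exists>c. range c \<subseteq> q_constants q \<and> (\<forall>i. \<forall>\<^sub>\<approx>x\<in>-{0}. f i x = (\<Sum>k\<in>UNIV. c k x * blocks q m x $ k))"
    unfolding fg by (intro exI[of _ c]) blast
qed

section \<open>The annihilating ideal\<close>

lemma shift_sums_pow:
  fixes g :: "nat \<Rightarrow> complex"
  assumes "(\<lambda>n. g n * M ^ n) sums L"
  shows "(\<lambda>n. (if n < j then 0 else g (n - j)) * M ^ n) sums (M ^ j * L)"
proof (induction j)
  case (Suc j)
  have "(if n = 0 then 0 else if n - 1 < j then 0 else g (n - 1 - j)) = (if n < Suc j then 0 else g (n - Suc j))" for n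
    by (cases n) auto
  then show ?case using shift_sums[OF Suc.IH] by (simp add: mult.assoc)
qed (use assms in simp)

lemma poly_altdef_le:
  fixes p :: "complex poly"
  assumes "degree p \<le> J"
  shows "poly p x = (\<Sum>j\<le>J. coeff p j * x ^ j)"
  unfolding poly_altdef by (rule sum.mono_neutral_left) (use assms in \<open>auto simp: coeff_eq_0\<close>)

lemma ac_nonzero:
  assumes "nonres q x u" "u \<noteq> 0" "q \<noteq> 0"
  shows "ac q x u n \<noteq> 0"
  using assms unfolding ac_def ratio_def nonres_def by (auto simp del: power_Suc)

text \<open>Comparing the coefficients of \<open>M^N\<close> and eliminating all \<open>a n\<close> but one gives a polynomial identity
  in \<open>s = u q^N\<close>. At the zeros \<open>1, x, 1 / x\<close> of \<open>Dp\<close> only its term \<open>j = 0\<close> survives.\<close>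

lemma no_relation_constant_term:
  fixes e :: "nat \<Rightarrow> complex poly"
  assumes adm: "admissible q" and q1: "norm q < 1" and gen: "generic q x" and u: "u \<in> {1, x, inverse x}"
    and rel: "\<And>n. (\<Sum>k<3. poly (e k) (q ^ n) * (u ^ k * phi q x u (q ^ k * q ^ n))) = 0"
  shows "k < 3 \<Longrightarrow> coeff (e k) 0 = 0"
proof -
  have q: "q \<noteq> 0" "x \<noteq> 0" using generic_nonzero[OF adm gen] by auto
  have u0: "u \<noteq> 0" using u q by auto
  define a where "a = ac q x u"
  define t where "t n = u * q ^ n" for n
  define J where "J = degree (e 0) + degree (e 1) + degree (e 2)"
  have J: "degree (e k) \<le> J" if "k < 3" for k
    using that by (auto simp: J_def numeral_3_eq_3 less_Suc_eq numeral_2_eq_2)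
  \<comment> \<open>The coefficients of M^j in the three polynomials, regarded as a quadratic
    polynomial in t, since the k-th shift multiplies terms by t^k.\<close>
  define Ep where "Ep j = [:coeff (e 0) j, coeff (e 1) j, coeff (e 2) j:]" for j
  have Ep: "poly (Ep j) s = (\<Sum>k<3. coeff (e k) j * s ^ k)" for j s
    by (simp add: Ep_def numeral_3_eq_3 numeral_2_eq_2 algebra_simps)
  define \<Phi> where "\<Phi> M = (\<Sum>k<3. poly (e k) M * (u ^ k * phi q x u (q ^ k * M)))" for M
  define c where "c N = (\<Sum>j\<le>J. if N < j then 0 else poly (Ep j) (t (N - j)) * a (N - j))" for N
  have S: "(\<lambda>N. c N * M ^ N) sums \<Phi> M" for M
  proof -
    have "(\<lambda>n. poly (Ep j) (t n) * a n * M ^ n) sums (\<Sum>k<3. coeff (e k) j * (u ^ k * phi q x u (q ^ k * M)))" for j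
    proof -
      have "(\<lambda>n. \<Sum>k<3. coeff (e k) j * ((u * q ^ n) ^ k * (ac q x u n * M ^ n))) sums
          (\<Sum>k<3. coeff (e k) j * (u ^ k * phi q x u (q ^ k * M)))"
        by (intro sums_sum sums_mult phi_sums_q adm q u0)
      moreover have "(\<Sum>k<3. coeff (e k) j * ((u * q ^ n) ^ k * (ac q x u n * M ^ n))) = poly (Ep j) (t n) * a n * M ^ n" for n
        unfolding Ep t_def a_def sum_distrib_right by (simp only: mult_ac)
      ultimately show ?thesis by simp
    qed
    from shift_sums_pow[OF this]
    have "(\<lambda>N. \<Sum>j\<le>J. (if N < j then 0 else poly (Ep j) (t (N - j)) * a (N - j)) * M ^ N) sums
        (\<Sum>j\<le>J. M ^ j * (\<Sum>k<3. coeff (e k) j * (u ^ k * phi q x u (q ^ k * M))))"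
      by (intro sums_sum)
    moreover have "(\<Sum>j\<le>J. M ^ j * (\<Sum>k<3. coeff (e k) j * (u ^ k * phi q x u (q ^ k * M)))) = \<Phi> M"
    proof -
      have "\<Phi> M = (\<Sum>k<3. \<Sum>j\<le>J. coeff (e k) j * M ^ j * (u ^ k * phi q x u (q ^ k * M)))"
        unfolding \<Phi>_def sum_distrib_right[symmetric]
        by (rule sum.cong[OF refl]) (subst poly_altdef_le[OF J]; simp)
      also have "\<dots> = (\<Sum>j\<le>J. M ^ j * (\<Sum>k<3. coeff (e k) j * (u ^ k * phi q x u (q ^ k * M))))"
        unfolding sum_distrib_left by (subst sum.swap) (simp only: mult_ac)
      finally show ?thesis ..
    qed
    ultimately show ?thesis unfolding c_def sum_distrib_right by simp
  qed
  have q0: "(\<lambda>n. q ^ n) \<longlonglongrightarrow> 0" using q1 by (rule LIMSEQ_power_zero)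
  have \<Phi>q: "\<Phi> (q ^ n) = 0" for n using rel by (simp add: \<Phi>_def)
  have \<Phi>0: "\<Phi> 0 = 0"
  proof -
    have c: "isCont (phi q x u) z" for z
      using holomorphic_on_imp_continuous_on[OF phi_holomorphic[OF adm q(2) u0, of UNIV]]
      by (simp add: continuous_on_eq_continuous_at)
    have "isCont (\<lambda>M. phi q x u (b * M)) 0" for b
      by (rule isCont_o2[where f = "\<lambda>M. b * M" and g = "phi q x u"]) (auto intro: c)
    then have "isCont \<Phi> 0" unfolding \<Phi>_def[abs_def] by (intro continuous_intros)
    then have "(\<lambda>n. \<Phi> (q ^ n)) \<longlonglongrightarrow> \<Phi> 0" using q0 by (rule isCont_tendsto_compose)
    then show ?thesis unfolding \<Phi>q by (simp add: LIMSEQ_const_iff)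
  qed
  \<comment> \<open>The entire function \<open>\<Phi>\<close> vanishes at the points q^n, which
    accumulate at 0, so all its coefficients vanish.\<close>
  have c0: "c N = 0" for N
  proof (rule ccontr)
    assume cN: "c N \<noteq> 0"
    have "c 0 = \<Phi> 0" using S[of 0] powser_sums_zero[of c] sums_unique2 by blast
    then have N: "N > 0" using cN \<Phi>0 by (cases N) auto
    obtain s where s: "s > 0" "\<And>z. z \<in> cball 0 s - {0} \<Longrightarrow> \<Phi> z \<noteq> 0"
      using powser_0_nonzero[of 1 0 c \<Phi> N] S \<Phi>0 cN N by auto
    have "\<forall>\<^sub>F n in sequentially. q ^ n \<in> ball 0 s"
      by (rule topological_tendstoD[OF q0]) (use s(1) in auto)
    then obtain n where "q ^ n \<in> ball 0 s" using eventually_happens by force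
    then show False using s(2)[of "q ^ n"] \<Phi>q q by auto
  qed
  define Dp where "Dp = [:1, -1:] * [:1, - x:] * [:1, - inverse x:]"
  have Dp: "poly Dp s = (1 - s) * (1 - x * s) * (1 - s / x)" for s
    by (simp add: Dp_def divide_inverse algebra_simps)
  have nr: "nonres q x u" by (rule nonres_generic[OF gen adm u])
  have an: "a n \<noteq> 0" for n unfolding a_def by (rule ac_nonzero[OF nr u0 q(1)])
  have Da: "poly Dp (t (Suc n)) * a (Suc n) = (t (Suc n))\<^sup>2 * a n" for n
    unfolding Dp t_def a_def using ac_recurrence[OF nr, of n] .
  define p where "p = inverse q"
  have tp: "t (N - i) = t N * p ^ i" if "i \<le> N" for N i
    using that q by (simp add: t_def p_def power_diff divide_inverse power_inverse)
  \<comment> \<open>\<open>c N\<close> multiplied by the values of \<open>Dp\<close> at t N, ..., t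
    (N - J + 1). The recursion of the coefficients then turns every a (N - j) into a (N - J) times
    squares, and all arguments are t N times powers of 1 / q.\<close>
  define R where "R = (\<Sum>j\<le>J. (Ep j \<circ>\<^sub>p [:0, p ^ j:]) * (\<Prod>i<j. Dp \<circ>\<^sub>p [:0, p ^ i:]) * (\<Prod>i\<in>{j..<J}. [:0, p ^ i:]\<^sup>2))"
  have R: "poly R s = (\<Sum>j\<le>J. poly (Ep j) (s * p ^ j) * (\<Prod>i<j. poly Dp (s * p ^ i)) * (\<Prod>i\<in>{j..<J}. (s * p ^ i)\<^sup>2))" for s
    by (simp add: R_def poly_sum poly_prod poly_pcompose)
  have "poly R (t N) = 0" if N: "N \<ge> J" for N
  proof -
    have tail: "a (N - j) * (\<Prod>i\<in>{j..<J}. poly Dp (t (N - i))) = a (N - J) * (\<Prod>i\<in>{j..<J}. (t (N - i))\<^sup>2)" if "j \<le> J" for j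
      using that
    proof (induction j rule: inc_induct)
      case (step j)
      have Sn: "N - j = Suc (N - Suc j)" using step N by simp
      have "a (N - j) * (\<Prod>i\<in>{j..<J}. poly Dp (t (N - i))) =
          (poly Dp (t (N - j)) * a (N - j)) * (\<Prod>i\<in>{Suc j..<J}. poly Dp (t (N - i)))"
        using step by (simp add: prod.atLeast_Suc_lessThan mult_ac)
      also have "\<dots> = (t (N - j))\<^sup>2 * (a (N - Suc j) * (\<Prod>i\<in>{Suc j..<J}. poly Dp (t (N - i))))"
        unfolding Sn Da by (simp only: mult.assoc)
      also have "\<dots> = a (N - J) * (\<Prod>i\<in>{j..<J}. (t (N - i))\<^sup>2)"
        unfolding step.IH using step by (simp add: prod.atLeast_Suc_lessThan mult_ac)
      finally show ?case .
    qed simp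
    have "0 = c N * (\<Prod>i<J. poly Dp (t (N - i)))" by (simp add: c0)
    also have "\<dots> = (\<Sum>j\<le>J. poly (Ep j) (t (N - j)) * a (N - j) * (\<Prod>i<J. poly Dp (t (N - i))))"
      unfolding c_def sum_distrib_right using N by (intro sum.cong) auto
    also have "\<dots> = (\<Sum>j\<le>J. a (N - J) * (poly (Ep j) (t (N - j)) * (\<Prod>i<j. poly Dp (t (N - i))) * (\<Prod>i\<in>{j..<J}. (t (N - i))\<^sup>2)))"
    proof (rule sum.cong[OF refl])
      fix j assume "j \<in> {..J}"
      then have j: "j \<le> J" by simp
      have "(\<Prod>i<J. poly Dp (t (N - i))) = (\<Prod>i<j. poly Dp (t (N - i))) * (\<Prod>i\<in>{j..<J}. poly Dp (t (N - i)))"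
        using prod.atLeastLessThan_concat[of 0 j J "\<lambda>i. poly Dp (t (N - i))"] j by (simp add: lessThan_atLeast0)
      then have "poly (Ep j) (t (N - j)) * a (N - j) * (\<Prod>i<J. poly Dp (t (N - i))) =
          poly (Ep j) (t (N - j)) * (\<Prod>i<j. poly Dp (t (N - i))) * (a (N - j) * (\<Prod>i\<in>{j..<J}. poly Dp (t (N - i))))"
        by (simp only: mult_ac)
      then show "poly (Ep j) (t (N - j)) * a (N - j) * (\<Prod>i<J. poly Dp (t (N - i))) =
          a (N - J) * (poly (Ep j) (t (N - j)) * (\<Prod>i<j. poly Dp (t (N - i))) * (\<Prod>i\<in>{j..<J}. (t (N - i))\<^sup>2))"
        unfolding tail[OF j] by (simp only: mult_ac)
    qed
    also have "\<dots> = a (N - J) * poly R (t N)"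
      unfolding R sum_distrib_left
    proof (rule sum.cong[OF refl])
      fix j assume "j \<in> {..J}"
      then have "t (N - j) = t N * p ^ j" "\<And>i. i < j \<Longrightarrow> t (N - i) = t N * p ^ i" "\<And>i. i < J \<Longrightarrow> t (N - i) = t N * p ^ i"
        using N by (intro tp; simp)+
      then show "a (N - J) * (poly (Ep j) (t (N - j)) * (\<Prod>i<j. poly Dp (t (N - i))) * (\<Prod>i\<in>{j..<J}. (t (N - i))\<^sup>2)) =
          a (N - J) * (poly (Ep j) (t N * p ^ j) * (\<Prod>i<j. poly Dp (t N * p ^ i)) * (\<Prod>i\<in>{j..<J}. (t N * p ^ i)\<^sup>2))"
        by simp
    qed
    finally show ?thesis using an[of "N - J"] by simp
  qed
  then have "t ` {J..} \<subseteq> {s. poly R s = 0}" by auto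
  moreover have "infinite (t ` {J..})"
  proof -
    have "inj t"
    proof (rule injI)
      fix m n assume "t m = t n"
      then have "q ^ m = q ^ n" using u0 by (simp add: t_def)
      then have "norm (q ^ m) = norm (q ^ n)" by (rule arg_cong)
      then have "norm q ^ m = norm q ^ n" by (simp only: norm_power)
      then show "m = n" using power_inject_exp'[of "norm q" m n] q q1 by simp
    qed
    then show ?thesis using infinite_Ici[of J] by (metis finite_imageD inj_on_subset subset_UNIV)
  qed
  ultimately have "R = 0" using poly_roots_finite[of R] finite_subset by blast
  have root: "poly (Ep 0) s = 0" if s: "s \<in> {1, x, inverse x}" for s
  proof -
    have Ds: "poly Dp s = 0" using s q unfolding Dp by auto
    have s0: "s \<noteq> 0" using s q by auto
    have "0 = poly R s" using \<open>R = 0\<close> by simp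
    also have "\<dots> = (\<Sum>j\<in>{0}. poly (Ep j) (s * p ^ j) * (\<Prod>i<j. poly Dp (s * p ^ i)) * (\<Prod>i\<in>{j..<J}. (s * p ^ i)\<^sup>2))"
      unfolding R
    proof (rule sum.mono_neutral_right)
      show "\<forall>j\<in>{..J} - {0}. poly (Ep j) (s * p ^ j) * (\<Prod>i<j. poly Dp (s * p ^ i)) * (\<Prod>i\<in>{j..<J}. (s * p ^ i)\<^sup>2) = 0"
      proof
        fix j assume "j \<in> {..J} - {0}"
        then have "(\<Prod>i<j. poly Dp (s * p ^ i)) = 0" using Ds by (intro prod_zero) (auto intro!: bexI[of _ 0])
        then show "poly (Ep j) (s * p ^ j) * (\<Prod>i<j. poly Dp (s * p ^ i)) * (\<Prod>i\<in>{j..<J}. (s * p ^ i)\<^sup>2) = 0" by simp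
      qed
    qed auto
    also have "\<dots> = poly (Ep 0) s * (\<Prod>i\<in>{0..<J}. (s * p ^ i)\<^sup>2)" by simp
    moreover have "(\<Prod>i\<in>{0..<J}. (s * p ^ i)\<^sup>2) \<noteq> 0" using s0 q by (simp add: p_def)
    ultimately show ?thesis by simp
  qed
  have "Ep 0 = 0"
  proof (rule ccontr)
    assume E: "Ep 0 \<noteq> 0"
    have d: "x \<noteq> 1" "inverse x \<noteq> 1" "x \<noteq> inverse x"
      using generic_power[OF gen, of 0] q by (auto simp: field_simps power2_eq_square)
    have "card {1, x, inverse x} \<le> card {s. poly (Ep 0) s = 0}"
      by (rule card_mono[OF poly_roots_finite[OF E]]) (use root in auto)
    also have "\<dots> \<le> degree (Ep 0)" by (rule card_poly_roots_bound[OF E])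
    also have "\<dots> \<le> 2" unfolding Ep_def by (auto intro!: degree_pCons_le[THEN order_trans])
    finally show False using d by simp
  qed
  then show "k < 3 \<Longrightarrow> coeff (e k) 0 = 0"
    by (auto simp: Ep_def numeral_3_eq_3 less_Suc_eq numeral_2_eq_2)
qed

text \<open>When the constant terms vanish, the relation is divisible by M = q^n, and the quotient
  is a relation of the same kind.\<close>

lemma no_relation:
  assumes "admissible q" "norm q < 1" "generic q x" "u \<in> {1, x, inverse x}"
    and "\<And>n. (\<Sum>k<3. poly (e k) (q ^ n) * (u ^ k * phi q x u (q ^ k * q ^ n))) = 0" "k < 3"
  shows "coeff (e k) j = 0"
  using assms(5)
proof (induction j arbitrary: e)
  case 0
  show ?case by (rule no_relation_constant_term[OF assms(1-4) 0 assms(6)])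
next
  case (Suc j)
  have c0: "coeff (e k) 0 = 0" if "k < 3" for k by (rule no_relation_constant_term[OF assms(1-4) Suc.prems that])
  have q: "q \<noteq> 0" using assms(1) by (simp add: admissible_def)
  define e' where "e' k = poly_shift 1 (e k)" for k
  have e': "e k = pCons 0 (e' k)" if "k < 3" for k
    using c0[OF that] by (intro poly_eqI) (auto simp: e'_def coeff_pCons coeff_poly_shift split: nat.split)
  have "q ^ n * (\<Sum>k<3. poly (e' k) (q ^ n) * (u ^ k * phi q x u (q ^ k * q ^ n))) = 0" for n
  proof -
    have "q ^ n * (\<Sum>k<3. poly (e' k) (q ^ n) * (u ^ k * phi q x u (q ^ k * q ^ n))) =
        (\<Sum>k<3. poly (e k) (q ^ n) * (u ^ k * phi q x u (q ^ k * q ^ n)))"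
      unfolding sum_distrib_left by (rule sum.cong) (auto simp: e')
    then show ?thesis using Suc.prems[of n] by simp
  qed
  then have "coeff (e' k) j = 0" using Suc.IH[of e'] q by simp
  then show ?case using e'[OF assms(6)] by simp
qed

section \<open>From operators to relations at a single point\<close>

lemma common_regular:
  assumes "finite K"
  shows "\<exists>E. E \<noteq> 0 \<and> (\<forall>x M q. eval3 x M q E \<noteq> 0 \<longrightarrow> (\<forall>k\<in>K. regular_at x M q (r k)))"
  using assms
proof (induction K)
  case (insert k K)
  then obtain E where E: "E \<noteq> 0" "\<And>x M q. eval3 x M q E \<noteq> 0 \<Longrightarrow> \<forall>k\<in>K. regular_at x M q (r k)" by blast
  obtain a b where ab: "r k = Fract a b" "b \<noteq> 0" by (cases "r k")
  show ?case
    by (rule exI[of _ "E * b"]) (use E ab in \<open>auto intro: regular_at_Fract\<close>)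
qed (auto intro!: exI[of _ 1])

lemma triple_denominator:
  fixes v :: triple
  obtains A B C D where "D \<noteq> 0" "v = (Fract A D, Fract B D, Fract C D)"
proof -
  obtain a b c where v: "v = (a, b, c)" by (cases v)
  obtain a1 d1 where a: "a = Fract a1 d1" "d1 \<noteq> 0" by (cases a)
  obtain b1 d2 where b: "b = Fract b1 d2" "d2 \<noteq> 0" by (cases b)
  obtain c1 d3 where c: "c = Fract c1 d3" "d3 \<noteq> 0" by (cases c)
  have "v = (Fract (a1 * (d2 * d3)) (d1 * d2 * d3), Fract (b1 * (d1 * d3)) (d1 * d2 * d3), Fract (c1 * (d1 * d2)) (d1 * d2 * d3))"
    using a b c by (simp add: v eq_fract)
  then show ?thesis using that[of "d1 * d2 * d3"] a(2) b(2) c(2) by (simp add: mult.assoc)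
qed

lemma eval3_as_poly:
  "eval3 x M q p = poly (map_poly (\<lambda>c. poly c q) (poly p [:[:x:]:])) M"
  "coeff (map_poly (\<lambda>c. poly c q) (poly p [:[:x:]:])) j = poly (map_poly (\<lambda>c. poly (coeff c j) q) p) x"
proof -
  have "poly (poly p1 [:M:]) q = poly (map_poly (\<lambda>c. poly c q) p1) M" for p1 :: "complex poly poly"
    by (induction p1) (simp_all add: map_poly_pCons)
  then show "eval3 x M q p = poly (map_poly (\<lambda>c. poly c q) (poly p [:[:x:]:])) M" by (simp add: eval3_def)
  have "poly (coeff (poly p [:[:x:]:]) j) q = poly (map_poly (\<lambda>c. poly (coeff c j) q) p) x"
    by (induction p) (simp_all add: map_poly_pCons)
  then show "coeff (map_poly (\<lambda>c. poly c q) (poly p [:[:x:]:])) j = poly (map_poly (\<lambda>c. poly (coeff c j) q) p) x"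
    by (simp add: coeff_map_poly)
qed

lemma pick_outside_countable:
  assumes "countable S"
  obtains z :: complex where "norm z < 1" "z \<notin> S"
proof -
  have "uncountable (ball (0::complex) 1 - S)" by (intro uncountable_minus_countable uncountable_ball assms) simp
  then have "ball (0::complex) 1 - S \<noteq> {}" by (metis countable_empty)
  then obtain z where "z \<in> ball (0::complex) 1 - S" by blast
  then show ?thesis using that[of z] by simp
qed

lemma countable_exceptions:
  assumes "\<forall>\<^sub>\<approx>x\<in>-{0::complex}. P x"
  shows "countable {x. x \<noteq> 0 \<and> \<not> P x}"
proof -
  have "countable (-{0} \<inter> {x. \<not> P x})"
    using assms by (intro sparse_imp_countable) (auto simp: eventually_cosparse)
  moreover have "-{0} \<inter> {x. \<not> P x} = {x. x \<noteq> 0 \<and> \<not> P x}" by auto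
  ultimately show ?thesis by simp
qed

text \<open>A nonzero normal form has, after clearing denominators, a coefficient of some x^l M^j
  that is a nonzero polynomial in q. For suitable q and then x it does not vanish, and the block
  would satisfy a relation that \<open>no_relation\<close> excludes.\<close>

lemma nform_annihilator:
  assumes "P \<in> annihilator (\<lambda>q m x. blocks q m x $ k)"
  shows "nform P = 0"
proof (rule ccontr)
  assume nz: "nform P \<noteq> 0"
  obtain A B C D where D: "D \<noteq> 0" "nform P = (Fract A D, Fract B D, Fract C D)" by (rule triple_denominator)
  obtain E where E: "E \<noteq> 0" "\<And>x M q. eval3 x M q E \<noteq> 0 \<Longrightarrow>
      \<forall>k\<in>Poly_Mapping.keys P. regular_at x M q (Poly_Mapping.lookup P k)"
    using common_regular[OF finite_keys[of P], of "Poly_Mapping.lookup P"] by blast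
  \<comment> \<open>D clears the denominators of the normal form. E vanishes wherever a coefficient
    of P has a pole, so at such points the relation is trivially true and no m has to be left
    out.\<close>
  define Q where "Q i = E * D * [A, B, C] ! i" for i
  have rel: "\<forall>\<^sub>\<approx>x\<in>-{0}. (\<Sum>i<3. eval3 x (q powi m) q (Q i) * blocks q (m + int i) x $ k) = 0"
    if adm: "admissible q" for q m
  proof -
    have "\<forall>\<^sub>\<approx>x\<in>-{0}. (\<forall>k\<in>Poly_Mapping.keys P. regular_at x (q powi m) q (Poly_Mapping.lookup P k)) \<longrightarrow>
        act q P (\<lambda>m x. blocks q m x $ k) m x = 0"
      using assms adm unfolding annihilator_def kills_at_def by blast
    then show ?thesis using generic_cosparse[OF adm]
    proof eventually_elim
      case (elim x)
      let ?e = "eval3 x (q powi m) q"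
      have sum3: "(\<Sum>i<3. ?e (Q i) * blocks q (m + int i) x $ k) =
          ?e E * ?e D * (?e A * blocks q m x $ k + ?e B * blocks q (m + 1) x $ k + ?e C * blocks q (m + 2) x $ k)"
        by (simp add: Q_def numeral_3_eq_3 numeral_2_eq_2 algebra_simps)
      show ?case
      proof (cases "?e E = 0 \<or> ?e D = 0")
        case False
        then have r: "qreg q m x P" unfolding qreg_keys using E(2) by blast
        have "pair3 q (nform P) (\<lambda>m x. blocks q m x $ k) m x = 0"
          using elim(1) r act_blocks(2)[OF adm elim(2) r, of k] unfolding qreg_keys by simp
        then have "?e A / ?e D * blocks q m x $ k + ?e B / ?e D * blocks q (m + 1) x $ k + ?e C / ?e D * blocks q (m + 2) x $ k = 0"
          using False by (simp add: pair3_def D(2) ratval_Fract)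
        then have "(?e A * blocks q m x $ k + ?e B * blocks q (m + 1) x $ k + ?e C * blocks q (m + 2) x $ k) / ?e D = 0"
          by (simp add: add_divide_distrib)
        then show ?thesis unfolding sum3 using False by simp
      qed (auto simp: sum3)
    qed
  qed
  have "\<exists>i<3. Q i \<noteq> 0"
  proof -
    have "A \<noteq> 0 \<or> B \<noteq> 0 \<or> C \<noteq> 0"
      using nz D by (auto simp: zero_prod_def Zero_fract_def eq_fract)
    then obtain i where "i < 3" "[A, B, C] ! i \<noteq> 0"
      by (elim disjE) (rule that[of 0] that[of 1] that[of 2]; simp)+
    then show ?thesis using D E by (auto simp: Q_def)
  qed
  then obtain i where i: "i < 3" "Q i \<noteq> 0" by blast
  then obtain l where "coeff (Q i) l \<noteq> 0" by (metis leading_coeff_0_iff)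
  then obtain j where j: "coeff (coeff (Q i) l) j \<noteq> 0" by (metis leading_coeff_0_iff)
  have "countable (insert 0 {q. poly (coeff (coeff (Q i) l) j) q = 0})"
    using poly_roots_finite[OF j] by (auto intro: countable_finite)
  then obtain q :: complex where q: "norm q < 1" "q \<notin> insert 0 {q. poly (coeff (coeff (Q i) l) j) q = 0}"
    by (rule pick_outside_countable)
  have adm: "admissible q" using q by (auto simp: admissible_def)
  define S where "S = map_poly (\<lambda>c. poly (coeff c j) q) (Q i)"
  have "coeff S l \<noteq> 0" using q(2) by (simp add: S_def coeff_map_poly)
  then have S: "S \<noteq> 0" by auto
  \<comment> \<open>For each m the relation may fail on a countable set of x. Their union over all m
    = n is still countable, so one x works for every n.\<close>
  let ?bad = "(\<Union>n. {x. x \<noteq> 0 \<and> (\<Sum>i<3. eval3 x (q powi int n) q (Q i) * blocks q (int n + int i) x $ k) \<noteq> 0})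
      \<union> {x. x \<noteq> 0 \<and> \<not> generic q x} \<union> insert 0 {x. poly S x = 0}"
  have "countable (insert 0 {x. poly S x = 0})"
    using poly_roots_finite[OF S] by (simp add: countable_finite)
  then have "countable ?bad"
    by (intro countable_Un countable_UN countableI_type countable_exceptions[OF rel[OF adm]]
        countable_exceptions[OF generic_cosparse[OF adm]])
  then obtain x :: complex where x: "x \<notin> ?bad" by (rule pick_outside_countable)
  then have x0: "x \<noteq> 0" and gen: "generic q x" and Sx: "poly S x \<noteq> 0"
    and rel0: "\<And>n. (\<Sum>i<3. eval3 x (q powi int n) q (Q i) * blocks q (int n + int i) x $ k) = 0" by auto
  define u where "u = uroot x $ k"
  have u: "u \<in> {1, x, inverse x}" "u \<noteq> 0" using uroot_in uroot_nonzero[OF x0] by (auto simp: u_def)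
  define e where "e i = map_poly (\<lambda>c. poly c q) (poly (Q i) [:[:x:]:])" for i
  have "(\<Sum>i<3. poly (e i) (q ^ n) * (u ^ i * phi q x u (q ^ i * q ^ n))) = 0" for n
  proof -
    have q0: "q \<noteq> 0" using q by auto
    have b: "blocks q (int n + int i) x $ k = pre q x $ k * u ^ n * (u ^ i * phi q x u (q ^ i * q ^ n))" for i
      unfolding blocks_series[OF adm gen] u_def[symmetric] using u(2) q0
      by (simp add: power_int_add mult_ac)
    have "pre q x $ k * u ^ n * (\<Sum>i<3. poly (e i) (q ^ n) * (u ^ i * phi q x u (q ^ i * q ^ n))) =
        (\<Sum>i<3. eval3 x (q powi int n) q (Q i) * blocks q (int n + int i) x $ k)"
      unfolding b sum_distrib_left eval3_as_poly(1) e_def power_int_of_nat by (simp only: mult_ac)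
    also have "\<dots> = 0" by (rule rel0)
    finally show ?thesis using pre_nonzero[OF adm gen, of k] u(2) by simp
  qed
  then have "coeff (e i) j = 0" by (rule no_relation[OF adm q(1) gen u(1) _ i(1)])
  then show False using Sx by (simp add: e_def eval3_as_poly(2) S_def)
qed

lemma annihilator_blocks: "annihilator (\<lambda>q m x. blocks q m x $ k) = I52"
proof
  show "annihilator (\<lambda>q m x. blocks q m x $ k) \<subseteq> I52"
    using nform_annihilator by (auto simp: I52_eq)
  show "I52 \<subseteq> annihilator (\<lambda>q m x. blocks q m x $ k)"
    using I52_kills_blocks by (auto simp: annihilator_def)
qed

theorem theorem24:
  shows
    "(\<forall>F\<in>{block_A, block_B, block_C}. q_holonomic F \<and> annihilator F = I52) \<and>
     has_rank I52 3 \<and>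
     (\<forall>q. admissible q \<longrightarrow>
        q_basis q (system_solutions q {P1, P2, P3}) (\<lambda>k m x. blocks q m x $ k)) \<and>
     (\<forall>q x. admissible q \<and> generic q x \<longrightarrow>
        seq_basis (B52_solutions q x) (\<lambda>k m. blocks q m x $ k)) \<and>
     (\<forall>q m x. admissible q \<and> generic q x \<longrightarrow>
        det (Wronskian_m q m x) =
          - (theta (- inverse (qhalf q) * x) q powi (-2)) * theta (- inverse (qhalf q) * x\<^sup>2) q) \<and>
     (\<forall>q x. admissible q \<and> generic q x \<longrightarrow>
        Wronskian_m q (-1) x ** transpose (Wronskian_m (inverse q) (-1) x) =
          vector [vector [1, 0, 0], vector [0, 0, 1], vector [0, 1, x + inverse x]]) \<and>
     (\<forall>m l. \<exists>L :: laurent_qx ^ 3 ^ 3. invertible L \<and>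
        (\<forall>q x. admissible q \<and> generic q x \<longrightarrow>
           Wronskian_m q m x ** transpose (Wronskian_m (inverse q) l x) =
             map_matrix (laurent_eval q x) L)) \<and>
     (\<forall>q m. admissible q \<longrightarrow>
        q_basis q (C52_solutions q m) (\<lambda>k (_ :: unit) x. blocks q m x $ k)) \<and>
     (\<forall>q m x. admissible q \<and> generic q x \<longrightarrow>
        det (Wronskian_x q m x) =
          q powi (-5 - 2 * m) * x powi (-5) * (1 - q\<^sup>2 * x\<^sup>2) * (1 - q * x\<^sup>2) * (1 - q^3 * x\<^sup>2) *
          theta (- inverse (qhalf q) * x) q powi (-2) * theta (- inverse (qhalf q) * x\<^sup>2) q)"
proof (intro conjI allI impI ballI; (elim conjE)?)
  fix F assume "F \<in> {block_A, block_B, block_C}"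
  then obtain k :: 3 where "F = (\<lambda>q m x. blocks q m x $ k)"
    by (elim insertE emptyE) (rule that[of 1] that[of 2] that[of 3]; simp)+
  then show "annihilator F = I52" by (simp add: annihilator_blocks)
  then show "q_holonomic F" by (rule q_holonomic_I52)
next
  fix m l
  show "\<exists>L :: laurent_qx ^ 3 ^ 3. invertible L \<and> (\<forall>q x. admissible q \<and> generic q x \<longrightarrow>
      Wronskian_m q m x ** transpose (Wronskian_m (inverse q) l x) = map_matrix (laurent_eval q x) L)"
    using laurent_Wronskian[of m l] unfolding laurent_family_def .
qed (rule has_rank_I52 q_basis_system seq_basis_blocks det_Wronskian_m Wronskian_orthogonality q_basis_C52
      det_Wronskian_x; assumption)+

end
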